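(* Let $H\in\{\mathbb{T},\mathbb{O},\mathbb{I}\}$, $n=|H|$, and let $(e_0,\psi_0)$, $\psi_0=(\psi_{0,1},\psi_{0,2},\psi_{0,3})\in\mathbb{R}^3$, satisfy: (i) $e_0\in(0,1)$ and $\cos\psi_{0,2}\neq0$; (ii) the great circle $\{R(\psi_0)(\cos\theta,\sin\theta,0):\theta\in\mathbb{R}\}$ avoids the rotation axes of $H$, i.e. contains no vector fixed by some $L\in H\setminus\{I\}$ (so that the $H$-orbit of $u_{e_0,\psi_0}$ is free of collisions); (iii) $(e_0,\psi_0)$ is a nondegenerate critical point of $\Phi(e,\psi)=\mathcal{A}_1(u_{e,\psi})$, i.e. $\nabla\Phi(e_0,\psi_0)=0$ and the $4\times4$ Hessian $\nabla^2\Phi(e_0,\psi_0)$ is invertible. Then there exist $\varepsilon_0>0$ and a $C^1$ branch $\varepsilon\mapsto u_\varepsilon\in X$, defined for $0\le\varepsilon<\varepsilon_0$, of critical points of $\mathcal{A}_H(\cdot;\varepsilon)$ with $u_0=u_{e_0,\psi_0}$, unique up to time translation, in the sense that every critical point of $\mathcal{A}_H(\cdot;\varepsilon)$ in a fixed neighbourhood of $u_0$ in $X$ equals $u_\varepsilon(\cdot+\varphi)$ for some $\varphi\in S^1$, so that the solutions come in circles, one orbit of the time-translation action. Consequently, the symmetric $(n+1)$-body problem (with central mass $\varepsilon^{-1}$) possesses a family of $2\pi\varepsilon^{1/2}$-periodic solutions, carrying the symmetry $q_0=0$, $q_L=Lq_I$ $(L\in H)$ of the group $H$, namely $$q_0(t)=0,\qquad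 q_L(t)=L\,u_\varepsilon(\varepsilon^{-1/2}t)\quad(L\in H),$$ bifurcating from the Kepler ellipse $u_{e_0,\psi_0}$. Moreover the branch is asymptotic to the base ellipse: there are parameters $(e_\varepsilon,\psi_\varepsilon)$ with $$u_\varepsilon=u_{e_\varepsilon,\psi_\varepsilon}+O(\varepsilon)\ \text{ in }X,\qquad (e_\varepsilon,\psi_\varepsilon)=(e_0,\psi_0)+O(\varepsilon),$$ so that in particular $u_\varepsilon=u_{e_0,\psi_0}+O(\varepsilon)$.
   Context: **Groups.** $H<SO(3)$ is one of the following matrix groups, each generated by the two listed matrices $A,B$ ($I$ is the identity matrix): - $\mathbb{T}$ (tetrahedral, order 12): $A=\mathrm{diag}(1,-1,-1)$, $B=\begin{pmatrix}0&1&0\\0&0&1\\1&0&0\end{pmatrix}$. - $\mathbb{O}$ (octahedral, order 24): $A=\begin{pmatrix}0&-1&0\\1&0&0\\0&0&1\end{pmatrix}$, $B=\begin{pmatrix}-1&0&0\\0&0&1\\0&1&0\end{pmatrix}$. - $\mathbb{I}$ (icosahedral, order 60): with $\phi=\frac12(1+\sqrt5)$, $A=\frac12\begin{pmatrix}\phi-1&\phi&1\\\phi&-1&\phi-1\\1&\phi-1&-\phi\end{pmatrix}$, $B=\begin{pmatrix}0&0&1\\1&0&0\\0&1&0\end{pmatrix}$. **$(n+1)$-body problem.** A central body of mass $\mu=\varepsilon^{-1}$ at $q_0(t)\in\mathbb{R}^3$ and $n=|H|$ unit masses at $q_L(t)$, $L\in H$, with Newtonian potential $V=-\mu\sum_{L}|q_L-q_0|^{-1}-\sum_{\{L,L'\},L\ne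 L'}|q_L-q_{L'}|^{-1}$ and equations $\mu\ddot q_0=-\nabla_{q_0}V$, $\ddot q_L=-\nabla_{q_L}V$. The symmetric problem restricts to motions with $q_0=0$, $q_L=Lq_I$ for all $L\in H$. **Reduced action.** $X=H^2_{2\pi}(\mathbb{R}^3)$ is the Sobolev space of $2\pi$-periodic $H^2$ maps $\mathbb{R}\to\mathbb{R}^3$. On the open set of $u\in X$ such that $u(\tau)\neq0$ and $u(\tau)\ne Lu(\tau)$ for all $\tau$ and all $L\in H\setminus\{I\}$, put $\mathcal{A}_H(u;\varepsilon)=\mathcal{A}_0(u)+\varepsilon\mathcal{A}_1(u)$, $$\mathcal{A}_0(u)=\int_0^{2\pi}\frac{|\dot u|^2}2+\frac1{|u|}\,d\tau,\qquad \mathcal{A}_1(u)=\frac12\int_0^{2\pi}\sum_{L\in H\setminus\{I\}}\frac1{|u-Lu|}\,d\tau.$$ Critical points are the $u$ with $-\ddot u-\frac{u}{|u|^3}-\varepsilon\sum_{L\neq I}\frac{u-Lu}{|u-Lu|^3}=0$. **Kepler ellipses.** For $e\in[0,1)$, $c_e=\sqrt{1-e^2}$, $u_e(\tau)=r(\cos\theta,\sin\theta,0)$ with $r=c_e^2/(1+e\cos\theta)$, $\dot\theta=c_e/r^2$, $\theta(0)=0$ (this curve is $2\pi$-periodic). With $$J_1=\begin{pmatrix}0&0&0\\0&0&-1\\0&1&0\end{pmatrix},\quad J_2=\begin{pmatrix}0&0&-1\\0&0&0\\1&0&0\end{pmatrix},\quad J_3=\begin{pmatrix}0&-1&0\\1&0&0\\0&0&0\end{pmatrix},$$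 $R(\psi)=e^{\psi_1J_1}e^{\psi_2J_2}e^{\psi_3J_3}$ for $\psi=(\psi_1,\psi_2,\psi_3)\in\mathbb{R}^3$, and $u_{e,\psi}=R(\psi)u_e$. The reduced function $\Phi(e,\psi):=\mathcal{A}_1(u_{e,\psi})$ is smooth on the open set of $(e,\psi)$, $0<e<1$, whose great circle $\{R(\psi)(\cos\theta,\sin\theta,0)\}$ avoids the rotation axes of $H$; its gradient and Hessian are with respect to the four variables $(e,\psi_1,\psi_2,\psi_3)$. $S^1=\mathbb{R}/2\pi\mathbb{Z}$.
   Formalization: Uniqueness up to time translation is stated only for 0 < ε < ε₀: at ε = 0 it is false, since every nearby Kepler ellipse u_{e,ψ} is also a critical point of A₀ and is not a translate of u₀; all other claims include ε = 0 where they make sense. *)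

theory Defs
  imports "HOL-Analysis.Analysis" "HOL-Library.Landau_Symbols" "HOL-Algebra.Generated_Groups"
begin

section \<open>The Sobolev space of periodic $H^2$ curves\<close>

definition period_measure :: "real measure" where
  "period_measure = restrict_space lborel {0..2 * pi}"

definition L2_period :: "(real \<Rightarrow> real^3) set" where
  "L2_period = {f \<in> borel_measurable period_measure. integrable period_measure (\<lambda>t. (norm (f t))\<^sup>2)}"

definition smooth_periodic :: "(real \<Rightarrow> real) set" where
  "smooth_periodic =
     {\<phi>. (\<forall>k t. (deriv ^^ k) \<phi> differentiable (at t)) \<and> (\<forall>t. \<phi> (t + 2 * pi) = \<phi> t)}"

text \<open>Distributional derivative on the circle: test functions are the smooth
  \<open>2\<pi>\<close>-periodic ones, so periodicity of \<open>f\<close> is encoded as well.\<close>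

definition weak_deriv :: "(real \<Rightarrow> real^3) \<Rightarrow> (real \<Rightarrow> real^3) \<Rightarrow> bool" where
  "weak_deriv f g \<longleftrightarrow> f \<in> L2_period \<and> g \<in> L2_period \<and>
     (\<forall>\<phi>\<in>smooth_periodic.
        (\<integral>t. deriv \<phi> t *\<^sub>R f t \<partial>period_measure) = - (\<integral>t. \<phi> t *\<^sub>R g t \<partial>period_measure))"

text \<open>Weak derivatives are unique almost everywhere (\<open>weak_deriv_unique\<close> below), so the
  choice does not affect any integral.\<close>

definition wderiv :: "(real \<Rightarrow> real^3) \<Rightarrow> (real \<Rightarrow> real^3)" where
  "wderiv f = (SOME g. weak_deriv f g)"

lemma space_period_measure [simp]: "space period_measure = {0..2 * pi}"
  by (simp add: period_measure_def space_restrict_space)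

lemma finite_measure_period_measure [simp]: "finite_measure period_measure"
  by (rule finite_measureI) (simp add: period_measure_def space_restrict_space emeasure_restrict_space)

lemma period_continuous_measurable:
  fixes g :: "real \<Rightarrow> 'a::topological_space"
  assumes "continuous_on {0..2 * pi} g"
  shows "g \<in> borel_measurable period_measure"
  using borel_measurable_continuous_on_restrict[OF assms] unfolding period_measure_def
  by (metis (no_types, lifting) measurable_cong_sets sets_lborel sets_restrict_space_cong)

lemma L2_period_integrable_inner:
  assumes "f \<in> L2_period" "g \<in> L2_period"
  shows "integrable period_measure (\<lambda>t. f t \<bullet> g t)"
proof (rule Bochner_Integration.integrable_bound)
  show "integrable period_measure (\<lambda>t. (norm (f t))\<^sup>2 + (norm (g t))\<^sup>2)"
    using assms by (auto simp: L2_period_def)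
  show "(\<lambda>t. f t \<bullet> g t) \<in> borel_measurable period_measure"
    using assms by (auto simp: L2_period_def)
  have "\<bar>x \<bullet> y\<bar> \<le> (norm x)\<^sup>2 + (norm y)\<^sup>2" for x y :: "real^3"
  proof -
    have "0 \<le> (norm x - norm y)\<^sup>2" by simp
    then have "2 * (norm x * norm y) \<le> (norm x)\<^sup>2 + (norm y)\<^sup>2"
      by (simp add: power2_diff)
    moreover have "0 \<le> norm x * norm y" by simp
    ultimately show ?thesis using Cauchy_Schwarz_ineq2[of x y] by linarith
  qed
  then show "AE t in period_measure. norm (f t \<bullet> g t) \<le> norm ((norm (f t))\<^sup>2 + (norm (g t))\<^sup>2)"
    by (auto intro!: AE_I2)
qed

lemma L2_period_add: "f \<in> L2_period \<Longrightarrow> g \<in> L2_period \<Longrightarrow> (\<lambda>t. f t + g t) \<in> L2_period"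
  using L2_period_integrable_inner[of f g]
  by (auto simp: L2_period_def power2_norm_eq_inner inner_add_left inner_add_right inner_commute
      intro!: Bochner_Integration.integrable_add)

lemma L2_period_scaleR: "f \<in> L2_period \<Longrightarrow> (\<lambda>t. c *\<^sub>R f t) \<in> L2_period"
  by (auto simp: L2_period_def power_mult_distrib)

lemma L2_period_integrable:
  assumes "f \<in> L2_period" shows "integrable period_measure f"
proof (rule Bochner_Integration.integrable_bound)
  show "integrable period_measure (\<lambda>t. 1 + (norm (f t))\<^sup>2)"
    using assms finite_measure.integrable_const[OF finite_measure_period_measure, of "1::real"]
    by (auto simp: L2_period_def)
  show "f \<in> borel_measurable period_measure" using assms by (auto simp: L2_period_def)
  have "x \<le> 1 + x\<^sup>2" for x :: real
    using sum_power2_ge_zero[of "x - 1" x] zero_le_power2[of "x - 1"] zero_le_power2[of x]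
    unfolding power2_diff by (simp; linarith)
  then show "AE t in period_measure. norm (f t) \<le> norm (1 + (norm (f t))\<^sup>2)"
    by (auto intro!: AE_I2)
qed

lemma smooth_periodic_deriv:
  assumes "\<phi> \<in> smooth_periodic" shows "(\<phi> has_real_derivative deriv \<phi> t) (at t)"
proof -
  have "(deriv ^^ 0) \<phi> differentiable (at t)" using assms unfolding smooth_periodic_def by blast
  then show ?thesis by (simp add: DERIV_deriv_iff_real_differentiable)
qed

lemma smooth_periodic_cont:
  assumes "\<phi> \<in> smooth_periodic" shows "continuous_on S \<phi>" "continuous_on S (deriv \<phi>)"
proof -
  show "continuous_on S \<phi>"
    using smooth_periodic_deriv[OF assms] by (intro DERIV_continuous_on) (auto intro: DERIV_subset)
  have "(deriv ^^ 1) \<phi> differentiable (at t)" for t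
    using assms unfolding smooth_periodic_def by blast
  then show "continuous_on S (deriv \<phi>)"
    by (intro continuous_at_imp_continuous_on ballI differentiable_imp_continuous_within) simp
qed

lemma period_integrable_scaleR:
  fixes f :: "real \<Rightarrow> real^3"
  assumes f: "integrable period_measure f" and g: "continuous_on {0..2 * pi} g"
  shows "integrable period_measure (\<lambda>t. g t *\<^sub>R f t)"
proof -
  have "bounded (g ` {0..2 * pi})"
    by (intro compact_imp_bounded compact_continuous_image g) simp
  then obtain B where B: "\<And>t. t \<in> {0..2 * pi} \<Longrightarrow> norm (g t) \<le> B"
    unfolding bounded_iff by (meson imageI)
  show ?thesis
  proof (rule Bochner_Integration.integrable_bound)
    show "integrable period_measure (\<lambda>t. B *\<^sub>R f t)" using f by simp
    show "(\<lambda>t. g t *\<^sub>R f t) \<in> borel_measurable period_measure"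
      using period_continuous_measurable[OF g] f by measurable
    show "AE t in period_measure. norm (g t *\<^sub>R f t) \<le> norm (B *\<^sub>R f t)"
    proof (rule AE_I2)
      fix t assume "t \<in> space period_measure"
      then show "norm (g t *\<^sub>R f t) \<le> norm (B *\<^sub>R f t)"
        using B[of t] by (auto intro!: mult_right_mono)
    qed
  qed
qed

lemma weak_deriv_add:
  assumes "weak_deriv f f'" "weak_deriv g g'"
  shows "weak_deriv (\<lambda>t. f t + g t) (\<lambda>t. f' t + g' t)"
proof -
  note L = assms[unfolded weak_deriv_def]
  have "(\<integral>t. deriv \<phi> t *\<^sub>R (f t + g t) \<partial>period_measure) = - (\<integral>t. \<phi> t *\<^sub>R (f' t + g' t) \<partial>period_measure)"
    if \<phi>: "\<phi> \<in> smooth_periodic" for \<phi>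
    using L \<phi>
    by (simp add: scaleR_add_right period_integrable_scaleR L2_period_integrable smooth_periodic_cont)
  then show ?thesis using L by (simp add: weak_deriv_def L2_period_add)
qed

lemma weak_deriv_scaleR:
  assumes "weak_deriv f f'"
  shows "weak_deriv (\<lambda>t. c *\<^sub>R f t) (\<lambda>t. c *\<^sub>R f' t)"
proof -
  note L = assms[unfolded weak_deriv_def]
  have "(\<integral>t. deriv \<phi> t *\<^sub>R (c *\<^sub>R f t) \<partial>period_measure) = - (\<integral>t. \<phi> t *\<^sub>R (c *\<^sub>R f' t) \<partial>period_measure)"
    if \<phi>: "\<phi> \<in> smooth_periodic" for \<phi>
  proof -
    have "(\<integral>t. deriv \<phi> t *\<^sub>R (c *\<^sub>R f t) \<partial>period_measure) = (\<integral>t. c *\<^sub>R (deriv \<phi> t *\<^sub>R f t) \<partial>period_measure)"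
      by (simp add: mult.commute)
    also have "\<dots> = c *\<^sub>R (\<integral>t. deriv \<phi> t *\<^sub>R f t \<partial>period_measure)" by (rule integral_scaleR_right)
    also have "\<dots> = - (c *\<^sub>R (\<integral>t. \<phi> t *\<^sub>R f' t \<partial>period_measure))" using L \<phi> by simp
    also have "c *\<^sub>R (\<integral>t. \<phi> t *\<^sub>R f' t \<partial>period_measure) = (\<integral>t. c *\<^sub>R (\<phi> t *\<^sub>R f' t) \<partial>period_measure)"
      by (rule integral_scaleR_right[symmetric])
    also have "\<dots> = (\<integral>t. \<phi> t *\<^sub>R (c *\<^sub>R f' t) \<partial>period_measure)"
      by (simp add: mult.commute)
    finally show ?thesis .
  qed
  then show ?thesis using L by (simp add: weak_deriv_def L2_period_scaleR)
qed

lemma weak_deriv_zero: "weak_deriv (\<lambda>_. 0) (\<lambda>_. 0)"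
  by (simp add: weak_deriv_def L2_period_def)

inductive_set trig_poly :: "(real \<Rightarrow> real) set" where
  "(\<lambda>_. c) \<in> trig_poly"
| "cos \<in> trig_poly"
| "sin \<in> trig_poly"
| "f \<in> trig_poly \<Longrightarrow> g \<in> trig_poly \<Longrightarrow> (\<lambda>t. f t + g t) \<in> trig_poly"
| "f \<in> trig_poly \<Longrightarrow> g \<in> trig_poly \<Longrightarrow> (\<lambda>t. f t * g t) \<in> trig_poly"

lemma trig_poly_deriv:
  "f \<in> trig_poly \<Longrightarrow> \<exists>f'\<in>trig_poly. \<forall>t. (f has_real_derivative f' t) (at t)"
proof (induction rule: trig_poly.induct)
  case (1 c) show ?case by (rule bexI[of _ "\<lambda>_. 0"]) (auto intro: trig_poly.intros)
next
  case 2
  have "(\<lambda>t. (-1) * sin t) \<in> trig_poly" by (rule trig_poly.intros)+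
  then show ?case by (rule bexI[rotated]) (auto intro!: derivative_eq_intros)
next
  case 3 show ?case by (rule bexI[of _ cos]) (auto intro: trig_poly.intros DERIV_sin)
next
  case (4 f g)
  then obtain f' g' where "f' \<in> trig_poly" "g' \<in> trig_poly"
    "\<forall>t. (f has_real_derivative f' t) (at t)" "\<forall>t. (g has_real_derivative g' t) (at t)" by auto
  then show ?case
    by (intro bexI[of _ "\<lambda>t. f' t + g' t"]) (auto intro!: trig_poly.intros derivative_intros)
next
  case (5 f g)
  then obtain f' g' where *: "f' \<in> trig_poly" "g' \<in> trig_poly"
    "\<forall>t. (f has_real_derivative f' t) (at t)" "\<forall>t. (g has_real_derivative g' t) (at t)" by auto
  have "(\<lambda>t. f' t * g t + g' t * f t) \<in> trig_poly"
    using * 5 by (intro trig_poly.intros)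
  moreover have "\<forall>t. ((\<lambda>t. f t * g t) has_real_derivative f' t * g t + g' t * f t) (at t)"
    using * by (auto intro!: DERIV_mult)
  ultimately show ?case by (intro bexI[of _ "\<lambda>t. f' t * g t + g' t * f t"])
qed

lemma trig_poly_smooth: assumes "f \<in> trig_poly" shows "f \<in> smooth_periodic"
proof -
  have "(deriv ^^ k) f \<in> trig_poly" for k
  proof (induction k)
    case 0 show ?case using assms by simp
  next
    case (Suc k)
    then obtain f' where f': "f' \<in> trig_poly" "\<forall>t. ((deriv ^^ k) f has_real_derivative f' t) (at t)"
      using trig_poly_deriv by blast
    then have "deriv ((deriv ^^ k) f) = f'" by (auto intro: DERIV_imp_deriv)
    then show ?case using f' by simp
  qed
  then have "(deriv ^^ k) f differentiable (at t)" for k t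
    using trig_poly_deriv real_differentiable_def by blast
  moreover have "f (t + 2 * pi) = f t" for t
    using assms by (induction rule: trig_poly.induct) auto
  ultimately show ?thesis by (auto simp: smooth_periodic_def)
qed

lemma trig_poly_dense:
  assumes g: "continuous_on {0..2 * pi} g" and ends: "g 0 = g (2 * pi)" and "0 < e"
  obtains p where "p \<in> trig_poly" "\<And>t. t \<in> {0..2 * pi} \<Longrightarrow> \<bar>g t - p t\<bar> < e"
proof -
  let ?S = "sphere (0::complex) 1"
  define G where "G z = g (Arg2pi z)" for z
  have cis: "G (cis t) = g t" if "t \<in> {0..2 * pi}" for t
  proof (cases "t = 2 * pi")
    case True
    then show ?thesis using ends Arg2pi_of_real[of 1] by (simp add: G_def)
  next
    case False
    then have "Arg2pi (cis t) = t"
      using that by (intro Arg2pi_unique[of 1]) (auto simp: cis_conv_exp)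
    then show ?thesis by (simp add: G_def)
  qed
  have im: "cis ` {0..2 * pi} = ?S"
  proof
    show "?S \<subseteq> cis ` {0..2 * pi}"
    proof
      fix z assume "z \<in> ?S"
      then have "z = cis (Arg2pi z)"
        using complex_norm_eq_1_exp[of z] by (simp add: cis_conv_exp)
      moreover have "Arg2pi z \<in> {0..2 * pi}"
        using Arg2pi[of z] by auto
      ultimately show "z \<in> cis ` {0..2 * pi}" by blast
    qed
  qed auto
  have q: "quotient_map (top_of_set {0..2 * pi}) (top_of_set ?S) cis"
    using im
    by (intro continuous_imp_quotient_map)
      (auto intro!: continuous_intros simp: compact_space_subtopology Hausdorff_space_subtopology)
  have "continuous_on {0..2 * pi} (G \<circ> cis)"
    using g by (rule continuous_on_eq) (simp add: cis)
  then have "continuous_map (top_of_set {0..2 * pi}) euclidean (G \<circ> cis)"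
    by (simp add: continuous_map_iff_continuous)
  then have "continuous_map (top_of_set ?S) euclidean G"
    using continuous_compose_quotient_map[OF q] by blast
  then have "continuous_on ?S G" by (simp add: continuous_map_iff_continuous)
  then obtain P where P: "real_polynomial_function P" "\<And>x. x \<in> ?S \<Longrightarrow> \<bar>G x - P x\<bar> < e"
    using Stone_Weierstrass_real_polynomial_function[of ?S G e] \<open>0 < e\<close> by auto
  have "(\<lambda>t. P (cis t)) \<in> trig_poly"
    using P(1)
  proof (induction rule: real_polynomial_function.induct)
    case (linear f)
    then interpret bounded_linear f .
    have "f (cis t) = cos t * f 1 + sin t * f \<i>" for t
    proof -
      have "cis t = cos t *\<^sub>R 1 + sin t *\<^sub>R \<i>" by (simp add: complex_eq_iff)
      then show ?thesis by (metis add scale real_scaleR_def)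
    qed
    then show ?case by (auto intro!: trig_poly.intros)
  qed (auto intro: trig_poly.intros)
  moreover have "\<bar>g t - P (cis t)\<bar> < e" if "t \<in> {0..2 * pi}" for t
    using P(2)[of "cis t"] cis[OF that] by auto
  ultimately show thesis by (rule that)
qed

lemma orthogonal_smooth_imp_AE_zero:
  fixes h :: "real \<Rightarrow> real^3"
  assumes h: "integrable period_measure h"
    and orth: "\<And>\<phi>. \<phi> \<in> smooth_periodic \<Longrightarrow> (\<integral>t. \<phi> t *\<^sub>R h t \<partial>period_measure) = 0"
  shows "AE t in period_measure. h t = 0"
proof -
  have cont: "(\<integral>t. g t *\<^sub>R h t \<partial>period_measure) = 0"
    if g: "continuous_on {0..2 * pi} g" "g 0 = g (2 * pi)" for g
  proof (rule ccontr)
    assume neq: "(\<integral>t. g t *\<^sub>R h t \<partial>period_measure) \<noteq> 0"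
    define N where "N = (\<integral>t. norm (h t) \<partial>period_measure)"
    have N: "0 \<le> N" unfolding N_def by simp
    define e where "e = norm (\<integral>t. g t *\<^sub>R h t \<partial>period_measure) / (N + 1)"
    have "0 < e" using neq N by (simp add: e_def)
    then obtain p where p: "p \<in> trig_poly" "\<And>t. t \<in> {0..2 * pi} \<Longrightarrow> \<bar>g t - p t\<bar> < e"
      using trig_poly_dense[OF g] by metis
    have cp: "continuous_on {0..2 * pi} p"
      using smooth_periodic_cont trig_poly_smooth p(1) by blast
    have "(\<integral>t. (g t - p t) *\<^sub>R h t \<partial>period_measure) = (\<integral>t. g t *\<^sub>R h t \<partial>period_measure)"
      using orth[OF trig_poly_smooth[OF p(1)]] period_integrable_scaleR[OF h g(1)]
        period_integrable_scaleR[OF h cp] by (simp add: scaleR_diff_left)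
    moreover have "norm (\<integral>t. (g t - p t) *\<^sub>R h t \<partial>period_measure) \<le> (\<integral>t. e * norm (h t) \<partial>period_measure)"
    proof (rule Bochner_Integration.integral_norm_bound_integral)
      show "integrable period_measure (\<lambda>t. (g t - p t) *\<^sub>R h t)"
        by (intro period_integrable_scaleR h continuous_intros g cp)
      show "integrable period_measure (\<lambda>t. e * norm (h t))" using h by simp
      show "norm ((g t - p t) *\<^sub>R h t) \<le> e * norm (h t)" if "t \<in> space period_measure" for t
        using p(2)[of t] that by (auto intro!: mult_right_mono)
    qed
    ultimately have "norm (\<integral>t. g t *\<^sub>R h t \<partial>period_measure) \<le> e * N" by (simp add: N_def)
    moreover have "norm (\<integral>t. g t *\<^sub>R h t \<partial>period_measure) = e * (N + 1)" using N by (simp add: e_def)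
    ultimately show False using \<open>0 < e\<close> by (simp add: algebra_simps)
  qed
  have ind_meas: "(\<lambda>t. indicator A t :: real) \<in> borel_measurable period_measure" if "A \<in> sets borel" for A
    unfolding period_measure_def using that by (intro measurable_restrict_space1) simp
  have ioo: "(\<integral>t. indicator {a<..<b} t *\<^sub>R h t \<partial>period_measure) = 0" for a b :: real
  proof -
    define a' b' where "a' = max a 0" and "b' = min b (2 * pi)"
    define g where "g n t = max 0 (min 1 (real n * min (t - a') (b' - t)))" for n t
    have "(\<integral>t. g n t *\<^sub>R h t \<partial>period_measure) = 0" for n
    proof (rule cont)
      show "continuous_on {0..2 * pi} (g n)" unfolding g_def by (intro continuous_intros)
      have "min (0 - a') (b' - 0) \<le> 0" "min (2 * pi - a') (b' - 2 * pi) \<le> 0"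
        unfolding a'_def b'_def by auto
      then have "real n * min (0 - a') (b' - 0) \<le> 0" "real n * min (2 * pi - a') (b' - 2 * pi) \<le> 0"
        by (auto intro: mult_nonneg_nonpos)
      then show "g n 0 = g n (2 * pi)" by (simp add: g_def)
    qed
    moreover have "(\<lambda>n. \<integral>t. g n t *\<^sub>R h t \<partial>period_measure) \<longlonglongrightarrow> (\<integral>t. indicator {a'<..<b'} t *\<^sub>R h t \<partial>period_measure)"
    proof (rule integral_dominated_convergence[where w = "\<lambda>t. norm (h t)"])
      have "continuous_on {0..2 * pi} (g n)" for n unfolding g_def by (intro continuous_intros)
      then show "(\<lambda>t. g n t *\<^sub>R h t) \<in> borel_measurable period_measure" for n
        using period_continuous_measurable[of "g n"] h by measurable
      show "(\<lambda>t. indicator {a'<..<b'} t *\<^sub>R h t) \<in> borel_measurable period_measure"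
        using ind_meas[of "{a'<..<b'}"] h by measurable
      show "integrable period_measure (\<lambda>t. norm (h t))" using h by simp
      show "AE t in period_measure. norm (g n t *\<^sub>R h t) \<le> norm (h t)" for n
        by (intro AE_I2) (auto simp: g_def intro!: mult_left_le_one_le)
      show "AE t in period_measure. (\<lambda>n. g n t *\<^sub>R h t) \<longlonglongrightarrow> indicator {a'<..<b'} t *\<^sub>R h t"
      proof (intro AE_I2 tendsto_scaleR tendsto_const)
        fix t
        define d where "d = min (t - a') (b' - t)"
        show "(\<lambda>n. g n t) \<longlonglongrightarrow> indicator {a'<..<b'} t"
        proof (cases "t \<in> {a'<..<b'}")
          case True
          then have "0 < d" by (auto simp: d_def)
          obtain m :: nat where m: "1 < real m * d" using reals_Archimedean3[OF \<open>0 < d\<close>] by blast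
          have "g n t = 1" if "m \<le> n" for n
          proof -
            have "real m * d \<le> real n * d" using that \<open>0 < d\<close> by simp
            then show ?thesis using m by (simp add: g_def flip: d_def)
          qed
          then have "\<forall>\<^sub>F n in sequentially. g n t = indicator {a'<..<b'} t"
            using True by (auto simp: eventually_sequentially)
          then show ?thesis by (rule tendsto_eventually)
        next
          case False
          then have "d \<le> 0" by (auto simp: d_def)
          then have "real n * d \<le> 0" for n by (auto intro: mult_nonneg_nonpos)
          then have "min 1 (real n * d) \<le> 0" for n by (rule min.coboundedI2)
          then have "g n t = 0" for n by (simp add: g_def max_absorb1 flip: d_def)
          then show ?thesis using False by simp
        qed
      qed
    qed
    ultimately have "(\<integral>t. indicator {a'<..<b'} t *\<^sub>R h t \<partial>period_measure) = 0"
      by (simp add: LIMSEQ_const_iff)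
    moreover have "AE t in period_measure. indicator {a'<..<b'} t *\<^sub>R h t = indicator {a<..<b} t *\<^sub>R h t"
    proof -
      have "AE t in lborel. t \<noteq> 0" "AE t in lborel. t \<noteq> 2 * pi" by (auto intro: AE_lborel_singleton)
      then have "AE t in period_measure. t \<noteq> 0 \<and> t \<noteq> 2 * pi"
        unfolding period_measure_def by (subst AE_restrict_space_iff) auto
      then show ?thesis
      proof (rule AE_mp, intro AE_I2 impI)
        fix t assume "t \<in> space period_measure" "t \<noteq> 0 \<and> t \<noteq> 2 * pi"
        then show "indicator {a'<..<b'} t *\<^sub>R h t = indicator {a<..<b} t *\<^sub>R h t"
          by (auto simp: a'_def b'_def indicator_def)
      qed
    qed
    moreover have "(\<lambda>t. indicator {p<..<q} t *\<^sub>R h t) \<in> borel_measurable period_measure" for p q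
      using ind_meas[of "{p<..<q}"] h by measurable
    ultimately show ?thesis
      using integral_cong_AE[of "\<lambda>t. indicator {a'<..<b'} t *\<^sub>R h t" period_measure
          "\<lambda>t. indicator {a<..<b} t *\<^sub>R h t"] by simp
  qed
  have borel: "(\<integral>t. indicator A t *\<^sub>R h t \<partial>period_measure) = 0" if "A \<in> sets borel" for A
  proof -
    have meas: "A \<inter> {0..2 * pi} \<in> sets period_measure" if "A \<in> sets borel" for A
      using that by (auto simp: period_measure_def sets_restrict_space)
    have int: "integrable period_measure (\<lambda>t. indicator A t *\<^sub>R h t)" if "A \<in> sets borel" for A
    proof -
      have "integrable period_measure (\<lambda>t. indicator (A \<inter> {0..2 * pi}) t *\<^sub>R h t)"
        by (rule integrable_mult_indicator[OF meas[OF that] h])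
      then show ?thesis
        by (rule Bochner_Integration.integrable_cong[THEN iffD1, rotated 2]) (auto simp: indicator_def)
    qed
    let ?G = "range (\<lambda>(a, b). {a<..<b::real})"
    have box: "(\<lambda>(a, b). box a b) = (\<lambda>(a, b). {a<..<b::real})" by (auto simp: fun_eq_iff)
    have sig: "sets borel = sigma_sets UNIV ?G"
      using arg_cong[OF borel_eq_box[where 'a = real], of sets] unfolding box
      by (simp add: sets_measure_of)
    have "Int_stable ?G"
    proof (rule Int_stableI)
      fix a b :: "real set" assume "a \<in> ?G" "b \<in> ?G"
      then obtain p q r s where "a = {p<..<q}" "b = {r<..<s}" by auto
      then have "a \<inter> b = (\<lambda>(a, b). {a<..<b}) (max p r, min q s)" by auto
      then show "a \<inter> b \<in> ?G" by blast
    qed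
    moreover have "?G \<subseteq> Pow UNIV" by simp
    moreover have "A \<in> sigma_sets UNIV ?G" using that sig by simp
    ultimately show ?thesis
    proof (induction rule: sigma_sets_induct_disjoint)
      case (basic A) then show ?case using ioo by auto
    next
      case (compl A)
      then have A: "A \<in> sets borel" using sig by simp
      have "(\<integral>t. h t \<partial>period_measure) = 0" using cont[of "\<lambda>_. 1"] by simp
      moreover have "(\<integral>t. indicator (UNIV - A) t *\<^sub>R h t \<partial>period_measure)
          = (\<integral>t. h t - indicator A t *\<^sub>R h t \<partial>period_measure)"
        by (rule Bochner_Integration.integral_cong) (auto simp: indicator_def)
      ultimately show ?case using compl int[OF A] h by simp
    next
      case (union A)
      then have A: "A i \<in> sets borel" for i using sig by auto
      let ?B = "\<lambda>i. A i \<inter> {0..2 * pi}"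
      have eq: "(LINT t:?B i|period_measure. h t) = 0" for i
      proof -
        have "(LINT t:?B i|period_measure. h t) = (\<integral>t. indicator (A i) t *\<^sub>R h t \<partial>period_measure)"
          unfolding set_lebesgue_integral_def
          by (rule Bochner_Integration.integral_cong) (auto simp: indicator_def)
        then show ?thesis using union by simp
      qed
      have "(\<Union>i. ?B i) \<in> sets period_measure" using meas[OF A] by (intro sets.countable_UN) auto
      then have "set_integrable period_measure (\<Union>i. ?B i) h"
        unfolding set_integrable_def using h by (rule integrable_mult_indicator)
      moreover have "?B i \<inter> ?B j = {}" if "i \<noteq> j" for i j
        using union(1) that by (auto simp: disjoint_family_on_def)
      ultimately have "(LINT t:(\<Union>i. ?B i)|period_measure. h t) = (\<Sum>i. (LINT t:?B i|period_measure. h t))"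
        using meas[OF A] by (intro lebesgue_integral_countable_add)
      then have "(LINT t:(\<Union>i. ?B i)|period_measure. h t) = 0" using eq by simp
      moreover have "(LINT t:(\<Union>i. ?B i)|period_measure. h t) = (\<integral>t. indicator (\<Union>i. A i) t *\<^sub>R h t \<partial>period_measure)"
        unfolding set_lebesgue_integral_def
        by (rule Bochner_Integration.integral_cong) (auto simp: indicator_def)
      ultimately show ?case by simp
    qed simp
  qed
  show ?thesis
  proof (rule sigma_finite_measure.density_zero[OF finite_measure.axioms(1)[OF finite_measure_period_measure] h])
    fix A assume "A \<in> sets period_measure"
    then have "A \<in> sets borel" by (auto simp: period_measure_def sets_restrict_space)
    then show "set_lebesgue_integral period_measure A h = 0"
      using borel by (simp add: set_lebesgue_integral_def)
  qed
qed

lemma weak_deriv_unique: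
  assumes "weak_deriv f v" "weak_deriv g w" "AE t in period_measure. f t = g t"
  shows "AE t in period_measure. v t = w t"
proof -
  note L = assms(1,2)[unfolded weak_deriv_def]
  have "AE t in period_measure. v t - w t = 0"
  proof (rule orthogonal_smooth_imp_AE_zero)
    show "integrable period_measure (\<lambda>t. v t - w t)" using L by (simp add: L2_period_integrable)
    fix \<phi> assume \<phi>: "\<phi> \<in> smooth_periodic"
    have "(\<integral>t. deriv \<phi> t *\<^sub>R f t \<partial>period_measure) = (\<integral>t. deriv \<phi> t *\<^sub>R g t \<partial>period_measure)"
      using L \<phi> assms(3)
      by (intro integral_cong_AE borel_measurable_integrable period_integrable_scaleR
          L2_period_integrable smooth_periodic_cont) auto
    then have "(\<integral>t. \<phi> t *\<^sub>R v t \<partial>period_measure) = (\<integral>t. \<phi> t *\<^sub>R w t \<partial>period_measure)"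
      using L \<phi> by simp
    then show "(\<integral>t. \<phi> t *\<^sub>R (v t - w t) \<partial>period_measure) = 0"
      using L \<phi>
      by (simp add: scaleR_diff_right period_integrable_scaleR L2_period_integrable smooth_periodic_cont)
  qed
  then show ?thesis by simp
qed

lemma weak_deriv_cong:
  assumes "weak_deriv f v" "AE t in period_measure. f t = g t" "g \<in> L2_period"
  shows "weak_deriv g v"
proof -
  note L = assms(1)[unfolded weak_deriv_def]
  have "(\<integral>t. deriv \<phi> t *\<^sub>R g t \<partial>period_measure) = (\<integral>t. deriv \<phi> t *\<^sub>R f t \<partial>period_measure)"
    if \<phi>: "\<phi> \<in> smooth_periodic" for \<phi>
    using L \<phi> assms(2,3)
    by (intro integral_cong_AE borel_measurable_integrable period_integrable_scaleR
        L2_period_integrable smooth_periodic_cont) auto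
  then show ?thesis using L assms(3) by (simp add: weak_deriv_def)
qed

lemma weak_deriv_wderiv: "weak_deriv f v \<Longrightarrow> weak_deriv f (wderiv f)"
  unfolding wderiv_def by (rule someI[of "weak_deriv f"])

text \<open>\<open>curve u\<close> is the continuous representative of the Sobolev class.\<close>

typedef H2_per = "{u :: real \<Rightarrow> real^3. continuous_on UNIV u \<and> (\<forall>t. u (t + 2 * pi) = u t) \<and>
    (\<exists>v w. weak_deriv u v \<and> weak_deriv v w)}"
  morphisms curve Abs_H2_per
  by (rule exI[of _ "\<lambda>_. 0"]) (use weak_deriv_zero in auto)

setup_lifting type_definition_H2_per

instantiation H2_per :: real_vector
begin

lift_definition zero_H2_per :: H2_per is "\<lambda>_. 0"
  using weak_deriv_zero by auto

lift_definition plus_H2_per :: "H2_per \<Rightarrow> H2_per \<Rightarrow> H2_per" is "\<lambda>u v t. u t + v t"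
proof (elim conjE exE, intro conjI)
  fix u v :: "real \<Rightarrow> real^3" and u' u'' v' v''
  assume "weak_deriv u u'" "weak_deriv u' u''" "weak_deriv v v'" "weak_deriv v' v''"
  then show "\<exists>a b. weak_deriv (\<lambda>t. u t + v t) a \<and> weak_deriv a b"
    by (intro exI[of _ "\<lambda>t. u' t + v' t"] exI[of _ "\<lambda>t. u'' t + v'' t"] conjI weak_deriv_add)
qed (auto intro: continuous_on_add)

lift_definition scaleR_H2_per :: "real \<Rightarrow> H2_per \<Rightarrow> H2_per" is "\<lambda>c u t. c *\<^sub>R u t"
proof (elim conjE exE, intro conjI)
  fix u :: "real \<Rightarrow> real^3" and c :: real and u' u''
  assume "weak_deriv u u'" "weak_deriv u' u''"
  then show "\<exists>a b. weak_deriv (\<lambda>t. c *\<^sub>R u t) a \<and> weak_deriv a b"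
    by (intro exI[of _ "\<lambda>t. c *\<^sub>R u' t"] exI[of _ "\<lambda>t. c *\<^sub>R u'' t"] conjI weak_deriv_scaleR)
qed (auto intro: continuous_intros)

definition uminus_H2_per :: "H2_per \<Rightarrow> H2_per" where "uminus_H2_per u = (-1) *\<^sub>R u"

definition minus_H2_per :: "H2_per \<Rightarrow> H2_per \<Rightarrow> H2_per" where "minus_H2_per u v = u + (-1) *\<^sub>R v"

instance
proof
  fix u v w :: H2_per and a b :: real
  show "u + v + w = u + (v + w)" by transfer (simp add: add.assoc)
  show "u + v = v + u" by transfer (simp add: add.commute)
  show "0 + u = u" by transfer simp
  show "- u + u = 0" unfolding uminus_H2_per_def by transfer simp
  show "u - v = u + - v" by (simp add: uminus_H2_per_def minus_H2_per_def)
  show "a *\<^sub>R (u + v) = a *\<^sub>R u + a *\<^sub>R v" by transfer (simp add: scaleR_add_right)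
  show "(a + b) *\<^sub>R u = a *\<^sub>R u + b *\<^sub>R u" by transfer (simp add: scaleR_add_left)
  show "a *\<^sub>R b *\<^sub>R u = (a * b) *\<^sub>R u" by transfer simp
  show "1 *\<^sub>R u = u" by transfer simp
qed

end

lemma curve_weak_deriv:
  "weak_deriv (curve u) (wderiv (curve u))" "weak_deriv (wderiv (curve u)) (wderiv (wderiv (curve u)))"
proof -
  obtain v w where vw: "weak_deriv (curve u) v" "weak_deriv v w" using curve[of u] by blast
  then show 1: "weak_deriv (curve u) (wderiv (curve u))" by (intro weak_deriv_wderiv)
  have "weak_deriv (wderiv (curve u)) w"
    by (rule weak_deriv_cong[OF vw(2)])
      (use weak_deriv_unique[OF vw(1) 1] 1 in \<open>auto simp: weak_deriv_def\<close>)
  then show "weak_deriv (wderiv (curve u)) (wderiv (wderiv (curve u)))" by (rule weak_deriv_wderiv)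
qed

lemma curve_L2: "curve u \<in> L2_period" "wderiv (curve u) \<in> L2_period" "wderiv (wderiv (curve u)) \<in> L2_period"
  using curve_weak_deriv[of u] by (auto simp: weak_deriv_def)

lemma wderiv_add:
  "AE t in period_measure. wderiv (curve (u + v)) t = wderiv (curve u) t + wderiv (curve v) t"
  "AE t in period_measure. wderiv (wderiv (curve (u + v))) t = wderiv (wderiv (curve u)) t + wderiv (wderiv (curve v)) t"
proof -
  show 1: "AE t in period_measure. wderiv (curve (u + v)) t = wderiv (curve u) t + wderiv (curve v) t"
    by (rule weak_deriv_unique[OF curve_weak_deriv(1) weak_deriv_add[OF curve_weak_deriv(1) curve_weak_deriv(1)]])
      (simp add: plus_H2_per.rep_eq)
  show "AE t in period_measure. wderiv (wderiv (curve (u + v))) t = wderiv (wderiv (curve u)) t + wderiv (wderiv (curve v)) t"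
    by (rule weak_deriv_unique[OF curve_weak_deriv(2) weak_deriv_add[OF curve_weak_deriv(2) curve_weak_deriv(2)] 1])
qed

lemma wderiv_scaleR:
  "AE t in period_measure. wderiv (curve (c *\<^sub>R u)) t = c *\<^sub>R wderiv (curve u) t"
  "AE t in period_measure. wderiv (wderiv (curve (c *\<^sub>R u))) t = c *\<^sub>R wderiv (wderiv (curve u)) t"
proof -
  show 1: "AE t in period_measure. wderiv (curve (c *\<^sub>R u)) t = c *\<^sub>R wderiv (curve u) t"
    by (rule weak_deriv_unique[OF curve_weak_deriv(1) weak_deriv_scaleR[OF curve_weak_deriv(1)]])
      (simp add: scaleR_H2_per.rep_eq)
  show "AE t in period_measure. wderiv (wderiv (curve (c *\<^sub>R u))) t = c *\<^sub>R wderiv (wderiv (curve u)) t"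
    by (rule weak_deriv_unique[OF curve_weak_deriv(2) weak_deriv_scaleR[OF curve_weak_deriv(2)] 1])
qed

lemma continuous_AE_zero_period:
  fixes f :: "real \<Rightarrow> real^3"
  assumes c: "continuous_on UNIV f" and p: "\<And>t. f (t + 2 * pi) = f t"
    and ae: "AE t in period_measure. f t = 0"
  shows "f t = 0"
proof -
  have "AE t in lborel. t \<in> {0..2 * pi} \<longrightarrow> f t = 0"
    using ae unfolding period_measure_def by (subst (asm) AE_restrict_space_iff) auto
  then have ae0: "AE t in lborel. t \<in> {0<..<2 * pi} \<longrightarrow> f t = 0" by (rule AE_mp) auto
  let ?N = "{0<..<2 * pi} \<inter> f -` (- {0})"
  have "open ?N" by (intro open_Int open_vimage c) auto
  moreover have "?N \<in> null_sets lborel"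
    using ae0 \<open>open ?N\<close> by (subst AE_iff_null_sets) (auto elim: AE_mp)
  then have "negligible ?N" by (simp add: negligible_iff_null_sets null_sets_completionI)
  ultimately have "?N = {}" using open_not_negligible by blast
  then have "f s = 0" if "s \<in> {0<..<2 * pi}" for s using that by auto
  moreover have "closure {0<..<2 * pi} = {0..2 * pi}" by simp
  ultimately have icc: "f s = 0" if "s \<in> {0..2 * pi}" for s
    using continuous_constant_on_closure[of "{0<..<2 * pi}" f 0 s] that
      continuous_on_subset[OF c subset_UNIV] by metis
  have per: "f (s + 2 * pi * real n) = f s" for s n
  proof (induction n)
    case (Suc n)
    then show ?case using p[of "s + 2 * pi * real n"] by (simp add: algebra_simps)
  qed simp
  define k where "k = \<lfloor>t / (2 * pi)\<rfloor>"
  define s where "s = t - 2 * pi * of_int k"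
  have "of_int k \<le> t / (2 * pi)" "t / (2 * pi) < of_int k + 1" unfolding k_def by linarith+
  then have "s \<in> {0..2 * pi}" by (auto simp: s_def field_simps)
  moreover have "f t = f s"
  proof (cases "0 \<le> k")
    case True
    then show ?thesis using per[of s "nat k"] by (simp add: s_def)
  next
    case False
    then show ?thesis using per[of t "nat (- k)"] by (simp add: s_def)
  qed
  ultimately show ?thesis using icc by simp
qed

instantiation H2_per :: real_inner
begin

definition inner_H2_per :: "H2_per \<Rightarrow> H2_per \<Rightarrow> real" where
  "inner_H2_per u v =
     (\<integral>t. curve u t \<bullet> curve v t + wderiv (curve u) t \<bullet> wderiv (curve v) t + wderiv (wderiv (curve u)) t \<bullet> wderiv (wderiv (curve v)) t \<partial>period_measure)"

definition norm_H2_per :: "H2_per \<Rightarrow> real" where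
  "norm_H2_per u = sqrt (u \<bullet> u)"

definition dist_H2_per :: "H2_per \<Rightarrow> H2_per \<Rightarrow> real" where
  "dist_H2_per u v = norm (u - v)"

definition sgn_H2_per :: "H2_per \<Rightarrow> H2_per" where
  "sgn_H2_per u = u /\<^sub>R norm u"

definition uniformity_H2_per :: "(H2_per \<times> H2_per) filter" where
  "uniformity_H2_per = (INF e\<in>{0<..}. principal {(u, v). dist u v < e})"

definition open_H2_per :: "H2_per set \<Rightarrow> bool" where
  "open_H2_per U \<longleftrightarrow> (\<forall>u\<in>U. eventually (\<lambda>(u', v). u' = u \<longrightarrow> v \<in> U) uniformity)"

instance
proof
  fix u v w :: H2_per and c :: real and U :: "H2_per set"
  note int = L2_period_integrable_inner[OF curve_L2(1) curve_L2(1)]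
    L2_period_integrable_inner[OF curve_L2(2) curve_L2(2)] L2_period_integrable_inner[OF curve_L2(3) curve_L2(3)]
  note meas = borel_measurable_integrable[OF int(1)] borel_measurable_integrable[OF int(2)]
    borel_measurable_integrable[OF int(3)]
  show "dist u v = norm (u - v)" by (rule dist_H2_per_def)
  show "sgn u = u /\<^sub>R norm u" by (rule sgn_H2_per_def)
  show "uniformity = (INF e\<in>{0<..}. principal {(u, v :: H2_per). dist u v < e})"
    by (rule uniformity_H2_per_def)
  show "open U \<longleftrightarrow> (\<forall>u\<in>U. eventually (\<lambda>(u', v). u' = u \<longrightarrow> v \<in> U) uniformity)"
    by (rule open_H2_per_def)
  show "norm u = sqrt (u \<bullet> u)" by (rule norm_H2_per_def)
  show "u \<bullet> v = v \<bullet> u" by (simp add: inner_H2_per_def inner_commute)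
  have split: "x \<bullet> y = (\<integral>t. curve x t \<bullet> curve y t \<partial>period_measure) + (\<integral>t. wderiv (curve x) t \<bullet> wderiv (curve y) t \<partial>period_measure)
      + (\<integral>t. wderiv (wderiv (curve x)) t \<bullet> wderiv (wderiv (curve y)) t \<partial>period_measure)" for x y
    unfolding inner_H2_per_def by (simp add: int)
  have "(\<integral>t. curve (u + v) t \<bullet> curve w t \<partial>period_measure) = (\<integral>t. curve u t \<bullet> curve w t + curve v t \<bullet> curve w t \<partial>period_measure)"
    by (simp add: plus_H2_per.rep_eq inner_add_left)
  moreover have "(\<integral>t. wderiv (curve (u + v)) t \<bullet> wderiv (curve w) t \<partial>period_measure)
      = (\<integral>t. wderiv (curve u) t \<bullet> wderiv (curve w) t + wderiv (curve v) t \<bullet> wderiv (curve w) t \<partial>period_measure)"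
    using wderiv_add(1)[of u v] by (intro integral_cong_AE meas borel_measurable_add) (auto simp: inner_add_left)
  moreover have "(\<integral>t. wderiv (wderiv (curve (u + v))) t \<bullet> wderiv (wderiv (curve w)) t \<partial>period_measure)
      = (\<integral>t. wderiv (wderiv (curve u)) t \<bullet> wderiv (wderiv (curve w)) t + wderiv (wderiv (curve v)) t \<bullet> wderiv (wderiv (curve w)) t \<partial>period_measure)"
    using wderiv_add(2)[of u v] by (intro integral_cong_AE meas borel_measurable_add) (auto simp: inner_add_left)
  ultimately show "(u + v) \<bullet> w = u \<bullet> w + v \<bullet> w" by (simp add: split int)
  have "(\<integral>t. curve (c *\<^sub>R u) t \<bullet> curve v t \<partial>period_measure) = (\<integral>t. c * (curve u t \<bullet> curve v t) \<partial>period_measure)"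
    by (simp add: scaleR_H2_per.rep_eq)
  moreover have "(\<integral>t. wderiv (curve (c *\<^sub>R u)) t \<bullet> wderiv (curve v) t \<partial>period_measure)
      = (\<integral>t. c * (wderiv (curve u) t \<bullet> wderiv (curve v) t) \<partial>period_measure)"
    using wderiv_scaleR(1)[of c u] by (intro integral_cong_AE meas borel_measurable_times) auto
  moreover have "(\<integral>t. wderiv (wderiv (curve (c *\<^sub>R u))) t \<bullet> wderiv (wderiv (curve v)) t \<partial>period_measure)
      = (\<integral>t. c * (wderiv (wderiv (curve u)) t \<bullet> wderiv (wderiv (curve v)) t) \<partial>period_measure)"
    using wderiv_scaleR(2)[of c u] by (intro integral_cong_AE meas borel_measurable_times) auto
  ultimately show "(c *\<^sub>R u) \<bullet> v = c * (u \<bullet> v)" by (simp add: split distrib_left)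
  show "0 \<le> u \<bullet> u" by (simp add: inner_H2_per_def)
  show "u \<bullet> u = 0 \<longleftrightarrow> u = 0"
  proof
    assume "u = 0"
    have "AE t in period_measure. wderiv (curve u) t = 0" "AE t in period_measure. wderiv (wderiv (curve u)) t = 0"
      using wderiv_scaleR[of 0 u] \<open>u = 0\<close> by auto
    then have "(\<integral>t. wderiv (curve u) t \<bullet> wderiv (curve u) t \<partial>period_measure) = 0"
      "(\<integral>t. wderiv (wderiv (curve u)) t \<bullet> wderiv (wderiv (curve u)) t \<partial>period_measure) = 0"
      by (auto intro!: integral_eq_zero_AE)
    then show "u \<bullet> u = 0" using \<open>u = 0\<close> by (simp add: split zero_H2_per.rep_eq)
  next
    assume "u \<bullet> u = 0"
    moreover have "0 \<le> (\<integral>t. curve u t \<bullet> curve u t \<partial>period_measure)"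
      "0 \<le> (\<integral>t. wderiv (curve u) t \<bullet> wderiv (curve u) t \<partial>period_measure)"
      "0 \<le> (\<integral>t. wderiv (wderiv (curve u)) t \<bullet> wderiv (wderiv (curve u)) t \<partial>period_measure)" by simp_all
    ultimately have "(\<integral>t. curve u t \<bullet> curve u t \<partial>period_measure) = 0" unfolding split by linarith
    then have "AE t in period_measure. curve u t \<bullet> curve u t = 0"
      by (subst (asm) integral_nonneg_eq_0_iff_AE[OF int(1)]) auto
    then have "curve u t = 0" for t
      using curve[of u] by (intro continuous_AE_zero_period) auto
    then show "u = 0" by (simp add: curve_inject[symmetric] zero_H2_per.rep_eq fun_eq_iff)
  qed
qed

end


section \<open>The rotation groups\<close>

definition SO3 :: "(real^3^3) monoid" where
  "SO3 = \<lparr>carrier = {M. rotation_matrix M}, mult = (**), one = mat 1\<rparr>"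

definition tetrahedral :: "(real^3^3) set" where
  "tetrahedral = generate SO3
     {vector [vector [1, 0, 0], vector [0, -1, 0], vector [0, 0, -1]],
      vector [vector [0, 1, 0], vector [0, 0, 1], vector [1, 0, 0]]}"

definition octahedral :: "(real^3^3) set" where
  "octahedral = generate SO3
     {vector [vector [0, -1, 0], vector [1, 0, 0], vector [0, 0, 1]],
      vector [vector [-1, 0, 0], vector [0, 0, 1], vector [0, 1, 0]]}"

definition golden :: real where
  "golden = (1 + sqrt 5) / 2"

definition icosahedral :: "(real^3^3) set" where
  "icosahedral = generate SO3
     {(1 / 2) *\<^sub>R vector [vector [golden - 1, golden, 1],
                       vector [golden, -1, golden - 1],
                       vector [1, golden - 1, - golden]],
      vector [vector [0, 0, 1], vector [1, 0, 0], vector [0, 1, 0]]}"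


section \<open>The Newtonian problem\<close>

text \<open>The central body has mass \<open>\<mu>\<close> and position \<open>x0\<close>; the unit masses are indexed by the
  elements of \<open>H\<close>. The factor \<open>1 / 2\<close> accounts for counting each unordered pair twice.\<close>

definition nbody_potential ::
  "(real^3^3) set \<Rightarrow> real \<Rightarrow> real^3 \<Rightarrow> (real^3^3 \<Rightarrow> real^3) \<Rightarrow> real" where
  "nbody_potential H \<mu> x0 x =
     - \<mu> * (\<Sum>L\<in>H. 1 / norm (x L - x0))
     - (1 / 2) * (\<Sum>L\<in>H. \<Sum>L'\<in>H - {L}. 1 / norm (x L - x L'))"

definition nbody_solution ::
  "(real^3^3) set \<Rightarrow> real \<Rightarrow> (real \<Rightarrow> real^3) \<Rightarrow> (real^3^3 \<Rightarrow> real \<Rightarrow> real^3) \<Rightarrow> bool" where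
  "nbody_solution H \<mu> q0 q \<longleftrightarrow>
     (\<forall>t. (\<forall>L\<in>H. q L t \<noteq> q0 t) \<and> inj_on (\<lambda>L. q L t) H) \<and>
     (\<exists>v a. \<forall>t. (q0 has_vector_derivative v t) (at t) \<and> (v has_vector_derivative a t) (at t) \<and>
        GDERIV (\<lambda>x. nbody_potential H \<mu> x (\<lambda>L. q L t)) (q0 t) :> - (\<mu> *\<^sub>R a t)) \<and>
     (\<forall>L\<in>H. \<exists>v a. \<forall>t.
        (q L has_vector_derivative v t) (at t) \<and> (v has_vector_derivative a t) (at t) \<and>
        GDERIV (\<lambda>x. nbody_potential H \<mu> (q0 t) ((\<lambda>L'. q L' t)(L := x))) (q L t) :> - a t)"

definition H_symmetric ::
  "(real^3^3) set \<Rightarrow> (real \<Rightarrow> real^3) \<Rightarrow> (real^3^3 \<Rightarrow> real \<Rightarrow> real^3) \<Rightarrow> bool" where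
  "H_symmetric H q0 q \<longleftrightarrow> (\<forall>t. q0 t = 0) \<and> (\<forall>L\<in>H. \<forall>t. q L t = L *v q (mat 1) t)"


section \<open>The reduced action\<close>

definition action0 :: "(real \<Rightarrow> real^3) \<Rightarrow> real" where
  "action0 u = (\<integral>t. (norm (wderiv u t))\<^sup>2 / 2 + 1 / norm (u t) \<partial>period_measure)"

definition action1 :: "(real^3^3) set \<Rightarrow> (real \<Rightarrow> real^3) \<Rightarrow> real" where
  "action1 H u =
     (1 / 2) * (\<integral>t. (\<Sum>L\<in>H - {mat 1}. 1 / norm (u t - L *v u t)) \<partial>period_measure)"

definition action :: "(real^3^3) set \<Rightarrow> real \<Rightarrow> H2_per \<Rightarrow> real" where
  "action H \<epsilon> u = action0 (curve u) + \<epsilon> * action1 H (curve u)"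

definition collision_free :: "(real^3^3) set \<Rightarrow> H2_per \<Rightarrow> bool" where
  "collision_free H u \<longleftrightarrow>
     (\<forall>t. curve u t \<noteq> 0 \<and> (\<forall>L\<in>H - {mat 1}. curve u t \<noteq> L *v curve u t))"

definition critical_point :: "(real^3^3) set \<Rightarrow> real \<Rightarrow> H2_per \<Rightarrow> bool" where
  "critical_point H \<epsilon> u \<longleftrightarrow>
     collision_free H u \<and> (action H \<epsilon> has_derivative (\<lambda>_. 0)) (at u)"


section \<open>Kepler ellipses\<close>

definition kepler_c :: "real \<Rightarrow> real" where
  "kepler_c e = sqrt (1 - e\<^sup>2)"

definition kepler_radius :: "real \<Rightarrow> real \<Rightarrow> real" where
  "kepler_radius e \<theta> = (kepler_c e)\<^sup>2 / (1 + e * cos \<theta>)"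

definition kepler_angle :: "real \<Rightarrow> real \<Rightarrow> real" where
  "kepler_angle e = (THE \<theta>. \<theta> 0 = 0 \<and>
     (\<forall>t. (\<theta> has_real_derivative kepler_c e / (kepler_radius e (\<theta> t))\<^sup>2) (at t)))"

definition unit_circle :: "real \<Rightarrow> real^3" where
  "unit_circle \<theta> = vector [cos \<theta>, sin \<theta>, 0]"

text \<open>The library's \<open>exp\<close> is not available on matrices (the type is not a normed algebra).\<close>

definition matrix_exp :: "real^3^3 \<Rightarrow> real^3^3" where
  "matrix_exp M = (\<Sum>k. (1 / fact k) *\<^sub>R (((**) M) ^^ k) (mat 1))"

definition J1 :: "real^3^3" where
  "J1 = vector [vector [0, 0, 0], vector [0, 0, -1], vector [0, 1, 0]]"

definition J2 :: "real^3^3" where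
  "J2 = vector [vector [0, 0, -1], vector [0, 0, 0], vector [1, 0, 0]]"

definition J3 :: "real^3^3" where
  "J3 = vector [vector [0, -1, 0], vector [1, 0, 0], vector [0, 0, 0]]"

definition rot :: "real^3 \<Rightarrow> real^3^3" where
  "rot \<psi> = matrix_exp (\<psi> $ 1 *\<^sub>R J1) ** matrix_exp (\<psi> $ 2 *\<^sub>R J2) ** matrix_exp (\<psi> $ 3 *\<^sub>R J3)"

definition kepler_ellipse :: "real \<Rightarrow> real^3 \<Rightarrow> real \<Rightarrow> real^3" where
  "kepler_ellipse e \<psi> t =
     rot \<psi> *v (kepler_radius e (kepler_angle e t) *\<^sub>R unit_circle (kepler_angle e t))"

text \<open>The four variables \<open>(e, \<psi>\<^sub>1, \<psi>\<^sub>2, \<psi>\<^sub>3)\<close> are the components of a vector in \<open>real^4\<close>.\<close>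

definition reduced_action :: "(real^3^3) set \<Rightarrow> real^4 \<Rightarrow> real" where
  "reduced_action H p = action1 H (kepler_ellipse (p $ 1) (vector [p $ 2, p $ 3, p $ 4]))"

text \<open>\<open>M\<close> is the Hessian matrix of \<open>f\<close> at \<open>p\<close>: the derivative at \<open>p\<close> of the gradient field
  \<open>G\<close> of \<open>f\<close>.\<close>

definition nondegenerate_critical_point :: "(real^'n \<Rightarrow> real) \<Rightarrow> real^'n \<Rightarrow> bool" where
  "nondegenerate_critical_point f p \<longleftrightarrow>
     GDERIV f p :> 0 \<and>
     (\<exists>G M. (\<forall>\<^sub>F x in nhds p. GDERIV f x :> G x) \<and>
        (G has_derivative (\<lambda>h. M *v h)) (at p) \<and> invertible M)"

end

theory Submission
  imports Defs
begin

text \<open>Critical points of the action are the \<open>2 * pi\<close>-periodic solutions of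
  \<open>u'' = - fK u - \<epsilon> gH H u\<close>. At \<open>\<epsilon> = 0\<close> the Kepler ellipses form a four-parameter family of periodic
  orbits, so the linearised equation is degenerate. Near an ellipse \<open>kep p\<close> we blow up,
  \<open>u = kep p + \<epsilon> v\<close>, and treat \<open>p\<close>, the second derivative \<open>h\<close> of \<open>v\<close> and the initial speed
  \<open>\<kappa>\<close> of \<open>v\<close> as unknowns; time translation is factored out by putting an apsis at time \<open>0\<close>. The
  rescaled equation is \<open>C\<^sup>1\<close> up to \<open>\<epsilon> = 0\<close>. Its linearisation there is a Volterra operator in \<open>h\<close>
  bordered by finitely many conditions, and pairing it with the six solutions of the Jacobi equation
  along the ellipse turns injectivity into invertibility of the Hessian of the reduced action:
  the pairing with the variation of the ellipse in the parameters is minus the gradient of the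
  reduced action, the pairing with the scaling variation determines \<open>\<kappa>\<close>, and the pairing with the
  velocity vanishes by conservation of energy, which also removes the one periodicity condition that
  is left out of the system. The implicit function theorem then gives the branch. Any critical point
  close to the ellipse can be blown up in the same way, and the pairing with the scaling variation bounds
  the blown-up solution a priori, which places it in the uniqueness neighbourhood of
  the implicit function theorem.\<close>

section \<open>Continuously differentiable maps between normed spaces\<close>

text \<open>The unknown is a continuous second derivative in the sup norm, not a curve in X:
  superposition operators are \<open>C^1\<close> there, and \<open>Pop\<close> carries solutions
  into X by a bounded linear map. The pair \<open>(p, \<kappa>)\<close> has five scalars, and
  \<open>v (2 * pi) = 0\<close> with two components of the jump of \<open>v'\<close> are five
  conditions, so the bordered operator is square and injectivity suffices. The obstacle is its
  derivative in \<open>p\<close>, which would involve second derivatives of the ellipses, handled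
  only as a \<open>C^1\<close> family. It is never computed: Green's identity holds at every
  \<open>p\<close> near \<open>p0\<close>; at \<open>p0 + s p\<close> it is divided by
  \<open>s\<close>, and in the limit only the given Hessian enters. The fixed period fixes the
  semi-major axis, so the scaling variation is not periodic; its drift along the velocity is the
  nonzero coefficient of \<open>\<kappa>\<close>. Positive eccentricity separates time shift from
  rotation in the orbital plane and makes the apsis a transversal zero of the radial speed;
  \<open>cos (\<psi>0 $ 2) \<noteq> 0\<close> makes the Euler angles regular. For uniqueness only
  \<open>\<epsilon> v\<close> is known to be small, not \<open>v\<close> itself: hence the a priori
  bound.\<close>

definition fderiv :: "('a::real_normed_vector \<Rightarrow> 'b::real_normed_vector) \<Rightarrow> 'a \<Rightarrow> 'a \<Rightarrow>\<^sub>L 'b" where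
  "fderiv f x = Blinfun (frechet_derivative f (at x))"

text \<open>The derivative is taken in the full space and not within \<open>S\<close>, so the rules
  for composition carry no openness conditions; on an open \<open>S\<close> this is the usual
  notion.\<close>

definition C1_on :: "'a::real_normed_vector set \<Rightarrow> ('a \<Rightarrow> 'b::real_normed_vector) \<Rightarrow> bool" where
  "C1_on S f \<longleftrightarrow> (\<forall>x\<in>S. f differentiable (at x)) \<and> continuous_on S (fderiv f)"

lemma fderiv_eq: "(f has_derivative blinfun_apply f') (at x) \<Longrightarrow> fderiv f x = f'"
  unfolding fderiv_def by (simp add: frechet_derivative_at[symmetric] blinfun_apply_inverse)

lemma C1_onI:
  assumes "\<And>x. x \<in> S \<Longrightarrow> (f has_derivative blinfun_apply (f' x)) (at x)" "continuous_on S f'"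
  shows "C1_on S f"
  unfolding C1_on_def
proof
  show "\<forall>x\<in>S. f differentiable (at x)" using assms(1) differentiableI by blast
  show "continuous_on S (fderiv f)"
    using assms(2) by (rule continuous_on_eq) (use assms(1) fderiv_eq in metis)
qed

lemma C1_on_has_derivative:
  "C1_on S f \<Longrightarrow> x \<in> S \<Longrightarrow> (f has_derivative blinfun_apply (fderiv f x)) (at x)"
  unfolding C1_on_def fderiv_def
  by (metis bounded_linear_Blinfun_apply frechet_derivative_works has_derivative_bounded_linear)

lemma C1_on_fderiv: "C1_on S f \<Longrightarrow> continuous_on S (fderiv f)"
  by (simp add: C1_on_def)

lemma C1_on_subset: "C1_on S f \<Longrightarrow> T \<subseteq> S \<Longrightarrow> C1_on T f"
  unfolding C1_on_def by (meson continuous_on_subset subsetD)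

lemma C1_on_imp_continuous_on: "C1_on S f \<Longrightarrow> continuous_on S f"
  by (meson C1_on_has_derivative continuous_at_imp_continuous_on has_derivative_continuous)

lemma C1_on_imp_isCont: "C1_on S f \<Longrightarrow> x \<in> S \<Longrightarrow> isCont f x"
  using C1_on_has_derivative has_derivative_continuous by blast

section \<open>Closure rules for \<open>C^1\<close> maps\<close>

named_theorems C1_intros

lemma C1_on_const [C1_intros]: "C1_on S (\<lambda>x. c)"
  by (rule C1_onI[where f' = "\<lambda>x. 0"]) (auto intro!: continuous_intros derivative_eq_intros)

lemma C1_on_linear:
  assumes "bounded_linear f" shows "C1_on S f"
  by (rule C1_onI[where f' = "\<lambda>x. Blinfun f"])
    (auto simp: bounded_linear_Blinfun_apply assms intro!: continuous_intros bounded_linear_imp_has_derivative)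

lemma C1_on_id [C1_intros]: "C1_on S (\<lambda>x. x)"
  by (intro C1_on_linear bounded_linear_ident)

lemma C1_on_compose:
  assumes f: "C1_on S f" and g: "C1_on T g" and ST: "\<And>x. x \<in> S \<Longrightarrow> f x \<in> T"
  shows "C1_on S (\<lambda>x. g (f x))"
proof (rule C1_onI)
  show "((\<lambda>x. g (f x)) has_derivative blinfun_apply (fderiv g (f x) o\<^sub>L fderiv f x)) (at x)" if "x \<in> S" for x
    using has_derivative_compose[OF C1_on_has_derivative[OF f that] C1_on_has_derivative[OF g ST[OF that]]]
    by (simp add: blinfun_compose.rep_eq o_def)
  have "continuous_on S (\<lambda>x. fderiv g (f x))"
    using C1_on_imp_continuous_on[OF f] C1_on_fderiv[OF g] ST continuous_on_compose2 by blast
  then show "continuous_on S (\<lambda>x. fderiv g (f x) o\<^sub>L fderiv f x)"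
    by (intro continuous_intros C1_on_fderiv f)
qed

lemma C1_on_linear_compose: "bounded_linear g \<Longrightarrow> C1_on S f \<Longrightarrow> C1_on S (\<lambda>x. g (f x))"
  by (rule C1_on_compose[OF _ C1_on_linear[of g UNIV]]) auto

lemma C1_on_bilinear:
  assumes "bounded_bilinear B" shows "C1_on UNIV (\<lambda>z. B (fst z) (snd z))"
proof -
  interpret bounded_bilinear B by fact
  let ?D = "\<lambda>z. (prod_right (fst z) o\<^sub>L snd_blinfun) + (prod_left (snd z) o\<^sub>L fst_blinfun)"
  show ?thesis
  proof (rule C1_onI)
    show "((\<lambda>z. B (fst z) (snd z)) has_derivative blinfun_apply (?D z)) (at z)" for z
      by (rule has_derivative_eq_rhs[OF FDERIV[OF bounded_linear_imp_has_derivative[OF bounded_linear_fst]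
              bounded_linear_imp_has_derivative[OF bounded_linear_snd]]])
        (simp add: fun_eq_iff prod_right.rep_eq prod_left.rep_eq blinfun.add_left)
    show "continuous_on UNIV ?D"
      by (intro continuous_intros bounded_linear.continuous_on[OF bounded_linear_prod_left]
          bounded_linear.continuous_on[OF bounded_linear_prod_right])
  qed
qed

lemma C1_on_Pair [C1_intros]:
  assumes f: "C1_on S f" and g: "C1_on S g"
  shows "C1_on S (\<lambda>x. (f x, g x))"
proof -
  let ?i = "Blinfun (\<lambda>x. (x, 0))" and ?j = "Blinfun (\<lambda>x. (0, x))"
  have i: "blinfun_apply ?i = (\<lambda>x. (x, 0))" "blinfun_apply ?j = (\<lambda>x. (0, x))"
    by (intro bounded_linear_Blinfun_apply bounded_linear_Pair bounded_linear_ident bounded_linear_zero)+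
  show ?thesis
  proof (rule C1_onI)
    show "((\<lambda>x. (f x, g x)) has_derivative blinfun_apply ((?i o\<^sub>L fderiv f x) + (?j o\<^sub>L fderiv g x))) (at x)" if "x \<in> S" for x
      by (rule has_derivative_eq_rhs[OF has_derivative_Pair[OF C1_on_has_derivative[OF f that]
              C1_on_has_derivative[OF g that]]])
        (simp add: fun_eq_iff blinfun.add_left i)
    show "continuous_on S (\<lambda>x. (?i o\<^sub>L fderiv f x) + (?j o\<^sub>L fderiv g x))"
      by (intro continuous_intros C1_on_fderiv f g)
  qed
qed

lemma C1_on_bilinear_compose:
  "bounded_bilinear B \<Longrightarrow> C1_on S f \<Longrightarrow> C1_on S g \<Longrightarrow> C1_on S (\<lambda>x. B (f x) (g x))"
  using C1_on_compose[OF C1_on_Pair C1_on_bilinear] by fastforce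

lemmas C1_on_add [C1_intros] =
  C1_on_compose[OF C1_on_Pair C1_on_linear[OF bounded_linear_add[OF bounded_linear_fst bounded_linear_snd], of UNIV], simplified]
lemmas C1_on_diff [C1_intros] =
  C1_on_compose[OF C1_on_Pair C1_on_linear[OF bounded_linear_sub[OF bounded_linear_fst bounded_linear_snd], of UNIV], simplified]
lemmas C1_on_minus [C1_intros] = C1_on_linear_compose[OF bounded_linear_minus[OF bounded_linear_ident]]
lemmas C1_on_fst [C1_intros] = C1_on_linear_compose[OF bounded_linear_fst]
lemmas C1_on_snd [C1_intros] = C1_on_linear_compose[OF bounded_linear_snd]
lemmas C1_on_vec_nth [C1_intros] = C1_on_linear_compose[OF bounded_linear_vec_nth]
lemmas C1_on_matrix_vector_mult [C1_intros] = C1_on_linear_compose[OF matrix_vector_mul_bounded_linear]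
lemmas C1_on_scaleR [C1_intros] = C1_on_bilinear_compose[OF bounded_bilinear_scaleR]
lemmas C1_on_mult [C1_intros] = C1_on_bilinear_compose[OF bounded_bilinear_mult]
lemmas C1_on_inner [C1_intros] = C1_on_bilinear_compose[OF bounded_bilinear_inner]

lemma C1_on_sum [C1_intros]: "(\<And>i. i \<in> I \<Longrightarrow> C1_on S (f i)) \<Longrightarrow> C1_on S (\<lambda>x. \<Sum>i\<in>I. f i x)"
  by (induction I rule: infinite_finite_induct) (auto intro!: C1_intros)

lemma C1_on_real:
  fixes f :: "real \<Rightarrow> real"
  assumes "\<And>x. x \<in> S \<Longrightarrow> (f has_real_derivative f' x) (at x)" "continuous_on S f'"
  shows "C1_on S f"
  by (rule C1_onI[where f' = "\<lambda>x. blinfun_scaleR_left (f' x)"])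
    (use assms in \<open>auto simp: has_field_derivative_def mult_commute_abs
      intro!: bounded_linear.continuous_on[OF bounded_linear_blinfun_scaleR_left]\<close>)

lemma C1_on_sin [C1_intros]: "C1_on S f \<Longrightarrow> C1_on S (\<lambda>x. sin (f x :: real))"
  by (rule C1_on_compose[OF _ C1_on_real[of UNIV sin cos]]) (auto intro!: DERIV_sin continuous_intros)

lemma C1_on_cos [C1_intros]: "C1_on S f \<Longrightarrow> C1_on S (\<lambda>x. cos (f x :: real))"
  by (rule C1_on_compose[OF _ C1_on_real[of UNIV cos "\<lambda>x. - sin x"]]) (auto intro!: DERIV_cos continuous_intros)

lemma C1_on_inverse [C1_intros]:
  "C1_on S f \<Longrightarrow> (\<And>x. x \<in> S \<Longrightarrow> f x \<noteq> 0) \<Longrightarrow> C1_on S (\<lambda>x. inverse (f x :: real))"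
  by (rule C1_on_compose[OF _ C1_on_real[of "-{0}" inverse "\<lambda>x. - (inverse x ^ Suc (Suc 0))"]])
    (auto intro!: DERIV_inverse[simplified] continuous_intros)

lemma C1_on_divide [C1_intros]:
  "C1_on S f \<Longrightarrow> C1_on S g \<Longrightarrow> (\<And>x. x \<in> S \<Longrightarrow> g x \<noteq> 0) \<Longrightarrow> C1_on S (\<lambda>x. f x / g x :: real)"
  unfolding divide_inverse by (intro C1_intros)

lemma C1_on_sqrt [C1_intros]:
  "C1_on S f \<Longrightarrow> (\<And>x. x \<in> S \<Longrightarrow> 0 < f x) \<Longrightarrow> C1_on S (\<lambda>x. sqrt (f x))"
  by (rule C1_on_compose[OF _ C1_on_real[of "{0<..}" sqrt "\<lambda>x. inverse (sqrt x) / 2"]])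
    (auto intro!: DERIV_real_sqrt continuous_intros)

lemma C1_on_power [C1_intros]: "C1_on S f \<Longrightarrow> C1_on S (\<lambda>x. f x ^ n :: real)"
  by (induction n) (auto intro!: C1_intros)

lemma C1_on_norm [C1_intros]:
  fixes f :: "'a::real_normed_vector \<Rightarrow> 'b::real_inner"
  shows "C1_on S f \<Longrightarrow> (\<And>x. x \<in> S \<Longrightarrow> f x \<noteq> 0) \<Longrightarrow> C1_on S (\<lambda>x. norm (f x))"
  unfolding norm_eq_sqrt_inner by (intro C1_intros) auto

text \<open>The sum of \<open>K\<close> and a closed ball is compact because closed balls are.
  Uniform continuity thereby becomes available at the perturbed points \<open>x + k\<close> as well
  as on \<open>K\<close>.\<close>

lemma compact_tube:
  fixes K :: "'a::{real_normed_vector, heine_borel} set"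
  assumes S: "open S" and K: "compact K" "K \<subseteq> S"
  obtains r L where "0 < r" "compact L" "L \<subseteq> S" "\<And>x k. x \<in> K \<Longrightarrow> norm k \<le> r \<Longrightarrow> x + k \<in> L"
proof -
  obtain r where r: "0 < r" "(\<Union>x\<in>K. cball x r) \<subseteq> S"
    using compact_subset_open_imp_cball_epsilon_subset[OF K(1) S K(2)] by blast
  define L where "L = (\<Union>x\<in>K. \<Union>y\<in>cball 0 r. {x + y})"
  show thesis
  proof (rule that[OF r(1)])
    show "compact L" unfolding L_def by (intro compact_sums' K compact_cball)
    show "L \<subseteq> S"
    proof
      fix z assume "z \<in> L"
      then obtain x y where "x \<in> K" "y \<in> cball 0 r" "z = x + y" by (auto simp: L_def)
      then have "z \<in> cball x r" by (simp add: dist_norm)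
      then show "z \<in> S" using r \<open>x \<in> K\<close> by blast
    qed
    show "x + k \<in> L" if "x \<in> K" "norm k \<le> r" for x k
      using that unfolding L_def by (intro UN_I[of x] UN_I[of k]) auto
  qed
qed

text \<open>Uniform continuity of \<open>fderiv f\<close> on a compact tube bounds its oscillation,
  and the mean value inequality on \<open>cball x (norm k)\<close> turns this into a first-order
  remainder uniform over \<open>K\<close>. This is what makes superposition operators differentiable
  in the sup norm.\<close>

lemma C1_on_uniform:
  fixes f :: "'a::{real_normed_vector, heine_borel} \<Rightarrow> 'b::real_normed_vector"
  assumes f: "C1_on S f" and S: "open S" and K: "compact K" "K \<subseteq> S" and "0 < e"
  obtains d where "0 < d" "\<And>x k. x \<in> K \<Longrightarrow> norm k \<le> d \<Longrightarrow> x + k \<in> S"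
    "\<And>x k. x \<in> K \<Longrightarrow> norm k \<le> d \<Longrightarrow> norm (fderiv f (x + k) - fderiv f x) \<le> e"
    "\<And>x k. x \<in> K \<Longrightarrow> norm k \<le> d \<Longrightarrow> norm (f (x + k) - f x - fderiv f x k) \<le> e * norm k"
proof -
  obtain r L where r: "0 < r" and L: "compact L" and LS: "L \<subseteq> S"
    and inL: "\<And>x k. x \<in> K \<Longrightarrow> norm k \<le> r \<Longrightarrow> x + k \<in> L"
    using compact_tube[OF S K] by blast
  have "uniformly_continuous_on L (fderiv f)"
    using C1_on_fderiv[OF f] LS by (intro compact_uniformly_continuous L) (rule continuous_on_subset)
  then obtain d where d: "0 < d" "\<And>x y. x \<in> L \<Longrightarrow> y \<in> L \<Longrightarrow> dist y x < d \<Longrightarrow> dist (fderiv f y) (fderiv f x) < e"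
    using \<open>0 < e\<close> unfolding uniformly_continuous_on_def by metis
  have est: "norm (fderiv f (x + k) - fderiv f x) \<le> e" if "x \<in> K" "norm k \<le> min r (d / 2)" for x k
  proof -
    have "dist (fderiv f (x + k)) (fderiv f x) < e"
    proof (rule d(2))
      show "x \<in> L" "x + k \<in> L" using inL[of x 0] inL[of x k] that r by auto
      show "dist (x + k) x < d" using that d(1) by (simp add: dist_norm)
    qed
    then show ?thesis by (simp add: dist_norm)
  qed
  show thesis
  proof
    show "0 < min r (d / 2)" using r d by simp
    show "x + k \<in> S" if "x \<in> K" "norm k \<le> min r (d / 2)" for x k
      using inL[of x k] LS that by auto
    show "norm (f (x + k) - f x - fderiv f x k) \<le> e * norm k" if xk: "x \<in> K" "norm k \<le> min r (d / 2)" for x k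
    proof -
      have in_S: "y \<in> S" if "y \<in> cball x (norm k)" for y
        using inL[of x "y - x"] LS xk that by (auto simp: dist_norm norm_minus_commute)
      have "norm (f (x + k) - f x - fderiv f x ((x + k) - x)) \<le> norm ((x + k) - x) * e"
      proof (rule differentiable_bound_linearization[where S = "cball x (norm k)"])
        show "x + t *\<^sub>R ((x + k) - x) \<in> cball x (norm k)" if "t \<in> {0..1}" for t
          using that by (simp add: dist_norm mult_left_le_one_le)
        show "(f has_derivative blinfun_apply (fderiv f y)) (at y within cball x (norm k))" if "y \<in> cball x (norm k)" for y
          using C1_on_has_derivative[OF f in_S[OF that]] has_derivative_at_withinI by blast
        show "onorm (blinfun_apply (fderiv f y) - blinfun_apply (fderiv f x)) \<le> e" if "y \<in> cball x (norm k)" for y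
        proof -
          have "norm (fderiv f (x + (y - x)) - fderiv f x) \<le> e"
            using that xk by (intro est) (auto simp: dist_norm norm_minus_commute)
          then show ?thesis by (simp add: norm_blinfun.rep_eq minus_blinfun.rep_eq fun_diff_def)
        qed
      qed auto
      then show ?thesis by (simp add: mult.commute)
    qed
  qed (rule est)
qed

section \<open>The implicit function theorem in Banach spaces\<close>

text \<open>Solving \<open>A x = y\<close> is a fixed point problem for
  \<open>x + (y - A x)\<close>, a contraction with constant 1/2. The bound 2 on the inverse does not
  depend on \<open>A\<close>, which later gives continuity of the inverse in the base point.\<close>

lemma neumann_inverse:
  fixes A :: "'a::banach \<Rightarrow>\<^sub>L 'a"
  assumes A: "norm (A - id_blinfun) \<le> 1 / 2"
  obtains R where "R o\<^sub>L A = id_blinfun" "A o\<^sub>L R = id_blinfun" "norm R \<le> 2"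
proof -
  have half: "norm (A x - x) \<le> norm x / 2" for x
    using norm_blinfun[of "A - id_blinfun" x] mult_right_mono[OF A, of "norm x"]
    by (simp add: blinfun.diff_left)
  have ex: "\<exists>!x. x + (y - A x) = x" for y
  proof (rule banach_fix_type[of "1/2"])
    have "dist (x + (y - A x)) (z + (y - A z)) \<le> 1 / 2 * dist x z" for x z
    proof -
      have "x + (y - A x) - (z + (y - A z)) = - (A (x - z) - (x - z))"
        by (simp add: blinfun.diff_right)
      then show ?thesis using half[of "x - z"] by (simp only: dist_norm norm_minus_cancel mult.commute[of "1 / 2"] times_divide_eq_right mult_1_right)
    qed
    then show "\<forall>x z. dist (x + (y - A x)) (z + (y - A z)) \<le> 1 / 2 * dist x z" by blast
  qed auto
  define r where "r y = (THE x. A x = y)" for y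
  have "x + (y - A x) = x \<longleftrightarrow> A x = y" for x y by auto
  then have ex': "\<exists>!x. A x = y" for y using ex[of y] by simp
  have Ar: "A (r y) = y" for y using theI'[OF ex'[of y]] by (simp add: r_def)
  have rA: "r (A x) = x" for x using ex'[of "A x"] Ar[of "A x"] by blast
  have bd: "norm (r y) \<le> norm y * 2" for y
    using half[of "r y"] norm_triangle_ineq2[of "r y" "r y - y"] by (simp add: Ar norm_minus_commute)
  have "bounded_linear r"
  proof (rule bounded_linear_intro)
    show "r (x + y) = r x + r y" for x y using rA[of "r x + r y"] by (simp add: blinfun.add_right Ar)
    show "r (c *\<^sub>R x) = c *\<^sub>R r x" for c x using rA[of "c *\<^sub>R r x"] by (simp add: blinfun.scaleR_right Ar)
  qed (rule bd)
  then have r: "blinfun_apply (Blinfun r) = r" by (rule bounded_linear_Blinfun_apply)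
  show thesis
  proof (rule that[of "Blinfun r"])
    show "norm (Blinfun r) \<le> 2" by (rule norm_blinfun_bound) (use bd in \<open>auto simp: r mult.commute\<close>)
  qed (auto intro!: blinfun_eqI simp: r Ar rA)
qed

lemma continuous_on_dist_le:
  fixes f :: "'a::metric_space \<Rightarrow> 'b::metric_space" and g :: "'a \<Rightarrow> 'c::metric_space"
  assumes "continuous_on S g" "\<And>x y. x \<in> S \<Longrightarrow> y \<in> S \<Longrightarrow> dist (f x) (f y) \<le> c * dist (g x) (g y)"
    "0 < (c::real)"
  shows "continuous_on S f"
  unfolding continuous_on_iff
proof (intro ballI allI impI)
  fix x and e :: real assume x: "x \<in> S" and "0 < e"
  then obtain d where "0 < d" "\<And>y. y \<in> S \<Longrightarrow> dist y x < d \<Longrightarrow> dist (g y) (g x) < e / c"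
    using assms(1,3) unfolding continuous_on_iff by (metis divide_pos_pos)
  then show "\<exists>d>0. \<forall>y\<in>S. dist y x < d \<longrightarrow> dist (f y) (f x) < e"
    using assms(2)[OF _ x] assms(3) by (fastforce simp: field_simps intro: exI[of _ d] order_le_less_trans)
qed

text \<open>Composed with the inverse \<open>T\<close> of the derivative at \<open>x0\<close>, the
  equation \<open>f x = y\<close> becomes a fixed point problem for \<open>x + T (y - f x)\<close>
  in the domain, so completeness is asked of the domain alone. The local inverse has derivative
  \<open>R (g y)\<close> composed with \<open>T\<close>, where \<open>R x\<close> inverts
  \<open>A x\<close>.\<close>

theorem C1_inverse_function:
  fixes f :: "'a::banach \<Rightarrow> 'b::real_normed_vector"
  assumes f: "C1_on S f" and S: "open S" "x0 \<in> S"
    and T: "T o\<^sub>L fderiv f x0 = id_blinfun" "fderiv f x0 o\<^sub>L T = id_blinfun"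
  obtains r V g where "0 < r" "open V" "f x0 \<in> V" "cball x0 r \<subseteq> S" "C1_on V g"
    "\<And>y. y \<in> V \<Longrightarrow> g y \<in> ball x0 r" "\<And>x y. x \<in> ball x0 r \<Longrightarrow> y \<in> V \<Longrightarrow> f x = y \<longleftrightarrow> x = g y"
proof -
  define A where "A x = T o\<^sub>L fderiv f x" for x
  have TF: "fderiv f x0 (T y) = y" for y by (metis T(2) blinfun_apply_blinfun_compose blinfun_apply_id_blinfun)
  have Tinj: "T y = 0 \<Longrightarrow> y = 0" for y using TF[of y] by simp
  have cA: "continuous_on S A" unfolding A_def by (intro continuous_intros C1_on_fderiv f)
  have A0: "A x0 = id_blinfun" by (simp add: A_def T)
  obtain r1 where r1: "0 < r1" "cball x0 r1 \<subseteq> S" using S open_contains_cball by blast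
  obtain r2 where r2: "0 < r2" "\<And>x. x \<in> S \<Longrightarrow> dist x x0 < r2 \<Longrightarrow> dist (A x) (A x0) < 1 / 2"
    using cA S unfolding continuous_on_iff by (metis half_gt_zero_iff zero_less_one)
  define r where "r = min r1 (r2 / 2)"
  have r: "0 < r" "cball x0 r \<subseteq> S" using r1 r2 by (auto simp: r_def)
  have Anear: "norm (A x - id_blinfun) \<le> 1 / 2" if "x \<in> cball x0 r" for x
    using r2(2)[of x] that r r2(1) by (auto simp: A0 dist_norm r_def norm_minus_commute)
  have contr: "norm (x - z - (T (f x) - T (f z))) \<le> 1 / 2 * norm (x - z)" if xz: "x \<in> cball x0 r" "z \<in> cball x0 r" for x z
  proof -
    have "norm ((x - T (f x)) - (z - T (f z))) \<le> 1 / 2 * norm (x - z)"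
    proof (rule differentiable_bound)
      fix x assume x: "x \<in> cball x0 r"
      then have "(f has_derivative blinfun_apply (fderiv f x)) (at x within cball x0 r)"
        using C1_on_has_derivative[OF f, of x] r has_derivative_at_withinI by blast
      from has_derivative_diff[OF has_derivative_ident bounded_linear.has_derivative[OF blinfun.bounded_linear_right this, of T]]
      show "((\<lambda>x. x - T (f x)) has_derivative blinfun_apply (id_blinfun - A x)) (at x within cball x0 r)"
        by (rule has_derivative_eq_rhs) (simp add: fun_eq_iff A_def blinfun.diff_left)
      show "onorm (blinfun_apply (id_blinfun - A x)) \<le> 1 / 2"
        unfolding norm_blinfun.rep_eq[symmetric] using Anear[OF x] by (simp add: norm_minus_commute)
    qed (use xz in \<open>simp_all add: convex_cball\<close>)
    then show ?thesis by (simp add: algebra_simps)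
  qed
  have contr': "norm (x - z) \<le> 2 * norm (T (f x - f z))" if "x \<in> cball x0 r" "z \<in> cball x0 r" for x z
    using contr[OF that] norm_triangle_ineq2[of "x - z" "T (f x) - T (f z)"] by (simp add: blinfun.diff_right)
  \<comment> \<open>With this \<open>V\<close> the map \<open>?u\<close> sends the closed ball into
    the open one: the contraction contributes at most \<open>r / 2\<close> and the shift by
    \<open>y\<close> strictly less than \<open>r / 2\<close>.\<close>
  define V where "V = (\<lambda>y. norm (T (y - f x0))) -` {..<r / 2}"
  have V: "open V" "f x0 \<in> V" unfolding V_def using r by (auto intro!: open_vimage continuous_intros)
  have ex: "\<exists>x\<in>ball x0 r. f x = y" if y: "y \<in> V" for y
  proof -
    let ?u = "\<lambda>x. x + T (y - f x)"
    have into: "?u x \<in> ball x0 r" if x: "x \<in> cball x0 r" for x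
    proof -
      have "?u x - x0 = (x - x0 - (T (f x) - T (f x0))) + T (y - f x0)"
        by (simp add: blinfun.diff_right)
      then have "norm (?u x - x0) \<le> 1 / 2 * norm (x - x0) + norm (T (y - f x0))"
        using contr[OF x, of x0] r norm_triangle_ineq[of "x - x0 - (T (f x) - T (f x0))" "T (y - f x0)"]
        by (simp only: centre_in_cball less_imp_le True_implies_equals)
      also have "\<dots> < r" using x y by (auto simp: V_def dist_norm norm_minus_commute)
      finally show ?thesis by (simp add: dist_norm norm_minus_commute)
    qed
    have "\<exists>!x\<in>cball x0 r. ?u x = x"
    proof (rule Banach_fix[of _ "1/2"])
      show "dist (?u x) (?u z) \<le> 1 / 2 * dist x z" if "x \<in> cball x0 r" "z \<in> cball x0 r" for x z
        using contr[OF that] by (simp add: dist_norm blinfun.diff_right algebra_simps)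
      show "?u ` cball x0 r \<subseteq> cball x0 r"
      proof
        fix z assume "z \<in> ?u ` cball x0 r"
        then have "z \<in> ball x0 r" using into by blast
        then show "z \<in> cball x0 r" by simp
      qed
    qed (use r in \<open>auto simp: complete_eq_closed\<close>)
    then obtain x where x: "x \<in> cball x0 r" "?u x = x" by blast
    then have "f x = y" using Tinj[of "y - f x"] by simp
    then show ?thesis using into[OF x(1)] x(2) by auto
  qed
  define g where "g y = (SOME x. x \<in> ball x0 r \<and> f x = y)" for y
  have g: "g y \<in> ball x0 r" "f (g y) = y" if "y \<in> V" for y
    using someI_ex[of "\<lambda>x. x \<in> ball x0 r \<and> f x = y"] ex[OF that] unfolding g_def by blast+
  have cball: "x \<in> ball x0 r \<Longrightarrow> x \<in> cball x0 r" for x by simp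
  have uniq: "f x = y \<longleftrightarrow> x = g y" if "x \<in> ball x0 r" "y \<in> V" for x y
    using contr'[of x "g y"] g[OF that(2)] that(1) cball by (auto simp: blinfun.zero_right)
  have contg: "continuous_on V g"
  proof -
    have "norm (g y - g z) \<le> 2 * norm (T (y - z))" if "y \<in> V" "z \<in> V" for y z
      using contr'[of "g y" "g z"] g[OF that(1)] g[OF that(2)] cball by auto
    moreover have "2 * norm (T w) \<le> (2 * norm T) * norm w" for w
      using norm_blinfun[of T w] by simp
    ultimately have "norm (g y - g z) \<le> (2 * norm T) * norm (y - z)" if "y \<in> V" "z \<in> V" for y z
      using that order_trans by blast
    then have "(2 * norm T)-lipschitz_on V g" by (auto intro!: lipschitz_onI simp: dist_norm)
    then show ?thesis by (rule lipschitz_on_continuous_on)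
  qed
  define R where "R x = (SOME R. R o\<^sub>L A x = id_blinfun \<and> A x o\<^sub>L R = id_blinfun \<and> norm R \<le> 2)" for x
  have R: "R x o\<^sub>L A x = id_blinfun" "A x o\<^sub>L R x = id_blinfun" "norm (R x) \<le> 2" if "x \<in> cball x0 r" for x
  proof -
    have "\<exists>R. R o\<^sub>L A x = id_blinfun \<and> A x o\<^sub>L R = id_blinfun \<and> norm R \<le> 2"
      using neumann_inverse[OF Anear[OF that]] by metis
    from someI_ex[OF this] show "R x o\<^sub>L A x = id_blinfun" "A x o\<^sub>L R x = id_blinfun" "norm (R x) \<le> 2"
      unfolding R_def by blast+
  qed
  have contR: "continuous_on (cball x0 r) R"
  proof -
    have "norm (R x - R z) \<le> 4 * norm (A x - A z)" if x: "x \<in> cball x0 r" and z: "z \<in> cball x0 r" for x z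
    proof -
      have "R x (A x w) = w" "A z (R z w) = w" for w
        using R(1)[OF x] R(2)[OF z] by (metis blinfun_apply_blinfun_compose blinfun_apply_id_blinfun)+
      \<comment> \<open>The resolvent identity; as both inverses are bounded by 2, it yields the
        Lipschitz factor 4.\<close>
      then have "R x - R z = - (R x o\<^sub>L (A x - A z) o\<^sub>L R z)"
        by (intro blinfun_eqI) (simp add: blinfun.diff_left blinfun.diff_right blinfun.minus_left)
      then have "norm (R x - R z) \<le> norm (R x o\<^sub>L (A x - A z)) * norm (R z)"
        using norm_blinfun_compose by simp
      also have "\<dots> \<le> (norm (R x) * norm (A x - A z)) * norm (R z)"
        by (intro mult_right_mono norm_blinfun_compose) auto
      also have "\<dots> \<le> (2 * norm (A x - A z)) * 2"
        by (intro mult_mono R x z) auto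
      finally show ?thesis by simp
    qed
    then have "dist (R x) (R z) \<le> 4 * dist (A x) (A z)" if "x \<in> cball x0 r" "z \<in> cball x0 r" for x z
      using that by (simp add: dist_norm)
    from continuous_on_dist_le[OF continuous_on_subset[OF cA r(2)] this] show ?thesis by simp
  qed
  have C1g: "C1_on V g"
  proof (rule C1_onI)
    show "(g has_derivative blinfun_apply (R (g y) o\<^sub>L T)) (at y)" if y: "y \<in> V" for y
    proof (rule has_derivative_inverse_basic[where f = f and T = V])
      have gc: "g y \<in> cball x0 r" using g(1)[OF y] by simp
      show "(f has_derivative blinfun_apply (fderiv f (g y))) (at (g y))"
        using C1_on_has_derivative[OF f] r gc by blast
      have "(R (g y) o\<^sub>L A (g y)) v = v" for v using R(1)[OF gc] by simp
      then show "blinfun_apply (R (g y) o\<^sub>L T) \<circ> blinfun_apply (fderiv f (g y)) = id"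
        by (simp add: fun_eq_iff A_def)
      show "continuous (at y) g" using contg y V(1) continuous_on_eq_continuous_at by blast
    qed (use g y V blinfun.bounded_linear_right in auto)
    have "continuous_on V (\<lambda>y. R (g y))"
      by (rule continuous_on_compose2[OF contR contg]) (use g cball in blast)
    then show "continuous_on V (\<lambda>y. R (g y) o\<^sub>L T)" by (intro continuous_intros)
  qed
  show thesis by (rule that[of r V g]) (fact r V C1g g(1) uniq)+
qed

theorem C1_implicit_function:
  fixes F :: "'a::banach \<times> real \<Rightarrow> 'b::real_normed_vector"
  assumes F: "C1_on S F" and S: "open S" "(x0, 0) \<in> S" and F0: "F (x0, 0) = 0"
    and T: "\<And>x. blinfun_apply T (fderiv F (x0, 0) (x, 0)) = x" "\<And>y. fderiv F (x0, 0) (blinfun_apply T y, 0) = y"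
  obtains r d \<xi> where "0 < r" "0 < d" "C1_on {-d<..<d} \<xi>" "\<xi> 0 = x0"
    "\<And>\<epsilon>. \<bar>\<epsilon>\<bar> < d \<Longrightarrow> (\<xi> \<epsilon>, \<epsilon>) \<in> S" "\<And>\<epsilon>. \<bar>\<epsilon>\<bar> < d \<Longrightarrow> F (\<xi> \<epsilon>, \<epsilon>) = 0"
    "\<And>\<epsilon> x. \<bar>\<epsilon>\<bar> < d \<Longrightarrow> dist x0 x < r \<Longrightarrow> F (x, \<epsilon>) = 0 \<Longrightarrow> x = \<xi> \<epsilon>"
proof -
  let ?f = "\<lambda>z. (F z, snd z)" and ?D = "fderiv F (x0, 0)"
  have f: "C1_on S ?f" by (intro C1_intros F)
  have D: "blinfun_apply (fderiv ?f (x0, 0)) = (\<lambda>h. (?D h, snd h))"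
  proof -
    have "(?f has_derivative (\<lambda>h. (?D h, snd h))) (at (x0, 0))"
      by (intro derivative_intros C1_on_has_derivative[OF F S(2)])
    then show ?thesis using C1_on_has_derivative[OF f S(2)] has_derivative_unique by blast
  qed
  define T' where "T' = Blinfun (\<lambda>z. (T (fst z - ?D (0, snd z)), snd z))"
  have T': "blinfun_apply T' = (\<lambda>z. (T (fst z - ?D (0, snd z)), snd z))"
    unfolding T'_def
    by (intro bounded_linear_Blinfun_apply bounded_linear_Pair bounded_linear_compose[OF blinfun.bounded_linear_right]
        bounded_linear_sub bounded_linear_fst bounded_linear_snd bounded_linear_zero)
  have split: "?D h = ?D (fst h, 0) + ?D (0, snd h)" for h
    by (simp flip: blinfun.add_right)
  have 1: "T' o\<^sub>L fderiv ?f (x0, 0) = id_blinfun"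
  proof (rule blinfun_eqI)
    fix h
    show "(T' o\<^sub>L fderiv ?f (x0, 0)) h = id_blinfun h"
    proof -
      have "?D h - ?D (0, snd h) = ?D (fst h, 0)" by (simp flip: blinfun.diff_right add: minus_prod_def)
      then show ?thesis using T(1)[of "fst h"] by (simp add: D T')
    qed
  qed
  have 2: "fderiv ?f (x0, 0) o\<^sub>L T' = id_blinfun"
  proof (rule blinfun_eqI)
    fix z show "(fderiv ?f (x0, 0) o\<^sub>L T') z = id_blinfun z"
      using split[of "(T (fst z - ?D (0, snd z)), snd z)"] by (simp add: D T' T prod_eq_iff)
  qed
  obtain r V g where *: "0 < r" "open V" "?f (x0, 0) \<in> V" "cball (x0, 0) r \<subseteq> S" "C1_on V g"
    "\<And>y. y \<in> V \<Longrightarrow> g y \<in> ball (x0, 0) r"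
    "\<And>x y. x \<in> ball (x0, 0) r \<Longrightarrow> y \<in> V \<Longrightarrow> ?f x = y \<longleftrightarrow> x = g y"
    by (rule C1_inverse_function[OF f S 1 2]) (rule that; assumption)
  have V0: "(0, 0) \<in> V" using *(3) by (simp add: F0)
  obtain d1 where d1: "0 < d1" "ball (0, 0) d1 \<subseteq> V" using *(2) V0 open_contains_ball by blast
  define d where "d = min d1 (r / 2)"
  have inV: "(0, \<epsilon>) \<in> V" if "\<bar>\<epsilon>\<bar> < d" for \<epsilon>
    using that d1 by (auto simp: d_def dist_Pair_Pair dist_norm)
  define \<xi> where "\<xi> \<epsilon> = fst (g (0, \<epsilon>))" for \<epsilon>
  have g: "?f (g (0, \<epsilon>)) = (0, \<epsilon>)" "g (0, \<epsilon>) \<in> ball (x0, 0) r" if "\<bar>\<epsilon>\<bar> < d" for \<epsilon>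
    using *(6,7) inV[OF that] by blast+
  have g\<xi>: "g (0, \<epsilon>) = (\<xi> \<epsilon>, \<epsilon>)" if "\<bar>\<epsilon>\<bar> < d" for \<epsilon>
    using g(1)[OF that] by (auto simp: \<xi>_def prod_eq_iff)
  have uniq: "x = \<xi> \<epsilon>" if "\<bar>\<epsilon>\<bar> < d" "dist x0 x < r / 2" "F (x, \<epsilon>) = 0" for x \<epsilon>
  proof -
    have "dist (x0, 0) (x, \<epsilon>) \<le> dist x0 x + dist 0 \<epsilon>"
      unfolding dist_Pair_Pair by (rule sqrt_sum_squares_le_sum) auto
    then have "(x, \<epsilon>) \<in> ball (x0, 0) r" using that by (auto simp: d_def)
    then have "(x, \<epsilon>) = g (0, \<epsilon>)" using *(7)[of "(x, \<epsilon>)" "(0, \<epsilon>)"] inV that by auto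
    then show ?thesis by (simp add: g\<xi> that)
  qed
  show thesis
  proof (rule that[of "r / 2" d \<xi>])
    show "C1_on {-d<..<d} \<xi>" unfolding \<xi>_def
      by (intro C1_on_fst C1_on_compose[OF C1_on_Pair[OF C1_on_const C1_on_id] *(5)]) (auto intro: inV)
    show "\<xi> 0 = x0" using uniq[of 0 x0] * d1 F0 by (simp add: d_def)
    show "(\<xi> \<epsilon>, \<epsilon>) \<in> S" "F (\<xi> \<epsilon>, \<epsilon>) = 0" if "\<bar>\<epsilon>\<bar> < d" for \<epsilon>
      using g[OF that] *(4) by (auto simp: g\<xi>[OF that])
  qed (use * d1 uniq in \<open>auto simp: d_def\<close>)
qed

section \<open>Bounded continuous functions on one period\<close>

instance bcontfun :: (metric_space, banach) banach ..

text \<open>Bounded continuous functions on the whole line stand in for continuous functions on one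
  period; clamping the time extends such data constantly beyond the ends, which leaves sup norms
  unchanged.\<close>

definition clampt :: "real \<Rightarrow> real" where
  "clampt t = max 0 (min t (2 * pi))"

lemma clampt_in [simp]: "clampt t \<in> {0..2 * pi}" "0 \<le> clampt t" "clampt t \<le> 2 * pi"
  by (auto simp: clampt_def)

lemma clampt_id [simp]: "t \<in> {0..2 * pi} \<Longrightarrow> clampt t = t"
  by (auto simp: clampt_def)

lemma clampt_le: "s \<in> {0..clampt t} \<Longrightarrow> s \<in> {0..2 * pi}"
  by (auto intro: order_trans[OF _ clampt_in(3)])

lemma clampt_simps [simp]: "clampt 0 = 0" "clampt (2 * pi) = 2 * pi"
  by (auto simp: clampt_def)

lemma clampt_cont [continuous_intros]: "continuous_on S f \<Longrightarrow> continuous_on S (\<lambda>x. clampt (f x))"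
  unfolding clampt_def by (intro continuous_intros)

declare continuous_on_apply_bcontfun [continuous_intros]

lemma Bcontfun_apply:
  assumes "continuous_on UNIV f" "\<And>x. norm (f x) \<le> b"
  shows "apply_bcontfun (Bcontfun f) = f"
  using bcontfun_normI[OF assms] by (rule Bcontfun_inverse)

definition bc_bil :: "('b \<Rightarrow> 'c \<Rightarrow> 'd) \<Rightarrow> (real \<Rightarrow>\<^sub>C 'b::real_normed_vector) \<Rightarrow> (real \<Rightarrow>\<^sub>C 'c::real_normed_vector)
    \<Rightarrow> (real \<Rightarrow>\<^sub>C 'd::real_normed_vector)" where
  "bc_bil B f g = Bcontfun (\<lambda>t. B (f t) (g t))"

lemma bc_bil_apply:
  assumes "bounded_bilinear B" shows "bc_bil B f g t = B (f t) (g t)"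
proof -
  interpret bounded_bilinear B by fact
  obtain K where K: "K \<ge> 0" "\<And>a b. norm (B a b) \<le> norm a * norm b * K" using nonneg_bounded by blast
  have "norm (B (f t) (g t)) \<le> norm f * norm g * K" for t
    by (rule order_trans[OF K(2)]) (intro mult_right_mono mult_mono norm_bounded K(1) norm_ge_zero)
  then show ?thesis unfolding bc_bil_def
    by (subst Bcontfun_apply) (auto intro!: continuous_on continuous_on_apply_bcontfun)
qed

lemma bounded_bilinear_bc_bil:
  assumes "bounded_bilinear B" shows "bounded_bilinear (bc_bil B)"
proof -
  interpret bounded_bilinear B by fact
  obtain K where K: "K \<ge> 0" "\<And>a b. norm (B a b) \<le> norm a * norm b * K" using nonneg_bounded by blast
  have "norm (bc_bil B f g) \<le> norm f * norm g * K" for f g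
    unfolding norm_conv_dist
    by (rule dist_bound) (use order_trans[OF K(2)] in \<open>auto simp: bc_bil_apply[OF assms]
          intro!: mult_right_mono mult_mono norm_bounded K(1) order_trans[OF K(2)] simp flip: norm_conv_dist\<close>)
  then show ?thesis
    by (intro bounded_bilinear.intro exI[of _ K] bcontfun_eqI)
      (auto simp: bc_bil_apply[OF assms] add_left add_right scaleR_left scaleR_right)
qed

lemma integral_norm_le:
  fixes h :: "real \<Rightarrow> 'b::banach"
  assumes "continuous_on {a..b} h" "a \<le> b" "\<And>t. t \<in> {a..b} \<Longrightarrow> norm (h t) \<le> M"
  shows "norm (integral {a..b} h) \<le> M * (b - a)"
  using integral_bound[OF assms(2,1), of M] assms(3) by auto

text \<open>The primitive that vanishes at 0. Thus \<open>Jop (Jop h)\<close> is, on one period, the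
  curve with second derivative \<open>h\<close> and zero initial position and velocity, the form in
  which the linearised equations are posed.\<close>

definition Jop :: "(real \<Rightarrow>\<^sub>C 'b::banach) \<Rightarrow>\<^sub>L (real \<Rightarrow>\<^sub>C 'b)" where
  "Jop = Blinfun (\<lambda>h. Bcontfun (\<lambda>t. integral {0..clampt t} (apply_bcontfun h)))"

lemma
  fixes h :: "real \<Rightarrow>\<^sub>C 'b::banach"
  shows Jop_apply: "Jop h t = integral {0..clampt t} (apply_bcontfun h)"
    and norm_Jop: "norm (Jop h) \<le> 2 * pi * norm h"
proof -
  have bd: "norm (integral {0..clampt t} (apply_bcontfun h)) \<le> 2 * pi * norm h" for h :: "real \<Rightarrow>\<^sub>C 'b" and t
  proof -
    have "norm (integral {0..clampt t} (apply_bcontfun h)) \<le> norm h * (clampt t - 0)"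
      by (rule integral_norm_le) (auto simp: norm_bounded)
    also have "\<dots> \<le> norm h * (2 * pi)" by (intro mult_left_mono) auto
    finally show ?thesis by (simp add: mult.commute)
  qed
  have cont: "continuous_on UNIV (\<lambda>t. integral {0..clampt t} (apply_bcontfun h))" for h :: "real \<Rightarrow>\<^sub>C 'b"
    by (rule continuous_on_compose2[OF indefinite_integral_continuous_1, of "apply_bcontfun h" 0 "2 * pi" UNIV clampt])
      (auto intro!: integrable_continuous_real continuous_intros simp del: clampt_in(1))
  define I where "I h = Bcontfun (\<lambda>t. integral {0..clampt t} (apply_bcontfun h))" for h :: "real \<Rightarrow>\<^sub>C 'b"
  have I: "I h t = integral {0..clampt t} (apply_bcontfun h)" for h t
    unfolding I_def by (subst Bcontfun_apply[OF cont bd]) simp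
  have "bounded_linear I"
  proof (rule bounded_linear_intro[where K = "2 * pi"])
    show "norm (I h) \<le> norm h * (2 * pi)" for h
      by (rule norm_bound) (use bd in \<open>simp add: I mult.commute\<close>)
  qed (auto intro!: bcontfun_eqI simp: I integral_add integrable_continuous_real)
  then have J: "blinfun_apply Jop h = I h" for h :: "real \<Rightarrow>\<^sub>C 'b"
    unfolding Jop_def I_def[abs_def] by (simp add: bounded_linear_Blinfun_apply)
  show "Jop h t = integral {0..clampt t} (apply_bcontfun h)" by (simp add: J I)
  show "norm (Jop h) \<le> 2 * pi * norm h" by (rule norm_bound) (use bd in \<open>simp add: J I\<close>)
qed

lemma Jop_0 [simp]: "Jop h 0 = 0"
  by (simp add: Jop_apply)

lemma Jop_deriv:
  fixes h :: "real \<Rightarrow>\<^sub>C 'b::banach"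
  assumes "t \<in> {0..2 * pi}"
  shows "(apply_bcontfun (Jop h) has_vector_derivative h t) (at t within {0..2 * pi})"
  by (rule has_vector_derivative_transform[OF assms _
        integral_has_vector_derivative[OF continuous_on_apply_bcontfun assms]]) (simp add: Jop_apply)

lemma Jop_FTC:
  fixes h :: "real \<Rightarrow>\<^sub>C 'b::banach"
  assumes "\<And>t. t \<in> {0..2 * pi} \<Longrightarrow> (F has_vector_derivative h t) (at t within {0..2 * pi})"
    and t: "t \<in> {0..2 * pi}"
  shows "F t - F 0 = Jop h t"
proof -
  have der: "(F has_vector_derivative h s) (at s within {0..t})" if "s \<in> {0..t}" for s
    by (rule has_vector_derivative_within_subset[OF assms(1)]) (use that t in auto)
  then have "(apply_bcontfun h has_integral (F t - F 0)) {0..t}"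
    using t by (intro fundamental_theorem_of_calculus der) auto
  then show ?thesis using t by (simp add: Jop_apply integral_unique)
qed

definition clampf :: "(real \<Rightarrow> 'b::real_normed_vector) \<Rightarrow> (real \<Rightarrow>\<^sub>C 'b)" where
  "clampf f = Bcontfun (\<lambda>t. f (clampt t))"

lemma clampf_apply:
  assumes "continuous_on {0..2 * pi} f" shows "clampf f t = f (clampt t)"
proof -
  have "bounded (f ` {0..2 * pi})" by (intro compact_imp_bounded compact_continuous_image assms) auto
  then obtain b where b: "\<And>t. t \<in> {0..2 * pi} \<Longrightarrow> norm (f t) \<le> b" unfolding bounded_iff by blast
  have "continuous_on UNIV (\<lambda>t. f (clampt t))"
    by (rule continuous_on_compose2[OF assms]) (auto intro!: continuous_intros simp del: clampt_in(1))
  then show ?thesis unfolding clampf_def by (subst Bcontfun_apply) (use b clampt_in(1) in blast)+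
qed

section \<open>Volterra operators\<close>

text \<open>The operator of the initial value problem \<open>v'' + A v = f\<close>,
  \<open>v 0 = 0\<close>, \<open>v' 0 = 0\<close>, written for the unknown
  \<open>h = v''\<close>.\<close>

definition volterra :: "(real \<Rightarrow>\<^sub>C 'b::banach \<Rightarrow>\<^sub>L 'b) \<Rightarrow> (real \<Rightarrow>\<^sub>C 'b) \<Rightarrow> (real \<Rightarrow>\<^sub>C 'b)" where
  "volterra A h = h + bc_bil blinfun_apply A (Jop (Jop h))"

lemma volterra_apply: "volterra A h t = h t + A t (Jop (Jop h) t)"
  by (simp add: volterra_def bc_bil_apply[OF bounded_bilinear_blinfun_apply])

text \<open>In the norm weighted by \<open>exp (- k t)\<close> the operator \<open>Jop\<close> has norm at most \<open>1 / k\<close>.\<close>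

lemma volterra_inverse:
  fixes A :: "real \<Rightarrow>\<^sub>C 'b::banach \<Rightarrow>\<^sub>L 'b"
  obtains W :: "(real \<Rightarrow>\<^sub>C 'b) \<Rightarrow>\<^sub>L (real \<Rightarrow>\<^sub>C 'b)" where
    "\<And>h. W (volterra A h) = h" "\<And>h. volterra A (W h) = h" "norm W \<le> 2 * exp (2 * pi * (1 + 2 * norm A))"
proof -
  \<comment> \<open>Since \<open>k >= 1\<close>, also \<open>k * k >= k >= 2 * norm A\<close>, so
    \<open>A\<close> composed with two primitives of norm \<open>1 / k\<close> has norm at most
    1/2.\<close>
  define k where "k = 1 + 2 * norm A"
  have k: "1 \<le> k" "0 < k" using norm_ge_zero[of A] unfolding k_def by linarith+
  define w :: "real \<Rightarrow> real \<Rightarrow>\<^sub>C real" where "w a = clampf (\<lambda>t. exp (a * t))" for a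
  have w: "w a t = exp (a * clampt t)" for a t
    unfolding w_def by (rule clampf_apply) (intro continuous_intros)
  define E :: "real \<Rightarrow> (real \<Rightarrow>\<^sub>C 'b) \<Rightarrow>\<^sub>L (real \<Rightarrow>\<^sub>C 'b)" where "E a = Blinfun (bc_bil scaleR (w a))" for a
  have E: "E a h t = exp (a * clampt t) *\<^sub>R h t" for a h t
    unfolding E_def
    by (simp add: bounded_linear_Blinfun_apply bounded_bilinear.bounded_linear_right bounded_bilinear_bc_bil
        bounded_bilinear_scaleR bc_bil_apply w)
  have EE: "E (- k) (E k h) = h" "E k (E (- k) h) = h" for h
    by (auto intro!: bcontfun_eqI simp: E simp flip: exp_add)
  \<comment> \<open>Conjugation with the exponential weights takes the place of a weighted norm on
    the path space.\<close>
  define J' :: "(real \<Rightarrow>\<^sub>C 'b) \<Rightarrow>\<^sub>L (real \<Rightarrow>\<^sub>C 'b)" where "J' = E (- k) o\<^sub>L Jop o\<^sub>L E k"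
  have J': "norm (J' h) \<le> norm h / k" for h
  proof (rule norm_bound)
    fix t
    let ?c = "clampt t"
    have "norm (J' h t) = norm (integral {0..?c} (\<lambda>s. exp (- (k * ?c)) *\<^sub>R E k h s))"
      by (subst integral_cmul) (simp add: J'_def E Jop_apply)
    also have "\<dots> \<le> integral {0..?c} (\<lambda>s. norm h * exp (k * (s - ?c)))"
    proof (rule integral_norm_bound_integral)
      show "(\<lambda>s. exp (- (k * ?c)) *\<^sub>R E k h s) integrable_on {0..?c}"
        by (intro integrable_continuous_real continuous_intros)
      show "(\<lambda>s. norm h * exp (k * (s - ?c))) integrable_on {0..?c}"
        by (intro integrable_continuous_real continuous_intros)
      fix s assume "s \<in> {0..?c}"
      then have "clampt s = s" by (intro clampt_id clampt_le)
      then show "norm (exp (- (k * ?c)) *\<^sub>R E k h s) \<le> norm h * exp (k * (s - ?c))"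
        using norm_bounded[of h s] by (simp add: E algebra_simps exp_diff exp_minus divide_simps)
    qed
    also have "\<dots> = norm h * (1 / k - exp (- (k * ?c)) / k)"
    proof -
      have "((\<lambda>s. norm h * exp (k * (s - ?c))) has_integral
          norm h * exp (k * (?c - ?c)) / k - norm h * exp (k * (0 - ?c)) / k) {0..?c}"
        by (rule fundamental_theorem_of_calculus)
          (use k in \<open>auto intro!: derivative_eq_intros simp flip: has_real_derivative_iff_has_vector_derivative\<close>)
      from integral_unique[OF this] show ?thesis by (rule trans) (simp add: right_diff_distrib)
    qed
    also have "\<dots> \<le> norm h * (1 / k)" using k by (intro mult_left_mono) auto
    finally show "norm (J' h t) \<le> norm h / k" by simp
  qed
  define K where "K = Blinfun (bc_bil blinfun_apply A) o\<^sub>L J' o\<^sub>L J'"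
  have bA: "bounded_linear (bc_bil blinfun_apply A)"
    by (intro bounded_bilinear.bounded_linear_right bounded_bilinear_bc_bil bounded_bilinear_blinfun_apply)
  have K: "K h t = A t (J' (J' h) t)" for h t
    by (simp add: K_def bounded_linear_Blinfun_apply[OF bA] bc_bil_apply bounded_bilinear_blinfun_apply)
  have near: "norm (id_blinfun + K - id_blinfun) \<le> 1 / 2"
  proof (rule norm_blinfun_bound)
    fix h
    have "norm (K h) \<le> norm A * norm (J' (J' h))"
    proof (rule norm_bound)
      fix t
      have "norm (K h t) \<le> norm (A t) * norm (J' (J' h) t)" unfolding K by (rule norm_blinfun)
      also have "\<dots> \<le> norm A * norm (J' (J' h))" by (intro mult_mono norm_bounded) auto
      finally show "norm (K h t) \<le> norm A * norm (J' (J' h))" .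
    qed
    also have "\<dots> \<le> norm A * (norm h / k / k)"
      using k by (intro mult_left_mono order_trans[OF J'] divide_right_mono J') auto
    also have "\<dots> \<le> 1 / 2 * norm h"
    proof -
      have "norm A * 2 \<le> k" by (simp add: k_def)
      moreover have "k \<le> k * k" using mult_left_mono[OF k(1), of k] k(2) by simp
      ultimately have "norm A * 2 \<le> k * k" by linarith
      then have "norm A / (k * k) \<le> 1 / 2" using k by (simp add: divide_simps)
      from mult_right_mono[OF this, of "norm h"] show ?thesis by simp
    qed
    finally show "norm ((id_blinfun + K - id_blinfun) h) \<le> 1 / 2 * norm h"
      by (simp add: blinfun.diff_left blinfun.add_left)
  qed simp
  obtain R where R: "R o\<^sub>L (id_blinfun + K) = id_blinfun" "(id_blinfun + K) o\<^sub>L R = id_blinfun" "norm R \<le> 2"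
    by (rule neumann_inverse[OF near]) (rule that; assumption)
  have RK: "R (h + K h) = h" "R h + K (R h) = h" for h
    using arg_cong[OF R(1), of "\<lambda>f. f h"] arg_cong[OF R(2), of "\<lambda>f. f h"] by (simp_all add: blinfun.add_left)
  have KE: "E (- k) (volterra A h) = E (- k) h + K (E (- k) h)" for h
    by (rule bcontfun_eqI) (simp add: E K volterra_apply J'_def EE scaleR_add_right blinfun.scaleR_right)
  define W where "W = E k o\<^sub>L R o\<^sub>L E (- k)"
  show thesis
  proof (rule that[of W])
    show 1: "W (volterra A h) = h" for h by (simp add: W_def KE RK EE)
    have inj: "E (- k) x = E (- k) y \<Longrightarrow> x = y" for x y by (metis EE(2))
    show "volterra A (W h) = h" for h by (rule inj) (simp add: KE W_def EE RK)
    show "norm W \<le> 2 * exp (2 * pi * (1 + 2 * norm A))"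
    proof (rule norm_blinfun_bound)
      fix h
      have "norm (E k g) \<le> exp (2 * pi * k) * norm g" for g
        by (rule norm_bound)
          (use k in \<open>auto simp: E mult.commute[of _ k] intro!: mult_mono norm_bounded\<close>)
      moreover have "norm (R g) \<le> 2 * norm g" for g
        using norm_blinfun[of R g] mult_right_mono[OF R(3), of "norm g"] by simp
      moreover have "norm (E (- k) g) \<le> norm g" for g
      proof (rule norm_bound)
        fix t
        have "exp (- k * clampt t) * norm (g t) \<le> 1 * norm g"
          using k by (intro mult_mono norm_bounded) auto
        then show "norm (E (- k) g t) \<le> norm g" by (simp add: E)
      qed
      ultimately have "norm (R (E (- k) h)) \<le> 2 * norm h" "norm (W h) \<le> exp (2 * pi * k) * norm (R (E (- k) h))"
        unfolding W_def blinfun_apply_blinfun_compose by (blast intro: order_trans mult_left_mono zero_le_numeral)+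
      then have "norm (W h) \<le> exp (2 * pi * k) * (2 * norm h)"
        by (blast intro: order_trans mult_left_mono exp_ge_zero)
      then show "norm (W h) \<le> 2 * exp (2 * pi * (1 + 2 * norm A)) * norm h" by (simp add: k_def)
    qed simp
  qed
qed

section \<open>Superposition operators\<close>

text \<open>A bounded continuous function on the whole line may take values in an open
  \<open>S\<close> and still approach its boundary. Asking for a compact subset of \<open>S\<close>
  around the range makes the domain open in the sup norm.\<close>

definition nem_dom :: "'e::euclidean_space set \<Rightarrow> (real \<Rightarrow>\<^sub>C 'e) set" where
  "nem_dom S = {x. \<exists>K. compact K \<and> K \<subseteq> S \<and> range (apply_bcontfun x) \<subseteq> K}"

definition Nem :: "('e::euclidean_space \<Rightarrow> 'f::real_normed_vector) \<Rightarrow> (real \<Rightarrow>\<^sub>C 'e) \<Rightarrow> (real \<Rightarrow>\<^sub>C 'f)" where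
  "Nem G x = Bcontfun (\<lambda>t. G (x t))"

lemma Nem_apply:
  fixes x :: "real \<Rightarrow>\<^sub>C 'e::euclidean_space"
  assumes "continuous_on S G" "x \<in> nem_dom S" shows "Nem G x t = G (x t)"
proof -
  obtain K where K: "compact K" "K \<subseteq> S" "range (apply_bcontfun x) \<subseteq> K" using assms(2) by (auto simp: nem_dom_def)
  have "bounded (G ` K)" using K assms(1) by (meson compact_continuous_image compact_imp_bounded continuous_on_subset)
  then obtain b where "\<And>y. y \<in> K \<Longrightarrow> norm (G y) \<le> b" by (auto simp: bounded_iff)
  then have "norm (G (x t)) \<le> b" for t using K(3) by auto
  moreover have "continuous_on UNIV (\<lambda>t. G (x t))"
    by (rule continuous_on_compose2[OF assms(1)]) (use K in auto)
  ultimately show ?thesis unfolding Nem_def by (subst Bcontfun_apply) auto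
qed

lemma nem_dom_tube:
  fixes x :: "real \<Rightarrow>\<^sub>C 'e::euclidean_space"
  assumes S: "open S" and x: "x \<in> nem_dom S"
  obtains K r where "compact K" "K \<subseteq> S" "range (apply_bcontfun x) \<subseteq> K" "0 < r" "ball x r \<subseteq> nem_dom S"
proof -
  obtain K where K: "compact K" "K \<subseteq> S" "range (apply_bcontfun x) \<subseteq> K" using x by (auto simp: nem_dom_def)
  obtain r L where r: "0 < r" and L: "compact L" "L \<subseteq> S"
    and inL: "\<And>x k. x \<in> K \<Longrightarrow> norm k \<le> r \<Longrightarrow> x + k \<in> L"
    using compact_tube[OF S K(1,2)] by blast
  have "y \<in> nem_dom S" if "y \<in> ball x r" for y
  proof -
    have "y t \<in> L" for t
    proof -
      have "norm (y t - x t) \<le> r" using dist_bounded[of x t y] that by (simp add: dist_norm norm_minus_commute)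
      then show ?thesis using K(3) inL[of "x t" "y t - x t"] by auto
    qed
    then show ?thesis using L unfolding nem_dom_def by blast
  qed
  then show thesis using that[OF K r(1)] by blast
qed

lemma open_nem_dom: "open S \<Longrightarrow> open (nem_dom S)"
  unfolding open_contains_ball by (metis nem_dom_tube open_contains_ball)

lemma nem_domI:
  fixes x :: "real \<Rightarrow>\<^sub>C 'e::euclidean_space"
  assumes "continuous_on {0..2 * pi} y" "\<And>t. t \<in> {0..2 * pi} \<Longrightarrow> y t \<in> S" "\<And>t. x t = y (clampt t)"
  shows "x \<in> nem_dom S"
  unfolding nem_dom_def
  by (intro CollectI exI[of _ "y ` {0..2 * pi}"] conjI compact_continuous_image assms)
    (use assms(2,3) clampt_in(1) in auto)

lemma continuous_on_Nem:
  assumes G: "continuous_on S G" and S: "open S" shows "continuous_on (nem_dom S) (Nem G)"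
proof (rule continuous_at_imp_continuous_on, rule ballI)
  fix x assume x: "x \<in> nem_dom S"
  then obtain K where K: "compact K" "K \<subseteq> S" "range (apply_bcontfun x) \<subseteq> K" by (auto simp: nem_dom_def)
  obtain r0 where r0: "0 < r0" "ball x r0 \<subseteq> nem_dom S" using nem_dom_tube[OF S x] by metis
  obtain r L where r: "0 < r" and L: "compact L" "L \<subseteq> S"
    and inL: "\<And>x k. x \<in> K \<Longrightarrow> norm k \<le> r \<Longrightarrow> x + k \<in> L"
    using compact_tube[OF S K(1,2)] by blast
  have uc: "uniformly_continuous_on L G" using G L by (meson compact_uniformly_continuous continuous_on_subset)
  show "isCont (Nem G) x"
    unfolding continuous_at_eps_delta
  proof (intro allI impI)
    fix e :: real assume e: "0 < e"
    obtain d where d: "0 < d" "\<And>a b. a \<in> L \<Longrightarrow> b \<in> L \<Longrightarrow> dist b a < d \<Longrightarrow> dist (G b) (G a) < e / 2"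
      using uc e unfolding uniformly_continuous_on_def by (metis half_gt_zero_iff)
    have "dist (Nem G y) (Nem G x) < e" if y: "dist y x < min d (min r r0)" for y
    proof -
      have "dist (Nem G y t) (Nem G x t) \<le> e / 2" for t
      proof -
        have yt: "dist (y t) (x t) < d" "norm (y t - x t) \<le> r"
          using dist_bounded[of y t x] y by (auto simp: dist_norm)
        have "x t \<in> L" "y t \<in> L" using K(3) r yt inL[of "x t" 0] inL[of "x t" "y t - x t"] by auto
        then have "dist (G (y t)) (G (x t)) < e / 2" using d(2) yt(1) by blast
        moreover have "y \<in> nem_dom S" using r0 y by (auto simp: dist_commute)
        ultimately show ?thesis using Nem_apply[OF G] x by auto
      qed
      then have "dist (Nem G y) (Nem G x) \<le> e / 2" by (rule dist_bound)
      then show ?thesis using e by simp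
    qed
    then show "\<exists>d>0. \<forall>y. dist y x < d \<longrightarrow> dist (Nem G y) (Nem G x) < e"
      using d(1) r r0(1) by (intro exI[of _ "min d (min r r0)"]) auto
  qed
qed

text \<open>The remainder estimate of \<open>C1_on_uniform\<close>, applied along the range of
  \<open>x\<close>, is uniform in time. The derivative is multiplication by \<open>fderiv G\<close>
  along \<open>x\<close>, and depends continuously on \<open>x\<close> because it comes from another
  superposition operator.\<close>

lemma
  fixes G :: "'e::euclidean_space \<Rightarrow> 'f::real_normed_vector"
  assumes G: "C1_on S G" and S: "open S"
  shows C1_on_Nem: "C1_on (nem_dom S) (Nem G)"
    and fderiv_Nem: "\<And>x k t. x \<in> nem_dom S \<Longrightarrow> fderiv (Nem G) x k t = fderiv G (x t) (k t)"
proof -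
  let ?D = "\<lambda>x. Blinfun (bc_bil blinfun_apply (Nem (fderiv G) x))"
  note bb = bounded_bilinear_bc_bil[OF bounded_bilinear_blinfun_apply]
  have D: "?D x k t = fderiv G (x t) (k t)" if "x \<in> nem_dom S" for x k t
    by (simp add: bounded_linear_Blinfun_apply bounded_bilinear.bounded_linear_right[OF bb]
        bc_bil_apply[OF bounded_bilinear_blinfun_apply] Nem_apply[OF C1_on_fderiv[OF G] that])
  have deriv: "(Nem G has_derivative blinfun_apply (?D x)) (at x)" if x: "x \<in> nem_dom S" for x
    unfolding has_derivative_at_alt
  proof (intro conjI allI impI)
    fix e :: real assume "0 < e"
    obtain K r where K: "compact K" "K \<subseteq> S" "range (apply_bcontfun x) \<subseteq> K" "0 < r" "ball x r \<subseteq> nem_dom S"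
      using nem_dom_tube[OF S x] .
    obtain d where d: "0 < d"
      "\<And>z k. z \<in> K \<Longrightarrow> norm k \<le> d \<Longrightarrow> norm (G (z + k) - G z - fderiv G z k) \<le> e * norm k"
      using C1_on_uniform[OF G S K(1,2) \<open>0 < e\<close>] by metis
    have "norm (Nem G y - Nem G x - ?D x (y - x)) \<le> e * norm (y - x)" if y: "norm (y - x) < min d r" for y
    proof (rule norm_bound)
      fix t
      have yx: "norm (y t - x t) \<le> norm (y - x)" using norm_bounded[of "y - x" t] by simp
      have "y \<in> nem_dom S" using K(5) y by (auto simp: dist_norm norm_minus_commute)
      then have "(Nem G y - Nem G x - ?D x (y - x)) t = G (x t + (y t - x t)) - G (x t) - fderiv G (x t) (y t - x t)"
        using Nem_apply[OF C1_on_imp_continuous_on[OF G]] x by (simp add: D)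
      then have "norm ((Nem G y - Nem G x - ?D x (y - x)) t) \<le> e * norm (y t - x t)"
        using d(2)[of "x t" "y t - x t"] K(3) yx y by (simp only:) auto
      also have "\<dots> \<le> e * norm (y - x)" using \<open>0 < e\<close> yx by simp
      finally show "norm ((Nem G y - Nem G x - ?D x (y - x)) t) \<le> e * norm (y - x)" .
    qed
    then show "\<exists>d>0. \<forall>y. norm (y - x) < d \<longrightarrow> norm (Nem G y - Nem G x - ?D x (y - x)) \<le> e * norm (y - x)"
      using d(1) K(4) by (intro exI[of _ "min d r"]) auto
  qed (rule blinfun.bounded_linear_right)
  show "C1_on (nem_dom S) (Nem G)"
  proof (rule C1_onI[OF deriv])
    have "bounded_linear (\<lambda>A. Blinfun (bc_bil blinfun_apply A) :: (real \<Rightarrow>\<^sub>C 'e) \<Rightarrow>\<^sub>L (real \<Rightarrow>\<^sub>C 'f))"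
      using bounded_bilinear.bounded_linear_prod_right[OF bb]
      by (simp add: bounded_bilinear.prod_right_def[OF bb] map_fun_def o_def id_def)
    from bounded_linear.continuous_on[OF this continuous_on_Nem[OF C1_on_fderiv[OF G] S]]
    show "continuous_on (nem_dom S) ?D" .
  qed
  show "fderiv (Nem G) x k t = fderiv G (x t) (k t)" if "x \<in> nem_dom S" for x k t
    by (simp add: fderiv_eq[OF deriv[OF that]] D that)
qed

section \<open>Weak derivatives and the Sobolev embedding\<close>

lemma period_integrable_iff:
  fixes f :: "real \<Rightarrow> 'b::{banach, second_countable_topology}"
  shows "integrable period_measure f \<longleftrightarrow> set_integrable lborel {0..2 * pi} f"
    and period_integral_set: "(\<integral>t. f t \<partial>period_measure) = (LINT t:{0..2 * pi}|lborel. f t)"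
  unfolding period_measure_def set_integrable_def set_lebesgue_integral_def
  by (simp_all add: integrable_restrict_space integral_restrict_space)

lemma
  fixes f :: "real \<Rightarrow> 'b::euclidean_space"
  assumes "continuous_on {0..2 * pi} f"
  shows period_integrable_cont: "integrable period_measure f"
    and period_integral_cont: "(\<integral>t. f t \<partial>period_measure) = integral {0..2 * pi} f"
  using borel_integrable_atLeastAtMost'[OF assms] set_borel_integral_eq_integral(2)
  by (auto simp: period_integrable_iff period_integral_set)

lemma L2_period_cont: "continuous_on {0..2 * pi} f \<Longrightarrow> f \<in> L2_period"
  unfolding L2_period_def
  by (auto intro!: period_continuous_measurable period_integrable_cont continuous_intros)

lemma continuous_AE_zero:
  fixes f :: "real \<Rightarrow> 'b::euclidean_space"
  assumes f: "continuous_on {0..2 * pi} f" and ae: "AE t in period_measure. f t = 0" and t: "t \<in> {0..2 * pi}"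
  shows "f t = 0"
proof -
  have c: "continuous_on {0..2 * pi} (\<lambda>t. norm (f t))" by (intro continuous_intros f)
  have "(\<integral>t. norm (f t) \<partial>period_measure) = 0" by (rule integral_eq_zero_AE) (use ae in auto)
  then have "integral {0..2 * pi} (\<lambda>t. norm (f t)) = 0" using period_integral_cont[OF c] by simp
  then have "((\<lambda>t. norm (f t)) has_integral 0) (cbox 0 (2 * pi))"
    using integrable_continuous_real[OF c] by (metis cbox_interval integrable_integral)
  then have "norm (f t) = 0"
    by (rule has_integral_0_cbox_imp_0[rotated 2]) (use c t pi_gt_zero in \<open>auto simp: not_le\<close>)
  then show ?thesis by simp
qed

lemma antiderivative_exists:
  fixes f :: "real \<Rightarrow> 'b::euclidean_space"
  assumes "continuous_on UNIV f"
  obtains F where "\<And>t. (F has_vector_derivative f t) (at t)" "F 0 = c"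
proof -
  obtain F where F: "\<And>t. (F has_vector_derivative f t) (at t)"
    using einterval_antiderivative[of "-\<infinity>" "\<infinity>" f] assms by (auto simp: continuous_on_eq_continuous_at)
  show thesis
    by (rule that[of "\<lambda>t. F t - F 0 + c"]) (auto intro!: derivative_eq_intros F)
qed

lemma periodic_primitive:
  fixes f F :: "real \<Rightarrow> 'b::euclidean_space"
  assumes F: "\<And>t. (F has_vector_derivative f t) (at t)" and f: "\<And>t. f (t + 2 * pi) = f t"
    and "F (2 * pi) = F 0"
  shows "F (t + 2 * pi) = F t"
proof -
  have "((\<lambda>t. F (t + 2 * pi) - F t) has_vector_derivative 0) (at s)" for s
  proof -
    have "((\<lambda>t. t + 2 * pi) has_vector_derivative 1) (at s)" by (auto intro!: derivative_eq_intros)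
    from has_vector_derivative_diff[OF vector_diff_chain_at[OF this F] F[of s]] f
    show ?thesis by (simp add: o_def)
  qed
  from has_vector_derivative_zero_constant[OF convex_UNIV, of "\<lambda>t. F (t + 2 * pi) - F t"] this
  obtain c where "\<And>t. F (t + 2 * pi) - F t = c" by auto
  from this[of 0] this[of t] assms(3) show ?thesis by simp
qed

lemma smooth_periodic_0:
  assumes "\<phi> \<in> smooth_periodic" shows "\<phi> (2 * pi) = \<phi> 0"
proof -
  have "\<phi> (0 + 2 * pi) = \<phi> 0" using assms unfolding smooth_periodic_def by blast
  then show ?thesis by simp
qed

lemma smooth_periodic_vector_deriv:
  assumes "\<phi> \<in> smooth_periodic" shows "(\<phi> has_vector_derivative deriv \<phi> t) (at t within S)"
  using smooth_periodic_deriv[OF assms, of t]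
  unfolding has_real_derivative_iff_has_vector_derivative by (rule has_vector_derivative_at_within)

lemma smooth_periodic_const: "(\<lambda>_. c) \<in> smooth_periodic"
  by (intro trig_poly_smooth trig_poly.intros)

lemma weak_deriv_integral_zero:
  assumes "weak_deriv f g" shows "(\<integral>t. g t \<partial>period_measure) = 0"
  using assms smooth_periodic_const[of 1] unfolding weak_deriv_def by fastforce

lemma measure_period [simp]: "Sigma_Algebra.measure period_measure {0..2 * pi} = 2 * pi"
  by (simp add: period_measure_def measure_restrict_space)

text \<open>Subtracting the mean is exactly what makes the primitive periodic. It supplies the test
  functions for the du Bois-Reymond argument below.\<close>

lemma smooth_periodic_primitive:
  assumes \<psi>: "\<psi> \<in> smooth_periodic"
  obtains \<phi> where "\<phi> \<in> smooth_periodic" "\<And>t. deriv \<phi> t = \<psi> t - (\<integral>t. \<psi> t \<partial>period_measure) / (2 * pi)"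
proof -
  define m where "m = (\<integral>t. \<psi> t \<partial>period_measure) / (2 * pi)"
  have c: "continuous_on S (\<lambda>t. \<psi> t - m)" for S by (intro continuous_intros smooth_periodic_cont \<psi>)
  obtain \<phi> where \<phi>: "\<And>t. (\<phi> has_vector_derivative (\<psi> t - m)) (at t)" "\<phi> 0 = 0"
    using antiderivative_exists[OF c] by blast
  then have d: "(\<phi> has_real_derivative \<psi> t - m) (at t)" for t
    by (simp add: has_real_derivative_iff_has_vector_derivative)
  have dphi: "deriv \<phi> = (\<lambda>t. \<psi> t - m)" using d by (auto intro: DERIV_imp_deriv)
  have per: "\<phi> (t + 2 * pi) = \<phi> t" for t
  proof (rule periodic_primitive[OF \<phi>(1)])
    show "\<psi> (t + 2 * pi) - m = \<psi> t - m" for t using \<psi> by (simp add: smooth_periodic_def)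
    have "((\<lambda>t. \<psi> t - m) has_integral (\<phi> (2 * pi) - \<phi> 0)) {0..2 * pi}"
      by (rule fundamental_theorem_of_calculus) (auto intro: has_vector_derivative_at_within \<phi>)
    moreover have "integral {0..2 * pi} (\<lambda>t. \<psi> t - m) = 0"
      unfolding period_integral_cont[OF c, symmetric]
      using smooth_periodic_cont(1)[OF \<psi>, of "{0..2 * pi}"]
      by (subst Bochner_Integration.integral_diff) (auto intro: period_integrable_cont simp: m_def)
    ultimately show "\<phi> (2 * pi) = \<phi> 0" by (simp add: has_integral_iff)
  qed
  have "(deriv ^^ k) (\<lambda>t. \<psi> t - m) differentiable (at t)" for k t
  proof (cases k)
    case 0
    have "((\<lambda>t. \<psi> t - m) has_real_derivative deriv \<psi> t - 0) (at t)"
      by (intro DERIV_diff smooth_periodic_deriv \<psi> DERIV_const)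
    then show ?thesis using 0 real_differentiable_def by auto
  next
    case (Suc j)
    have "deriv (\<lambda>t. \<psi> t - m) = deriv \<psi>"
      using DERIV_diff[OF smooth_periodic_deriv[OF \<psi>] DERIV_const[of m]] by (intro ext DERIV_imp_deriv) simp
    then have "(deriv ^^ k) (\<lambda>t. \<psi> t - m) = (deriv ^^ k) \<psi>" by (simp add: Suc funpow_swap1 funpow_Suc_right del: funpow.simps)
    then show ?thesis using \<psi> by (simp add: smooth_periodic_def)
  qed
  note k = this
  have "(deriv ^^ k) \<phi> differentiable (at t)" for k t
  proof (cases k)
    case 0
    then show ?thesis using d real_differentiable_def by auto
  next
    case (Suc j)
    then show ?thesis using k[of j] by (simp add: funpow_Suc_right dphi del: funpow.simps)
  qed
  then have "\<phi> \<in> smooth_periodic" using per by (simp add: smooth_periodic_def)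
  then show thesis using that[of \<phi>] by (simp add: dphi m_def)
qed

text \<open>Du Bois-Reymond on the circle: every test function is a constant plus the derivative of
  a test function, and subtraction of the mean value \<open>c\<close> makes \<open>y - c\<close>
  orthogonal to constants as well.\<close>

lemma orthogonal_derivs_imp_AE_const:
  fixes y :: "real \<Rightarrow> real^3"
  assumes y: "integrable period_measure y"
    and orth: "\<And>\<phi>. \<phi> \<in> smooth_periodic \<Longrightarrow> (\<integral>t. deriv \<phi> t *\<^sub>R y t \<partial>period_measure) = 0"
  obtains c where "AE t in period_measure. y t = c"
proof -
  define c where "c = (1 / (2 * pi)) *\<^sub>R (\<integral>t. y t \<partial>period_measure)"
  have cc: "integrable period_measure (\<lambda>t. c)" by (rule period_integrable_cont) (rule continuous_on_const)
  have "AE t in period_measure. y t - c = 0"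
  proof (rule orthogonal_smooth_imp_AE_zero)
    show yc: "integrable period_measure (\<lambda>t. y t - c)" using y cc by simp
    fix \<psi> assume \<psi>: "\<psi> \<in> smooth_periodic"
    define m where "m = (\<integral>t. \<psi> t \<partial>period_measure) / (2 * pi)"
    obtain \<phi> where \<phi>: "\<phi> \<in> smooth_periodic" "\<And>t. deriv \<phi> t = \<psi> t - m"
      using smooth_periodic_primitive[OF \<psi>] unfolding m_def by blast
    note i = period_integrable_scaleR[OF _ smooth_periodic_cont(1)[OF \<psi>]]
      period_integrable_scaleR[OF _ smooth_periodic_cont(2)[OF \<phi>(1)]]
    have "(\<integral>t. \<psi> t *\<^sub>R (y t - c) \<partial>period_measure)
        = (\<integral>t. deriv \<phi> t *\<^sub>R y t - deriv \<phi> t *\<^sub>R c + m *\<^sub>R (y t - c) \<partial>period_measure)"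
      by (rule Bochner_Integration.integral_cong) (auto simp: \<phi>(2) algebra_simps)
    also have "\<dots> = (\<integral>t. deriv \<phi> t *\<^sub>R y t \<partial>period_measure) - (\<integral>t. deriv \<phi> t *\<^sub>R c \<partial>period_measure)
        + m *\<^sub>R (\<integral>t. y t - c \<partial>period_measure)"
      using i(2)[OF y] i(2)[OF cc] yc by simp
    also have "(\<integral>t. y t - c \<partial>period_measure) = 0"
      using y cc by (simp add: c_def)
    also have "(\<integral>t. deriv \<phi> t *\<^sub>R c \<partial>period_measure) = 0"
    proof -
      have d: "((\<lambda>t. \<phi> t *\<^sub>R c) has_vector_derivative deriv \<phi> t *\<^sub>R c) (at t within S)" for t S
        by (rule bounded_linear.has_vector_derivative[OF bounded_linear_scaleR_left
              smooth_periodic_vector_deriv[OF \<phi>(1)]])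
      have "((\<lambda>t. deriv \<phi> t *\<^sub>R c) has_integral (\<phi> (2 * pi) *\<^sub>R c - \<phi> 0 *\<^sub>R c)) {0..2 * pi}"
        by (rule fundamental_theorem_of_calculus[OF _ d]) simp
      moreover have "\<phi> (2 * pi) = \<phi> 0" by (rule smooth_periodic_0[OF \<phi>(1)])
      ultimately have "integral {0..2 * pi} (\<lambda>t. deriv \<phi> t *\<^sub>R c) = 0" by (simp add: has_integral_iff)
      then show ?thesis
        using continuous_on_scaleR[OF smooth_periodic_cont(2)[OF \<phi>(1)] continuous_on_const]
        by (subst period_integral_cont) auto
    qed
    finally show "(\<integral>t. \<psi> t *\<^sub>R (y t - c) \<partial>period_measure) = 0" by (simp add: orth[OF \<phi>(1)])
  qed
  then show thesis using that[of c] by simp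
qed

lemma
  fixes g :: "real \<Rightarrow> real^3"
  assumes g: "integrable period_measure g"
  shows period_primitive_cont: "continuous_on {0..2 * pi} (\<lambda>t. integral {0..t} g)"
    and period_primitive_set: "t \<in> {0..2 * pi} \<Longrightarrow>
      integral {0..t} g = (\<integral>s. indicator {..t} s *\<^sub>R g s \<partial>period_measure)"
proof -
  have s: "set_integrable lborel {0..2 * pi} g" using g by (simp add: period_integrable_iff)
  show "continuous_on {0..2 * pi} (\<lambda>t. integral {0..t} g)"
    by (intro indefinite_integral_continuous_1 set_borel_integral_eq_integral(1) s)
  assume t: "t \<in> {0..2 * pi}"
  have "set_integrable lborel {0..t} g" by (rule set_integrable_subset[OF s]) (use t in auto)
  then have "integral {0..t} g = (LINT s:{0..t}|lborel. g s)"
    by (simp add: set_borel_integral_eq_integral(2))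
  also have "\<dots> = (\<integral>s. indicator {..t} s *\<^sub>R g s \<partial>period_measure)"
    unfolding period_integral_set unfolding set_lebesgue_integral_def
    by (rule Bochner_Integration.integral_cong) (use t in \<open>auto simp: indicator_def\<close>)
  finally show "integral {0..t} g = (\<integral>s. indicator {..t} s *\<^sub>R g s \<partial>period_measure)" .
qed

text \<open>By Fubini on the triangle \<open>s <= t\<close>, the primitive \<open>G\<close> has the
  same pairings with derivatives of test functions as \<open>f\<close>. The boundary term,
  \<open>\<phi> (2 * pi)\<close> times the integral of \<open>g\<close>, drops out because a weak
  derivative on the circle has mean zero. Hence \<open>f - G\<close> is constant almost
  everywhere.\<close>

lemma weak_deriv_AE_primitive:
  assumes fg: "weak_deriv f g"
  obtains c where "AE t in period_measure. f t = c + integral {0..t} g"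
proof -
  let ?M = period_measure
  have f: "integrable ?M f" and g: "integrable ?M g" using fg by (auto simp: weak_deriv_def L2_period_integrable)
  define G where "G t = integral {0..t} g" for t
  have Gc: "continuous_on {0..2 * pi} G" unfolding G_def by (rule period_primitive_cont[OF g])
  interpret M: finite_measure ?M by simp
  interpret P: pair_sigma_finite ?M ?M by unfold_locales
  obtain c where "AE t in ?M. f t - G t = c"
  proof (rule orthogonal_derivs_imp_AE_const[of "\<lambda>t. f t - G t"])
    show fG: "integrable ?M (\<lambda>t. f t - G t)" using f period_integrable_cont[OF Gc] by simp
    fix \<phi> assume \<phi>: "\<phi> \<in> smooth_periodic"
    note c\<phi> = smooth_periodic_cont[OF \<phi>]
    define k where "k t s = (deriv \<phi> t * indicator {..t} s) *\<^sub>R g s" for t s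
    have m[measurable]: "g \<in> borel_measurable ?M" "deriv \<phi> \<in> borel_measurable ?M" "(\<lambda>t. t) \<in> borel_measurable ?M"
      using g by (auto intro!: period_continuous_measurable c\<phi> continuous_on_id)
    have km: "(\<lambda>z. k (fst z) (snd z)) \<in> borel_measurable (?M \<Otimes>\<^sub>M ?M)"
    proof -
      have *: "fst \<in> borel_measurable (?M \<Otimes>\<^sub>M ?M)" "snd \<in> borel_measurable (?M \<Otimes>\<^sub>M ?M)"
        using measurable_compose[OF measurable_fst m(3)] measurable_compose[OF measurable_snd m(3)] by auto
      have "(\<lambda>z. if snd z \<le> fst z then deriv \<phi> (fst z) *\<^sub>R g (snd z) else 0) \<in> borel_measurable (?M \<Otimes>\<^sub>M ?M)"
        using * by measurable
      then show ?thesis by (rule measurable_cong[THEN iffD1, rotated]) (auto simp: k_def indicator_def)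
    qed
    obtain B where B: "\<And>t. t \<in> {0..2 * pi} \<Longrightarrow> \<bar>deriv \<phi> t\<bar> \<le> B"
      using compact_imp_bounded[OF compact_continuous_image[OF c\<phi>(2), of "{0..2 * pi}"]]
      unfolding bounded_iff by (metis compact_Icc imageI real_norm_def)
    have ki: "integrable ?M (k t)" if "t \<in> {0..2 * pi}" for t
    proof -
      have "integrable ?M (\<lambda>s. indicator ({..t} \<inter> {0..2 * pi}) s *\<^sub>R g s)"
        by (rule integrable_mult_indicator[OF _ g]) (auto simp: period_measure_def sets_restrict_space)
      then have "integrable ?M (\<lambda>s. indicator {..t} s *\<^sub>R g s)"
        by (rule Bochner_Integration.integrable_cong[THEN iffD1, rotated 2]) (auto simp: indicator_def)
      then show ?thesis unfolding k_def by (simp flip: scaleR_scaleR)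
    qed
    have kint: "integrable (?M \<Otimes>\<^sub>M ?M) (\<lambda>z. k (fst z) (snd z))"
    proof (rule P.Fubini_integrable[OF km])
      show "AE t in ?M. integrable ?M (\<lambda>s. k (fst (t, s)) (snd (t, s)))" using ki by (auto intro!: AE_I2)
      have bound: "(\<integral>s. norm (k t s) \<partial>?M) \<le> B * (\<integral>s. norm (g s) \<partial>?M)" if "t \<in> {0..2 * pi}" for t
      proof -
        have "(\<integral>s. norm (k t s) \<partial>?M) \<le> (\<integral>s. B * norm (g s) \<partial>?M)"
        proof (rule integral_mono)
          show "integrable ?M (\<lambda>s. norm (k t s))" "integrable ?M (\<lambda>s. B * norm (g s))" using ki[OF that] g by auto
          have "0 \<le> B" using B[OF that] by linarith
          then show "norm (k t s) \<le> B * norm (g s)" for s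
            using mult_right_mono[OF B[OF that], of "norm (g s)"] by (auto simp: k_def indicator_def)
        qed
        then show ?thesis by simp
      qed
      have bm: "(\<lambda>t. \<integral>s. norm (k t s) \<partial>?M) \<in> borel_measurable ?M"
      proof (rule M.borel_measurable_lebesgue_integral)
        have "(\<lambda>z. norm (k (fst z) (snd z))) \<in> borel_measurable (?M \<Otimes>\<^sub>M ?M)" using km by measurable
        then show "(\<lambda>(t, s). norm (k t s)) \<in> borel_measurable (?M \<Otimes>\<^sub>M ?M)" by (simp add: split_beta')
      qed
      show "integrable ?M (\<lambda>t. \<integral>s. norm (k (fst (t, s)) (snd (t, s))) \<partial>?M)"
      proof (rule Bochner_Integration.integrable_bound[OF M.integrable_const[of "B * (\<integral>s. norm (g s) \<partial>?M)"], rotated 1])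
        show "AE t in ?M. norm (\<integral>s. norm (k (fst (t, s)) (snd (t, s))) \<partial>?M) \<le> norm (B * (\<integral>s. norm (g s) \<partial>?M))"
        proof (rule AE_I2)
          fix t assume "t \<in> space ?M"
          then have "(\<integral>s. norm (k t s) \<partial>?M) \<le> B * (\<integral>s. norm (g s) \<partial>?M)" by (intro bound) simp
          then show "norm (\<integral>s. norm (k (fst (t, s)) (snd (t, s))) \<partial>?M) \<le> norm (B * (\<integral>s. norm (g s) \<partial>?M))"
            by simp
        qed
      qed (use bm in simp)
    qed
    have "(\<integral>t. deriv \<phi> t *\<^sub>R G t \<partial>?M) = (\<integral>t. (\<integral>s. k t s \<partial>?M) \<partial>?M)"
      by (rule Bochner_Integration.integral_cong)
        (auto simp: G_def k_def period_primitive_set[OF g] simp flip: scaleR_scaleR)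
    also have "\<dots> = (\<integral>s. (\<integral>t. k t s \<partial>?M) \<partial>?M)"
      using P.Fubini_integral[of k] kint by (simp add: split_beta')
    also have "\<dots> = (\<integral>s. \<phi> (2 * pi) *\<^sub>R g s - \<phi> s *\<^sub>R g s \<partial>?M)"
    proof (rule Bochner_Integration.integral_cong)
      fix s assume "s \<in> space ?M"
      then have s: "s \<in> {0..2 * pi}" by simp
      have "(\<integral>t. k t s \<partial>?M) = (\<integral>t. (deriv \<phi> t * indicator {..t} s) \<partial>?M) *\<^sub>R g s"
      proof -
        have "integrable ?M (\<lambda>t. indicator ({s..} \<inter> {0..2 * pi}) t *\<^sub>R deriv \<phi> t)"
          by (rule integrable_mult_indicator[OF _ period_integrable_cont[OF c\<phi>(2)]])
            (auto simp: period_measure_def sets_restrict_space)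
        then have "integrable ?M (\<lambda>t. deriv \<phi> t * indicator {..t} s)"
          by (rule Bochner_Integration.integrable_cong[THEN iffD1, rotated 2]) (auto simp: indicator_def)
        then show ?thesis unfolding k_def by (rule integral_scaleR_left)
      qed
      also have "(\<integral>t. (deriv \<phi> t * indicator {..t} s) \<partial>?M) = (LINT t:{s..2 * pi}|lborel. deriv \<phi> t)"
        unfolding period_integral_set unfolding set_lebesgue_integral_def
        by (rule Bochner_Integration.integral_cong) (use s in \<open>auto simp: indicator_def\<close>)
      also have "\<dots> = integral {s..2 * pi} (deriv \<phi>)"
        by (intro set_borel_integral_eq_integral(2) borel_integrable_atLeastAtMost' c\<phi>)
      also have "\<dots> = \<phi> (2 * pi) - \<phi> s"
        by (rule integral_unique[OF fundamental_theorem_of_calculus[OF _ smooth_periodic_vector_deriv[OF \<phi>]]])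
          (use s in simp)
      finally show "(\<integral>t. k t s \<partial>?M) = \<phi> (2 * pi) *\<^sub>R g s - \<phi> s *\<^sub>R g s" by (simp add: scaleR_diff_left)
    qed simp
    also have "\<dots> = - (\<integral>s. \<phi> s *\<^sub>R g s \<partial>?M)"
      using g period_integrable_scaleR[OF g c\<phi>(1)] weak_deriv_integral_zero[OF fg] by simp
    also have "\<dots> = (\<integral>t. deriv \<phi> t *\<^sub>R f t \<partial>?M)" using fg \<phi> by (simp add: weak_deriv_def)
    finally show "(\<integral>t. deriv \<phi> t *\<^sub>R (f t - G t) \<partial>?M) = 0"
      using period_integrable_scaleR[OF f c\<phi>(2)] period_integrable_scaleR[OF period_integrable_cont[OF Gc] c\<phi>(2)]
      by (simp add: scaleR_diff_right)
  qed
  then have "AE t in ?M. f t = c + G t" by (rule AE_mp) (auto intro!: AE_I2 simp: algebra_simps)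
  then show thesis using that[of c] by (simp add: G_def)
qed

lemma weak_deriv_primitive:
  assumes fg: "weak_deriv f g" and f: "continuous_on {0..2 * pi} f" and t: "t \<in> {0..2 * pi}"
  shows "f t = f 0 + integral {0..t} g"
proof -
  have g: "integrable period_measure g" using fg by (auto simp: weak_deriv_def L2_period_integrable)
  obtain c where c: "AE t in period_measure. f t = c + integral {0..t} g" using weak_deriv_AE_primitive[OF fg] .
  have *: "f t - (c + integral {0..t} g) = 0" if "t \<in> {0..2 * pi}" for t
    by (rule continuous_AE_zero[OF _ _ that])
      (use c in \<open>auto intro!: continuous_intros f period_primitive_cont[OF g]\<close>)
  from *[of 0] *[OF t] show ?thesis by simp
qed

text \<open>The mean value of \<open>f\<close> is controlled by \<open>f\<close>, the oscillation by the integral of \<open>g\<close>; both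
  integrals are estimated with \<open>x \<le> l / 2 + x\<^sup>2 / (2 l)\<close> for \<open>l\<close> the norm on the right.\<close>

lemma weak_deriv_sup_bound:
  assumes fg: "weak_deriv f g" and f: "continuous_on {0..2 * pi} f" and t: "t \<in> {0..2 * pi}"
  shows "norm (f t) \<le> 8 * sqrt ((\<integral>t. (norm (f t))\<^sup>2 \<partial>period_measure) + (\<integral>t. (norm (g t))\<^sup>2 \<partial>period_measure))"
    (is "_ \<le> 8 * sqrt (?a + ?b)")
proof -
  let ?M = period_measure
  have L2: "f \<in> L2_period" "g \<in> L2_period" using fg by (auto simp: weak_deriv_def)
  note i = L2_period_integrable[OF L2(1)] L2_period_integrable[OF L2(2)]
  have sq: "integrable ?M (\<lambda>t. (norm (f t))\<^sup>2)" "integrable ?M (\<lambda>t. (norm (g t))\<^sup>2)"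
    using L2 by (auto simp: L2_period_def)
  have const: "integrable ?M (\<lambda>t. c)" for c :: real by (rule period_integrable_cont) (rule continuous_on_const)
  have osc: "norm (f t - f s) \<le> 2 * (\<integral>r. norm (g r) \<partial>?M)" if s: "s \<in> {0..2 * pi}" for s
  proof -
    have "norm (integral {0..r} g) \<le> (\<integral>r. norm (g r) \<partial>?M)" if "r \<in> {0..2 * pi}" for r
    proof -
      have "norm (integral {0..r} g) \<le> (\<integral>s. norm (indicator {..r} s *\<^sub>R g s) \<partial>?M)"
        unfolding period_primitive_set[OF i(2) that] by (rule integral_norm_bound)
      also have "\<dots> \<le> (\<integral>r. norm (g r) \<partial>?M)"
        by (rule integral_mono') (use i(2) in \<open>auto simp: indicator_def\<close>)
      finally show ?thesis .
    qed
    from this[OF s] this[OF t] show ?thesis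
      using weak_deriv_primitive[OF fg f s] weak_deriv_primitive[OF fg f t]
        norm_triangle_ineq4[of "integral {0..t} g" "integral {0..s} g"] by simp
  qed
  have est: "2 * pi * norm (f t) \<le> (\<integral>s. norm (f s) \<partial>?M) + 4 * pi * (\<integral>r. norm (g r) \<partial>?M)"
  proof -
    have "(\<integral>s. norm (f t) \<partial>?M) \<le> (\<integral>s. norm (f s) + 2 * (\<integral>r. norm (g r) \<partial>?M) \<partial>?M)"
    proof (rule integral_mono)
      fix s assume "s \<in> space ?M"
      then show "norm (f t) \<le> norm (f s) + 2 * (\<integral>r. norm (g r) \<partial>?M)"
        using osc[of s] norm_triangle_sub[of "f t" "f s"] by simp
    qed (use i const in auto)
    moreover have "(\<integral>s. norm (f t) \<partial>?M) = 2 * pi * norm (f t)" by simp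
    moreover have "(\<integral>s. norm (f s) + 2 * (\<integral>r. norm (g r) \<partial>?M) \<partial>?M)
        = (\<integral>s. norm (f s) \<partial>?M) + 2 * pi * (2 * (\<integral>r. norm (g r) \<partial>?M))"
      using i const by simp
    ultimately show ?thesis by linarith
  qed
  have l1: "(\<integral>s. norm (h s) \<partial>?M) \<le> pi * l + (\<integral>s. (norm (h s))\<^sup>2 \<partial>?M) / (2 * l)"
    if "0 < l" "h \<in> L2_period" for l h
  proof -
    have hi: "integrable ?M (\<lambda>s. (norm (h s))\<^sup>2)" "integrable ?M (\<lambda>s. norm (h s))"
      using that(2) L2_period_integrable[OF that(2)] by (auto simp: L2_period_def)
    have "x \<le> l / 2 + x\<^sup>2 / (2 * l)" for x
    proof -
      have "0 \<le> (x - l)\<^sup>2" by simp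
      then have "2 * x * l \<le> l\<^sup>2 + x\<^sup>2" by (simp add: power2_diff)
      then show ?thesis using that(1) by (simp add: field_simps power2_eq_square)
    qed
    then have "(\<integral>s. norm (h s) \<partial>?M) \<le> (\<integral>s. l / 2 + (norm (h s))\<^sup>2 / (2 * l) \<partial>?M)"
      using hi const by (intro integral_mono) auto
    then show ?thesis using hi const by simp
  qed
  have ab: "0 \<le> ?a" "0 \<le> ?b" by simp_all
  have main: "norm (f t) \<le> 7 * l + (?a + ?b) / l" if l: "0 < l" for l
  proof -
    have "2 * pi * norm (f t) \<le> (pi * l + ?a / (2 * l)) + 4 * pi * (pi * l + ?b / (2 * l))"
      by (rule order_trans[OF est]) (intro add_mono mult_left_mono l1 l L2; simp)
    also have "\<dots> = 2 * pi * (l / 2 + 2 * pi * l + ?a / (4 * pi * l) + ?b / l)"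
      using l by (simp add: field_simps)
    finally have "norm (f t) \<le> l / 2 + 2 * pi * l + ?a / (4 * pi * l) + ?b / l" by simp
    moreover have "?a / (4 * pi * l) \<le> ?a / l"
    proof -
      have "1 * l \<le> 4 * pi * l" using l pi_gt3 by (intro mult_right_mono) auto
      then show ?thesis using ab l by (intro divide_left_mono) auto
    qed
    \<comment> \<open>This gives \<open>l / 2 + 2 * pi * l <= 7 * l\<close>. With \<open>l\<close>
      the root of \<open>?a + ?b\<close> the two terms become 7 and 1 times that root, whence the
      constant 8.\<close>
    moreover have "pi * l \<le> 3.25 * l" using pi_less_4 l pi_approx(2) by (intro mult_right_mono) auto
    ultimately show ?thesis by (simp add: add_divide_distrib)
  qed
  show ?thesis
  proof (cases "?a + ?b = 0")
    case False
    then have "0 < ?a + ?b" using ab by linarith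
    then show ?thesis using main[of "sqrt (?a + ?b)"] by (simp add: real_div_sqrt)
  next
    case True
    have "norm (f t) \<le> 0"
    proof (rule field_le_epsilon)
      show "norm (f t) \<le> 0 + e" if "0 < e" for e using main[of "e / 7"] that True by simp
    qed
    then show ?thesis by simp
  qed
qed

section \<open>The space of periodic curves\<close>

type_synonym path = "real \<Rightarrow>\<^sub>C (real^3)"

lemma curve_cont [continuous_intros]: "continuous_on S (curve u)"
  by (rule continuous_on_subset[OF _ subset_UNIV]) (use curve[of u] in simp)

lemma curve_periodic: "curve u (t + 2 * pi) = curve u t"
  using curve[of u] by simp

lemma curve_ext: "(\<And>t. curve u t = curve v t) \<Longrightarrow> u = v"
  by (metis curve_inject ext)

lemma curve_add: "curve (u + v) t = curve u t + curve v t"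
  by (simp add: plus_H2_per.rep_eq)

lemma curve_scaleR: "curve (c *\<^sub>R u) t = c *\<^sub>R curve u t"
  by (simp add: scaleR_H2_per.rep_eq)

lemma curve_diff: "curve (u - v) t = curve u t - curve v t"
  using curve_add[of "u - v" v t] by simp

lemma periodic_add_int:
  assumes "\<And>t. f (t + 2 * pi) = (f t :: 'a)" shows "f (t + 2 * pi * of_int k) = f t"
proof -
  have nat: "f (t + 2 * pi * real n) = f t" for t n
  proof (induction n)
    case (Suc n)
    then show ?case using assms[of "t + 2 * pi * real n"] by (simp add: algebra_simps)
  qed simp
  show ?thesis
  proof (cases "0 \<le> k")
    case True
    then show ?thesis using nat[of t "nat k"] by simp
  next
    case False
    then show ?thesis using nat[of "t + 2 * pi * of_int k" "nat (- k)"] by simp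
  qed
qed

definition per :: "real \<Rightarrow> real" where
  "per t = t - 2 * pi * of_int \<lfloor>t / (2 * pi)\<rfloor>"

lemma per_in: "per t \<in> {0..<2 * pi}"
proof -
  have "of_int \<lfloor>t / (2 * pi)\<rfloor> \<le> t / (2 * pi)" "t / (2 * pi) < of_int \<lfloor>t / (2 * pi)\<rfloor> + 1" by linarith+
  then have "of_int \<lfloor>t / (2 * pi)\<rfloor> * (2 * pi) \<le> t" "t < (of_int \<lfloor>t / (2 * pi)\<rfloor> + 1) * (2 * pi)"
    by (simp_all only: pos_le_divide_eq pos_divide_less_eq zero_less_mult_iff pi_gt_zero zero_less_numeral simp_thms)
  then show ?thesis by (simp add: per_def algebra_simps)
qed

lemma per_in' [simp]: "per t \<in> {0..2 * pi}" "0 \<le> per t" "per t \<le> 2 * pi"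
  using per_in[of t] by auto

lemma per_periodic: "per (t + 2 * pi) = per t"
proof -
  have "(t + 2 * pi) / (2 * pi) = t / (2 * pi) + 1" by (simp add: field_simps)
  then show ?thesis by (simp add: per_def algebra_simps)
qed

lemma per_eq: "t \<in> {0..<2 * pi} \<Longrightarrow> per t = t"
  by (auto simp: per_def floor_eq_iff)

lemma per_eq_2pi: "per (2 * pi) = 0"
  by (simp add: per_def)

lemma periodic_per:
  assumes "\<And>t. f (t + 2 * pi) = (f t :: 'a)" shows "f (per t) = f t"
  using periodic_add_int[of f "per t" "\<lfloor>t / (2 * pi)\<rfloor>", OF assms] by (simp add: per_def)

lemma periodic_eqI:
  assumes "\<And>t. f (t + 2 * pi) = (f t :: 'a)" "\<And>t. g (t + 2 * pi) = g t" "\<And>t. t \<in> {0..2 * pi} \<Longrightarrow> f t = g t"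
  shows "f t = g t"
  using periodic_per[of f t, OF assms(1)] periodic_per[of g t, OF assms(2)] assms(3)[of "per t"] by simp

lemma per_agree: "g 0 = g (2 * pi) \<Longrightarrow> t \<in> {0..2 * pi} \<Longrightarrow> g (per t) = g t"
  using per_eq[of t] per_eq_2pi by (cases "t = 2 * pi") auto

text \<open>On each closed period the extension is a translate of \<open>g\<close>, at the right end
  too because the end values agree. Two neighbouring periods glued together contain a neighbourhood
  of any point, period ends included.\<close>

lemma continuous_periodic_extension:
  fixes g :: "real \<Rightarrow> 'b::topological_space"
  assumes g: "continuous_on {0..2 * pi} g" and ends: "g 0 = g (2 * pi)"
  shows "continuous_on UNIV (\<lambda>t. g (per t))"
proof -
  have piece: "continuous_on {2 * pi * of_int k..2 * pi * of_int (k + 1)} (\<lambda>t. g (per t))" for k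
  proof (rule continuous_on_eq)
    show "continuous_on {2 * pi * of_int k..2 * pi * of_int (k + 1)} (\<lambda>t. g (t - 2 * pi * of_int k))"
      by (rule continuous_on_compose2[OF g]) (auto intro!: continuous_intros simp: algebra_simps)
    fix t assume "t \<in> {2 * pi * of_int k..2 * pi * of_int (k + 1)}"
    then have "t - 2 * pi * of_int k \<in> {0..2 * pi}" by (auto simp: algebra_simps)
    from per_agree[OF ends this]
    show "g (t - 2 * pi * of_int k) = g (per t)"
      using periodic_add_int[of per "t - 2 * pi * of_int k" k, OF per_periodic] by simp
  qed
  show ?thesis
  proof (rule continuous_at_imp_continuous_on, rule ballI)
    fix t :: real
    define k where "k = \<lfloor>t / (2 * pi)\<rfloor>"
    have "of_int k \<le> t / (2 * pi)" "t / (2 * pi) < of_int k + 1" unfolding k_def by linarith+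
    then have t: "2 * pi * of_int k \<le> t" "t < 2 * pi * of_int (k + 1)"
      using per_in[of t] by (simp_all add: per_def k_def algebra_simps)
    let ?S = "{2 * pi * of_int (k - 1)..2 * pi * of_int (k - 1 + 1)} \<union> {2 * pi * of_int k..2 * pi * of_int (k + 1)} :: real set"
    have c: "continuous_on ?S (\<lambda>t. g (per t))" by (intro continuous_on_closed_Un piece) auto
    have "{2 * pi * of_int (k - 1)<..<2 * pi * of_int (k + 1)} \<subseteq> ?S" by (auto simp: algebra_simps)
    moreover have "t \<in> {2 * pi * of_int (k - 1)<..<2 * pi * of_int (k + 1)}"
      using t by (auto simp: algebra_simps)
    ultimately show "isCont (\<lambda>t. g (per t)) t"
      using continuous_on_subset[OF c] continuous_on_eq_continuous_at[OF open_greaterThanLessThan] by blast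
  qed
qed

text \<open>Integration by parts; the boundary term against a periodic test function vanishes
  because the end values of \<open>x\<close> agree.\<close>

lemma weak_deriv_classical:
  fixes x V :: "real \<Rightarrow> real^3"
  assumes x: "\<And>t. t \<in> {0..2 * pi} \<Longrightarrow> (x has_vector_derivative V t) (at t within {0..2 * pi})"
    and V: "continuous_on {0..2 * pi} V" and ends: "x 0 = x (2 * pi)"
  shows "weak_deriv x V"
proof -
  have xc: "continuous_on {0..2 * pi} x"
    using x by (rule continuous_on_vector_derivative)
  have "(\<integral>t. deriv \<phi> t *\<^sub>R x t \<partial>period_measure) = - (\<integral>t. \<phi> t *\<^sub>R V t \<partial>period_measure)"
    if \<phi>: "\<phi> \<in> smooth_periodic" for \<phi>
  proof -
    note c = smooth_periodic_cont[OF \<phi>]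
    have d: "((\<lambda>t. \<phi> t *\<^sub>R x t) has_vector_derivative \<phi> t *\<^sub>R V t + deriv \<phi> t *\<^sub>R x t) (at t within {0..2 * pi})"
      if "t \<in> {0..2 * pi}" for t
      using has_vector_derivative_scaleR[OF has_field_derivative_at_within[OF smooth_periodic_deriv[OF \<phi>]] x[OF that]] .
    have "((\<lambda>t. \<phi> t *\<^sub>R V t + deriv \<phi> t *\<^sub>R x t) has_integral
        (\<phi> (2 * pi) *\<^sub>R x (2 * pi) - \<phi> 0 *\<^sub>R x 0)) {0..2 * pi}"
      by (rule fundamental_theorem_of_calculus[OF _ d]) simp_all
    then have "integral {0..2 * pi} (\<lambda>t. \<phi> t *\<^sub>R V t + deriv \<phi> t *\<^sub>R x t) = 0"
      using smooth_periodic_0[OF \<phi>] ends by (simp add: has_integral_iff)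
    moreover have "integral {0..2 * pi} (\<lambda>t. \<phi> t *\<^sub>R V t + deriv \<phi> t *\<^sub>R x t)
        = integral {0..2 * pi} (\<lambda>t. \<phi> t *\<^sub>R V t) + integral {0..2 * pi} (\<lambda>t. deriv \<phi> t *\<^sub>R x t)"
      by (intro integral_add integrable_continuous_real continuous_on_scaleR c V xc)
    ultimately show ?thesis
      using period_integral_cont[OF continuous_on_scaleR[OF c(1) V]] period_integral_cont[OF continuous_on_scaleR[OF c(2) xc]]
      by (simp add: eq_neg_iff_add_eq_0 add.commute)
  qed
  then show ?thesis by (simp add: weak_deriv_def L2_period_cont xc V)
qed

lemma weak_deriv_cong_right:
  assumes "weak_deriv f v" "AE t in period_measure. v t = w t" "w \<in> L2_period"
  shows "weak_deriv f w"
proof -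
  note L = assms(1)[unfolded weak_deriv_def]
  have "(\<integral>t. \<phi> t *\<^sub>R w t \<partial>period_measure) = (\<integral>t. \<phi> t *\<^sub>R v t \<partial>period_measure)"
    if \<phi>: "\<phi> \<in> smooth_periodic" for \<phi>
    using L \<phi> assms(2,3)
    by (intro integral_cong_AE borel_measurable_integrable period_integrable_scaleR
        L2_period_integrable smooth_periodic_cont) auto
  then show ?thesis using L assms(3) by (simp add: weak_deriv_def)
qed

lemma norm_H2_per_sq:
  "(norm u)\<^sup>2 = (\<integral>t. (norm (curve u t))\<^sup>2 \<partial>period_measure) + (\<integral>t. (norm (wderiv (curve u) t))\<^sup>2 \<partial>period_measure)
     + (\<integral>t. (norm (wderiv (wderiv (curve u)) t))\<^sup>2 \<partial>period_measure)"
proof -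
  have "(norm u)\<^sup>2 = u \<bullet> u" by (simp add: power2_norm_eq_inner)
  then show ?thesis
    using L2_period_integrable_inner[OF curve_L2(1)[of u] curve_L2(1)[of u]]
      L2_period_integrable_inner[OF curve_L2(2)[of u] curve_L2(2)[of u]]
      L2_period_integrable_inner[OF curve_L2(3)[of u] curve_L2(3)[of u]]
    by (simp add: inner_H2_per_def power2_norm_eq_inner)
qed

lemma curve_sup_bound: "norm (curve u t) \<le> 8 * norm u"
proof -
  have "norm (curve u t) \<le> 8 * norm u" if t: "t \<in> {0..2 * pi}" for t
  proof -
    have "norm (curve u t) \<le> 8 * sqrt ((\<integral>t. (norm (curve u t))\<^sup>2 \<partial>period_measure) + (\<integral>t. (norm (wderiv (curve u) t))\<^sup>2 \<partial>period_measure))"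
      by (rule weak_deriv_sup_bound[OF curve_weak_deriv(1) curve_cont t])
    also have "\<dots> \<le> 8 * sqrt ((norm u)\<^sup>2)" by (simp add: norm_H2_per_sq)
    finally show ?thesis by simp
  qed
  from this[of "per t"] show ?thesis using periodic_per[of "curve u" t, OF curve_periodic] by simp
qed

text \<open>Applying the primitive formula to the weak derivative itself yields a continuous
  representative \<open>w\<close>, so elements of X are classically \<open>C^1\<close>. The bound on
  \<open>w\<close> later turns nearness in X into nearness of positions and velocities.\<close>

lemma H2_per_C1:
  obtains w where "continuous_on {0..2 * pi} w" "AE t in period_measure. wderiv (curve u) t = w t"
    "\<And>t. t \<in> {0..2 * pi} \<Longrightarrow> (curve u has_vector_derivative w t) (at t within {0..2 * pi})"
    "w 0 = w (2 * pi)" "\<And>t. t \<in> {0..2 * pi} \<Longrightarrow> norm (w t) \<le> 8 * norm u"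
proof -
  let ?g = "wderiv (wderiv (curve u))"
  note W = curve_weak_deriv[of u]
  have g: "integrable period_measure ?g" by (rule L2_period_integrable[OF curve_L2(3)])
  obtain c where c: "AE t in period_measure. wderiv (curve u) t = c + integral {0..t} ?g"
    using weak_deriv_AE_primitive[OF W(2)] .
  define w where "w t = c + integral {0..t} ?g" for t
  have wc: "continuous_on {0..2 * pi} w" unfolding w_def by (intro continuous_intros period_primitive_cont[OF g])
  have ae: "AE t in period_measure. wderiv (curve u) t = w t" using c by (simp add: w_def)
  have uw: "weak_deriv (curve u) w" by (rule weak_deriv_cong_right[OF W(1) ae L2_period_cont[OF wc]])
  have wg: "weak_deriv w ?g" by (rule weak_deriv_cong[OF W(2) ae L2_period_cont[OF wc]])
  have "(curve u has_vector_derivative w t) (at t within {0..2 * pi})" if t: "t \<in> {0..2 * pi}" for t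
  proof (rule has_vector_derivative_transform[OF t])
    show "((\<lambda>s. curve u 0 + integral {0..s} w) has_vector_derivative w t) (at t within {0..2 * pi})"
      using has_vector_derivative_add[OF has_vector_derivative_const integral_has_vector_derivative[OF wc t]] by simp
  qed (rule weak_deriv_primitive[OF uw curve_cont])
  moreover have "w 0 = w (2 * pi)"
  proof -
    have "integral {0..2 * pi} ?g = (\<integral>s. indicator {..2 * pi} s *\<^sub>R ?g s \<partial>period_measure)"
      by (rule period_primitive_set[OF g]) simp
    also have "\<dots> = (\<integral>s. ?g s \<partial>period_measure)" by (rule Bochner_Integration.integral_cong) auto
    finally show ?thesis using weak_deriv_integral_zero[OF W(2)] by (simp add: w_def)
  qed
  moreover have "norm (w t) \<le> 8 * norm u" if t: "t \<in> {0..2 * pi}" for t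
  proof -
    have "(\<integral>t. (norm (w t))\<^sup>2 \<partial>period_measure) = (\<integral>t. (norm (wderiv (curve u) t))\<^sup>2 \<partial>period_measure)"
      using ae curve_L2(2)[of u] L2_period_cont[OF wc] by (intro integral_cong_AE) (auto simp: L2_period_def)
    then have "norm (w t) \<le> 8 * sqrt ((\<integral>t. (norm (wderiv (curve u) t))\<^sup>2 \<partial>period_measure) + (\<integral>t. (norm (?g t))\<^sup>2 \<partial>period_measure))"
      using weak_deriv_sup_bound[OF wg wc t] by simp
    also have "\<dots> \<le> 8 * sqrt ((norm u)\<^sup>2)" by (simp add: norm_H2_per_sq)
    finally show ?thesis by simp
  qed
  ultimately show thesis by (rule that[OF wc ae])
qed

text \<open>Each of the three integrals is at most \<open>2 * pi * B\<^sup>2\<close>; the factor 5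
  comes from \<open>6 * pi <= 25\<close>. This is the converse direction, from sup norms of paths to
  the norm of X.\<close>

lemma H2_per_norm_le:
  assumes V: "weak_deriv (curve u) V" and W: "weak_deriv V W"
    and B: "\<And>t. t \<in> {0..2 * pi} \<Longrightarrow> norm (curve u t) \<le> B" "\<And>t. t \<in> {0..2 * pi} \<Longrightarrow> norm (V t) \<le> B"
      "\<And>t. t \<in> {0..2 * pi} \<Longrightarrow> norm (W t) \<le> B"
  shows "norm u \<le> 5 * B"
proof -
  have ae: "AE t in period_measure. wderiv (curve u) t = V t"
    by (rule weak_deriv_unique[OF curve_weak_deriv(1) V]) simp
  have ae2: "AE t in period_measure. wderiv (wderiv (curve u)) t = W t"
    by (rule weak_deriv_unique[OF curve_weak_deriv(2) W ae])
  have "0 \<le> B" using order_trans[OF norm_ge_zero B(1)[of 0]] by simp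
  have c: "integrable period_measure (\<lambda>t. B\<^sup>2)" by (rule period_integrable_cont) (rule continuous_on_const)
  have le: "(\<integral>t. (norm (f t))\<^sup>2 \<partial>period_measure) \<le> 2 * pi * B\<^sup>2"
    if "f \<in> L2_period" "AE t in period_measure. norm (f t) \<le> B" for f :: "real \<Rightarrow> real^3"
  proof -
    have "(\<integral>t. (norm (f t))\<^sup>2 \<partial>period_measure) \<le> (\<integral>t. B\<^sup>2 \<partial>period_measure)"
    proof (rule integral_mono_AE)
      show "AE t in period_measure. (norm (f t))\<^sup>2 \<le> B\<^sup>2"
        using that(2) by (rule AE_mp) (auto intro!: AE_I2 power_mono)
    qed (use that c in \<open>simp_all add: L2_period_def\<close>)
    then show ?thesis by simp
  qed
  have "(norm u)\<^sup>2 \<le> 3 * (2 * pi * B\<^sup>2)"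
  proof -
    have 1: "AE t in period_measure. norm (curve u t) \<le> B" using B(1) by (auto intro!: AE_I2)
    have 2: "AE t in period_measure. norm (wderiv (curve u) t) \<le> B"
      using ae by (rule AE_mp) (use B(2) in \<open>auto intro!: AE_I2\<close>)
    have 3: "AE t in period_measure. norm (wderiv (wderiv (curve u)) t) \<le> B"
      using ae2 by (rule AE_mp) (use B(3) in \<open>auto intro!: AE_I2\<close>)
    show ?thesis
      using le[OF curve_L2(1) 1] le[OF curve_L2(2) 2] le[OF curve_L2(3) 3] by (simp add: norm_H2_per_sq)
  qed
  also have "\<dots> \<le> (5 * B)\<^sup>2"
  proof -
    have "6 * pi * B\<^sup>2 \<le> 25 * B\<^sup>2" using pi_less_4 by (intro mult_right_mono) simp_all
    then show ?thesis by (simp add: power_mult_distrib)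
  qed
  finally show ?thesis by (rule power2_le_imp_le) (use \<open>0 \<le> B\<close> in simp)
qed

section \<open>Periodic curves from their second derivative\<close>

text \<open>The mean over one period is the obstruction to a periodic primitive; this projection
  removes it.\<close>

definition mz :: "path \<Rightarrow> path" where
  "mz h = h - const_bcontfun ((1 / (2 * pi)) *\<^sub>R Jop h (2 * pi))"

lemma mz_apply: "mz h t = h t - (1 / (2 * pi)) *\<^sub>R Jop h (2 * pi)"
  by (simp add: mz_def)

lemma Jop_const: "Jop (const_bcontfun c) t = clampt t *\<^sub>R c"
  by (simp add: Jop_apply const_bcontfun.rep_eq)

lemma Jop_mz: "Jop (mz h) (2 * pi) = 0"
  by (simp add: mz_def blinfun.diff_right Jop_const)

lemma mz_id: "Jop h (2 * pi) = 0 \<Longrightarrow> mz h = h"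
  by (intro bcontfun_eqI) (simp add: mz_apply)

lemma Jop_point_bound: "norm (Jop h t) \<le> 2 * pi * norm h"
  using norm_bounded[of "Jop h" t] norm_Jop[of h] by linarith

lemma bounded_linear_mz: "bounded_linear mz"
proof (rule bounded_linear_intro[where K = 2])
  show "norm (mz h) \<le> norm h * 2" for h
  proof (rule norm_bound)
    fix t
    have "norm ((1 / (2 * pi)) *\<^sub>R Jop h (2 * pi)) \<le> norm h"
      using Jop_point_bound[of h "2 * pi"] by (simp add: field_simps)
    then show "norm (mz h t) \<le> norm h * 2"
      using norm_bounded[of h t] norm_triangle_ineq4[of "h t" "(1 / (2 * pi)) *\<^sub>R Jop h (2 * pi)"] by (simp add: mz_apply)
  qed
qed (auto intro!: bcontfun_eqI simp: mz_apply blinfun.add_right blinfun.scaleR_right algebra_simps)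

text \<open>Each \<open>mz\<close> buys one periodicity condition: the inner one makes the velocity
  periodic, the outer one the curve itself, whose initial velocity is thereby determined.\<close>

definition Pz :: "real^3 \<Rightarrow> path \<Rightarrow> path" where
  "Pz a h = const_bcontfun a + Jop (mz (Jop (mz h)))"

text \<open>The periodic curve with value \<open>a\<close> at \<open>0\<close> whose second derivative on \<open>{0..2 * pi}\<close> is \<open>h\<close>
  minus its mean.\<close>

definition Pop :: "real^3 \<Rightarrow> path \<Rightarrow> H2_per" where
  "Pop a h = Abs_H2_per (\<lambda>t. Pz a h (per t))"

lemma Pz_ends: "Pz a h 0 = a" "Pz a h (2 * pi) = a"
  by (simp_all add: Pz_def Jop_mz)

lemma Pz_weak_deriv:
  "weak_deriv (\<lambda>t. Pz a h (per t)) (apply_bcontfun (mz (Jop (mz h))))"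
  "weak_deriv (apply_bcontfun (mz (Jop (mz h)))) (apply_bcontfun (mz h))"
proof -
  have "(apply_bcontfun (Pz a h) has_vector_derivative mz (Jop (mz h)) t) (at t within {0..2 * pi})" if "t \<in> {0..2 * pi}" for t
    using has_vector_derivative_add[OF has_vector_derivative_const Jop_deriv[OF that, of "mz (Jop (mz h))"], of a]
    by (simp add: Pz_def[abs_def] plus_bcontfun.rep_eq const_bcontfun.rep_eq)
  then have 1: "weak_deriv (apply_bcontfun (Pz a h)) (apply_bcontfun (mz (Jop (mz h))))"
    by (intro weak_deriv_classical) (auto simp: Pz_ends)
  have ext: "continuous_on UNIV (\<lambda>t. Pz a h (per t))"
    by (rule continuous_periodic_extension) (auto simp: Pz_ends)
  show "weak_deriv (\<lambda>t. Pz a h (per t)) (apply_bcontfun (mz (Jop (mz h))))"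
  proof (rule weak_deriv_cong[OF 1])
    show "AE t in period_measure. Pz a h t = Pz a h (per t)"
      by (rule AE_I2) (use per_agree[of "apply_bcontfun (Pz a h)"] in \<open>simp add: Pz_ends\<close>)
    show "(\<lambda>t. Pz a h (per t)) \<in> L2_period"
      by (rule L2_period_cont) (rule continuous_on_subset[OF ext subset_UNIV])
  qed
  have "(apply_bcontfun (mz (Jop (mz h))) has_vector_derivative mz h t) (at t within {0..2 * pi})" if "t \<in> {0..2 * pi}" for t
    using has_vector_derivative_diff[OF Jop_deriv[OF that, of "mz h"] has_vector_derivative_const]
    by (simp add: mz_apply[of "Jop (mz h)", abs_def])
  then show "weak_deriv (apply_bcontfun (mz (Jop (mz h)))) (apply_bcontfun (mz h))"
    by (intro weak_deriv_classical) (auto simp: mz_apply[of "Jop (mz h)"] Jop_mz)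
qed

lemma curve_Pop: "curve (Pop a h) = (\<lambda>t. Pz a h (per t))"
  unfolding Pop_def
proof (rule Abs_H2_per_inverse, intro CollectI conjI allI exI)
  show "continuous_on UNIV (\<lambda>t. Pz a h (per t))"
    by (rule continuous_periodic_extension) (auto simp: Pz_ends)
qed (auto simp: per_periodic intro: Pz_weak_deriv)

text \<open>Through this map every \<open>C^1\<close> dependence of \<open>(a, h)\<close> becomes a
  \<open>C^1\<close> dependence in X, although the bifurcation equation is solved for continuous
  second derivatives. The constant only collects \<open>norm (mz h) <= 2 * norm h\<close> and
  \<open>norm (Jop h) <= 2 * pi * norm h\<close>.\<close>

lemma bounded_linear_Pop: "bounded_linear (\<lambda>z. Pop (fst z) (snd z))"
proof -
  interpret mz: bounded_linear mz by (rule bounded_linear_mz)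
  have mzn: "norm (mz h) \<le> 2 * norm h" for h
  proof (rule norm_bound)
    fix t
    have "norm ((1 / (2 * pi)) *\<^sub>R Jop h (2 * pi)) \<le> norm h"
      using Jop_point_bound[of h "2 * pi"] by (simp add: field_simps)
    then show "norm (mz h t) \<le> 2 * norm h"
      using norm_bounded[of h t] norm_triangle_ineq4[of "h t" "(1 / (2 * pi)) *\<^sub>R Jop h (2 * pi)"] by (simp add: mz_apply)
  qed
  show ?thesis
  proof (rule bounded_linear_intro[where K = "5 * (1 + 16 * pi\<^sup>2 + 8 * pi + 2)"])
    show "norm (Pop (fst z) (snd z)) \<le> norm z * (5 * (1 + 16 * pi\<^sup>2 + 8 * pi + 2))" for z
    proof -
      let ?a = "fst z" and ?h = "snd z"
      have z: "norm ?a \<le> norm z" "norm ?h \<le> norm z" using norm_fst_le[of "fst z" "snd z"] norm_snd_le[of "snd z" "fst z"] by simp_all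
      have w: "norm (mz ?h) \<le> 2 * norm z" using mzn[of ?h] z by linarith
      have J: "norm (Jop x) \<le> 2 * pi * b" if "norm x \<le> b" for x :: "path" and b
        by (rule order_trans[OF norm_Jop mult_left_mono[OF that]]) simp
      have v: "norm (mz (Jop (mz ?h))) \<le> 8 * pi * norm z"
        using mzn[of "Jop (mz ?h)"] J[OF w] by simp
      have x: "norm (Jop (mz (Jop (mz ?h)))) \<le> 16 * pi\<^sup>2 * norm z"
        using J[OF v] by (simp add: power2_eq_square)
      let ?B = "norm z * (1 + 16 * pi\<^sup>2 + 8 * pi + 2)"
      have n0: "0 \<le> norm z" "0 \<le> norm z * pi" "0 \<le> norm z * pi\<^sup>2" by simp_all
      have "norm (Pop ?a ?h) \<le> 5 * ?B"
      proof (rule H2_per_norm_le[where V = "apply_bcontfun (mz (Jop (mz ?h)))" and W = "apply_bcontfun (mz ?h)"])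
        show "weak_deriv (curve (Pop ?a ?h)) (apply_bcontfun (mz (Jop (mz ?h))))"
          unfolding curve_Pop by (rule Pz_weak_deriv)
        show "weak_deriv (apply_bcontfun (mz (Jop (mz ?h)))) (apply_bcontfun (mz ?h))" by (rule Pz_weak_deriv)
        fix t
        have "norm (Jop (mz (Jop (mz ?h))) (per t)) \<le> 16 * pi\<^sup>2 * norm z" using norm_bounded x by (rule order_trans)
        then have "norm (curve (Pop ?a ?h) t) \<le> norm z + 16 * pi\<^sup>2 * norm z"
          using norm_triangle_ineq[of ?a "Jop (mz (Jop (mz ?h))) (per t)"] z by (simp add: curve_Pop Pz_def)
        moreover have "?B = norm z + 16 * pi\<^sup>2 * norm z + (8 * (norm z * pi) + 2 * norm z)"
          by (simp add: algebra_simps)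
        ultimately show "norm (curve (Pop ?a ?h) t) \<le> ?B" using n0 by linarith
        have B: "?B = 3 * norm z + 16 * (norm z * pi\<^sup>2) + 8 * (norm z * pi)" by (simp add: algebra_simps)
        have "norm (mz (Jop (mz ?h)) t) \<le> 8 * pi * norm z" using norm_bounded v by (rule order_trans)
        then have "norm (mz (Jop (mz ?h)) t) \<le> 8 * (norm z * pi)" by (simp add: mult_ac)
        then show "norm (mz (Jop (mz ?h)) t) \<le> ?B" using n0 B by linarith
        have "norm (mz ?h t) \<le> 2 * norm z" using norm_bounded w by (rule order_trans)
        then show "norm (mz ?h t) \<le> ?B" using n0 B by linarith
      qed
      then show ?thesis by (simp add: mult_ac)
    qed
  qed (auto intro!: curve_ext simp: curve_add curve_scaleR curve_Pop Pz_def mz.add mz.scaleR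
      blinfun.add_right blinfun.scaleR_right algebra_simps)
qed

text \<open>For a curve that is already periodic the inner mean vanishes, and the outer one restores
  the initial velocity, since \<open>Jop (Jop h) (2 * pi)\<close> equals \<open>V 0\<close> times
  \<open>- 2 * pi\<close>. Position at 0 and second derivative thus determine the curve.\<close>

lemma curve_Pop_eq:
  fixes h :: path
  assumes per: "\<And>t. x (t + 2 * pi) = x t"
    and x: "\<And>t. t \<in> {0..2 * pi} \<Longrightarrow> (x has_vector_derivative V t) (at t within {0..2 * pi})"
    and V: "\<And>t. t \<in> {0..2 * pi} \<Longrightarrow> (V has_vector_derivative h t) (at t within {0..2 * pi})"
    and V0: "V (2 * pi) = V 0"
  shows "curve (Pop (x 0) h) = x"
proof -
  have x0: "x (2 * pi) = x 0" using per[of 0] by simp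
  have h: "Jop h (2 * pi) = 0" using Jop_FTC[of V h "2 * pi", OF V] V0 by simp
  have VJ: "Jop h t = V t - V 0" if "t \<in> {0..2 * pi}" for t using Jop_FTC[of V h t, OF V that] by simp
  have x': "((\<lambda>t. x t - t *\<^sub>R V 0) has_vector_derivative Jop h t) (at t within {0..2 * pi})" if "t \<in> {0..2 * pi}" for t
    unfolding VJ[OF that] by (intro has_vector_derivative_diff x that) (auto intro!: derivative_eq_intros)
  have JJ: "Jop (Jop h) t = x t - x 0 - t *\<^sub>R V 0" if "t \<in> {0..2 * pi}" for t
    using Jop_FTC[of "\<lambda>t. x t - t *\<^sub>R V 0" "Jop h" t, OF x' that, symmetric] by (simp add: algebra_simps)
  have JJ2: "Jop (Jop h) (2 * pi) = - (2 * pi) *\<^sub>R V 0" using JJ[of "2 * pi"] x0 by simp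
  have "curve (Pop (x 0) h) t = x t" if t: "t \<in> {0..2 * pi}" for t
  proof -
    have "Pz (x 0) h t = x t"
      unfolding Pz_def mz_id[OF h]
      by (simp add: mz_def[of "Jop h"] blinfun.diff_right Jop_const JJ2 JJ[OF t] t del: atLeastAtMost_iff)
    moreover have "Pz (x 0) h (per t) = Pz (x 0) h t" by (rule per_agree[OF _ t]) (simp add: Pz_ends)
    ultimately show ?thesis by (simp add: curve_Pop)
  qed
  then show ?thesis by (intro ext) (rule periodic_eqI[of "curve (Pop (x 0) h)" x, OF curve_periodic per])
qed

section \<open>Critical points of actions\<close>

lemma bounded_linear_bc_apply: "bounded_linear (\<lambda>x :: real \<Rightarrow>\<^sub>C 'b::real_normed_vector. x t)"
  by (rule bounded_linear_intro[where K = 1]) (auto simp: norm_bounded)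

definition path_of :: "H2_per \<Rightarrow> path" where
  "path_of u = clampf (curve u)"

lemma path_of_apply: "path_of u t = curve u (clampt t)"
  unfolding path_of_def by (rule clampf_apply) (rule curve_cont)

lemma bounded_linear_path_of: "bounded_linear path_of"
proof (rule bounded_linear_intro[where K = 8])
  show "norm (path_of u) \<le> norm u * 8" for u
    by (rule norm_bound) (use curve_sup_bound in \<open>simp add: path_of_apply mult.commute\<close>)
qed (auto intro!: bcontfun_eqI simp: path_of_apply curve_add curve_scaleR)

lemma path_of_nem_dom: "(\<And>t. curve u t \<in> D) \<Longrightarrow> path_of u \<in> nem_dom D"
  by (rule nem_domI[of "curve u"]) (auto simp: path_of_apply intro: curve_cont)

text \<open>The integral is a bounded linear functional of \<open>Nem U (path_of v)\<close>, and
  \<open>path_of\<close> is bounded by the Sobolev embedding; the chain rule applies on the open set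
  of curves that stay in \<open>D\<close>.\<close>

lemma potential_has_derivative:
  fixes U :: "real^3 \<Rightarrow> real"
  assumes U: "C1_on D U" and D: "open D" and u: "\<And>t. curve u t \<in> D"
  shows "((\<lambda>v. \<integral>t. U (curve v t) \<partial>period_measure) has_derivative
    (\<lambda>h. \<integral>t. fderiv U (curve u t) (curve h t) \<partial>period_measure)) (at u)"
proof -
  let ?S = "path_of -` nem_dom D"
  have S: "open ?S"
    by (intro open_vimage open_nem_dom D linear_continuous_on bounded_linear_path_of)
  have uS: "u \<in> ?S" using path_of_nem_dom[OF u] by simp
  note N = C1_on_has_derivative[OF C1_on_Nem[OF U D]]
  have "((\<lambda>v. Nem U (path_of v)) has_derivative (\<lambda>h. fderiv (Nem U) (path_of u) (path_of h))) (at u)"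
    using has_derivative_compose[OF bounded_linear_imp_has_derivative[OF bounded_linear_path_of] N] uS by simp
  from bounded_linear.has_derivative[OF bounded_linear_bc_apply
      bounded_linear.has_derivative[OF blinfun.bounded_linear_right[of Jop] this], of "2 * pi"]
  have d: "((\<lambda>v. Jop (Nem U (path_of v)) (2 * pi)) has_derivative
      (\<lambda>h. Jop (fderiv (Nem U) (path_of u) (path_of h)) (2 * pi))) (at u)" .
  have eq: "Jop (Nem U (path_of v)) (2 * pi) = (\<integral>t. U (curve v t) \<partial>period_measure)" if "v \<in> ?S" for v
  proof -
    have n: "Nem U (path_of v) t = U (curve v (clampt t))" for t
      using that by (simp add: Nem_apply[OF C1_on_imp_continuous_on[OF U]] path_of_apply)
    have "continuous_on {0..2 * pi} (\<lambda>t. U (curve v t))"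
      by (rule continuous_on_eq[OF continuous_on_apply_bcontfun[of _ "Nem U (path_of v)"]]) (simp add: n)
    then show ?thesis
      by (subst period_integral_cont) (auto simp: Jop_apply n intro!: integral_cong)
  qed
  have "Jop (fderiv (Nem U) (path_of u) (path_of h)) (2 * pi)
      = (\<integral>t. fderiv U (curve u t) (curve h t) \<partial>period_measure)" for h
  proof -
    have n: "fderiv (Nem U) (path_of u) (path_of h) t = fderiv U (curve u (clampt t)) (curve h (clampt t))" for t
      using uS by (simp add: fderiv_Nem[OF U D] path_of_apply)
    have "continuous_on {0..2 * pi} (\<lambda>t. fderiv U (curve u t) (curve h t))"
      by (rule continuous_on_eq[OF continuous_on_apply_bcontfun[of _ "fderiv (Nem U) (path_of u) (path_of h)"]])
        (simp add: n)
    then show ?thesis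
      by (subst period_integral_cont) (auto simp: Jop_apply n intro!: integral_cong)
  qed
  with d have d: "((\<lambda>v. Jop (Nem U (path_of v)) (2 * pi)) has_derivative
      (\<lambda>h. \<integral>t. fderiv U (curve u t) (curve h t) \<partial>period_measure)) (at u)" by simp
  show ?thesis
    by (rule has_derivative_transform_within_open[OF d S uS eq])
qed

definition kin :: "H2_per \<Rightarrow> H2_per \<Rightarrow> real" where
  "kin u v = (\<integral>t. wderiv (curve u) t \<bullet> wderiv (curve v) t \<partial>period_measure)"

lemma kin_integrable: "integrable period_measure (\<lambda>t. wderiv (curve u) t \<bullet> wderiv (curve v) t)"
  by (rule L2_period_integrable_inner[OF curve_L2(2) curve_L2(2)])

lemma kin_commute: "kin u v = kin v u"
  by (simp add: kin_def inner_commute)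

lemma kin_add_left: "kin (u + v) w = kin u w + kin v w"
proof -
  have "kin (u + v) w = (\<integral>t. wderiv (curve u) t \<bullet> wderiv (curve w) t + wderiv (curve v) t \<bullet> wderiv (curve w) t \<partial>period_measure)"
    unfolding kin_def using wderiv_add(1)[of u v]
    by (intro integral_cong_AE borel_measurable_integrable Bochner_Integration.integrable_add kin_integrable)
      (auto simp: inner_add_left)
  then show ?thesis by (simp add: kin_def kin_integrable)
qed

lemma kin_scaleR_left: "kin (c *\<^sub>R u) w = c * kin u w"
proof -
  have "kin (c *\<^sub>R u) w = (\<integral>t. c * (wderiv (curve u) t \<bullet> wderiv (curve w) t) \<partial>period_measure)"
    unfolding kin_def using wderiv_scaleR(1)[of c u]
    by (intro integral_cong_AE borel_measurable_integrable integrable_mult_right kin_integrable) auto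
  then show ?thesis by (simp add: kin_def)
qed

text \<open>The form \<open>kin\<close> is only semidefinite, constant curves having no kinetic
  energy, so the Cauchy-Schwarz inequality needs a separate degenerate case.\<close>

lemma kin_bound: "\<bar>kin u v\<bar> \<le> norm u * norm v"
proof -
  have nn: "0 \<le> kin u u" for u by (simp add: kin_def)
  have le: "kin u u \<le> (norm u)\<^sup>2" for u
    by (simp add: kin_def norm_H2_per_sq flip: power2_norm_eq_inner)
  have cs: "(kin u v)\<^sup>2 \<le> kin u u * kin v v"
  proof (cases "kin v v = 0")
    case False
    then have p: "0 < kin v v" using nn[of v] by linarith
    define a where "a = kin u v / kin v v"
    have "0 \<le> kin (u + (- a) *\<^sub>R v) (u + (- a) *\<^sub>R v)" by (rule nn)
    also have "\<dots> = kin u u - 2 * a * kin u v + a\<^sup>2 * kin v v"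
      using kin_commute[of v u] kin_commute[of u "u + (- a) *\<^sub>R v"] kin_commute[of v "u + (- a) *\<^sub>R v"]
      by (simp only: kin_add_left kin_scaleR_left) (simp add: algebra_simps power2_eq_square)
    also have "\<dots> = kin u u - (kin u v)\<^sup>2 / kin v v"
      using p by (simp add: a_def power2_eq_square divide_simps)
    finally show ?thesis using p by (simp add: field_simps)
  next
    case True
    \<comment> \<open>For \<open>kin v v = 0\<close> the form is affine in \<open>c\<close> and
      nonnegative, hence constant; the value of \<open>c\<close> used below would make it
      -1.\<close>
    have exp: "kin (u + c *\<^sub>R v) (u + c *\<^sub>R v) = kin u u + 2 * c * kin u v" for c
      using True kin_commute[of v u] kin_commute[of u "u + c *\<^sub>R v"] kin_commute[of v "u + c *\<^sub>R v"]
      by (simp only: kin_add_left kin_scaleR_left) (simp add: algebra_simps)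
    have "kin u v = 0"
    proof (rule ccontr)
      assume ne: "kin u v \<noteq> 0"
      have "0 \<le> kin u u + 2 * (- (kin u u + 1) / (2 * kin u v)) * kin u v" using nn exp by metis
      then show False using ne by (simp add: field_simps)
    qed
    then show ?thesis using True by simp
  qed
  also have "\<dots> \<le> (norm u)\<^sup>2 * (norm v)\<^sup>2" by (intro mult_mono le nn) simp
  finally show ?thesis
    by - (rule power2_le_imp_le; simp add: power_mult_distrib)
qed

lemma bounded_bilinear_kin: "bounded_bilinear kin"
proof
  show "kin a (b + b') = kin a b + kin a b'" for a b b'
    using kin_add_left[of b b' a] by (simp add: kin_commute)
  show "kin a (r *\<^sub>R b) = r *\<^sub>R kin a b" for r a b
    using kin_scaleR_left[of r b a] by (simp add: kin_commute)
  show "\<exists>K. \<forall>a b. norm (kin a b) \<le> norm a * norm b * K"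
    by (rule exI[of _ 1]) (use kin_bound in simp)
qed (simp_all add: kin_add_left kin_scaleR_left)

lemma action_has_derivative:
  fixes U :: "real^3 \<Rightarrow> real"
  assumes U: "C1_on D U" and D: "open D" and u: "\<And>t. curve u t \<in> D"
    and A: "\<And>v. (\<And>t. curve v t \<in> D) \<Longrightarrow> A v = kin v v / 2 + (\<integral>t. U (curve v t) \<partial>period_measure)"
  shows "(A has_derivative (\<lambda>h. kin u h + (\<integral>t. fderiv U (curve u t) (curve h t) \<partial>period_measure))) (at u)"
proof -
  let ?S = "path_of -` nem_dom D"
  have "((\<lambda>v. kin v v / 2) has_derivative (\<lambda>h. kin u h)) (at u)"
    by (rule has_derivative_eq_rhs[OF bounded_linear.has_derivative[OF bounded_linear_divide
            bounded_bilinear.FDERIV[OF bounded_bilinear_kin has_derivative_ident has_derivative_ident]]])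
      (simp add: fun_eq_iff kin_commute[of _ u])
  from has_derivative_add[OF this potential_has_derivative[OF U D u]]
  have d: "((\<lambda>v. kin v v / 2 + (\<integral>t. U (curve v t) \<partial>period_measure)) has_derivative
      (\<lambda>h. kin u h + (\<integral>t. fderiv U (curve u t) (curve h t) \<partial>period_measure))) (at u)" .
  show ?thesis
  proof (rule has_derivative_transform_within_open[OF d])
    show "open ?S" by (intro open_vimage open_nem_dom D linear_continuous_on bounded_linear_path_of)
    show "u \<in> ?S" using path_of_nem_dom[OF u] by simp
    show "kin v v / 2 + (\<integral>t. U (curve v t) \<partial>period_measure) = A v" if "v \<in> ?S" for v
    proof (rule A[symmetric])
      fix t
      have "path_of v \<in> nem_dom D" using that by simp
      then obtain K where "K \<subseteq> D" "range (apply_bcontfun (path_of v)) \<subseteq> K" unfolding nem_dom_def by blast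
      then have "path_of v (per t) \<in> D" by blast
      then show "curve v t \<in> D" using periodic_per[of "curve v" t, OF curve_periodic] by (simp add: path_of_apply)
    qed
  qed
qed

lemma smooth_periodic_deriv_closed:
  assumes \<phi>: "\<phi> \<in> smooth_periodic" shows "deriv \<phi> \<in> smooth_periodic"
proof -
  have "(deriv ^^ k) (deriv \<phi>) differentiable (at t)" for k t
  proof -
    have "(deriv ^^ Suc k) \<phi> differentiable (at t)" using \<phi> unfolding smooth_periodic_def by blast
    then show ?thesis by (simp add: funpow_Suc_right del: funpow.simps)
  qed
  moreover have "deriv \<phi> (t + 2 * pi) = deriv \<phi> t" for t
  proof -
    have "(\<lambda>s. \<phi> (s + 2 * pi)) = \<phi>" using \<phi> by (simp add: smooth_periodic_def fun_eq_iff)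
    moreover have "((\<lambda>s. \<phi> (s + 2 * pi)) has_real_derivative deriv \<phi> (t + 2 * pi)) (at t)"
      using smooth_periodic_deriv[OF \<phi>, of "t + 2 * pi"] by (simp add: DERIV_shift)
    ultimately show ?thesis using smooth_periodic_deriv[OF \<phi>, of t] DERIV_unique by metis
  qed
  ultimately show ?thesis by (simp add: smooth_periodic_def)
qed

text \<open>Test functions in a fixed direction \<open>e\<close> belong to X, so the weak equation
  can be tested with them one component at a time.\<close>

lemma smooth_periodic_H2:
  assumes \<phi>: "\<phi> \<in> smooth_periodic"
  obtains h where "\<And>t. curve h t = \<phi> t *\<^sub>R e" "AE t in period_measure. wderiv (curve h) t = deriv \<phi> t *\<^sub>R e"
proof -
  have w: "weak_deriv (\<lambda>t. \<psi> t *\<^sub>R e) (\<lambda>t. deriv \<psi> t *\<^sub>R e)" if \<psi>: "\<psi> \<in> smooth_periodic" for \<psi>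
  proof (rule weak_deriv_classical)
    show "((\<lambda>t. \<psi> t *\<^sub>R e) has_vector_derivative deriv \<psi> t *\<^sub>R e) (at t within {0..2 * pi})" for t
      by (rule bounded_linear.has_vector_derivative[OF bounded_linear_scaleR_left smooth_periodic_vector_deriv[OF \<psi>]])
  qed (simp_all add: smooth_periodic_0[OF \<psi>] continuous_on_scaleR[OF smooth_periodic_cont(2)[OF \<psi>] continuous_on_const])
  let ?h = "Abs_H2_per (\<lambda>t. \<phi> t *\<^sub>R e)"
  have c: "curve ?h = (\<lambda>t. \<phi> t *\<^sub>R e)"
  proof (rule Abs_H2_per_inverse, intro CollectI conjI allI exI)
    show "\<phi> (t + 2 * pi) *\<^sub>R e = \<phi> t *\<^sub>R e" for t using \<phi> by (simp add: smooth_periodic_def)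
    show "continuous_on UNIV (\<lambda>t. \<phi> t *\<^sub>R e)"
      by (rule continuous_on_scaleR[OF smooth_periodic_cont(1)[OF \<phi>] continuous_on_const])
  qed (rule w \<phi> smooth_periodic_deriv_closed)+
  show thesis
  proof (rule that[of ?h])
    show "AE t in period_measure. wderiv (curve ?h) t = deriv \<phi> t *\<^sub>R e"
      by (rule weak_deriv_unique[OF curve_weak_deriv(1)]) (use w[OF \<phi>] c in auto)
  qed (simp add: c)
qed

text \<open>Bootstrapping: tested with \<open>\<phi> t *\<^sub>R e\<close>, the equation says that
  the weak derivative of \<open>curve u\<close> has the continuous weak derivative
  \<open>F (curve u t)\<close>. Two primitives on the whole line recover velocity and position; they
  are periodic because weak derivatives have mean zero.\<close>

lemma weak_solution_imp_classical:
  assumes F: "continuous_on D F" and u: "\<And>t. curve u t \<in> D"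
    and weak: "\<And>h. kin u h + (\<integral>t. F (curve u t) \<bullet> curve h t \<partial>period_measure) = 0"
  obtains V where "\<And>t. (curve u has_vector_derivative V t) (at t)" "\<And>t. (V has_vector_derivative F (curve u t)) (at t)"
proof -
  let ?F = "\<lambda>t. F (curve u t)"
  have Fc: "continuous_on S ?F" for S
    by (rule continuous_on_compose2[OF F curve_cont]) (use u in auto)
  have Fper: "?F (t + 2 * pi) = ?F t" for t by (simp add: curve_periodic)
  have wF: "weak_deriv (wderiv (curve u)) ?F"
    unfolding weak_deriv_def
  proof (intro conjI ballI curve_L2 L2_period_cont Fc)
    fix \<phi> assume \<phi>: "\<phi> \<in> smooth_periodic"
    let ?a = "\<integral>t. deriv \<phi> t *\<^sub>R wderiv (curve u) t \<partial>period_measure" and ?b = "\<integral>t. \<phi> t *\<^sub>R ?F t \<partial>period_measure"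
    have i: "integrable period_measure (\<lambda>t. deriv \<phi> t *\<^sub>R wderiv (curve u) t)" "integrable period_measure (\<lambda>t. \<phi> t *\<^sub>R ?F t)"
      by (intro period_integrable_scaleR L2_period_integrable curve_L2 smooth_periodic_cont \<phi> L2_period_cont Fc)+
    have "(?a + ?b) \<bullet> e = 0" for e
    proof -
      obtain h where h: "\<And>t. curve h t = \<phi> t *\<^sub>R e" "AE t in period_measure. wderiv (curve h) t = deriv \<phi> t *\<^sub>R e"
        using smooth_periodic_H2[OF \<phi>] by metis
      have "kin u h = (\<integral>t. (deriv \<phi> t *\<^sub>R wderiv (curve u) t) \<bullet> e \<partial>period_measure)"
        unfolding kin_def using h(2) i(1)
        by (intro integral_cong_AE borel_measurable_integrable kin_integrable integrable_inner_left) auto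
      also have "\<dots> = ?a \<bullet> e" using i(1) by (rule integral_inner_left)
      finally have 1: "kin u h = ?a \<bullet> e" .
      have "(\<integral>t. ?F t \<bullet> curve h t \<partial>period_measure) = (\<integral>t. (\<phi> t *\<^sub>R ?F t) \<bullet> e \<partial>period_measure)"
        by (simp add: h(1))
      also have "\<dots> = ?b \<bullet> e" using i(2) by (rule integral_inner_left)
      finally show ?thesis using weak[of h] 1 by (simp add: inner_add_left)
    qed
    from this[of "?a + ?b"] have "?a + ?b = 0" by simp
    then show "?a = - ?b" by (simp add: eq_neg_iff_add_eq_0)
  qed
  obtain c where c: "AE t in period_measure. wderiv (curve u) t = c + integral {0..t} ?F"
    using weak_deriv_AE_primitive[OF wF] .
  obtain V where V: "\<And>t. (V has_vector_derivative ?F t) (at t)" "V 0 = c"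
    using antiderivative_exists[OF Fc] by blast
  have prim: "integral {0..t} f = G t - G 0" if "\<And>t. (G has_vector_derivative f t) (at t)" "0 \<le> t" for f G :: "real \<Rightarrow> real^3" and t
    by (rule integral_unique[OF fundamental_theorem_of_calculus[OF that(2) has_vector_derivative_at_within[OF that(1)]]])
  have int0: "integral {0..2 * pi} f = 0" if "weak_deriv g f" "continuous_on {0..2 * pi} f" for f g
    using weak_deriv_integral_zero[OF that(1)] period_integral_cont[OF that(2)] by simp
  have Vper: "V (t + 2 * pi) = V t" for t
    by (rule periodic_primitive[OF V(1) Fper]) (use prim[OF V(1), of "2 * pi"] int0[OF wF Fc] in simp)
  have Vc: "continuous_on S V" for S
    by (rule continuous_on_vector_derivative[OF has_vector_derivative_at_within[OF V(1)]])
  have uV: "weak_deriv (curve u) V"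
  proof (rule weak_deriv_cong_right[OF curve_weak_deriv(1) _ L2_period_cont[OF Vc]])
    show "AE t in period_measure. wderiv (curve u) t = V t"
      by (rule AE_mp[OF c]) (use prim[OF V(1)] V(2) in \<open>auto intro!: AE_I2\<close>)
  qed
  obtain X where X: "\<And>t. (X has_vector_derivative V t) (at t)" "X 0 = curve u 0"
    using antiderivative_exists[OF Vc] by blast
  have Xper: "X (t + 2 * pi) = X t" for t
    by (rule periodic_primitive[OF X(1) Vper]) (use prim[OF X(1), of "2 * pi"] int0[OF uV Vc] in simp)
  have "curve u t = X t" for t
  proof (rule periodic_eqI[of "curve u" X, OF curve_periodic Xper])
    fix t assume t: "t \<in> {0..2 * pi}"
    then show "curve u t = X t"
      using weak_deriv_primitive[OF uV curve_cont t] prim[OF X(1), of t] X(2) by simp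
  qed
  then have "curve u = X" by auto
  then show thesis using that[of V] X(1) V(1) by simp
qed

lemma classical_imp_weak_solution:
  assumes F: "continuous_on D F" and u: "\<And>t. curve u t \<in> D"
    and V: "\<And>t. (curve u has_vector_derivative V t) (at t)" "\<And>t. (V has_vector_derivative F (curve u t)) (at t)"
  shows "kin u h + (\<integral>t. F (curve u t) \<bullet> curve h t \<partial>period_measure) = 0"
proof -
  let ?F = "\<lambda>t. F (curve u t)"
  have Fc: "continuous_on S ?F" for S
    by (rule continuous_on_compose2[OF F curve_cont]) (use u in auto)
  have Vc: "continuous_on S V" for S
    by (rule continuous_on_vector_derivative[OF has_vector_derivative_at_within[OF V(2)]])
  obtain w where w: "continuous_on {0..2 * pi} w" "AE t in period_measure. wderiv (curve h) t = w t"
    "\<And>t. t \<in> {0..2 * pi} \<Longrightarrow> (curve h has_vector_derivative w t) (at t within {0..2 * pi})"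
    using H2_per_C1[of h] by metis
  have per: "V (2 * pi) = V 0"
  proof -
    have "((\<lambda>t. curve u (t + 2 * pi)) has_vector_derivative V (0 + 2 * pi)) (at 0)"
    proof -
      have "((\<lambda>t. t + 2 * pi) has_vector_derivative 1) (at 0)" by (auto intro!: derivative_eq_intros)
      from vector_diff_chain_at[OF this V(1)] show ?thesis by (simp add: o_def)
    qed
    then have "(curve u has_vector_derivative V (2 * pi)) (at 0)" by (simp add: curve_periodic)
    then show ?thesis using V(1)[of 0] vector_derivative_unique_at by blast
  qed
  have uV: "weak_deriv (curve u) V"
    by (rule weak_deriv_classical) (auto intro: has_vector_derivative_at_within V Vc simp: curve_periodic[of u 0, simplified])
  have ae: "AE t in period_measure. wderiv (curve u) t = V t"
    by (rule weak_deriv_unique[OF curve_weak_deriv(1) uV]) simp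
  have "kin u h = (\<integral>t. V t \<bullet> w t \<partial>period_measure)"
    unfolding kin_def
  proof (rule integral_cong_AE)
    show "(\<lambda>t. V t \<bullet> w t) \<in> borel_measurable period_measure"
      by (rule period_continuous_measurable) (intro continuous_intros Vc w)
    show "AE t in period_measure. wderiv (curve u) t \<bullet> wderiv (curve h) t = V t \<bullet> w t"
      using ae w(2) by eventually_elim simp
  qed (rule borel_measurable_integrable[OF kin_integrable])
  also have "\<dots> = integral {0..2 * pi} (\<lambda>t. V t \<bullet> w t)"
    by (rule period_integral_cont) (intro continuous_intros Vc w)
  finally have 1: "kin u h = integral {0..2 * pi} (\<lambda>t. V t \<bullet> w t)" .
  have 2: "(\<integral>t. ?F t \<bullet> curve h t \<partial>period_measure) = integral {0..2 * pi} (\<lambda>t. ?F t \<bullet> curve h t)"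
    by (rule period_integral_cont) (intro continuous_intros Fc)
  have "((\<lambda>t. V t \<bullet> w t + ?F t \<bullet> curve h t) has_integral (V (2 * pi) \<bullet> curve h (2 * pi) - V 0 \<bullet> curve h 0)) {0..2 * pi}"
  proof (rule fundamental_theorem_of_calculus)
    fix t assume t: "t \<in> {0..2 * pi}"
    show "((\<lambda>t. V t \<bullet> curve h t) has_vector_derivative V t \<bullet> w t + ?F t \<bullet> curve h t) (at t within {0..2 * pi})"
      using bounded_bilinear.has_vector_derivative[OF bounded_bilinear_inner has_vector_derivative_at_within[OF V(2)] w(3)[OF t]] .
  qed simp
  then have "integral {0..2 * pi} (\<lambda>t. V t \<bullet> w t + ?F t \<bullet> curve h t) = 0"
    using per curve_periodic[of h 0] by (simp add: has_integral_iff)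
  moreover have "integral {0..2 * pi} (\<lambda>t. V t \<bullet> w t + ?F t \<bullet> curve h t)
      = integral {0..2 * pi} (\<lambda>t. V t \<bullet> w t) + integral {0..2 * pi} (\<lambda>t. ?F t \<bullet> curve h t)"
    by (intro integral_add integrable_continuous_real continuous_intros Vc w Fc)
  ultimately show ?thesis by (simp add: 1 2)
qed

section \<open>The symmetry groups\<close>

text \<open>All that the proof takes from the three groups at this point. The last clause balances
  the forces on the central body; finiteness is obtained separately, in
  \<open>nondegenerate_finite\<close>.\<close>

definition rotation_group :: "(real^3^3) set \<Rightarrow> bool" where
  "rotation_group H \<longleftrightarrow> mat 1 \<in> H \<and> (\<forall>L\<in>H. orthogonal_matrix L) \<and> (\<forall>L\<in>H. \<forall>M\<in>H. L ** M \<in> H)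
     \<and> (\<forall>L\<in>H. transpose L \<in> H) \<and> (\<forall>x. (\<forall>L\<in>H. L *v x = x) \<longrightarrow> x = 0)"

lemma group_SO3: "group SO3"
proof (rule groupI)
  fix x y z assume "x \<in> carrier SO3" "y \<in> carrier SO3" "z \<in> carrier SO3"
  then show "x \<otimes>\<^bsub>SO3\<^esub> y \<in> carrier SO3" "x \<otimes>\<^bsub>SO3\<^esub> y \<otimes>\<^bsub>SO3\<^esub> z = x \<otimes>\<^bsub>SO3\<^esub> (y \<otimes>\<^bsub>SO3\<^esub> z)" "\<one>\<^bsub>SO3\<^esub> \<otimes>\<^bsub>SO3\<^esub> x = x"
    by (auto simp: SO3_def rotation_matrix_def orthogonal_matrix_mul det_mul matrix_mul_assoc)
  show "\<exists>y\<in>carrier SO3. y \<otimes>\<^bsub>SO3\<^esub> x = \<one>\<^bsub>SO3\<^esub>"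
    using \<open>x \<in> carrier SO3\<close>
    by (intro bexI[of _ "transpose x"]) (auto simp: SO3_def rotation_matrix_def orthogonal_matrix_transpose orthogonal_matrix_def)
qed (auto simp: SO3_def rotation_matrix_def orthogonal_matrix_id)

lemma inv_SO3: "rotation_matrix x \<Longrightarrow> inv\<^bsub>SO3\<^esub> x = transpose x"
  by (rule group.inv_equality[OF group_SO3])
    (auto simp: SO3_def rotation_matrix_def orthogonal_matrix_transpose orthogonal_matrix_def)

lemma generate_rotation_group:
  assumes AB: "rotation_matrix A" "rotation_matrix B"
    and fix0: "\<And>x. A *v x = x \<Longrightarrow> B *v x = x \<Longrightarrow> x = 0"
  shows "rotation_group (generate SO3 {A, B})"
proof -
  let ?S = "{A, B}"
  have S: "L \<in> ?S \<Longrightarrow> rotation_matrix L" for L using AB by auto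
  have "rotation_matrix L \<and> transpose L \<in> generate SO3 ?S" if "L \<in> generate SO3 ?S" for L
    using that
  proof (induction rule: generate.induct)
    case one
    then show ?case using generate.one[of SO3 ?S] by (simp add: SO3_def rotation_matrix_def orthogonal_matrix_id transpose_mat)
  next
    case (incl h)
    then show ?case using generate.inv[OF incl, of SO3] S by (simp add: inv_SO3)
  next
    case (inv h)
    then show ?case using generate.incl[OF inv, of SO3] S
      by (simp add: inv_SO3 rotation_matrix_def orthogonal_matrix_transpose)
  next
    case (eng h1 h2)
    then have "transpose h2 ** transpose h1 \<in> generate SO3 ?S"
      using generate.eng[of "transpose h2" SO3 ?S "transpose h1"] by (simp add: SO3_def)
    then show ?case using eng by (simp add: SO3_def matrix_transpose_mul rotation_matrix_def orthogonal_matrix_mul det_mul)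
  qed
  moreover have "mat 1 \<in> generate SO3 ?S" using generate.one[of SO3 ?S] by (simp add: SO3_def)
  moreover have "L ** M \<in> generate SO3 ?S" if "L \<in> generate SO3 ?S" "M \<in> generate SO3 ?S" for L M
    using generate.eng[OF that] by (simp add: SO3_def)
  moreover have "x = 0" if "\<forall>L\<in>generate SO3 ?S. L *v x = x" for x
    by (rule fix0) (use that generate.incl[of _ ?S SO3] in auto)
  ultimately show ?thesis unfolding rotation_group_def rotation_matrix_def by blast
qed

lemma golden_sq: "golden * golden = golden + 1"
  by (simp add: golden_def field_simps)

lemmas matrix3_simps = vec_eq_iff forall_3 matrix_matrix_mult_def matrix_vector_mult_def sum_3 vector_3
  transpose_def mat_def det_3 axis_def

lemma rotation_group_cases:
  assumes "H \<in> {tetrahedral, octahedral, icosahedral}" shows "rotation_group H"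
proof -
  have "rotation_group tetrahedral" unfolding tetrahedral_def
    by (rule generate_rotation_group)
      (auto simp: rotation_matrix_def orthogonal_matrix matrix3_simps)
  moreover have "rotation_group octahedral" unfolding octahedral_def
  proof (rule generate_rotation_group)
    let ?A = "vector [vector [0, - 1, 0], vector [1, 0, 0], vector [0, 0, 1]] :: real^3^3"
    let ?B = "vector [vector [- 1, 0, 0], vector [0, 0, 1], vector [0, 1, 0]] :: real^3^3"
    show "rotation_matrix ?A" "rotation_matrix ?B"
      by (auto simp: rotation_matrix_def orthogonal_matrix matrix3_simps)
    fix x assume A: "?A *v x = x" and B: "?B *v x = x"
    have "- x $ 2 = x $ 1" using arg_cong[OF A, of "\<lambda>v. v $ 1"] by (simp add: matrix_vector_mult_def sum_3 vector_3)
    moreover have "x $ 3 = x $ 2" using arg_cong[OF B, of "\<lambda>v. v $ 2"] by (simp add: matrix_vector_mult_def sum_3 vector_3)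
    moreover have "- x $ 1 = x $ 1" using arg_cong[OF B, of "\<lambda>v. v $ 1"] by (simp add: matrix_vector_mult_def sum_3 vector_3)
    ultimately show "x = 0" by (simp add: vec_eq_iff forall_3)
  qed
  moreover have "rotation_group icosahedral" unfolding icosahedral_def
  proof (rule generate_rotation_group)
    have g3: "golden * (golden * x) = golden * x + x" for x
      using golden_sq by (metis distrib_right mult.assoc mult_1)
    let ?A = "(1 / 2) *\<^sub>R vector [vector [golden - 1, golden, 1], vector [golden, - 1, golden - 1], vector [1, golden - 1, - golden]] :: real^3^3"
    let ?B = "vector [vector [0, 0, 1], vector [1, 0, 0], vector [0, 1, 0]] :: real^3^3"
    have "transpose ?A ** ?A = mat 1" "det ?A = 1"
      by (simp_all add: matrix3_simps) (simp_all add: algebra_simps golden_sq g3 add_divide_distrib diff_divide_distrib)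
    then show "rotation_matrix ?A" by (simp add: rotation_matrix_def orthogonal_matrix)
    show "rotation_matrix ?B"
      by (auto simp: rotation_matrix_def orthogonal_matrix matrix3_simps)
    fix x assume A: "?A *v x = x" and B: "?B *v x = x"
    have "x $ 3 = x $ 1" using arg_cong[OF B, of "\<lambda>v. v $ 1"] by (simp add: matrix_vector_mult_def sum_3 vector_3)
    moreover have "x $ 1 = x $ 2" using arg_cong[OF B, of "\<lambda>v. v $ 2"] by (simp add: matrix_vector_mult_def sum_3 vector_3)
    ultimately have e: "x $ 2 = x $ 1" "x $ 3 = x $ 1" by simp_all
    \<comment> \<open>\<open>?B\<close> forces \<open>x\<close> to be a multiple of
      \<open>(1, 1, 1)\<close>, and the entries in the third row of \<open>?A\<close> sum to
      0.\<close>
    have "x $ 1 / 2 + (golden - 1) / 2 * x $ 2 - golden / 2 * x $ 3 = x $ 3"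
      using arg_cong[OF A, of "\<lambda>v. v $ 3"] by (simp add: matrix_vector_mult_def sum_3 vector_3)
    then have "x $ 1 = 0" unfolding e by (simp add: field_simps)
    then show "x = 0" by (simp add: vec_eq_iff forall_3 e)
  qed
  ultimately show ?thesis using assms by blast
qed

lemma inner_matrix_left: "(L *v x) \<bullet> y = x \<bullet> (transpose L *v y)" for x y :: "real^3"
  by (metis dot_lmul_matrix inner_commute transpose_matrix_vector transpose_transpose)

lemma orthogonal_matrix_cancel: "orthogonal_matrix L \<Longrightarrow> transpose L *v (L *v x) = (x :: real^3)"
  by (simp add: matrix_vector_mul_assoc orthogonal_matrix)

lemma orthogonal_matrix_norm: "orthogonal_matrix L \<Longrightarrow> norm (L *v x) = norm (x :: real^3)"
  unfolding norm_eq_sqrt_inner inner_matrix_left by (simp only: orthogonal_matrix_cancel)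

lemma matrix_diff_right: "L *v (x - y) = L *v x - L *v (y :: real^3)"
  by (simp add: matrix_vector_mult_diff_distrib)

text \<open>Left multiplication by an element of \<open>H\<close> permutes the summands, so the sum
  is a common fixed vector.\<close>

lemma rotation_group_sum:
  assumes H: "rotation_group H" shows "(\<Sum>L\<in>H. L *v x) = 0"
proof -
  have "M *v (\<Sum>L\<in>H. L *v x) = (\<Sum>L\<in>H. L *v x)" if M: "M \<in> H" for M
  proof -
    have o: "transpose M ** M = mat 1" "M ** transpose M = mat 1"
      using H M by (auto simp: rotation_group_def orthogonal_matrix_def)
    have "M *v (\<Sum>L\<in>H. L *v x) = (\<Sum>L\<in>H. (M ** L) *v x)"
      by (simp add: linear_sum[OF matrix_vector_mul_linear] matrix_vector_mul_assoc)
    also have "\<dots> = (\<Sum>L\<in>H. L *v x)"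
      by (rule sum.reindex_bij_witness[of _ "\<lambda>L. transpose M ** L" "\<lambda>L. M ** L"])
        (use H M in \<open>auto simp: rotation_group_def matrix_mul_assoc o\<close>)
    finally show ?thesis .
  qed
  then show ?thesis using H by (simp add: rotation_group_def)
qed

section \<open>The forces\<close>

definition fK :: "real^3 \<Rightarrow> real^3" where
  "fK x = (1 / norm x) ^ 3 *\<^sub>R x"

definition gH :: "(real^3^3) set \<Rightarrow> real^3 \<Rightarrow> real^3" where
  "gH H x = (\<Sum>L\<in>H - {mat 1}. fK (x - L *v x))"

definition WH :: "(real^3^3) set \<Rightarrow> real^3 \<Rightarrow> real" where
  "WH H x = (1 / 2) * (\<Sum>L\<in>H - {mat 1}. 1 / norm (x - L *v x))"

definition Dom :: "(real^3^3) set \<Rightarrow> (real^3) set" where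
  "Dom H = {x. x \<noteq> 0 \<and> (\<forall>L\<in>H - {mat 1}. x \<noteq> L *v x)}"

text \<open>The derivative of \<open>fK\<close> at \<open>u\<close>; the Jacobi equation along
  \<open>u\<close> is \<open>k'' = - Kf u k\<close>.\<close>

definition Kf :: "real^3 \<Rightarrow> real^3 \<Rightarrow> real^3" where
  "Kf u v = (1 / norm u) ^ 3 *\<^sub>R v - (3 * (u \<bullet> v) * (1 / norm u) ^ 5) *\<^sub>R u"

lemma Dom_nonzero: "x \<in> Dom H \<Longrightarrow> x \<noteq> 0" "x \<in> Dom H \<Longrightarrow> L \<in> H \<Longrightarrow> L \<noteq> mat 1 \<Longrightarrow> x - L *v x \<noteq> 0"
  by (auto simp: Dom_def)

lemma open_Dom: assumes "finite H" shows "open (Dom H)"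
proof -
  have "Dom H = - {0} \<inter> (\<Inter>L\<in>H - {mat 1}. {x. x \<noteq> L *v x})" by (auto simp: Dom_def)
  moreover have "open {x. x \<noteq> L *v x}" for L :: "real^3^3"
    by (rule open_Collect_neq) (auto intro!: continuous_intros matrix_vector_mult_linear_continuous_on)
  ultimately show ?thesis using assms by (auto intro!: open_Int open_INT)
qed

lemma inverse_norm_has_derivative:
  fixes y :: "'a::real_inner"
  assumes "y \<noteq> 0"
  shows "((\<lambda>x. 1 / norm x) has_derivative (\<lambda>k. - (y \<bullet> k) * (1 / norm y) ^ 3)) (at y)"
proof -
  have "((\<lambda>x. inverse (norm x)) has_derivative (\<lambda>k. - (inverse (norm y) * (sgn y \<bullet> k) * inverse (norm y)))) (at y)"
    using Deriv.has_derivative_inverse[OF _ has_derivative_norm[OF assms]] assms by (simp add: inner_commute)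
  then show ?thesis
    by (rule has_derivative_transform[THEN has_derivative_eq_rhs, rotated 2])
      (auto simp: fun_eq_iff sgn_div_norm divide_simps power3_eq_cube)
qed

lemma fK_has_derivative:
  assumes "y \<noteq> 0" shows "(fK has_derivative Kf y) (at y)"
proof -
  have "((\<lambda>x. (1 / norm x) ^ 3 *\<^sub>R x) has_derivative
      (\<lambda>k. (1 / norm y) ^ 3 *\<^sub>R k + (3 * (- (y \<bullet> k) * (1 / norm y) ^ 3) * (1 / norm y) ^ (3 - 1)) *\<^sub>R y)) (at y)"
    using has_derivative_scaleR[OF has_derivative_power[OF inverse_norm_has_derivative[OF assms], of 3] has_derivative_ident]
    by (simp add: mult_ac)
  then show ?thesis unfolding fK_def[abs_def] Kf_def[abs_def]
    by (rule has_derivative_eq_rhs) (simp add: fun_eq_iff power_numeral_reduce mult_ac)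
qed

lemma bounded_linear_Kf: "bounded_linear (Kf u)"
  unfolding Kf_def
  by (intro bounded_linear_sub bounded_linear_scaleR_right bounded_linear_ident
      bounded_linear_compose[OF bounded_linear_scaleR_left] bounded_linear_mult_const bounded_linear_const_mult bounded_linear_inner_right)

lemma Kf_sym: "Kf u v \<bullet> w = v \<bullet> Kf u w"
  by (simp add: Kf_def inner_diff_left inner_diff_right inner_commute)

text \<open>Euler's relation for a field homogeneous of degree -2. It makes the scaling variation a
  solution of the Jacobi equation.\<close>

lemma Kf_self: "u \<noteq> 0 \<Longrightarrow> Kf u u = - 2 *\<^sub>R fK u"
  by (simp add: Kf_def fK_def dot_square_norm power_numeral_reduce divide_simps flip: scaleR_diff_left)

lemma C1_fK: "C1_on S h \<Longrightarrow> (\<And>x. x \<in> S \<Longrightarrow> h x \<noteq> 0) \<Longrightarrow> C1_on S (\<lambda>x. fK (h x))"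
  unfolding fK_def by (intro C1_intros) auto

lemma C1_gH:
  assumes "C1_on S h" "\<And>x. x \<in> S \<Longrightarrow> h x \<in> Dom H" shows "C1_on S (\<lambda>x. gH H (h x))"
  unfolding gH_def by (intro C1_intros C1_fK assms(1)) (use Dom_nonzero[OF assms(2)] in auto)

lemma C1_WH: "C1_on (Dom H) (WH H)"
  unfolding WH_def by (intro C1_intros) (auto simp: Dom_def)

text \<open>Since orthogonal maps preserve norms, the \<open>L *v k\<close> part of the term of
  \<open>L\<close> is minus the \<open>k\<close> part of the term of \<open>transpose L\<close>.
  Both occurrences of \<open>x\<close> therefore contribute equally, which cancels the factor
  1/2.\<close>

lemma WH_has_derivative:
  assumes H: "rotation_group H" and x: "x \<in> Dom H"
  shows "(WH H has_derivative (\<lambda>k. - (gH H x \<bullet> k))) (at x)"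
proof -
  let ?S = "H - {mat 1}"
  have "((\<lambda>x. 1 / norm (x - L *v x)) has_derivative (\<lambda>k. - ((x - L *v x) \<bullet> (k - L *v k)) * (1 / norm (x - L *v x)) ^ 3)) (at x)"
    if "L \<in> ?S" for L
    by (rule has_derivative_compose[OF has_derivative_diff[OF has_derivative_ident
          bounded_linear_imp_has_derivative[OF matrix_vector_mul_bounded_linear]] inverse_norm_has_derivative])
      (use x that in \<open>auto simp: Dom_def\<close>)
  then have "((\<lambda>x. (1 / 2) * (\<Sum>L\<in>?S. 1 / norm (x - L *v x))) has_derivative
      (\<lambda>k. (1 / 2) * (\<Sum>L\<in>?S. - ((x - L *v x) \<bullet> (k - L *v k)) * (1 / norm (x - L *v x)) ^ 3))) (at x)"
    by (intro has_derivative_mult_right has_derivative_sum)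
  then show ?thesis
    unfolding WH_def[abs_def]
  proof (rule has_derivative_eq_rhs, intro ext)
    fix k
    let ?t = "\<lambda>L y. (x - L *v x) \<bullet> y * (1 / norm (x - L *v x)) ^ 3"
    have "(\<Sum>L\<in>?S. ?t L (L *v k)) = (\<Sum>L\<in>?S. - ?t L k)"
    proof (rule sum.reindex_bij_witness[of _ transpose transpose])
      show tS: "transpose L \<in> ?S" if "L \<in> ?S" for L
        using that H unfolding rotation_group_def by (metis Diff_iff singleton_iff transpose_mat transpose_transpose)
      then show "transpose L \<in> ?S" if "L \<in> ?S" for L using that .
      fix L assume L: "L \<in> ?S"
      then have o: "orthogonal_matrix L" "transpose L \<in> H" using H by (auto simp: rotation_group_def)
      have d: "transpose L *v (x - L *v x) = - (x - transpose L *v x)"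
        unfolding matrix_diff_right orthogonal_matrix_cancel[OF o(1)] by simp
      have "norm (x - L *v x) = norm (transpose L *v (x - L *v x))"
        by (simp only: orthogonal_matrix_norm orthogonal_matrix_transpose o)
      then have n: "norm (x - transpose L *v x) = norm (x - L *v x)" unfolding d by (simp only: norm_minus_cancel)
      have "(L *v k) \<bullet> (x - L *v x) = k \<bullet> (- (x - transpose L *v x))"
        by (simp only: inner_matrix_left d)
      then have "(x - L *v x) \<bullet> (L *v k) = - ((x - transpose L *v x) \<bullet> k)"
        by (simp only: inner_commute[of "x - L *v x"] inner_commute[of _ k] inner_minus_right)
      then show "- ?t (transpose L) k = ?t L (L *v k)" by (simp only: n mult_minus_left)
    qed (auto simp: transpose_transpose)
    then have "(1 / 2) * (\<Sum>L\<in>?S. - (?t L k - ?t L (L *v k))) = - (\<Sum>L\<in>?S. ?t L k)"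
      by (simp add: sum_negf sum_subtractf)
    moreover have "gH H x \<bullet> k = (\<Sum>L\<in>?S. ?t L k)"
      by (simp add: gH_def fK_def inner_sum_left mult.commute)
    moreover have "(\<Sum>L\<in>?S. - ((x - L *v x) \<bullet> (k - L *v k)) * (1 / norm (x - L *v x)) ^ 3)
        = (\<Sum>L\<in>?S. - (?t L k - ?t L (L *v k)))"
      by (intro sum.cong refl) (simp add: inner_diff_right algebra_simps)
    ultimately show "(1 / 2) * (\<Sum>L\<in>?S. - ((x - L *v x) \<bullet> (k - L *v k)) * (1 / norm (x - L *v x)) ^ 3) = - (gH H x \<bullet> k)"
      by simp
  qed
qed

lemma fderiv_WH:
  "rotation_group H \<Longrightarrow> x \<in> Dom H \<Longrightarrow> fderiv (WH H) x k = - (gH H x \<bullet> k)"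
  using has_derivative_unique[OF C1_on_has_derivative[OF C1_WH] WH_has_derivative] by metis

definition potential :: "(real^3^3) set \<Rightarrow> real \<Rightarrow> real^3 \<Rightarrow> real" where
  "potential H \<epsilon> x = 1 / norm x + \<epsilon> * WH H x"

definition force :: "(real^3^3) set \<Rightarrow> real \<Rightarrow> real^3 \<Rightarrow> real^3" where
  "force H \<epsilon> x = - (fK x + \<epsilon> *\<^sub>R gH H x)"

lemma C1_potential: "C1_on (Dom H) (potential H \<epsilon>)"
  unfolding potential_def by (intro C1_intros C1_WH) (auto simp: Dom_def)

lemma C1_force: "C1_on (Dom H) (force H \<epsilon>)"
  unfolding force_def by (intro C1_intros C1_fK C1_gH) (auto simp: Dom_def)

lemma potential_has_derivative_force:
  assumes "rotation_group H" "x \<in> Dom H"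
  shows "(potential H \<epsilon> has_derivative (\<lambda>k. force H \<epsilon> x \<bullet> k)) (at x)"
proof -
  have "x \<noteq> 0" using assms(2) by (auto simp: Dom_def)
  from has_derivative_add[OF inverse_norm_has_derivative[OF this] has_derivative_mult_right[OF WH_has_derivative[OF assms], of \<epsilon>]]
  show ?thesis unfolding potential_def[abs_def]
    by (rule has_derivative_eq_rhs) (simp add: fun_eq_iff force_def fK_def inner_add_left inner_diff_left mult.commute)
qed

lemma collision_free_Dom: "collision_free H u \<longleftrightarrow> (\<forall>t. curve u t \<in> Dom H)"
  by (auto simp: collision_free_def Dom_def)

lemma action_eq:
  assumes u: "\<And>t. curve u t \<in> Dom H"
  shows "action H \<epsilon> u = kin u u / 2 + (\<integral>t. potential H \<epsilon> (curve u t) \<partial>period_measure)"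
proof -
  have c: "continuous_on {0..2 * pi} (\<lambda>t. h (curve u t))" if "continuous_on (Dom H) h" for h :: "real^3 \<Rightarrow> real"
    by (rule continuous_on_compose2[OF that curve_cont]) (use u in auto)
  have i: "integrable period_measure (\<lambda>t. 1 / norm (curve u t))" "integrable period_measure (\<lambda>t. WH H (curve u t))"
    by (intro period_integrable_cont c C1_on_imp_continuous_on C1_intros C1_WH; simp add: Dom_def)+
  have k: "integrable period_measure (\<lambda>t. (norm (wderiv (curve u) t))\<^sup>2 / 2)"
    using kin_integrable[of u u] by (simp add: power2_norm_eq_inner)
  have "action0 (curve u) = kin u u / 2 + (\<integral>t. 1 / norm (curve u t) \<partial>period_measure)"
    unfolding action0_def using i k by (simp add: kin_def power2_norm_eq_inner)
  moreover have "action1 H (curve u) = (\<integral>t. WH H (curve u t) \<partial>period_measure)"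
    by (simp add: action1_def WH_def)
  ultimately show ?thesis using i by (simp add: action_def potential_def)
qed

text \<open>From here on critical points are handled as classical periodic solutions; the weak
  formulation and its regularity theory enter only through this equivalence.\<close>

lemma critical_point_iff:
  assumes H: "rotation_group H" "finite H"
  shows "critical_point H \<epsilon> u \<longleftrightarrow> (\<forall>t. curve u t \<in> Dom H) \<and>
    (\<exists>V. \<forall>t. (curve u has_vector_derivative V t) (at t) \<and> (V has_vector_derivative force H \<epsilon> (curve u t)) (at t))"
proof (cases "\<forall>t. curve u t \<in> Dom H")
  case True
  then have u: "curve u t \<in> Dom H" for t by blast
  have fd: "fderiv (potential H \<epsilon>) x k = force H \<epsilon> x \<bullet> k" if "x \<in> Dom H" for x k
    using has_derivative_unique[OF C1_on_has_derivative[OF C1_potential that] potential_has_derivative_force[OF H(1) that]] by metis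
  have d: "(action H \<epsilon> has_derivative (\<lambda>h. kin u h + (\<integral>t. force H \<epsilon> (curve u t) \<bullet> curve h t \<partial>period_measure))) (at u)"
    using action_has_derivative[OF C1_potential open_Dom[OF H(2)] u, of "action H \<epsilon>" \<epsilon>] action_eq
    by (simp add: fd[OF u])
  have Fc: "continuous_on (Dom H) (force H \<epsilon>)" by (rule C1_on_imp_continuous_on[OF C1_force])
  have "(action H \<epsilon> has_derivative (\<lambda>_. 0)) (at u) \<longleftrightarrow>
    (\<exists>V. \<forall>t. (curve u has_vector_derivative V t) (at t) \<and> (V has_vector_derivative force H \<epsilon> (curve u t)) (at t))"
  proof
    assume "(action H \<epsilon> has_derivative (\<lambda>_. 0)) (at u)"
    from has_derivative_unique[OF d this]
    have "kin u h + (\<integral>t. force H \<epsilon> (curve u t) \<bullet> curve h t \<partial>period_measure) = 0" for h by metis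
    from weak_solution_imp_classical[OF Fc u this]
    show "\<exists>V. \<forall>t. (curve u has_vector_derivative V t) (at t) \<and> (V has_vector_derivative force H \<epsilon> (curve u t)) (at t)"
      by metis
  next
    assume "\<exists>V. \<forall>t. (curve u has_vector_derivative V t) (at t) \<and> (V has_vector_derivative force H \<epsilon> (curve u t)) (at t)"
    then obtain V where "\<And>t. (curve u has_vector_derivative V t) (at t)" "\<And>t. (V has_vector_derivative force H \<epsilon> (curve u t)) (at t)"
      by metis
    from classical_imp_weak_solution[OF Fc u this] d
    show "(action H \<epsilon> has_derivative (\<lambda>_. 0)) (at u)" by simp
  qed
  then show ?thesis using True by (simp add: critical_point_def collision_free_Dom)
next
  case False
  then show ?thesis unfolding critical_point_def collision_free_Dom by blast
qed

text \<open>Membership in X comes from \<open>Pop\<close>, fed with the force along the curve as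
  second derivative. Time translates of a critical point are treated this way.\<close>

lemma critical_pointI:
  assumes H: "rotation_group H" "finite H" and per: "\<And>t. x (t + 2 * pi) = x t" and D: "\<And>t. x t \<in> Dom H"
    and x: "\<And>t. (x has_vector_derivative V t) (at t)" "\<And>t. (V has_vector_derivative force H \<epsilon> (x t)) (at t)"
  obtains w where "curve w = x" "critical_point H \<epsilon> w"
proof -
  have xc: "continuous_on S x" for S
    by (rule continuous_on_vector_derivative[OF has_vector_derivative_at_within[OF x(1)]])
  have Fc: "continuous_on S (\<lambda>t. force H \<epsilon> (x t))" for S
    by (rule continuous_on_compose2[OF C1_on_imp_continuous_on[OF C1_force] xc]) (use D in auto)
  have V0: "V (2 * pi) = V 0"
  proof -
    have "((\<lambda>t. t + 2 * pi) has_vector_derivative 1) (at 0)" by (auto intro!: derivative_eq_intros)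
    from vector_diff_chain_at[OF this x(1)] have "(x has_vector_derivative V (2 * pi)) (at 0)" by (simp add: o_def per)
    then show ?thesis using x(1)[of 0] vector_derivative_unique_at by blast
  qed
  let ?h = "clampf (\<lambda>t. force H \<epsilon> (x t))"
  have "curve (Pop (x 0) ?h) = x"
    by (rule curve_Pop_eq[OF per has_vector_derivative_at_within[OF x(1)] _ V0])
      (simp add: clampf_apply[OF Fc] has_vector_derivative_at_within[OF x(2)])
  moreover from this have "critical_point H \<epsilon> (Pop (x 0) ?h)"
    unfolding critical_point_iff[OF H] using D x by auto
  ultimately show thesis by (rule that)
qed

text \<open>\<open>Qf u v \<epsilon>\<close> is the difference quotient \<open>(fK (u + \<epsilon> v) - fK u) / \<epsilon>\<close>, written so that it is
  visibly smooth across \<open>\<epsilon> = 0\<close>.\<close>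

definition Qf :: "real^3 \<Rightarrow> real^3 \<Rightarrow> real \<Rightarrow> real^3" where
  "Qf u v \<epsilon> = (let a = norm (u + \<epsilon> *\<^sub>R v); b = norm u in
     (1 / a) ^ 3 *\<^sub>R v
     - ((2 * (u \<bullet> v) + \<epsilon> * (v \<bullet> v)) * (a\<^sup>2 + a * b + b\<^sup>2) / ((a + b) * a ^ 3 * b ^ 3)) *\<^sub>R u)"

text \<open>The factor \<open>\<epsilon>\<close> sits in
  \<open>a\<^sup>2 - b\<^sup>2 = \<epsilon> (2 u.v + \<epsilon> v.v)\<close>. Division by
  \<open>a + b\<close> gives \<open>a - b\<close>, and multiplication by
  \<open>a\<^sup>2 + a b + b\<^sup>2\<close> then gives the difference of cubes needed for the
  inverse cubes of the norms.\<close>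

lemma Qf_mult:
  assumes "u \<noteq> 0" "u + \<epsilon> *\<^sub>R v \<noteq> 0"
  shows "\<epsilon> *\<^sub>R Qf u v \<epsilon> = fK (u + \<epsilon> *\<^sub>R v) - fK u"
proof -
  define a b where ab: "a = norm (u + \<epsilon> *\<^sub>R v)" "b = norm u"
  have "0 < a" "0 < b" using assms by (auto simp: ab)
  then have pos: "a \<noteq> 0" "b \<noteq> 0" "a + b \<noteq> 0" by linarith+
  have sq: "\<epsilon> * (2 * (u \<bullet> v) + \<epsilon> * (v \<bullet> v)) = a\<^sup>2 - b\<^sup>2"
    unfolding ab power2_norm_eq_inner by (simp add: inner_add_left inner_add_right inner_commute algebra_simps)
  define k where "k = (2 * (u \<bullet> v) + \<epsilon> * (v \<bullet> v)) * (a\<^sup>2 + a * b + b\<^sup>2) / ((a + b) * a ^ 3 * b ^ 3)"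
  have "\<epsilon> * k = (\<epsilon> * (2 * (u \<bullet> v) + \<epsilon> * (v \<bullet> v))) * (a\<^sup>2 + a * b + b\<^sup>2) / ((a + b) * a ^ 3 * b ^ 3)"
    by (simp add: k_def)
  also have "\<dots> = (a\<^sup>2 - b\<^sup>2) * (a\<^sup>2 + a * b + b\<^sup>2) / ((a + b) * a ^ 3 * b ^ 3)" by (simp only: sq)
  also have "(a\<^sup>2 - b\<^sup>2) * (a\<^sup>2 + a * b + b\<^sup>2) = (a + b) * (a ^ 3 - b ^ 3)"
    by (simp add: power2_eq_square power3_eq_cube algebra_simps)
  also have "(a + b) * (a ^ 3 - b ^ 3) / ((a + b) * a ^ 3 * b ^ 3) = (1 / b) ^ 3 - (1 / a) ^ 3"
    using pos by (simp add: divide_simps)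
  finally have k: "\<epsilon> * k = (1 / b) ^ 3 - (1 / a) ^ 3" .
  have "\<epsilon> *\<^sub>R Qf u v \<epsilon> = (\<epsilon> * (1 / a) ^ 3) *\<^sub>R v - (\<epsilon> * k) *\<^sub>R u"
    by (simp add: Qf_def Let_def scaleR_diff_right k_def flip: ab)
  also have "\<dots> = fK (u + \<epsilon> *\<^sub>R v) - fK u"
    unfolding k fK_def ab[symmetric] by (simp add: scaleR_add_right scaleR_diff_left mult.commute)
  finally show ?thesis .
qed

text \<open>So at parameter 0 the blown-up equation is the linear Jacobi equation along the ellipse,
  forced by \<open>gH\<close>.\<close>

lemma Qf_0:
  assumes "u \<noteq> 0" shows "Qf u v 0 = Kf u v"
proof -
  have "(2 * c) * (b\<^sup>2 + b * b + b\<^sup>2) / ((b + b) * b ^ 3 * b ^ 3) = 3 * c * (1 / b) ^ 5" if "b \<noteq> 0" for b c :: real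
    using that by (simp add: field_simps power2_eq_square power3_eq_cube power_numeral_reduce)
  then show ?thesis using assms by (simp add: Qf_def Kf_def Let_def)
qed

lemma C1_Qf:
  assumes "C1_on S u" "C1_on S v" "C1_on S e" "\<And>x. x \<in> S \<Longrightarrow> u x \<noteq> 0" "\<And>x. x \<in> S \<Longrightarrow> u x + e x *\<^sub>R v x \<noteq> 0"
  shows "C1_on S (\<lambda>x. Qf (u x) (v x) (e x))"
  unfolding Qf_def Let_def
  by (intro C1_intros assms) (use assms(4,5) in \<open>auto simp: add_nonneg_eq_0_iff\<close>)

section \<open>Kepler ellipses\<close>

text \<open>\<open>D\<close> is the projection onto the plane of rotation, on which \<open>J\<close>
  is a quarter turn. Even and odd powers of \<open>J\<close> reproduce the cosine and sine series
  there; off the plane only the term \<open>k = 0\<close> contributes.\<close>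

lemma matrix_exp_rotation:
  assumes "J ** D = J" "J ** J = - D"
  shows "matrix_exp (\<theta> *\<^sub>R J) = cos \<theta> *\<^sub>R D + sin \<theta> *\<^sub>R J + (mat 1 - D)"
proof -
  have pw: "(1 / fact k) *\<^sub>R (((**) (\<theta> *\<^sub>R J)) ^^ k) (mat 1)
      = (cos_coeff k *\<^sub>R \<theta> ^ k) *\<^sub>R D + (sin_coeff k *\<^sub>R \<theta> ^ k) *\<^sub>R J + (if k = 0 then mat 1 - D else 0)" for k
  proof (induction k)
    case (Suc k)
    have z: "J ** (mat 1 - D) = 0" using matrix_add_ldistrib[of J "mat 1 - D" D] by (simp add: assms)
    have "(1 / fact (Suc k)) *\<^sub>R (((**) (\<theta> *\<^sub>R J)) ^^ Suc k) (mat 1)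
        = (\<theta> / real (Suc k)) *\<^sub>R (J ** ((1 / fact k) *\<^sub>R (((**) (\<theta> *\<^sub>R J)) ^^ k) (mat 1)))"
      by (simp add: matrix_scalar_ac scalar_matrix_assoc[symmetric] del: of_nat_Suc)
    also have "\<dots> = (\<theta> / real (Suc k)) *\<^sub>R ((cos_coeff k * \<theta> ^ k) *\<^sub>R J - (sin_coeff k * \<theta> ^ k) *\<^sub>R D)"
      unfolding Suc.IH
      by (simp add: matrix_add_ldistrib matrix_scalar_ac scalar_matrix_assoc[symmetric] assms z if_distrib del: of_nat_Suc)
    also have "\<dots> = (cos_coeff (Suc k) *\<^sub>R \<theta> ^ Suc k) *\<^sub>R D + (sin_coeff (Suc k) *\<^sub>R \<theta> ^ Suc k) *\<^sub>R J"
      by (simp add: cos_coeff_Suc sin_coeff_Suc scaleR_diff_right mult_ac del: of_nat_Suc)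
    finally show ?case by simp
  qed simp
  have "(\<lambda>k. (1 / fact k) *\<^sub>R (((**) (\<theta> *\<^sub>R J)) ^^ k) (mat 1)) sums (cos \<theta> *\<^sub>R D + sin \<theta> *\<^sub>R J + (mat 1 - D))"
    unfolding pw
    by (intro sums_add bounded_linear.sums[OF bounded_linear_scaleR_left] cos_converges sin_converges sums_single)
  then show ?thesis unfolding matrix_exp_def by (simp add: sums_iff)
qed

text \<open>The columns of \<open>rot \<psi>\<close> as functions of the three angles.\<close>

definition fP :: "real \<Rightarrow> real \<Rightarrow> real \<Rightarrow> real^3" where
  "fP a b c = vector [cos b * cos c, cos a * sin c - sin a * sin b * cos c, sin a * sin c + cos a * sin b * cos c]"

definition fQ :: "real \<Rightarrow> real \<Rightarrow> real \<Rightarrow> real^3" where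
  "fQ a b c = vector [- cos b * sin c, cos a * cos c + sin a * sin b * sin c, sin a * cos c - cos a * sin b * sin c]"

definition fN :: "real \<Rightarrow> real \<Rightarrow> real \<Rightarrow> real^3" where
  "fN a b c = vector [- sin b, - sin a * cos b, cos a * cos b]"

lemma rot_unit_circle:
  "rot \<psi> *v (r *\<^sub>R unit_circle \<theta>) = (r * cos \<theta>) *\<^sub>R fP (\<psi> $ 1) (\<psi> $ 2) (\<psi> $ 3) + (r * sin \<theta>) *\<^sub>R fQ (\<psi> $ 1) (\<psi> $ 2) (\<psi> $ 3)"
proof -
  have 1: "matrix_exp (x *\<^sub>R J1) = vector [vector [1, 0, 0], vector [0, cos x, - sin x], vector [0, sin x, cos x]]" for x
    by (subst matrix_exp_rotation[where D = "vector [vector [0, 0, 0], vector [0, 1, 0], vector [0, 0, 1]]"])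
      (simp_all add: J1_def matrix3_simps)
  have 2: "matrix_exp (x *\<^sub>R J2) = vector [vector [cos x, 0, - sin x], vector [0, 1, 0], vector [sin x, 0, cos x]]" for x
    by (subst matrix_exp_rotation[where D = "vector [vector [1, 0, 0], vector [0, 0, 0], vector [0, 0, 1]]"])
      (simp_all add: J2_def matrix3_simps)
  have 3: "matrix_exp (x *\<^sub>R J3) = vector [vector [cos x, - sin x, 0], vector [sin x, cos x, 0], vector [0, 0, 1]]" for x
    by (subst matrix_exp_rotation[where D = "vector [vector [1, 0, 0], vector [0, 1, 0], vector [0, 0, 0]]"])
      (simp_all add: J3_def matrix3_simps)
  show ?thesis
    unfolding rot_def 1 2 3 unit_circle_def fP_def fQ_def matrix_vector_mul_assoc[symmetric]
    by (simp del: matrix_vector_mul_assoc add: vec_eq_iff forall_3 matrix_vector_mult_def sum_3 vector_3 algebra_simps)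
qed

lemma inner3: "x \<bullet> y = x $ 1 * y $ 1 + x $ 2 * y $ 2 + x $ 3 * y $ 3" for x y :: "real^3"
  by (simp add: inner_vec_def sum_3)

lemma frame_orthonormal:
  "fP a b c \<bullet> fP a b c = 1" "fQ a b c \<bullet> fQ a b c = 1" "fN a b c \<bullet> fN a b c = 1"
  "fP a b c \<bullet> fQ a b c = 0" "fP a b c \<bullet> fN a b c = 0" "fQ a b c \<bullet> fN a b c = 0"
  "fQ a b c \<bullet> fP a b c = 0" "fN a b c \<bullet> fP a b c = 0" "fN a b c \<bullet> fQ a b c = 0"
proof -
  define ca sa cb sb cc sc where d: "ca = cos a" "sa = sin a" "cb = cos b" "sb = sin b" "cc = cos c" "sc = sin c"
  have h: "ca * ca + sa * sa = 1" "cb * cb + sb * sb = 1" "cc * cc + sc * sc = 1"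
    by (simp_all add: d flip: power2_eq_square)
  note u = inner3 fP_def fQ_def fN_def vector_3 d[symmetric]
  show "fP a b c \<bullet> fP a b c = 1" "fQ a b c \<bullet> fQ a b c = 1" "fN a b c \<bullet> fN a b c = 1"
    "fP a b c \<bullet> fQ a b c = 0" "fP a b c \<bullet> fN a b c = 0" "fQ a b c \<bullet> fN a b c = 0"
    unfolding u using h by algebra+
  then show "fQ a b c \<bullet> fP a b c = 0" "fN a b c \<bullet> fP a b c = 0" "fN a b c \<bullet> fQ a b c = 0"
    by (simp_all add: inner_commute)
qed

lemma vector3_axis: "vector [x, y, z] = x *\<^sub>R axis 1 1 + y *\<^sub>R axis 2 1 + z *\<^sub>R (axis 3 1 :: real^3)"
  by (simp add: vec_eq_iff forall_3 vector_3 axis_def)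

lemma C1_frame [C1_intros]:
  assumes "C1_on S a" "C1_on S b" "C1_on S c"
  shows "C1_on S (\<lambda>x. fP (a x) (b x) (c x))" "C1_on S (\<lambda>x. fQ (a x) (b x) (c x))" "C1_on S (\<lambda>x. fN (a x) (b x) (c x))"
  unfolding fP_def fQ_def fN_def vector3_axis by (intro C1_intros assms)+

text \<open>The eccentric anomaly, the root of Kepler's equation for an ellipse of semi-major axis
  1. The ellipse is explicit in it, whereas the true anomaly \<open>kepler_angle\<close> is given
  only by a differential equation.\<close>

definition ecc :: "real \<Rightarrow> real \<Rightarrow> real" where
  "ecc e t = (THE x. x - e * sin x = t)"

lemma sin_lipschitz: "\<bar>sin x - sin y\<bar> \<le> \<bar>x - y\<bar>" for x y :: real
proof -
  have "\<bar>sin x - sin y\<bar> = 2 * \<bar>sin ((x - y) / 2)\<bar> * \<bar>cos ((x + y) / 2)\<bar>"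
    by (simp add: sin_diff_sin abs_mult)
  also have "\<dots> \<le> 2 * \<bar>(x - y) / 2\<bar> * 1"
    by (intro mult_mono abs_sin_x_le_abs_x abs_cos_le_one) auto
  finally show ?thesis by simp
qed

text \<open>One inequality serves twice: equal data give uniqueness of the root, different data give
  continuity jointly in time and eccentricity.\<close>

lemma ecc_estimate:
  fixes e e' x y s t :: real
  assumes "x - e * sin x = t" "y - e' * sin y = s"
  shows "(1 - \<bar>e\<bar>) * \<bar>x - y\<bar> \<le> \<bar>t - s\<bar> + \<bar>e - e'\<bar>"
proof -
  have "x - y = (t - s) + e * (sin x - sin y) + (e - e') * sin y" using assms by (simp add: algebra_simps)
  then have "\<bar>x - y\<bar> \<le> \<bar>t - s\<bar> + \<bar>e * (sin x - sin y)\<bar> + \<bar>(e - e') * sin y\<bar>"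
    using abs_triangle_ineq[of "t - s + e * (sin x - sin y)" "(e - e') * sin y"]
      abs_triangle_ineq[of "t - s" "e * (sin x - sin y)"] by simp
  also have "\<bar>e * (sin x - sin y)\<bar> \<le> \<bar>e\<bar> * \<bar>x - y\<bar>"
    unfolding abs_mult by (intro mult_left_mono sin_lipschitz) simp
  also have "\<bar>(e - e') * sin y\<bar> \<le> \<bar>e - e'\<bar> * 1"
    unfolding abs_mult by (intro mult_left_mono abs_sin_le_one) simp
  finally show ?thesis by (simp add: algebra_simps)
qed

lemma ecc_unique:
  fixes e x y t :: real
  assumes "\<bar>e\<bar> < 1" "x - e * sin x = t" "y - e * sin y = t" shows "x = y"
proof -
  have "(1 - \<bar>e\<bar>) * \<bar>x - y\<bar> \<le> 0" using ecc_estimate[OF assms(2,3)] by simp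
  then show ?thesis using assms(1) by (simp add: mult_le_0_iff)
qed

lemma ecc:
  assumes "\<bar>e\<bar> < 1" shows "ecc e t - e * sin (ecc e t) = t"
proof -
  have b: "\<bar>e * sin x\<bar> \<le> 1" for x
    unfolding abs_mult using mult_mono[of "\<bar>e\<bar>" 1 "\<bar>sin x\<bar>" 1] assms by simp
  have "\<exists>x. t - 1 \<le> x \<and> x \<le> t + 1 \<and> x - e * sin x = t"
    by (rule IVT') (use b[of "t - 1"] b[of "t + 1"] in \<open>auto intro!: continuous_intros simp: abs_le_iff\<close>)
  then have "\<exists>!x. x - e * sin x = t" using ecc_unique[OF assms] by blast
  from theI'[OF this] show ?thesis by (simp add: ecc_def)
qed

lemma ecc_eqI: "\<bar>e\<bar> < 1 \<Longrightarrow> x - e * sin x = t \<Longrightarrow> ecc e t = x"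
  using ecc_unique ecc by blast

lemma ecc_0: "\<bar>e\<bar> < 1 \<Longrightarrow> ecc e 0 = 0"
  by (rule ecc_eqI) auto

lemma ecc_period: "\<bar>e\<bar> < 1 \<Longrightarrow> ecc e (t + 2 * pi) = ecc e t + 2 * pi"
  using ecc[of e t] by (intro ecc_eqI) simp_all

lemma rho_pos:
  fixes e x :: real
  assumes "\<bar>e\<bar> < 1" shows "0 < 1 - e * cos x"
proof -
  have "\<bar>e * cos x\<bar> \<le> \<bar>e\<bar> * 1" unfolding abs_mult by (intro mult_left_mono abs_cos_le_one) simp
  then show ?thesis using assms by linarith
qed

definition ecc_dom :: "(real \<times> real) set" where
  "ecc_dom = UNIV \<times> {-1<..<1}"

lemma ecc_dom_iff: "z \<in> ecc_dom \<longleftrightarrow> \<bar>snd z\<bar> < 1"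
  by (cases z) (auto simp: ecc_dom_def)

lemma open_ecc_dom: "open ecc_dom"
  unfolding ecc_dom_def by (intro open_Times) auto

lemma continuous_ecc: "continuous_on ecc_dom (\<lambda>z. ecc (snd z) (fst z))"
proof (rule continuous_at_imp_continuous_on, rule ballI)
  fix z assume z: "z \<in> ecc_dom"
  let ?q = "1 - \<bar>snd z\<bar>"
  have q: "0 < ?q" using z by (simp add: ecc_dom_iff)
  have "((\<lambda>w. ecc (snd w) (fst w) - ecc (snd z) (fst z)) \<longlongrightarrow> 0) (at z)"
  proof (rule Lim_null_comparison)
    show "\<forall>\<^sub>F w in at z. norm (ecc (snd w) (fst w) - ecc (snd z) (fst z)) \<le> (\<bar>fst w - fst z\<bar> + \<bar>snd w - snd z\<bar>) / ?q"
    proof (rule eventually_mono[OF eventually_at_in_open'[OF open_ecc_dom z]])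
      fix w assume w: "w \<in> ecc_dom"
      have "?q * \<bar>ecc (snd z) (fst z) - ecc (snd w) (fst w)\<bar> \<le> \<bar>fst z - fst w\<bar> + \<bar>snd z - snd w\<bar>"
        by (rule ecc_estimate[OF ecc ecc]) (use z w in \<open>simp_all add: ecc_dom_iff\<close>)
      then show "norm (ecc (snd w) (fst w) - ecc (snd z) (fst z)) \<le> (\<bar>fst w - fst z\<bar> + \<bar>snd w - snd z\<bar>) / ?q"
        using q by (simp add: field_simps abs_minus_commute)
    qed
    have "((\<lambda>w. (\<bar>fst w - fst z\<bar> + \<bar>snd w - snd z\<bar>) / ?q) \<longlongrightarrow> (\<bar>fst z - fst z\<bar> + \<bar>snd z - snd z\<bar>) / ?q) (at z)"
      using q by (intro tendsto_intros) auto
    then show "((\<lambda>w. (\<bar>fst w - fst z\<bar> + \<bar>snd w - snd z\<bar>) / ?q) \<longlongrightarrow> 0) (at z)" by simp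
  qed
  then show "isCont (\<lambda>z. ecc (snd z) (fst z)) z" unfolding isCont_def by (simp add: LIM_zero_iff)
qed

text \<open>The explicit map \<open>?f\<close> inverts \<open>?g\<close>, and its derivative is
  invertible; continuity of \<open>ecc\<close> therefore already implies differentiability.\<close>

lemma ecc_has_derivative:
  assumes z: "z \<in> ecc_dom"
  shows "((\<lambda>z. ecc (snd z) (fst z)) has_derivative
    (\<lambda>h. (fst h + snd h * sin (ecc (snd z) (fst z))) / (1 - snd z * cos (ecc (snd z) (fst z))))) (at z)"
proof -
  let ?g = "\<lambda>z. (ecc (snd z) (fst z), snd z)" and ?f = "\<lambda>w. (fst w - snd w * sin (fst w), snd w)"
  define x where "x = ecc (snd z) (fst z)"
  define r where "r = 1 - snd z * cos x"
  have r: "0 < r" unfolding r_def using z by (intro rho_pos) (simp add: ecc_dom_iff)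
  have "(?g has_derivative (\<lambda>h. ((fst h + snd h * sin x) / r, snd h))) (at z)"
  proof (rule has_derivative_inverse_basic[where f = ?f and T = ecc_dom])
    show "(?f has_derivative (\<lambda>h. (fst h - (snd z * (fst h * cos x) + snd h * sin x), snd h))) (at (?g z))"
      by (auto intro!: derivative_eq_intros simp: x_def)
    show "bounded_linear (\<lambda>h. ((fst h + snd h * sin x) / r, snd h))"
      by (intro bounded_linear_Pair bounded_linear_snd bounded_linear_compose[OF bounded_linear_divide]
          bounded_linear_add bounded_linear_fst bounded_linear_mult_const)
    show "(\<lambda>h. ((fst h + snd h * sin x) / r, snd h)) \<circ> (\<lambda>h. (fst h - (snd z * (fst h * cos x) + snd h * sin x), snd h)) = id"
      using r by (auto simp: fun_eq_iff r_def field_simps)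
    show "continuous (at z) ?g"
      using continuous_ecc z by (intro continuous_Pair continuous_intros)
        (simp add: continuous_on_eq_continuous_at[OF open_ecc_dom])
    show "?f (?g w) = w" if "w \<in> ecc_dom" for w
      using ecc[of "snd w" "fst w"] that by (simp add: ecc_dom_iff prod_eq_iff)
  qed (use z open_ecc_dom in auto)
  from has_derivative_fst[OF this] show ?thesis by (simp add: x_def r_def)
qed

lemma C1_ecc:
  assumes t: "C1_on S t" and e: "C1_on S e" and e1: "\<And>x. x \<in> S \<Longrightarrow> \<bar>e x\<bar> < 1"
  shows "C1_on S (\<lambda>x. ecc (e x) (t x))"
proof -
  have "C1_on ecc_dom (\<lambda>z. ecc (snd z) (fst z))"
  proof (rule C1_onI)
    let ?E = "\<lambda>z. ecc (snd z) (fst z)"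
    let ?D = "\<lambda>z. (1 / (1 - snd z * cos (?E z))) *\<^sub>R fst_blinfun + (sin (?E z) / (1 - snd z * cos (?E z))) *\<^sub>R snd_blinfun"
    show "(?E has_derivative blinfun_apply (?D z)) (at z)" if "z \<in> ecc_dom" for z
      by (rule has_derivative_eq_rhs[OF ecc_has_derivative[OF that]])
        (simp add: fun_eq_iff blinfun.add_left blinfun.scaleR_left add_divide_distrib mult.commute)
    have "1 - snd z * cos (?E z) \<noteq> 0" if "z \<in> ecc_dom" for z
      using rho_pos[of "snd z" "?E z"] that by (simp add: ecc_dom_iff)
    then show "continuous_on ecc_dom ?D"
      by (intro continuous_intros continuous_ecc) auto
  qed
  from C1_on_compose[OF C1_on_Pair[OF t e] this] e1 show ?thesis by (simp add: ecc_dom_iff)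
qed

lemma ecc_deriv:
  assumes "\<bar>e\<bar> < 1"
  shows "(ecc e has_real_derivative 1 / (1 - e * cos (ecc e t))) (at t)"
proof -
  have "((\<lambda>t. (t, e)) has_derivative (\<lambda>h. (h, 0))) (at t)" by (auto intro!: derivative_eq_intros)
  from has_derivative_compose[OF this ecc_has_derivative] assms
  have "((\<lambda>t. ecc e t) has_derivative (\<lambda>h. h / (1 - e * cos (ecc e t)))) (at t)" by (simp add: ecc_dom_iff)
  then show ?thesis unfolding has_field_derivative_def by (rule has_derivative_eq_rhs) (simp add: fun_eq_iff)
qed

section \<open>The ellipse in the eccentric anomaly\<close>

definition kep :: "real^4 \<Rightarrow> real \<Rightarrow> real^3" where
  "kep p t = (cos (ecc (p $ 1) t) - p $ 1) *\<^sub>R fP (p $ 2) (p $ 3) (p $ 4)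
     + (kepler_c (p $ 1) * sin (ecc (p $ 1) t)) *\<^sub>R fQ (p $ 2) (p $ 3) (p $ 4)"

definition kepv :: "real^4 \<Rightarrow> real \<Rightarrow> real^3" where
  "kepv p t = (- sin (ecc (p $ 1) t) / (1 - p $ 1 * cos (ecc (p $ 1) t))) *\<^sub>R fP (p $ 2) (p $ 3) (p $ 4)
     + (kepler_c (p $ 1) * cos (ecc (p $ 1) t) / (1 - p $ 1 * cos (ecc (p $ 1) t))) *\<^sub>R fQ (p $ 2) (p $ 3) (p $ 4)"

definition kep_dom :: "(real^4) set" where
  "kep_dom = {p. \<bar>p $ 1\<bar> < 1}"

lemma open_kep_dom: "open kep_dom"
  unfolding kep_dom_def by (intro open_Collect_less continuous_intros)

lemma kepler_c_sq: "\<bar>e\<bar> < 1 \<Longrightarrow> kepler_c e * kepler_c e = 1 - e * e"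
  by (simp add: kepler_c_def power2_eq_square abs_square_le_1 less_imp_le flip: real_sqrt_mult)
    (simp add: abs_square_le_1[unfolded power2_eq_square] less_imp_le)

lemma kepler_c_pos: "\<bar>e\<bar> < 1 \<Longrightarrow> 0 < kepler_c e"
  by (simp add: kepler_c_def abs_square_less_1)

lemma C1_kepler_c: "C1_on S f \<Longrightarrow> (\<And>x. x \<in> S \<Longrightarrow> \<bar>f x\<bar> < 1) \<Longrightarrow> C1_on S (\<lambda>x. kepler_c (f x))"
  unfolding kepler_c_def by (intro C1_intros) (auto simp: abs_square_less_1)

lemma C1_kep:
  assumes "C1_on S t" "C1_on S p" "\<And>x. x \<in> S \<Longrightarrow> p x \<in> kep_dom"
  shows "C1_on S (\<lambda>x. kep (p x) (t x))"
  unfolding kep_def by (intro C1_intros C1_ecc C1_kepler_c assms) (use assms(3) in \<open>auto simp: kep_dom_def\<close>)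

lemma kep_deriv:
  assumes p: "p \<in> kep_dom" shows "(kep p has_vector_derivative kepv p t) (at t)"
proof -
  have E: "(ecc (p $ 1) has_real_derivative 1 / (1 - p $ 1 * cos (ecc (p $ 1) t))) (at t)"
    using p by (intro ecc_deriv) (simp add: kep_dom_def)
  have "((\<lambda>t. cos (ecc (p $ 1) t) - p $ 1) has_real_derivative - sin (ecc (p $ 1) t) / (1 - p $ 1 * cos (ecc (p $ 1) t))) (at t)"
    "((\<lambda>t. kepler_c (p $ 1) * sin (ecc (p $ 1) t)) has_real_derivative kepler_c (p $ 1) * cos (ecc (p $ 1) t) / (1 - p $ 1 * cos (ecc (p $ 1) t))) (at t)"
    by (auto intro!: derivative_eq_intros E)
  from has_vector_derivative_add[OF has_vector_derivative_scaleR[OF this(1) has_vector_derivative_const]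
      has_vector_derivative_scaleR[OF this(2) has_vector_derivative_const]]
  show ?thesis unfolding kep_def[abs_def] kepv_def by simp
qed

lemma kep_norm:
  assumes p: "p \<in> kep_dom" shows "norm (kep p t) = 1 - p $ 1 * cos (ecc (p $ 1) t)"
proof -
  define e where "e = p $ 1"
  define x where "x = ecc e t"
  note ex = e_def x_def
  have e: "\<bar>e\<bar> < 1" using p by (simp add: kep_dom_def ex)
  have "kep p t \<bullet> kep p t = (cos x - e) * (cos x - e) + (kepler_c e * kepler_c e) * (sin x * sin x)"
    unfolding kep_def ex[symmetric] by (simp add: inner_add_left inner_add_right frame_orthonormal algebra_simps)
  also have "\<dots> = (1 - e * cos x) * (1 - e * cos x)"
    unfolding kepler_c_sq[OF e] using sin_cos_squared_add3[of x] by algebra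
  finally have "norm (kep p t) = sqrt ((1 - e * cos x) * (1 - e * cos x))" by (simp add: norm_eq_sqrt_inner)
  also have "\<dots> = 1 - e * cos x" using rho_pos[OF e, of x] by simp
  finally show ?thesis by (simp add: ex)
qed

lemma kep_nonzero: "p \<in> kep_dom \<Longrightarrow> kep p t \<noteq> 0"
  using kep_norm[of p t] rho_pos[of "p $ 1" "ecc (p $ 1) t"] by (auto simp: kep_dom_def)

lemma kepv_deriv:
  assumes p: "p \<in> kep_dom" shows "(kepv p has_vector_derivative - fK (kep p t)) (at t)"
proof -
  define e where "e = p $ 1"
  define x where "x = ecc e t"
  note ex = e_def x_def
  define r where "r = 1 - e * cos x"
  have e: "\<bar>e\<bar> < 1" using p by (simp add: kep_dom_def ex)
  have r: "0 < r" using rho_pos[OF e] by (simp add: r_def)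
  have E: "(ecc e has_real_derivative 1 / r) (at t)" unfolding r_def x_def by (rule ecc_deriv[OF e])
  have sc: "sin x * sin x = 1 - cos x * cos x" using sin_cos_squared_add3[of x] by linarith
  have 1: "((\<lambda>t. - sin (ecc e t) / (1 - e * cos (ecc e t))) has_real_derivative - (cos x - e) / r ^ 3) (at t)"
    using r by (auto intro!: derivative_eq_intros E simp: x_def[symmetric] r_def[symmetric] divide_simps power3_eq_cube)
      (simp add: r_def sc algebra_simps)
  have 2: "((\<lambda>t. kepler_c e * cos (ecc e t) / (1 - e * cos (ecc e t))) has_real_derivative - (kepler_c e * sin x) / r ^ 3) (at t)"
    using r by (auto intro!: derivative_eq_intros E simp: x_def[symmetric] r_def[symmetric] divide_simps power3_eq_cube)
      (simp add: r_def algebra_simps)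
  have fk: "- fK (kep p t) = (- (cos x - e) / r ^ 3) *\<^sub>R fP (p $ 2) (p $ 3) (p $ 4) + (- (kepler_c e * sin x) / r ^ 3) *\<^sub>R fQ (p $ 2) (p $ 3) (p $ 4)"
    unfolding fK_def kep_norm[OF p] ex[symmetric] r_def[symmetric]
    by (simp add: kep_def ex[symmetric] scaleR_add_right divide_inverse power_inverse scaleR_diff_left algebra_simps)
  from has_vector_derivative_add[OF has_vector_derivative_scaleR[OF 1 has_vector_derivative_const]
      has_vector_derivative_scaleR[OF 2 has_vector_derivative_const]]
  show ?thesis unfolding kepv_def[abs_def] fk e_def[symmetric] by simp
qed

lemma kep_periodic: "p \<in> kep_dom \<Longrightarrow> kep p (t + 2 * pi) = kep p t"
  "p \<in> kep_dom \<Longrightarrow> kepv p (t + 2 * pi) = kepv p t"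
  by (simp_all add: kep_def kepv_def ecc_period kep_dom_def)

definition peri_speed :: "real \<Rightarrow> real" where
  "peri_speed e = kepler_c e / (1 - e)"

lemma kep_0: "p \<in> kep_dom \<Longrightarrow> kep p 0 = (1 - p $ 1) *\<^sub>R fP (p $ 2) (p $ 3) (p $ 4)"
  "p \<in> kep_dom \<Longrightarrow> kepv p 0 = peri_speed (p $ 1) *\<^sub>R fQ (p $ 2) (p $ 3) (p $ 4)"
  by (simp_all add: kep_def kepv_def ecc_0 kep_dom_def peri_speed_def)

text \<open>The true anomaly is the unique solution of an initial value problem, so a solution has
  to be constructed and shown to be the only one before it can be compared with the eccentric
  anomaly.\<close>

lemma kepler_angle:
  assumes "0 \<le> e" "e < 1"
  shows "cos (kepler_angle e t) = (cos (ecc e t) - e) / (1 - e * cos (ecc e t))"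
    "sin (kepler_angle e t) = kepler_c e * sin (ecc e t) / (1 - e * cos (ecc e t))"
    "kepler_radius e (kepler_angle e t) = 1 - e * cos (ecc e t)"
proof -
  have e: "\<bar>e\<bar> < 1" using assms by simp
  define r where "r t = 1 - e * cos (ecc e t)" for t
  define c where "c = kepler_c e"
  have r: "0 < r t" for t unfolding r_def by (rule rho_pos[OF e])
  have c: "0 < c" "c * c = 1 - e * e" unfolding c_def by (simp_all add: kepler_c_pos e kepler_c_sq)
  have E: "(ecc e has_real_derivative 1 / r t) (at t)" for t unfolding r_def by (rule ecc_deriv[OF e])
  have rc: "continuous_on UNIV r"
    unfolding r_def using E by (intro continuous_intros DERIV_continuous_on[of UNIV "ecc e"]) (auto intro: has_field_derivative_at_within)
  have rn: "r t \<noteq> 0" for t using r[of t] by simp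
  have kc: "continuous_on UNIV (\<lambda>t. c / (r t)\<^sup>2)" by (intro continuous_intros rc) (simp add: rn)
  obtain \<theta> where \<theta>: "\<And>t. (\<theta> has_vector_derivative c / (r t)\<^sup>2) (at t)" "\<theta> 0 = 0"
    by (rule antiderivative_exists[OF kc, of 0]) (rule that; assumption)
  then have \<theta>': "(\<theta> has_real_derivative c / (r t)\<^sup>2) (at t)" for t
    by (simp add: has_real_derivative_iff_has_vector_derivative)
  \<comment> \<open>The expected cosine and sine of the true anomaly. They obey the same rotation
    equation as \<open>cos (\<theta> t)\<close> and \<open>sin (\<theta> t)\<close>, so the two
    combinations formed below are constant.\<close>
  define C S where "C t = (cos (ecc e t) - e) / r t" and "S t = c * sin (ecc e t) / r t" for t
  have C0: "C 0 = 1" "S 0 = 0" using rn[of 0] by (simp_all add: C_def S_def r_def ecc_0[OF e])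
  have sc: "sin x * sin x = 1 - cos x * cos x" for x :: real using sin_cos_squared_add3[of x] by linarith
  have r': "(r has_real_derivative e * sin (ecc e t) / r t) (at t)" for t
    unfolding r_def[abs_def] using E[of t] r[of t] by (auto intro!: derivative_eq_intros simp: r_def)
  have C': "(C has_real_derivative - S t * (c / (r t)\<^sup>2)) (at t)" for t
  proof -
    have "(C has_real_derivative ((- sin (ecc e t) / r t) * r t - (cos (ecc e t) - e) * (e * sin (ecc e t) / r t)) / (r t * r t)) (at t)"
      unfolding C_def[abs_def] using r[of t] by (intro DERIV_divide r') (auto intro!: derivative_eq_intros E)
    moreover have "(- sin (ecc e t) / r t) * r t - (cos (ecc e t) - e) * (e * sin (ecc e t) / r t) = - (c * c) * sin (ecc e t) / r t"
      using r[of t] unfolding c(2) by (simp add: field_simps) (simp add: r_def algebra_simps)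
    ultimately show ?thesis by (simp add: S_def power2_eq_square mult_ac)
  qed
  have S': "(S has_real_derivative C t * (c / (r t)\<^sup>2)) (at t)" for t
  proof -
    have "(S has_real_derivative ((c * cos (ecc e t) / r t) * r t - c * sin (ecc e t) * (e * sin (ecc e t) / r t)) / (r t * r t)) (at t)"
      unfolding S_def[abs_def] using r[of t] by (intro DERIV_divide r') (auto intro!: derivative_eq_intros E)
    moreover have "(c * cos (ecc e t) / r t) * r t - c * sin (ecc e t) * (e * sin (ecc e t) / r t) = c * (cos (ecc e t) - e) / r t"
      using r[of t] by (simp add: field_simps) (simp add: r_def sc algebra_simps)
    ultimately show ?thesis by (simp add: C_def power2_eq_square mult_ac)
  qed
  have "((\<lambda>t. C t * cos (\<theta> t) + S t * sin (\<theta> t)) has_real_derivative 0) (at t)" for t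
    by (auto intro!: derivative_eq_intros C' S' \<theta>' simp: algebra_simps)
  from DERIV_isconst_all[OF allI[OF this]]
  have "C t * cos (\<theta> t) + S t * sin (\<theta> t) = C 0 * cos (\<theta> 0) + S 0 * sin (\<theta> 0)" for t .
  then have 1: "C t * cos (\<theta> t) + S t * sin (\<theta> t) = 1" for t by (simp add: \<theta>(2) C0)
  have "((\<lambda>t. S t * cos (\<theta> t) - C t * sin (\<theta> t)) has_real_derivative 0) (at t)" for t
    by (auto intro!: derivative_eq_intros C' S' \<theta>' simp: algebra_simps)
  from DERIV_isconst_all[OF allI[OF this]]
  have "S t * cos (\<theta> t) - C t * sin (\<theta> t) = S 0 * cos (\<theta> 0) - C 0 * sin (\<theta> 0)" for t .
  then have 2: "S t * cos (\<theta> t) - C t * sin (\<theta> t) = 0" for t by (simp add: \<theta>(2) C0)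
  have cs: "cos (\<theta> t) = C t" "sin (\<theta> t) = S t" for t
    using 1[of t] 2[of t] sin_cos_squared_add3[of "\<theta> t"] by algebra+
  have rad: "kepler_radius e (\<theta> t) = r t" for t
  proof -
    have *: "1 + e * C t = c * c / r t" using r[of t] unfolding c(2) by (simp add: C_def field_simps) (simp add: r_def algebra_simps)
    have "kepler_radius e (\<theta> t) = c * c / (1 + e * C t)"
      by (simp add: kepler_radius_def cs power2_eq_square c_def)
    then show ?thesis unfolding * using c(1) r[of t] by simp
  qed
  have "kepler_angle e = \<theta>"
    unfolding kepler_angle_def
  proof (rule the_equality)
    show "\<theta> 0 = 0 \<and> (\<forall>t. (\<theta> has_real_derivative kepler_c e / (kepler_radius e (\<theta> t))\<^sup>2) (at t))"
      using \<theta>' \<theta>(2) by (simp add: rad c_def)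
    fix \<eta> assume \<eta>: "\<eta> 0 = 0 \<and> (\<forall>t. (\<eta> has_real_derivative kepler_c e / (kepler_radius e (\<eta> t))\<^sup>2) (at t))"
    have kpos: "0 < kepler_radius e x" for x
      unfolding kepler_radius_def using rho_pos[of "- e" x] e c(1) by (simp add: c_def)
    have kc: "continuous_on UNIV (\<lambda>x. (kepler_radius e x)\<^sup>2 / c)"
      unfolding kepler_radius_def using rho_pos[of "- e"] e c(1)
      by (intro continuous_intros) (auto simp: less_imp_neq[symmetric])
    \<comment> \<open>Separation of variables: \<open>T\<close> is time as a function of the angle.
      Along any solution \<open>T\<close> grows at rate 1, and \<open>T\<close> is strictly
      increasing, hence injective.\<close>
    obtain T where "\<And>x. (T has_vector_derivative (kepler_radius e x)\<^sup>2 / c) (at x)" "T 0 = 0"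
      using antiderivative_exists[OF kc] by blast
    then have T: "(T has_real_derivative (kepler_radius e x)\<^sup>2 / c) (at x)" for x
      by (simp add: has_real_derivative_iff_has_vector_derivative)
    have one: "((\<lambda>t. T (\<eta> t)) has_real_derivative 1) (at t)"
      if "(\<eta> has_real_derivative c / (kepler_radius e (\<eta> t))\<^sup>2) (at t)" for \<eta> t
      using DERIV_chain2[OF T that] c kpos[of "\<eta> t"] by simp
    have "((\<lambda>t. T (\<eta> t) - T (\<theta> t)) has_real_derivative 0) (at t)" for t
      using DERIV_diff[OF one[of \<eta> t] one[of \<theta> t]] \<eta> \<theta>' by (simp add: rad c_def)
    from DERIV_isconst_all[OF allI[OF this]] have "T (\<eta> t) - T (\<theta> t) = T (\<eta> 0) - T (\<theta> 0)" for t .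
    then have TT: "T (\<eta> t) = T (\<theta> t)" for t using \<eta> \<theta>(2) by simp
    have mono: "T x < T y" if "x < y" for x y
    proof (rule DERIV_pos_imp_increasing[OF that])
      fix z show "\<exists>y. (T has_real_derivative y) (at z) \<and> 0 < y"
        using T[of z] kpos[of z] c(1) by (intro exI[of _ "(kepler_radius e z)\<^sup>2 / c"]) simp
    qed
    show "\<eta> = \<theta>"
    proof
      fix t show "\<eta> t = \<theta> t" using mono[of "\<eta> t" "\<theta> t"] mono[of "\<theta> t" "\<eta> t"] TT[of t] by (cases "\<eta> t" "\<theta> t" rule: linorder_cases) auto
    qed
  qed
  then show "cos (kepler_angle e t) = (cos (ecc e t) - e) / (1 - e * cos (ecc e t))"
    "sin (kepler_angle e t) = kepler_c e * sin (ecc e t) / (1 - e * cos (ecc e t))"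
    "kepler_radius e (kepler_angle e t) = 1 - e * cos (ecc e t)"
    by (simp_all add: cs rad, simp_all add: C_def S_def r_def c_def)
qed

lemma kepler_ellipse_kep:
  assumes "0 \<le> p $ 1" "p $ 1 < 1"
  shows "kepler_ellipse (p $ 1) (vector [p $ 2, p $ 3, p $ 4]) = kep p"
proof
  fix t
  have "0 < 1 - p $ 1 * cos (ecc (p $ 1) t)" by (rule rho_pos) (use assms in simp)
  then show "kepler_ellipse (p $ 1) (vector [p $ 2, p $ 3, p $ 4]) t = kep p t"
    unfolding kepler_ellipse_def rot_unit_circle kep_def kepler_angle[OF assms] by (simp add: vector_3)
qed

section \<open>Variations of Kepler ellipses\<close>

abbreviation PP :: "real^4 \<Rightarrow> real^3" where "PP p \<equiv> fP (p $ 2) (p $ 3) (p $ 4)"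
abbreviation QQ :: "real^4 \<Rightarrow> real^3" where "QQ p \<equiv> fQ (p $ 2) (p $ 3) (p $ 4)"
abbreviation NN :: "real^4 \<Rightarrow> real^3" where "NN p \<equiv> fN (p $ 2) (p $ 3) (p $ 4)"

lemma frame_expand: "x = (x \<bullet> fP a b c) *\<^sub>R fP a b c + (x \<bullet> fQ a b c) *\<^sub>R fQ a b c + (x \<bullet> fN a b c) *\<^sub>R fN a b c"
proof -
  define ca sa cb sb cc sc where d: "ca = cos a" "sa = sin a" "cb = cos b" "sb = sin b" "cc = cos c" "sc = sin c"
  have h: "ca * ca + sa * sa = 1" "cb * cb + sb * sb = 1" "cc * cc + sc * sc = 1"
    by (simp_all add: d flip: power2_eq_square)
  show ?thesis
    unfolding vec_eq_iff forall_3 vector_add_component vector_scaleR_component real_scaleR_def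
      inner3 fP_def fQ_def fN_def vector_3 d[symmetric]
  proof (intro conjI)
  qed (use h in algebra)+
qed

lemma frame_zero: "x \<bullet> fP a b c = 0 \<Longrightarrow> x \<bullet> fQ a b c = 0 \<Longrightarrow> x \<bullet> fN a b c = 0 \<Longrightarrow> x = 0"
  using frame_expand[of x a b c] by simp

lemma has_derivative_vector3:
  assumes "(f has_derivative f') F" "(g has_derivative g') F" "(h has_derivative h') F"
  shows "((\<lambda>x. vector [f x, g x, h x] :: real^3) has_derivative (\<lambda>k. vector [f' k, g' k, h' k])) F"
  unfolding vector3_axis by (intro has_derivative_add has_derivative_scaleR_left assms)

lemma has_derivative_nth [derivative_intros]: "((\<lambda>p :: real^'n. p $ i) has_derivative (\<lambda>\<delta>. \<delta> $ i)) F"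
  by (rule bounded_linear_imp_has_derivative[OF bounded_linear_vec_nth])

text \<open>Infinitesimal rotations written in the moving frame itself: components along
  \<open>PP\<close> and \<open>QQ\<close> turn the ellipse in its plane, components along
  \<open>NN\<close> tilt the plane.\<close>

lemma frame_has_derivative:
  "(PP has_derivative (\<lambda>\<delta>. \<delta> $ 2 *\<^sub>R (cos (p $ 3) * sin (p $ 4)) *\<^sub>R NN p - (\<delta> $ 2 * sin (p $ 3)) *\<^sub>R QQ p
      + (\<delta> $ 3 * cos (p $ 4)) *\<^sub>R NN p + \<delta> $ 4 *\<^sub>R QQ p)) (at p)"
  "(QQ has_derivative (\<lambda>\<delta>. \<delta> $ 2 *\<^sub>R (cos (p $ 3) * cos (p $ 4)) *\<^sub>R NN p + (\<delta> $ 2 * sin (p $ 3)) *\<^sub>R PP p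
      - (\<delta> $ 3 * sin (p $ 4)) *\<^sub>R NN p - \<delta> $ 4 *\<^sub>R PP p)) (at p)"
proof -

  define ca sa cb sb cc sc where d: "ca = cos (p $ 2)" "sa = sin (p $ 2)" "cb = cos (p $ 3)" "sb = sin (p $ 3)"
    "cc = cos (p $ 4)" "sc = sin (p $ 4)"
  have h: "ca * ca + sa * sa = 1" "cb * cb + sb * sb = 1" "cc * cc + sc * sc = 1"
    by (simp_all add: d flip: power2_eq_square)
  note v = vec_eq_iff forall_3 vector_add_component vector_minus_component vector_scaleR_component real_scaleR_def
    fP_def fQ_def fN_def vector_3 d[symmetric]
  show "(PP has_derivative (\<lambda>\<delta>. \<delta> $ 2 *\<^sub>R (cos (p $ 3) * sin (p $ 4)) *\<^sub>R NN p - (\<delta> $ 2 * sin (p $ 3)) *\<^sub>R QQ p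
      + (\<delta> $ 3 * cos (p $ 4)) *\<^sub>R NN p + \<delta> $ 4 *\<^sub>R QQ p)) (at p)"
    unfolding fP_def
    apply (rule has_derivative_eq_rhs)
     apply (rule has_derivative_vector3; (rule derivative_eq_intros refl)+)
    unfolding fun_eq_iff v
    apply (intro allI conjI)
    subgoal for x
    proof -
      define y2 y3 y4 where y: "y2 = x $ 2" "y3 = x $ 3" "y4 = x $ 4"
      show ?thesis unfolding y[symmetric] by ((simp add: algebra_simps; fail) | (insert h, algebra))
    qed
    subgoal for x
    proof -
      define y2 y3 y4 where y: "y2 = x $ 2" "y3 = x $ 3" "y4 = x $ 4"
      show ?thesis unfolding y[symmetric] by ((simp add: algebra_simps; fail) | (insert h, algebra))
    qed
    subgoal for x
    proof -
      define y2 y3 y4 where y: "y2 = x $ 2" "y3 = x $ 3" "y4 = x $ 4"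
      show ?thesis unfolding y[symmetric] by ((simp add: algebra_simps; fail) | (insert h, algebra))
    qed
    done
  show "(QQ has_derivative (\<lambda>\<delta>. \<delta> $ 2 *\<^sub>R (cos (p $ 3) * cos (p $ 4)) *\<^sub>R NN p + (\<delta> $ 2 * sin (p $ 3)) *\<^sub>R PP p
      - (\<delta> $ 3 * sin (p $ 4)) *\<^sub>R NN p - \<delta> $ 4 *\<^sub>R PP p)) (at p)"
    unfolding fQ_def
    apply (rule has_derivative_eq_rhs)
     apply (rule has_derivative_vector3; (rule derivative_eq_intros refl)+)
    unfolding fun_eq_iff v
    apply (intro allI conjI)
    subgoal for x
    proof -
      define y2 y3 y4 where y: "y2 = x $ 2" "y3 = x $ 3" "y4 = x $ 4"
      show ?thesis unfolding y[symmetric] by ((simp add: algebra_simps; fail) | (insert h, algebra))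
    qed
    subgoal for x
    proof -
      define y2 y3 y4 where y: "y2 = x $ 2" "y3 = x $ 3" "y4 = x $ 4"
      show ?thesis unfolding y[symmetric] by ((simp add: algebra_simps; fail) | (insert h, algebra))
    qed
    subgoal for x
    proof -
      define y2 y3 y4 where y: "y2 = x $ 2" "y3 = x $ 3" "y4 = x $ 4"
      show ?thesis unfolding y[symmetric] by ((simp add: algebra_simps; fail) | (insert h, algebra))
    qed
    done
qed

lemma peri_speed_deriv:
  assumes "\<bar>e\<bar> < 1"
  shows "(peri_speed has_real_derivative 1 / (peri_speed e * (1 - e)\<^sup>2)) (at e)"
proof -
  have e: "1 - e\<^sup>2 > 0" "1 - e > 0" using assms by (auto simp: abs_square_less_1)
  define c where "c = sqrt (1 - e\<^sup>2)"
  have c: "c > 0" "c * c = 1 - e * e" using e(1) by (simp_all add: c_def power2_eq_square)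
  have c': "((\<lambda>e. sqrt (1 - e\<^sup>2)) has_real_derivative - e / c) (at e)" "((\<lambda>e. 1 - e) has_real_derivative - 1) (at e)"
    using e by (auto intro!: derivative_eq_intros simp: c_def field_simps)
  have *: "((\<lambda>e. sqrt (1 - e\<^sup>2) / (1 - e)) has_real_derivative
      ((- e / c) * (1 - e) - c * (- 1)) / ((1 - e) * (1 - e))) (at e)"
    unfolding c_def by (rule DERIV_divide[OF c'[unfolded c_def]]) (use e in simp)
  have "(- e / c) * (1 - e) - c * (- 1) = (1 - e) / c"
    using c by (simp add: field_simps)
  then have **: "((- e / c) * (1 - e) - c * (- 1)) / ((1 - e) * (1 - e)) = 1 / (peri_speed e * (1 - e)\<^sup>2)"
    using e(2) c(1) unfolding peri_speed_def kepler_c_def c_def[symmetric] by (simp add: power2_eq_square)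
  show ?thesis using * unfolding ** peri_speed_def[abs_def] kepler_c_def .
qed

lemma peri_speed_sq:
  assumes "\<bar>e\<bar> < 1" shows "peri_speed e * peri_speed e * (1 - e) = 1 + e" "0 < peri_speed e"
  using kepler_c_sq[OF assms] kepler_c_pos[OF assms] assms
  by (auto simp: peri_speed_def divide_simps) (auto simp: algebra_simps)

text \<open>By \<open>peri_has_derivative\<close>, the change of the position at time 0 when the
  parameters move in direction \<open>\<delta>\<close>; \<open>apsis_v\<close> is that of the
  velocity. Together they are the initial data of the corresponding Jacobi solution.\<close>

definition apsis_x :: "real^4 \<Rightarrow> real^4 \<Rightarrow> real^3" where
  "apsis_x p \<delta> = - (\<delta> $ 1) *\<^sub>R PP p + (1 - p $ 1) *\<^sub>R (\<delta> $ 2 *\<^sub>R (cos (p $ 3) * sin (p $ 4)) *\<^sub>R NN p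
     - (\<delta> $ 2 * sin (p $ 3)) *\<^sub>R QQ p + (\<delta> $ 3 * cos (p $ 4)) *\<^sub>R NN p + \<delta> $ 4 *\<^sub>R QQ p)"

definition apsis_v :: "real^4 \<Rightarrow> real^4 \<Rightarrow> real^3" where
  "apsis_v p \<delta> = (\<delta> $ 1 / (peri_speed (p $ 1) * (1 - p $ 1)\<^sup>2)) *\<^sub>R QQ p
     + peri_speed (p $ 1) *\<^sub>R (\<delta> $ 2 *\<^sub>R (cos (p $ 3) * cos (p $ 4)) *\<^sub>R NN p + (\<delta> $ 2 * sin (p $ 3)) *\<^sub>R PP p
      - (\<delta> $ 3 * sin (p $ 4)) *\<^sub>R NN p - \<delta> $ 4 *\<^sub>R PP p)"

lemma peri_has_derivative:
  assumes p: "p \<in> kep_dom"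
  shows "((\<lambda>p. (1 - p $ 1) *\<^sub>R PP p) has_derivative apsis_x p) (at p)"
    "((\<lambda>p. peri_speed (p $ 1) *\<^sub>R QQ p) has_derivative apsis_v p) (at p)"
    "((\<lambda>p. kep p 0) has_derivative apsis_x p) (at p)"
    "((\<lambda>p. kepv p 0) has_derivative apsis_v p) (at p)"
proof -
  have *: "((\<lambda>p :: real^4. peri_speed (p $ 1)) has_derivative (\<lambda>\<delta>. \<delta> $ 1 / (peri_speed (p $ 1) * (1 - p $ 1)\<^sup>2))) (at p)"
    using has_derivative_compose[OF has_derivative_nth peri_speed_deriv[unfolded has_field_derivative_def], of "p" 1 UNIV] p
    by (simp add: kep_dom_def)
  show 1: "((\<lambda>p. (1 - p $ 1) *\<^sub>R PP p) has_derivative apsis_x p) (at p)"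
    by (rule has_derivative_eq_rhs[OF has_derivative_scaleR[OF has_derivative_diff[OF has_derivative_const has_derivative_nth] frame_has_derivative(1)]])
      (simp add: fun_eq_iff apsis_x_def)
  show 2: "((\<lambda>p. peri_speed (p $ 1) *\<^sub>R QQ p) has_derivative apsis_v p) (at p)"
    by (rule has_derivative_eq_rhs[OF has_derivative_scaleR[OF * frame_has_derivative(2)]])
      (simp add: fun_eq_iff apsis_v_def)
  show "((\<lambda>p. kep p 0) has_derivative apsis_x p) (at p)"
    by (rule has_derivative_transform_within_open[OF 1 open_kep_dom p]) (simp add: kep_0)
  show "((\<lambda>p. kepv p 0) has_derivative apsis_v p) (at p)"
    by (rule has_derivative_transform_within_open[OF 2 open_kep_dom p]) (simp add: kep_0)
qed

lemma apsis_frame: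
  "apsis_x p \<delta> \<bullet> PP p = - \<delta> $ 1"
  "apsis_x p \<delta> \<bullet> QQ p = (1 - p $ 1) * (\<delta> $ 4 - \<delta> $ 2 * sin (p $ 3))"
  "apsis_x p \<delta> \<bullet> NN p = (1 - p $ 1) * (\<delta> $ 2 * (cos (p $ 3) * sin (p $ 4)) + \<delta> $ 3 * cos (p $ 4))"
  "apsis_v p \<delta> \<bullet> PP p = peri_speed (p $ 1) * (\<delta> $ 2 * sin (p $ 3) - \<delta> $ 4)"
  "apsis_v p \<delta> \<bullet> QQ p = \<delta> $ 1 / (peri_speed (p $ 1) * (1 - p $ 1)\<^sup>2)"
  "apsis_v p \<delta> \<bullet> NN p = peri_speed (p $ 1) * (\<delta> $ 2 * (cos (p $ 3) * cos (p $ 4)) - \<delta> $ 3 * sin (p $ 4))"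
  unfolding apsis_x_def apsis_v_def
  by (simp_all add: inner_add_left inner_diff_left frame_orthonormal)

lemma rotate_zero:
  fixes x y a :: real
  assumes "x * sin a + y * cos a = 0" "x * cos a - y * sin a = 0" shows "x = 0" "y = 0"
proof -
  have "x * (sin a * sin a + cos a * cos a) = 0" "y * (cos a * cos a + sin a * sin a) = 0" using assms by algebra+
  then show "x = 0" "y = 0" by (simp_all flip: power2_eq_square)
qed

text \<open>The last two terms are the directions of a change of speed and of a time shift at the apsis.\<close>

lemma apsis_injective:
  assumes p: "p \<in> kep_dom" "cos (p $ 3) \<noteq> 0"
    and x: "apsis_x p \<delta> = 0" and v: "apsis_v p \<delta> + \<sigma> *\<^sub>R QQ p + \<rho> *\<^sub>R PP p = 0"
  shows "\<delta> = 0" "\<sigma> = 0" "\<rho> = 0"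
proof -
  have e: "\<bar>p $ 1\<bar> < 1" using p by (simp add: kep_dom_def)
  have r: "1 - p $ 1 \<noteq> 0" using e by simp
  have s: "peri_speed (p $ 1) \<noteq> 0" using peri_speed_sq(2)[OF e] by simp
  note a = apsis_frame[of p \<delta>, unfolded x]
  have d1: "\<delta> $ 1 = 0" using a(1) by simp
  have "(apsis_v p \<delta> + \<sigma> *\<^sub>R QQ p + \<rho> *\<^sub>R PP p) \<bullet> NN p = 0" using v by simp
  then have "apsis_v p \<delta> \<bullet> NN p = 0" by (simp add: inner_add_left frame_orthonormal)
  then have n: "(\<delta> $ 2 * cos (p $ 3)) * cos (p $ 4) - \<delta> $ 3 * sin (p $ 4) = 0" "(\<delta> $ 2 * cos (p $ 3)) * sin (p $ 4) + \<delta> $ 3 * cos (p $ 4) = 0"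
    using a(3) r s by (simp_all add: apsis_frame mult.assoc)
  \<comment> \<open>The tilt by \<open>p $ 2\<close> acts with the factor
    \<open>cos (p $ 3)\<close>; this is where the Euler angles have to be regular.\<close>
  from rotate_zero[OF n(2,1)] p have d23: "\<delta> $ 2 = 0" "\<delta> $ 3 = 0" by simp_all
  then have d4: "\<delta> $ 4 = 0" using a(2) r by simp
  show d: "\<delta> = 0" by (simp add: vec_eq_iff forall_4 d1 d23 d4)
  have "(apsis_v p \<delta> + \<sigma> *\<^sub>R QQ p + \<rho> *\<^sub>R PP p) \<bullet> QQ p = 0" "(apsis_v p \<delta> + \<sigma> *\<^sub>R QQ p + \<rho> *\<^sub>R PP p) \<bullet> PP p = 0" using v by simp_all
  then show "\<sigma> = 0" "\<rho> = 0" using d by (simp_all add: apsis_v_def inner_add_left frame_orthonormal)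
qed

text \<open>The six solutions of the Jacobi equation along a Kepler ellipse span its solution space.\<close>

lemma jacobi_span:
  assumes p: "p \<in> kep_dom" "cos (p $ 3) \<noteq> 0" "p $ 1 \<noteq> 0"
    and v: "\<And>\<delta>. \<beta> \<bullet> apsis_x p \<delta> = \<alpha> \<bullet> apsis_v p \<delta>"
    and t: "\<beta> \<bullet> kepv p 0 = - (\<alpha> \<bullet> fK (kep p 0))"
    and s: "\<beta> \<bullet> kep p 0 = - (1 / 2) * (\<alpha> \<bullet> kepv p 0)"
  shows "\<alpha> = 0" "\<beta> = 0"
proof -
  define r where "r = 1 - p $ 1"
  define s where "s = peri_speed (p $ 1)"
  have e: "\<bar>p $ 1\<bar> < 1" using p by (simp add: kep_dom_def)
  have r: "0 < r" using e by (simp add: r_def)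
  have sp: "0 < s" "s * s * r = 1 + p $ 1" using peri_speed_sq[OF e] by (simp_all add: s_def r_def)
  have sr: "s * s * r = 2 - r" using sp(2) by (simp add: r_def)
  define b1 b2 b3 a1 a2 a3 where ab: "b1 = \<beta> \<bullet> PP p" "b2 = \<beta> \<bullet> QQ p" "b3 = \<beta> \<bullet> NN p" "a1 = \<alpha> \<bullet> PP p" "a2 = \<alpha> \<bullet> QQ p" "a3 = \<alpha> \<bullet> NN p"
  have nz: "norm (kep p 0) = r" using e kep_norm[OF p(1), of 0] by (simp add: ecc_0 r_def)
  have "fK (kep p 0) = (1 / (r * r)) *\<^sub>R PP p" unfolding fK_def nz using r
    by (simp add: kep_0[OF p(1)] r_def[symmetric] power3_eq_cube)
  then have t': "s * b2 = - (a1 / (r * r))" using t by (simp add: kep_0[OF p(1)] s_def ab)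
  have s': "r * b1 = - (1 / 2) * (s * a2)" using s by (simp add: kep_0[OF p(1)] s_def r_def ab)
  have vv: "- (\<delta> $ 1) * b1 + r * (\<delta> $ 4 - \<delta> $ 2 * sin (p $ 3)) * b2 + r * (\<delta> $ 2 * (cos (p $ 3) * sin (p $ 4)) + \<delta> $ 3 * cos (p $ 4)) * b3
      = s * (\<delta> $ 2 * sin (p $ 3) - \<delta> $ 4) * a1 + (\<delta> $ 1 / (s * r\<^sup>2)) * a2 + s * (\<delta> $ 2 * (cos (p $ 3) * cos (p $ 4)) - \<delta> $ 3 * sin (p $ 4)) * a3" for \<delta> :: "real^4"
  proof -
    have l: "\<beta> \<bullet> apsis_x p \<delta> = - (\<delta> $ 1) * b1 + r * (\<delta> $ 4 - \<delta> $ 2 * sin (p $ 3)) * b2 + r * (\<delta> $ 2 * (cos (p $ 3) * sin (p $ 4)) + \<delta> $ 3 * cos (p $ 4)) * b3"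
      by (subst frame_expand[of "apsis_x p \<delta>" "p $ 2" "p $ 3" "p $ 4"]) (simp only: apsis_frame inner_add_right inner_scaleR_right ab r_def)
    have m: "\<alpha> \<bullet> apsis_v p \<delta> = s * (\<delta> $ 2 * sin (p $ 3) - \<delta> $ 4) * a1 + (\<delta> $ 1 / (s * r\<^sup>2)) * a2 + s * (\<delta> $ 2 * (cos (p $ 3) * cos (p $ 4)) - \<delta> $ 3 * sin (p $ 4)) * a3"
      by (subst frame_expand[of "apsis_v p \<delta>" "p $ 2" "p $ 3" "p $ 4"]) (simp only: apsis_frame inner_add_right inner_scaleR_right ab r_def s_def)
    show ?thesis using v[of \<delta>] unfolding l m .
  qed
  have ax: "(axis 1 1 :: real^4) $ 1 = 1" "(axis 1 1 :: real^4) $ 2 = 0" "(axis 1 1 :: real^4) $ 3 = 0" "(axis 1 1 :: real^4) $ 4 = 0"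
    "(axis 2 1 :: real^4) $ 1 = 0" "(axis 2 1 :: real^4) $ 2 = 1" "(axis 2 1 :: real^4) $ 3 = 0" "(axis 2 1 :: real^4) $ 4 = 0"
    "(axis 3 1 :: real^4) $ 1 = 0" "(axis 3 1 :: real^4) $ 2 = 0" "(axis 3 1 :: real^4) $ 3 = 1" "(axis 3 1 :: real^4) $ 4 = 0"
    "(axis 4 1 :: real^4) $ 1 = 0" "(axis 4 1 :: real^4) $ 2 = 0" "(axis 4 1 :: real^4) $ 3 = 0" "(axis 4 1 :: real^4) $ 4 = 1"
    by (simp_all add: axis_def)
  have v1: "- b1 = a2 / (s * r\<^sup>2)" using vv[of "axis 1 1"] by (simp add: ax)
  have v4: "r * b2 = - s * a1" using vv[of "axis 4 1"] by (simp add: ax)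
  have v3: "r * cos (p $ 4) * b3 = - s * sin (p $ 4) * a3" using vv[of "axis 3 1"] by (simp add: ax)
  have v2: "r * (- sin (p $ 3)) * b2 + r * (cos (p $ 3) * sin (p $ 4)) * b3 = s * sin (p $ 3) * a1 + s * (cos (p $ 3) * cos (p $ 4)) * a3"
    using vv[of "axis 2 1"] by (simp add: ax)
  have "a2 = - b1 * (s * (r * r))" using v1 sp(1) r by (simp add: field_simps power2_eq_square)
  note a2 = this
  \<comment> \<open>The eccentricity variation against the scaling variation: by
    \<open>s * s * r = 2 - r\<close> they are independent on every ellipse.\<close>
  then have "2 * b1 = (s * s * r) * b1" using s' r by (simp add: field_simps)
  then have "r * b1 = 0" unfolding sr by (simp add: algebra_simps)
  then have z1: "b1 = 0" "a2 = 0" using r a2 by simp_all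
  have "a1 = - (s * b2) * (r * r)" using t' r by (simp add: field_simps)
  note a1 = this
  \<comment> \<open>Rotation in the orbital plane against time shift. The relation reads
    \<open>b2 = (1 + e) * b2\<close>; on a circle the two motions coincide, so the eccentricity must
    not vanish.\<close>
  then have "b2 = (s * s * r) * b2" using v4 r by (simp add: field_simps)
  then have "p $ 1 * b2 = 0" unfolding sp(2) by (simp add: algebra_simps)
  then have z2: "b2 = 0" "a1 = 0" using p(3) a1 by simp_all
  have "cos (p $ 3) * (r * b3 * sin (p $ 4)) = cos (p $ 3) * (s * a3 * cos (p $ 4))" using v2 z2 by (simp add: mult_ac)
  then have "r * b3 * sin (p $ 4) - s * a3 * cos (p $ 4) = 0" using p(2) by simp
  moreover have "r * b3 * cos (p $ 4) + s * a3 * sin (p $ 4) = 0" using v3 by (simp add: mult_ac)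
  ultimately have "r * b3 = 0" "- (s * a3) = 0"
    using rotate_zero[of "r * b3" "p $ 4" "- (s * a3)"] by simp_all
  then have z3: "b3 = 0" "a3 = 0" using r sp(1) by simp_all
  show "\<alpha> = 0" "\<beta> = 0" using z1 z2 z3 unfolding ab by (auto intro: frame_zero)
qed

section \<open>The Jacobi equation along an ellipse\<close>

definition jacobi :: "real^4 \<Rightarrow> (real \<Rightarrow> real^3) \<Rightarrow> (real \<Rightarrow> real^3) \<Rightarrow> bool" where
  "jacobi p k k' \<longleftrightarrow> (\<forall>t\<in>{0..2 * pi}. (k has_vector_derivative k' t) (at t within {0..2 * pi}) \<and>
     (k' has_vector_derivative - Kf (kep p t) (k t)) (at t within {0..2 * pi}))"

text \<open>Green's identity for \<open>v t = t *\<^sub>R b + Jop (Jop h) t\<close>: the expression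
  \<open>v' . k - v . k'\<close> is differentiated, and the symmetry of \<open>Kf\<close> leaves the
  integrand. As \<open>v 0 = 0\<close>, only \<open>v' 0 = b\<close> survives at the initial
  end.\<close>

lemma jacobi_green:
  fixes h :: path and b :: "real^3"
  assumes k: "jacobi p k k'"
  shows "((\<lambda>t. (h t + Kf (kep p t) (t *\<^sub>R b + Jop (Jop h) t)) \<bullet> k t) has_integral
    (b + Jop h (2 * pi)) \<bullet> k (2 * pi) - b \<bullet> k 0 - ((2 * pi) *\<^sub>R b + Jop (Jop h) (2 * pi)) \<bullet> k' (2 * pi)) {0..2 * pi}"
proof -
  let ?I = "{0..2 * pi}"
  let ?F = "\<lambda>t. (b + Jop h t) \<bullet> k t - (t *\<^sub>R b + Jop (Jop h) t) \<bullet> k' t"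
  have "(?F has_vector_derivative (h t + Kf (kep p t) (t *\<^sub>R b + Jop (Jop h) t)) \<bullet> k t) (at t within ?I)" if t: "t \<in> ?I" for t
  proof -
    have 1: "((\<lambda>t. b + Jop h t) has_vector_derivative 0 + h t) (at t within ?I)"
      by (rule has_vector_derivative_add[OF has_vector_derivative_const Jop_deriv[OF t]])
    have 2: "((\<lambda>t. t *\<^sub>R b + Jop (Jop h) t) has_vector_derivative 1 *\<^sub>R b + Jop h t) (at t within ?I)"
      by (rule has_vector_derivative_add[OF _ Jop_deriv[OF t]]) (auto intro!: derivative_eq_intros)
    have 3: "(k has_vector_derivative k' t) (at t within ?I)" "(k' has_vector_derivative - Kf (kep p t) (k t)) (at t within ?I)"
      using k t by (auto simp: jacobi_def)
    have "(?F has_vector_derivative (((b + Jop h t) \<bullet> k' t + (0 + h t) \<bullet> k t)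
       - ((t *\<^sub>R b + Jop (Jop h) t) \<bullet> (- Kf (kep p t) (k t)) + (1 *\<^sub>R b + Jop h t) \<bullet> k' t))) (at t within ?I)"
      by (intro has_vector_derivative_diff bounded_bilinear.has_vector_derivative[OF bounded_bilinear_inner] 1 2 3)
    moreover have "(((b + Jop h t) \<bullet> k' t + (0 + h t) \<bullet> k t)
       - ((t *\<^sub>R b + Jop (Jop h) t) \<bullet> (- Kf (kep p t) (k t)) + (1 *\<^sub>R b + Jop h t) \<bullet> k' t))
       = (h t + Kf (kep p t) (t *\<^sub>R b + Jop (Jop h) t)) \<bullet> k t"
      by (simp add: inner_add_left Kf_sym)
    ultimately show ?thesis by simp
  qed
  from fundamental_theorem_of_calculus[OF _ this] show ?thesis by (simp add: inner_add_left algebra_simps)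
qed

definition tclamp :: "real \<Rightarrow>\<^sub>C real" where
  "tclamp = clampf (\<lambda>t. t)"

lemma tclamp_apply: "tclamp t = clampt t"
  unfolding tclamp_def by (subst clampf_apply) (auto intro: continuous_intros)

lemma bounded_linear_const_bcontfun: "bounded_linear (const_bcontfun :: 'b::real_normed_vector \<Rightarrow> real \<Rightarrow>\<^sub>C 'b)"
proof (rule bounded_linear_intro[where K = 1])
  show "norm (const_bcontfun x :: real \<Rightarrow>\<^sub>C 'b) \<le> norm x * 1" for x :: 'b by (rule norm_bound) simp
qed (auto intro!: bcontfun_eqI)

definition tpath :: "'b::real_normed_vector \<Rightarrow> real \<Rightarrow>\<^sub>C 'b" where
  "tpath z = bc_bil scaleR tclamp (const_bcontfun z)"

lemma tpath_apply: "tpath z t = clampt t *\<^sub>R z"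
  by (simp add: tpath_def bc_bil_apply[OF bounded_bilinear_scaleR] tclamp_apply)

lemma bounded_linear_tpath: "bounded_linear tpath"
  unfolding tpath_def
  by (rule bounded_linear_compose[OF bounded_bilinear.bounded_linear_right[OF bounded_bilinear_bc_bil[OF bounded_bilinear_scaleR]] bounded_linear_const_bcontfun])

text \<open>Time and parameter are fed to the superposition operator as components of one path, so
  \<open>C1_on_Nem\<close> gives \<open>C^1\<close> dependence on \<open>p\<close> uniformly in
  time.\<close>

definition par_path :: "(real^4 \<Rightarrow> real \<Rightarrow> real^3) \<Rightarrow> real^4 \<Rightarrow> path" where
  "par_path f p = Nem (\<lambda>z. f (snd z) (fst z)) (tpath (1, 0) + const_bcontfun (0, p))"

lemma par_dom:
  fixes p :: "real^4"
  assumes "p \<in> kep_dom" shows "tpath (1, 0) + const_bcontfun (0, p) \<in> nem_dom ((UNIV :: real set) \<times> kep_dom)"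
  by (rule nem_domI[of "\<lambda>t. (t, p)"]) (auto simp: assms intro!: continuous_intros simp: tpath_apply)

lemma open_par_dom: "open ((UNIV :: real set) \<times> kep_dom)"
  by (intro open_Times open_kep_dom open_UNIV)

lemma
  assumes f: "C1_on (UNIV \<times> kep_dom) (\<lambda>z. f (snd z) (fst z))"
  shows par_path_apply: "p \<in> kep_dom \<Longrightarrow> par_path f p t = f p (clampt t)"
    and C1_par_path: "C1_on kep_dom (par_path f)"
proof -
  show "p \<in> kep_dom \<Longrightarrow> par_path f p t = f p (clampt t)"
    unfolding par_path_def by (subst Nem_apply[OF C1_on_imp_continuous_on[OF f] par_dom]) (simp_all add: tpath_apply)
  show "C1_on kep_dom (par_path f)"
    unfolding par_path_def
    by (rule C1_on_compose[OF _ C1_on_Nem[OF f open_par_dom] par_dom], assumption?)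
      (intro C1_intros C1_on_linear_compose[OF bounded_linear_const_bcontfun])
qed

lemma C1_kepv:
  assumes "C1_on S t" "C1_on S p" "\<And>x. x \<in> S \<Longrightarrow> p x \<in> kep_dom"
  shows "C1_on S (\<lambda>x. kepv (p x) (t x))"
  unfolding kepv_def using rho_pos assms(3)
  by (intro C1_intros C1_ecc C1_kepler_c assms) (fastforce simp: kep_dom_def less_imp_neq[symmetric])+

lemma par_kep: "C1_on (UNIV \<times> kep_dom) (\<lambda>z. kep (snd z) (fst z))" "C1_on (UNIV \<times> kep_dom) (\<lambda>z. kepv (snd z) (fst z))"
  by (intro C1_kep C1_kepv C1_intros; auto)+

abbreviation kep_path :: "real^4 \<Rightarrow> path" where "kep_path \<equiv> par_path kep"
abbreviation kepv_path :: "real^4 \<Rightarrow> path" where "kepv_path \<equiv> par_path kepv"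

lemmas kep_path_apply = par_path_apply[OF par_kep(1)]
lemmas kepv_path_apply = par_path_apply[OF par_kep(2)]
lemmas C1_kep_path = C1_par_path[OF par_kep(1)]
lemmas C1_kepv_path = C1_par_path[OF par_kep(2)]

lemma kep_cont: "p \<in> kep_dom \<Longrightarrow> continuous_on S (kep p)" "p \<in> kep_dom \<Longrightarrow> continuous_on S (kepv p)"
  by (auto intro!: continuous_at_imp_continuous_on has_vector_derivative_continuous[OF kep_deriv] has_vector_derivative_continuous[OF kepv_deriv])

lemma kep_path_dom: "p \<in> kep_dom \<Longrightarrow> (\<And>t. kep p t \<in> S) \<Longrightarrow> kep_path p \<in> nem_dom S"
  by (rule nem_domI[of "kep p"]) (auto simp: kep_path_apply kep_cont)

lemma C1_fK': "C1_on (- {0}) fK"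
  using C1_fK[of "- {0}" "\<lambda>x. x"] by (simp add: C1_intros)

lemma Nem_fK_kep: "p \<in> kep_dom \<Longrightarrow> Nem fK (kep_path p) t = fK (kep p (clampt t))"
  by (subst Nem_apply[OF C1_on_imp_continuous_on[OF C1_fK'] kep_path_dom]) (auto simp: kep_nonzero kep_path_apply)

lemma Jop_clampt: "Jop h (clampt t) = Jop h t" for h :: "real \<Rightarrow>\<^sub>C 'b::banach"
  by (simp add: Jop_apply)

text \<open>The Kepler equation in integrated form. Every term is \<open>C^1\<close> in
  \<open>p\<close>, so it can be differentiated in the parameters without interchanging derivatives
  in \<open>t\<close> and \<open>p\<close>.\<close>

lemma kep_path_identity:
  assumes p: "p \<in> kep_dom"
  shows "kep_path p = const_bcontfun (kep p 0) + tpath (kepv p 0) - Jop (Jop (Nem fK (kep_path p)))"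
    "Jop (Nem fK (kep_path p)) (2 * pi) = 0"
proof -
  let ?I = "{0..2 * pi}" and ?f = "Nem fK (kep_path p)"
  have v: "kepv p t - kepv p 0 = - Jop ?f t" if "t \<in> ?I" for t
    using Jop_FTC[of "kepv p" "- ?f" t] kepv_deriv[OF p] that
    by (simp add: Nem_fK_kep[OF p] blinfun.minus_right has_vector_derivative_at_within)
  show "Jop ?f (2 * pi) = 0" using v[of "2 * pi"] kep_periodic(2)[OF p, of 0] by simp
  have "kep p t - t *\<^sub>R kepv p 0 - kep p 0 = - Jop (Jop ?f) t" if t: "t \<in> ?I" for t
  proof -
    have "((\<lambda>t. kep p t - t *\<^sub>R kepv p 0) has_vector_derivative (- Jop ?f) s) (at s within ?I)" if "s \<in> ?I" for s
    proof -
      have "((\<lambda>t. kep p t - t *\<^sub>R kepv p 0) has_vector_derivative kepv p s - 1 *\<^sub>R kepv p 0) (at s within ?I)"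
        by (intro has_vector_derivative_diff has_vector_derivative_at_within[OF kep_deriv[OF p]])
          (auto intro!: derivative_eq_intros)
      then show ?thesis using v[OF that] by simp
    qed
    from Jop_FTC[OF this t] show ?thesis by (simp add: blinfun.minus_right)
  qed
  note x = this
  show "kep_path p = const_bcontfun (kep p 0) + tpath (kepv p 0) - Jop (Jop ?f)"
  proof (rule bcontfun_eqI)
    fix t show "kep_path p t = (const_bcontfun (kep p 0) + tpath (kepv p 0) - Jop (Jop ?f)) t"
      using x[OF clampt_in(1), of t] by (simp add: kep_path_apply[OF p] tpath_apply Jop_clampt algebra_simps)
  qed
qed

text \<open>Differentiating \<open>kep_path_identity\<close> in \<open>p\<close>: the first identity
  gives the Jacobi equation with its initial data, the second the periodicity of the velocity
  variation. The variations close up because all ellipses have the same period.\<close>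

lemma jacobi_variation:
  assumes p: "p \<in> kep_dom"
  obtains k' where "jacobi p (fderiv kep_path p \<delta>) k'" "k' 0 = apsis_v p \<delta>" "k' (2 * pi) = apsis_v p \<delta>"
    "fderiv kep_path p \<delta> 0 = apsis_x p \<delta>" "fderiv kep_path p \<delta> (2 * pi) = apsis_x p \<delta>"
proof -
  define k where "k = fderiv kep_path p"
  have dom: "kep_path p \<in> nem_dom (- {0})" if "p \<in> kep_dom" for p using that by (intro kep_path_dom) (auto simp: kep_nonzero)
  have o: "open (- {0 :: real^3})" by (rule open_Compl) simp
  define q where "q = fderiv (Nem fK) (kep_path p)"
  have q: "q x t = Kf (kep p (clampt t)) (x t)" for x t
  proof -
    have "fderiv fK (kep p (clampt t)) (x t) = Kf (kep p (clampt t)) (x t)"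
      using has_derivative_unique[OF C1_on_has_derivative[OF C1_fK'] fK_has_derivative] kep_nonzero[OF p] by simp
    then show ?thesis unfolding q_def by (simp add: fderiv_Nem[OF C1_fK' o dom[OF p]] kep_path_apply[OF p])
  qed
  have K: "(kep_path has_derivative k) (at p)" unfolding k_def by (rule C1_on_has_derivative[OF C1_kep_path p])
  have D: "((\<lambda>p. Nem fK (kep_path p)) has_derivative (\<lambda>\<delta>. q (k \<delta>))) (at p)"
    unfolding q_def by (rule has_derivative_compose[OF K C1_on_has_derivative[OF C1_on_Nem[OF C1_fK' o] dom[OF p]]])
  note J = bounded_linear.has_derivative[OF blinfun.bounded_linear_right]
  have "((\<lambda>p. const_bcontfun (kep p 0) + tpath (kepv p 0) - Jop (Jop (Nem fK (kep_path p)))) has_derivative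
     (\<lambda>\<delta>. const_bcontfun (apsis_x p \<delta>) + tpath (apsis_v p \<delta>) - Jop (Jop (q (k \<delta>))))) (at p)"
    by (intro has_derivative_add has_derivative_diff bounded_linear.has_derivative[OF bounded_linear_const_bcontfun]
        bounded_linear.has_derivative[OF bounded_linear_tpath] peri_has_derivative(3,4)[OF p] J[OF J[OF D]])
  from has_derivative_transform_within_open[OF this open_kep_dom p, of kep_path]
  have "(kep_path has_derivative (\<lambda>\<delta>. const_bcontfun (apsis_x p \<delta>) + tpath (apsis_v p \<delta>) - Jop (Jop (q (k \<delta>))))) (at p)"
    using kep_path_identity(1) by metis
  from fun_cong[OF has_derivative_unique[OF K this]]
  have k: "k \<delta> = const_bcontfun (apsis_x p \<delta>) + tpath (apsis_v p \<delta>) - Jop (Jop (q (k \<delta>)))" .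
  have "((\<lambda>p. Jop (Nem fK (kep_path p)) (2 * pi)) has_derivative (\<lambda>\<delta>. Jop (q (k \<delta>)) (2 * pi))) (at p)"
    by (rule bounded_linear.has_derivative[OF bounded_linear_bc_apply J[OF D]])
  from has_derivative_transform_within_open[OF this open_kep_dom p, of "\<lambda>_. 0"]
  have "((\<lambda>_. 0) has_derivative (\<lambda>\<delta>. Jop (q (k \<delta>)) (2 * pi))) (at p)" by (simp add: kep_path_identity(2))
  from fun_cong[OF has_derivative_unique[OF this has_derivative_const]]
  have q0: "Jop (q (k \<delta>)) (2 * pi) = 0" by simp
  have "((\<lambda>p. kep_path p (2 * pi)) has_derivative (\<lambda>\<delta>. k \<delta> (2 * pi))) (at p)"
    by (rule bounded_linear.has_derivative[OF bounded_linear_bc_apply K])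
  from has_derivative_transform_within_open[OF this open_kep_dom p, of "\<lambda>p. kep p 0"]
  have "((\<lambda>p. kep p 0) has_derivative (\<lambda>\<delta>. k \<delta> (2 * pi))) (at p)"
    using kep_periodic(1)[of _ 0] by (simp add: kep_path_apply)
  from fun_cong[OF has_derivative_unique[OF this peri_has_derivative(3)[OF p]]]
  have k2: "k \<delta> (2 * pi) = apsis_x p \<delta>" .
  have kt: "k \<delta> t = apsis_x p \<delta> + clampt t *\<^sub>R apsis_v p \<delta> - Jop (Jop (q (k \<delta>))) t" for t
    by (subst k) (simp add: tpath_apply)
  let ?k' = "\<lambda>t. apsis_v p \<delta> - Jop (q (k \<delta>)) t"
  have "jacobi p (k \<delta>) ?k'"
    unfolding jacobi_def
  proof (intro ballI conjI)
    fix t assume t: "t \<in> {0..2 * pi}"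
    have "((\<lambda>t. apsis_x p \<delta> + t *\<^sub>R apsis_v p \<delta> - Jop (Jop (q (k \<delta>))) t) has_vector_derivative 0 + 1 *\<^sub>R apsis_v p \<delta> - Jop (q (k \<delta>)) t) (at t within {0..2 * pi})"
      by (intro has_vector_derivative_diff Jop_deriv t has_vector_derivative_add has_vector_derivative_const)
        (auto intro!: derivative_eq_intros)
    then show "(k \<delta> has_vector_derivative ?k' t) (at t within {0..2 * pi})"
      by (rule has_vector_derivative_transform[OF t, rotated, THEN has_vector_derivative_eq_rhs]) (simp_all add: kt)
    have "(?k' has_vector_derivative 0 - q (k \<delta>) t) (at t within {0..2 * pi})"
      by (intro has_vector_derivative_diff Jop_deriv t has_vector_derivative_const)
    then show "(?k' has_vector_derivative - Kf (kep p t) (k \<delta> t)) (at t within {0..2 * pi})"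
      using t by (simp add: q)
  qed
  then show ?thesis using that[of ?k'] k2 q0 kt[of 0] unfolding k_def by simp
qed

lemma jacobi_kepv:
  assumes p: "p \<in> kep_dom" shows "jacobi p (kepv p) (\<lambda>t. - fK (kep p t))"
proof -
  have "((\<lambda>t. fK (kep p t)) has_vector_derivative Kf (kep p t) (kepv p t)) (at t)" for t
    unfolding has_vector_derivative_def
    by (rule has_derivative_eq_rhs[OF has_derivative_compose[OF kep_deriv[OF p, unfolded has_vector_derivative_def]
          fK_has_derivative[OF kep_nonzero[OF p]]]])
      (simp add: fun_eq_iff linear_scale[OF bounded_linear.linear[OF bounded_linear_Kf]])
  from has_vector_derivative_minus[OF this] show ?thesis
    unfolding jacobi_def using kepv_deriv[OF p] by (simp add: has_vector_derivative_at_within)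
qed

text \<open>The variation of the ellipse under the scaling symmetry \<open>u \<mapsto> a u (a powr (- 3 / 2) t)\<close> of
  the Kepler problem.\<close>

definition scal :: "real^4 \<Rightarrow> real \<Rightarrow> real^3" where
  "scal p t = kep p t - (3 / 2 * t) *\<^sub>R kepv p t"

definition scal' :: "real^4 \<Rightarrow> real \<Rightarrow> real^3" where
  "scal' p t = - (1 / 2) *\<^sub>R kepv p t + (3 / 2 * t) *\<^sub>R fK (kep p t)"

lemma jacobi_scal:
  assumes p: "p \<in> kep_dom" shows "jacobi p (scal p) (scal' p)"
  unfolding jacobi_def
proof (intro ballI conjI)
  fix t assume t: "t \<in> {0..2 * pi}"
  let ?F = "at t within {0..2 * pi}"
  have k: "(kep p has_vector_derivative kepv p t) ?F" "(kepv p has_vector_derivative - fK (kep p t)) ?F"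
    "((\<lambda>t. - fK (kep p t)) has_vector_derivative - Kf (kep p t) (kepv p t)) ?F"
    using jacobi_kepv[OF p] t kep_deriv[OF p] by (auto simp: jacobi_def has_vector_derivative_at_within)
  from has_vector_derivative_minus[OF k(3)] have k3: "((\<lambda>t. fK (kep p t)) has_vector_derivative Kf (kep p t) (kepv p t)) ?F" by simp
  have m: "((\<lambda>t. 3 / 2 * t) has_real_derivative 3 / 2) ?F" by (auto intro!: derivative_eq_intros)
  from has_vector_derivative_diff[OF k(1) has_vector_derivative_scaleR[OF m k(2)]]
  show "(scal p has_vector_derivative scal' p t) ?F"
    unfolding scal_def[abs_def] scal'_def by (rule has_vector_derivative_eq_rhs)
      (simp add: vec_eq_iff field_simps)
  have K: "Kf (kep p t) (scal p t) = - 2 *\<^sub>R fK (kep p t) - (3 / 2 * t) *\<^sub>R Kf (kep p t) (kepv p t)"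
    using linear_diff[OF bounded_linear.linear[OF bounded_linear_Kf]] linear_scale[OF bounded_linear.linear[OF bounded_linear_Kf]]
    by (simp add: scal_def Kf_self[OF kep_nonzero[OF p]])
  from has_vector_derivative_add[OF has_vector_derivative_scaleR[OF DERIV_const k(2), of "- (1 / 2)"] has_vector_derivative_scaleR[OF m k3]]
  show "(scal' p has_vector_derivative - Kf (kep p t) (scal p t)) ?F"
    unfolding scal'_def[abs_def] K by (rule has_vector_derivative_eq_rhs)
      (simp add: vec_eq_iff field_simps)
qed

text \<open>The drift by \<open>3 * pi\<close> velocities over one period is the derivative of the
  period \<open>2 * pi * a powr (3 / 2)\<close> of Kepler's third law at
  \<open>a = 1\<close>.\<close>

lemma scal_ends:
  assumes p: "p \<in> kep_dom"
  shows "scal p 0 = kep p 0" "scal' p 0 = - (1 / 2) *\<^sub>R kepv p 0"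
    "scal p (2 * pi) = kep p 0 - (3 * pi) *\<^sub>R kepv p 0" "scal' p (2 * pi) = - (1 / 2) *\<^sub>R kepv p 0 + (3 * pi) *\<^sub>R fK (kep p 0)"
  using kep_periodic[OF p, of 0] by (simp_all add: scal_def scal'_def)

section \<open>The bifurcation equation\<close>

lemma linear_injective_inverse:
  fixes f :: "'a::euclidean_space \<Rightarrow> 'b::euclidean_space"
  assumes f: "linear f" and inj: "\<And>x. f x = 0 \<Longrightarrow> x = 0" and dim: "DIM('a) = DIM('b)"
  obtains g where "bounded_linear g" "\<And>x. g (f x) = x" "\<And>y. f (g y) = y"
proof -
  have i: "inj f" using inj by (simp add: linear_injective_0[OF f])
  obtain g where g: "linear g" "g \<circ> f = id" using linear_injective_left_inverse[OF f i] by blast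
  have "dim (range f) = DIM('b)" using dim_image_eq[OF f, of UNIV] i dim by (simp add: inj_on_subset)
  then have "span (range f) = UNIV" by (simp add: dim_eq_full)
  moreover have "span (range f) = range f" using f by (simp add: linear_span_image)
  ultimately have "f (g y) = y" for y using g(2) by (metis UNIV_I comp_apply id_apply imageE)
  then show ?thesis using that[of g] g by (simp add: linear_conv_bounded_linear fun_eq_iff)
qed

text \<open>On the infinite-dimensional factor only the block \<open>V\<close> acts, and
  \<open>W\<close> inverts it. Eliminating the first component leaves the Schur complement
  \<open>S\<close> between spaces of equal finite dimension, where injectivity already gives
  bijectivity.\<close>

lemma schur_inverse:
  fixes D :: "('a::banach \<times> 'b::euclidean_space) \<Rightarrow>\<^sub>L ('a \<times> 'c::euclidean_space)" and W :: "'a \<Rightarrow>\<^sub>L 'a"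
  assumes V: "\<And>h. fst (D (h, 0)) = V h" and W: "\<And>h. W (V h) = h" "\<And>h. V (W h) = h"
    and inj: "\<And>z. D z = 0 \<Longrightarrow> z = 0" and dim: "DIM('b) = DIM('c)"
  obtains T :: "('a \<times> 'c) \<Rightarrow>\<^sub>L ('a \<times> 'b)" where "\<And>z. T (D z) = z" "\<And>z. D (T z) = z"
proof -
  define B where "B y = fst (D (0, y))" for y
  define S where "S y = snd (D (- W (B y), y))" for y
  have split: "D (h, y) = D (h, 0) + D (0, y)" for h y by (simp flip: blinfun.add_right)
  have lB: "bounded_linear B" unfolding B_def
    by (intro bounded_linear_compose[OF bounded_linear_fst] bounded_linear_compose[OF blinfun.bounded_linear_right] bounded_linear_Pair bounded_linear_zero bounded_linear_ident)
  have lS: "bounded_linear S" unfolding S_def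
    by (intro bounded_linear_compose[OF bounded_linear_snd] bounded_linear_compose[OF blinfun.bounded_linear_right] bounded_linear_Pair bounded_linear_minus lB bounded_linear_ident)
  have DS: "D (- W (B y), y) = (0, S y)" for y
  proof -
    have "fst (D (- W (B y), y)) = 0"
      using blinfun.minus_right[of D "(W (B y), 0)"] by (subst split) (simp add: V[of "W (B y)"] W(2) flip: B_def)
    then show ?thesis by (simp add: S_def prod_eq_iff)
  qed
  have "y = 0" if "S y = 0" for y using inj[of "(- W (B y), y)"] DS[of y] that by (simp add: prod_eq_iff)
  then obtain R where R: "bounded_linear R" "\<And>x. R (S x) = x" "\<And>y. S (R y) = y"
    using linear_injective_inverse[OF bounded_linear.linear[OF lS] _ dim] by metis
  define N where "N z = R (snd z - snd (D (W (fst z), 0)))" for z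
  have lN: "bounded_linear N" unfolding N_def
    by (intro bounded_linear_compose[OF R(1)] bounded_linear_sub bounded_linear_snd bounded_linear_compose[OF bounded_linear_snd bounded_linear_compose[OF blinfun.bounded_linear_right]]
       bounded_linear_Pair bounded_linear_zero bounded_linear_compose[OF blinfun.bounded_linear_right] bounded_linear_fst)
  define T where "T z = (W (fst z) - W (B (N z)), N z)" for z
  have lT: "bounded_linear T" unfolding T_def
    by (intro bounded_linear_Pair bounded_linear_sub bounded_linear_compose[OF blinfun.bounded_linear_right] bounded_linear_fst lN bounded_linear_compose[OF lB lN])
  have DT: "D (T z) = z" for z
  proof -
    have "D (T z) = D (W (fst z), 0) + D (- W (B (N z)), N z)" by (simp add: T_def flip: blinfun.add_right)
    also have "\<dots> = z" using V[of "W (fst z)"] by (simp add: DS prod_eq_iff W(2)) (simp add: N_def R(3))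
    finally show ?thesis .
  qed
  have TD: "T (D z) = z" for z
  proof -
    have "D (T (D z) - z) = 0" by (simp add: blinfun.diff_right DT)
    from inj[OF this] show ?thesis by simp
  qed
  show ?thesis using that[of "Blinfun T"] TD DT by (simp add: bounded_linear_Blinfun_apply[OF lT])
qed

section \<open>Pairings over one period\<close>

definition pair :: "path \<Rightarrow> path \<Rightarrow> real" where
  "pair f g = Jop (bc_bil inner f g) (2 * pi)"

lemma pair_eq:
  fixes f g :: path
  shows "pair f g = integral {0..2 * pi} (\<lambda>t. f t \<bullet> g t)"
proof -
  have "apply_bcontfun (bc_bil inner f g) = (\<lambda>t. f t \<bullet> g t)"
    by (rule ext) (rule bc_bil_apply[OF bounded_bilinear_inner])
  then show ?thesis unfolding pair_def Jop_apply by simp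
qed

lemma pair_has_integral:
  fixes f g :: path
  shows "((\<lambda>t. f t \<bullet> g t) has_integral pair f g) {0..2 * pi}"
  unfolding pair_eq by (intro integrable_integral integrable_continuous_interval continuous_intros)

lemma tendsto_pair:
  fixes f g :: "'a \<Rightarrow> path"
  shows "(f \<longlongrightarrow> a) F \<Longrightarrow> (g \<longlongrightarrow> b) F \<Longrightarrow> ((\<lambda>x. pair (f x) (g x)) \<longlongrightarrow> pair a b) F"
  unfolding pair_def
  by (intro bounded_linear.tendsto[OF bounded_linear_bc_apply] blinfun.tendsto tendsto_const
      bounded_bilinear.tendsto[OF bounded_bilinear_bc_bil[OF bounded_bilinear_inner]])

lemma pair_scaleR:
  fixes f g :: path
  shows "pair (c *\<^sub>R f) g = c * pair f g"
  unfolding pair_eq by (simp add: integral_mult_right)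

lemma pair_0:
  fixes g :: path
  shows "pair 0 g = 0"
  unfolding pair_eq by simp

definition ring_dom :: "(real^3^3) set \<Rightarrow> (real^4) set" where
  "ring_dom H = {p \<in> kep_dom. kep_path p \<in> nem_dom (Dom H)}"

lemma open_ring_dom:
  assumes "finite H" shows "open (ring_dom H)"
proof -
  have "open (kep_dom \<inter> kep_path -` nem_dom (Dom H))"
    by (intro continuous_open_preimage C1_on_imp_continuous_on[OF C1_kep_path] open_kep_dom open_nem_dom open_Dom assms)
  then show ?thesis by (simp add: ring_dom_def Int_def vimage_def)
qed

lemma ring_dom_kep: "p \<in> ring_dom H \<Longrightarrow> p \<in> kep_dom"
  by (simp add: ring_dom_def)

lemma ring_dom_Dom: assumes "p \<in> ring_dom H" shows "kep p t \<in> Dom H"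
proof -
  have "kep_path p (per t) \<in> Dom H" using assms by (auto simp: ring_dom_def nem_dom_def)
  then have "kep p (per t) \<in> Dom H" using kep_path_apply[OF ring_dom_kep[OF assms], of "per t"] by simp
  then show ?thesis using periodic_per[of "kep p" t] kep_periodic(1)[OF ring_dom_kep[OF assms]] by simp
qed

lemma ring_domI: "p \<in> kep_dom \<Longrightarrow> (\<And>t. kep p t \<in> Dom H) \<Longrightarrow> p \<in> ring_dom H"
  unfolding ring_dom_def using kep_path_dom by blast

abbreviation gpath :: "(real^3^3) set \<Rightarrow> (real^4) \<Rightarrow> path" where
  "gpath H p \<equiv> Nem (gH H) (kep_path p)"

lemma C1_gH': "C1_on (Dom H) (gH H)"
  using C1_gH[of "Dom H" "\<lambda>x. x" H] by (simp add: C1_intros)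

lemma gpath_apply: "p \<in> ring_dom H \<Longrightarrow> gpath H p t = gH H (kep p (clampt t))"
  using Nem_apply[OF C1_on_imp_continuous_on[OF C1_gH'], of "kep_path p" H t] kep_path_apply[of p t]
  by (simp add: ring_dom_def)

text \<open>The integrand is minus the time derivative of \<open>WH\<close> along a closed curve; in
  other words, the perturbing action is invariant under time translation.\<close>

lemma gpath_kepv:
  assumes H: "rotation_group H" and p: "p \<in> ring_dom H"
  shows "pair (gpath H p) (kepv_path p) = 0"
proof -
  note k = ring_dom_kep[OF p]
  have "((\<lambda>t. WH H (kep p t)) has_vector_derivative - (gH H (kep p t) \<bullet> kepv p t)) (at t within {0..2 * pi})" for t
    unfolding has_vector_derivative_def
    by (rule has_derivative_at_withinI, rule has_derivative_eq_rhs[OF has_derivative_compose[OF kep_deriv[OF k, unfolded has_vector_derivative_def]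
          WH_has_derivative[OF H ring_dom_Dom[OF p]]]]) (simp add: fun_eq_iff)
  from fundamental_theorem_of_calculus[OF _ this]
  have "((\<lambda>t. - (gH H (kep p t) \<bullet> kepv p t)) has_integral 0) {0..2 * pi}"
    using kep_periodic(1)[OF k, of 0] by simp
  then have "((\<lambda>t. gH H (kep p t) \<bullet> kepv p t) has_integral 0) {0..2 * pi}"
    by (simp add: has_integral_neg_iff)
  then have "((\<lambda>t. gpath H p t \<bullet> kepv_path p t) has_integral 0) {0..2 * pi}"
    by (rule has_integral_eq[rotated]) (use p k in \<open>simp add: gpath_apply kepv_path_apply\<close>)
  then show ?thesis using pair_has_integral has_integral_unique by blast
qed

text \<open>Minus the directional derivative of the reduced action on collision-free ellipses of
  positive eccentricity, by \<open>reduced_action_derivative\<close>. In this form it is a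
  boundary-free term of Green's identity.\<close>

definition melnikov :: "(real^3^3) set \<Rightarrow> (real^4) \<Rightarrow> (real^4) \<Rightarrow> real" where
  "melnikov H p \<delta> = pair (gpath H p) (fderiv kep_path p \<delta>)"

section \<open>The blown-up equation\<close>

type_synonym unknown = "path \<times> ((real^4) \<times> real)"

text \<open>A curve near \<open>kep p\<close> is sought as \<open>kep p t + \<epsilon> v t\<close>, where \<open>v\<close> has initial values \<open>0\<close> and
  \<open>\<kappa> QQ p\<close> and second derivative \<open>h\<close>; this fixes the phase by an apsis at time \<open>0\<close>. \<close>

definition vpath :: "unknown \<Rightarrow> path" where
  "vpath \<theta> = tpath (snd (snd \<theta>) *\<^sub>R QQ (fst (snd \<theta>))) + Jop (Jop (fst \<theta>))"

definition emb :: "(real^3) \<Rightarrow>\<^sub>L (real \<times> ((real^3) \<times> ((real^4) \<times> real)))" where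
  "emb = Blinfun (\<lambda>v. (0, (v, 0)))"

text \<open>Time, blown-up curve, ellipse parameters and small parameter travel together as one
  bounded continuous function, so the whole nonlinearity is a single superposition operator,
  \<open>C^1\<close> jointly in all unknowns.\<close>

definition arg_path :: "unknown \<times> real \<Rightarrow> real \<Rightarrow>\<^sub>C (real \<times> ((real^3) \<times> ((real^4) \<times> real)))" where
  "arg_path z = tpath (1, 0) + bc_bil blinfun_apply (const_bcontfun emb) (vpath (fst z))
     + const_bcontfun (0, (0, (fst (snd (fst z)), snd z)))"

definition rhs :: "(real^3^3) set \<Rightarrow> real \<times> ((real^3) \<times> ((real^4) \<times> real)) \<Rightarrow> real^3" where
  "rhs H z = (let u = kep (fst (snd (snd z))) (fst z); v = fst (snd z); \<epsilon> = snd (snd (snd z)) in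
     Qf u v \<epsilon> + gH H (u + \<epsilon> *\<^sub>R v))"

definition rhs_dom :: "(real^3^3) set \<Rightarrow> (real \<times> ((real^3) \<times> ((real^4) \<times> real))) set" where
  "rhs_dom H = {z. fst (snd (snd z)) \<in> kep_dom \<and>
     kep (fst (snd (snd z))) (fst z) + snd (snd (snd z)) *\<^sub>R fst (snd z) \<in> Dom H}"

definition bif_dom :: "(real^3^3) set \<Rightarrow> (unknown \<times> real) set" where
  "bif_dom H = arg_path -` nem_dom (rhs_dom H)"

text \<open>There are five scalar conditions for the five scalar unknowns
  \<open>(p, \<kappa>)\<close>. The value \<open>Jop h (2 * pi)\<close> is the jump of
  \<open>v'\<close>; its components along the apsis direction and the normal are prescribed in the
  frame at \<open>p0\<close>, not at \<open>p\<close>, which keeps these two conditions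
  linear.\<close>

definition bif :: "(real^3^3) set \<Rightarrow> (real^4) \<Rightarrow> unknown \<times> real \<Rightarrow> path \<times> ((real^3) \<times> (real \<times> real))" where
  "bif H p0 z = (fst (fst z) + Nem (rhs H) (arg_path z),
     (vpath (fst z) (2 * pi), (PP p0 \<bullet> Jop (fst (fst z)) (2 * pi), NN p0 \<bullet> Jop (fst (fst z)) (2 * pi))))"

lemma vpath_apply: "vpath (h, (p, \<kappa>)) t = clampt t *\<^sub>R \<kappa> *\<^sub>R QQ p + Jop (Jop h) t"
  by (simp add: vpath_def tpath_apply)

lemma vpath_clampt: "vpath \<theta> (clampt t) = vpath \<theta> t"
  by (cases \<theta>) (auto simp: vpath_apply Jop_clampt split: prod.split)

lemma emb_apply: "emb v = (0, (v, 0))"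
  unfolding emb_def by (rule fun_cong[OF bounded_linear_Blinfun_apply])
    (intro bounded_linear_Pair bounded_linear_zero bounded_linear_ident)

lemma arg_path_apply: "arg_path (\<theta>, \<epsilon>) t = (clampt t, (vpath \<theta> t, (fst (snd \<theta>), \<epsilon>)))"
  by (simp add: arg_path_def bc_bil_apply[OF bounded_bilinear_blinfun_apply] emb_apply tpath_apply prod_eq_iff)

lemma C1_vpath: "C1_on S f \<Longrightarrow> C1_on S (\<lambda>x. vpath (f x))"
  unfolding vpath_def
  by (intro C1_intros C1_on_linear_compose[OF bounded_linear_tpath] C1_on_linear_compose[OF blinfun.bounded_linear_right])

lemma C1_arg_path: "C1_on UNIV arg_path"
  unfolding arg_path_def[abs_def]
  by (intro C1_intros C1_vpath C1_on_linear_compose[OF bounded_linear_const_bcontfun]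
      C1_on_linear_compose[OF bounded_bilinear.bounded_linear_right[OF bounded_bilinear_bc_bil[OF bounded_bilinear_blinfun_apply]]])

lemma open_rhs_dom: assumes "finite H" shows "open (rhs_dom H)"
proof -
  let ?K = "{z :: real \<times> ((real^3) \<times> ((real^4) \<times> real)). fst (snd (snd z)) \<in> kep_dom}"
  have K: "open ?K" using open_vimage[OF open_kep_dom, of "\<lambda>z :: real \<times> ((real^3) \<times> ((real^4) \<times> real)). fst (snd (snd z))"]
    by (simp add: vimage_def continuous_intros)
  have "C1_on ?K (\<lambda>z. kep (fst (snd (snd z))) (fst z) + snd (snd (snd z)) *\<^sub>R fst (snd z))"
    by (intro C1_intros C1_kep) auto
  from continuous_open_preimage[OF C1_on_imp_continuous_on[OF this] K open_Dom[OF assms]]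
  show ?thesis by (simp add: rhs_dom_def Int_def vimage_def)
qed

lemma C1_rhs: "C1_on (rhs_dom H) (rhs H)"
  unfolding rhs_def[abs_def] Let_def
  by (intro C1_intros C1_Qf C1_gH C1_kep) (auto simp: rhs_dom_def kep_nonzero dest: Dom_nonzero(1))

lemma open_bif_dom: "finite H \<Longrightarrow> open (bif_dom H)"
  unfolding bif_dom_def
  by (intro open_vimage open_nem_dom open_rhs_dom C1_on_imp_continuous_on[OF C1_arg_path])

lemma C1_bif: assumes "finite H" shows "C1_on (bif_dom H) (bif H p0)"
proof -
  have "C1_on (bif_dom H) (\<lambda>z. Nem (rhs H) (arg_path z))"
    by (rule C1_on_compose[OF C1_on_subset[OF C1_arg_path] C1_on_Nem[OF C1_rhs open_rhs_dom[OF assms]]])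
      (auto simp: bif_dom_def)
  then show ?thesis
    unfolding bif_def[abs_def]
    by (intro C1_intros C1_vpath C1_on_linear_compose[OF bounded_linear_bc_apply] C1_on_linear_compose[OF blinfun.bounded_linear_right])
qed

lemma bif_domI:
  assumes "p \<in> kep_dom" "\<And>t. t \<in> {0..2 * pi} \<Longrightarrow> kep p t + \<epsilon> *\<^sub>R vpath (h, (p, \<kappa>)) t \<in> Dom H"
  shows "((h, (p, \<kappa>)), \<epsilon>) \<in> bif_dom H"
  unfolding bif_dom_def vimage_eq
  by (rule nem_domI[of "\<lambda>t. (t, (vpath (h, (p, \<kappa>)) t, (p, \<epsilon>)))"])
    (auto intro!: continuous_intros simp: arg_path_apply rhs_dom_def assms vpath_clampt)

lemma bif_domD:
  assumes "((h, (p, \<kappa>)), \<epsilon>) \<in> bif_dom H"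
  shows "p \<in> kep_dom" "t \<in> {0..2 * pi} \<Longrightarrow> kep p t + \<epsilon> *\<^sub>R vpath (h, (p, \<kappa>)) t \<in> Dom H"
proof -
  have *: "arg_path ((h, (p, \<kappa>)), \<epsilon>) t \<in> rhs_dom H" for t
    using assms by (auto simp: bif_dom_def nem_dom_def)
  show "p \<in> kep_dom" "t \<in> {0..2 * pi} \<Longrightarrow> kep p t + \<epsilon> *\<^sub>R vpath (h, (p, \<kappa>)) t \<in> Dom H"
    using *[of t] by (simp_all add: arg_path_apply rhs_dom_def)
qed

lemma bif_apply:
  assumes "((h, (p, \<kappa>)), \<epsilon>) \<in> bif_dom H"
  shows "fst (bif H p0 ((h, (p, \<kappa>)), \<epsilon>)) t = h t + Qf (kep p (clampt t)) (vpath (h, (p, \<kappa>)) t) \<epsilon>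
     + gH H (kep p (clampt t) + \<epsilon> *\<^sub>R vpath (h, (p, \<kappa>)) t)"
  using Nem_apply[OF C1_on_imp_continuous_on[OF C1_rhs], of "arg_path ((h, (p, \<kappa>)), \<epsilon>)" H t] assms
  by (simp add: bif_def bif_dom_def rhs_def arg_path_apply Let_def)

lemma ring_bif_dom: "p \<in> ring_dom H \<Longrightarrow> ((h, (p, \<kappa>)), 0) \<in> bif_dom H"
  by (rule bif_domI) (auto simp: ring_dom_kep ring_dom_Dom)

lemma bif_apply_0:
  assumes "p \<in> ring_dom H"
  shows "fst (bif H p0 ((h, (p, \<kappa>)), 0)) t = h t + Kf (kep p (clampt t)) (vpath (h, (p, \<kappa>)) t) + gpath H p t"
  using bif_apply[OF ring_bif_dom[OF assms], of p0 h \<kappa> t] kep_nonzero[OF ring_dom_kep[OF assms]]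
  by (simp add: Qf_0 gpath_apply[OF assms])

text \<open>The ellipse is that of the variable parameter \<open>p\<close>, not the base ellipse.
  This freedom is what \<open>pairing_limit\<close> exploits.\<close>

lemma bif_green:
  fixes k :: path
  assumes p: "p \<in> ring_dom H" and k: "jacobi p y k'" "\<And>t. t \<in> {0..2 * pi} \<Longrightarrow> k t = y t"
  shows "pair (fst (bif H p0 ((h, (p, \<kappa>)), 0))) k = (\<kappa> *\<^sub>R QQ p + Jop h (2 * pi)) \<bullet> k (2 * pi) - \<kappa> *\<^sub>R QQ p \<bullet> k 0
     - vpath (h, (p, \<kappa>)) (2 * pi) \<bullet> k' (2 * pi) + pair (gpath H p) k"
proof -
  have "((\<lambda>t. (h t + Kf (kep p t) (t *\<^sub>R \<kappa> *\<^sub>R QQ p + Jop (Jop h) t)) \<bullet> k t + gpath H p t \<bullet> k t) has_integral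
    ((\<kappa> *\<^sub>R QQ p + Jop h (2 * pi)) \<bullet> k (2 * pi) - \<kappa> *\<^sub>R QQ p \<bullet> k 0
     - vpath (h, (p, \<kappa>)) (2 * pi) \<bullet> k' (2 * pi)) + pair (gpath H p) k) {0..2 * pi}"
  proof (rule has_integral_add[OF _ pair_has_integral])
    have e: "k 0 = y 0" "k (2 * pi) = y (2 * pi)" "vpath (h, (p, \<kappa>)) (2 * pi) = (2 * pi) *\<^sub>R \<kappa> *\<^sub>R QQ p + Jop (Jop h) (2 * pi)"
      by (simp_all add: k(2) vpath_apply)
    show "((\<lambda>t. (h t + Kf (kep p t) (t *\<^sub>R \<kappa> *\<^sub>R QQ p + Jop (Jop h) t)) \<bullet> k t) has_integral
      (\<kappa> *\<^sub>R QQ p + Jop h (2 * pi)) \<bullet> k (2 * pi) - \<kappa> *\<^sub>R QQ p \<bullet> k 0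
      - vpath (h, (p, \<kappa>)) (2 * pi) \<bullet> k' (2 * pi)) {0..2 * pi}"
      unfolding e by (rule has_integral_eq[OF _ jacobi_green[OF k(1)]]) (simp add: k(2))
  qed
  then have "((\<lambda>t. fst (bif H p0 ((h, (p, \<kappa>)), 0)) t \<bullet> k t) has_integral
    ((\<kappa> *\<^sub>R QQ p + Jop h (2 * pi)) \<bullet> k (2 * pi) - \<kappa> *\<^sub>R QQ p \<bullet> k 0
     - vpath (h, (p, \<kappa>)) (2 * pi) \<bullet> k' (2 * pi)) + pair (gpath H p) k) {0..2 * pi}"
    by (rule has_integral_eq[rotated]) (simp add: bif_apply_0[OF p] vpath_apply inner_add_left)
  from has_integral_unique[OF pair_has_integral this] show ?thesis .
qed

lemma has_vector_derivative_quotient_limit: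
  fixes f :: "real \<Rightarrow> 'a::real_normed_vector"
  assumes "(f has_vector_derivative d) (at 0)" "f 0 = 0"
  shows "((\<lambda>s. (1 / s) *\<^sub>R f s) \<longlongrightarrow> d) (at 0)"
proof -
  have "((\<lambda>h. norm (f (0 + h) - f 0 - h *\<^sub>R d) / norm h) \<longlongrightarrow> 0) (at 0)"
    using assms(1) unfolding has_vector_derivative_def has_derivative_at by blast
  then have *: "((\<lambda>h. norm (f h - h *\<^sub>R d) / \<bar>h\<bar>) \<longlongrightarrow> 0) (at 0)" using assms(2) by simp
  have "((\<lambda>s. (1 / s) *\<^sub>R f s - d) \<longlongrightarrow> 0) (at 0)"
  proof (rule Lim_null_comparison[OF _ *], rule eventually_at_filter[THEN iffD2], rule always_eventually, intro allI impI)
    fix s :: real assume s: "s \<noteq> 0"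
    have "(1 / s) *\<^sub>R f s - d = (1 / s) *\<^sub>R (f s - s *\<^sub>R d)" using s by (simp add: scaleR_diff_right)
    then show "norm ((1 / s) *\<^sub>R f s - d) \<le> norm (f s - s *\<^sub>R d) / \<bar>s\<bar>" by simp
  qed
  then show ?thesis by (simp add: LIM_zero_iff)
qed

definition kf_path :: "(real^4) \<Rightarrow> real \<Rightarrow>\<^sub>C ((real^3) \<Rightarrow>\<^sub>L (real^3))" where
  "kf_path p = Nem (fderiv fK) (kep_path p)"

lemma fderiv_fK: "x \<noteq> 0 \<Longrightarrow> fderiv fK x y = Kf x y"
  using has_derivative_unique[OF C1_on_has_derivative[OF C1_fK'] fK_has_derivative] by simp

lemma kf_path_apply: "p \<in> kep_dom \<Longrightarrow> kf_path p t x = Kf (kep p (clampt t)) x"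
  unfolding kf_path_def
  using Nem_apply[OF C1_on_fderiv[OF C1_fK'] kep_path_dom, of p t] kep_nonzero[of p]
  by (simp add: kep_path_apply fderiv_fK)

text \<open>The hypotheses on the reduced action in the form used by the linear analysis: as
  \<open>melnikov\<close> is minus its directional derivative, \<open>critical\<close> says that the
  gradient vanishes and \<open>M\<close> is the Hessian.\<close>

locale kepler_branch =
  fixes H :: "(real^3^3) set" and p0 :: "real^4" and M :: "real^4^4"
  assumes H: "rotation_group H" "finite H"
    and e0: "0 < p0 $ 1" "p0 $ 1 < 1" and c2: "cos (p0 $ 3) \<noteq> 0"
    and free: "p0 \<in> ring_dom H"
    and critical: "\<And>\<delta>. melnikov H p0 \<delta> = 0"
    and melnikov_derivative: "\<And>\<delta>. ((\<lambda>p. melnikov H p \<delta>) has_derivative (\<lambda>k. - ((M *v k) \<bullet> \<delta>))) (at p0)"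
    and M: "invertible M"
begin

abbreviation "F \<equiv> bif H p0"

lemma p0: "p0 \<in> kep_dom"
  using free by (rule ring_dom_kep)

lemma e0': "\<bar>p0 $ 1\<bar> < 1"
  using e0 by simp

definition W :: "path \<Rightarrow>\<^sub>L path" where
  "W = (SOME W :: path \<Rightarrow>\<^sub>L path. (\<forall>h. W (volterra (kf_path p0) h) = h) \<and> (\<forall>h. volterra (kf_path p0) (W h) = h))"

lemma W: "W (volterra (kf_path p0) h) = h" "volterra (kf_path p0) (W h) = h"
proof -
  obtain W' :: "path \<Rightarrow>\<^sub>L path" where "\<And>h. W' (volterra (kf_path p0) h) = h" "\<And>h. volterra (kf_path p0) (W' h) = h"
    by (rule volterra_inverse[of "kf_path p0"]) (rule that; assumption)
  then have "\<exists>W :: path \<Rightarrow>\<^sub>L path. (\<forall>h. W (volterra (kf_path p0) h) = h) \<and> (\<forall>h. volterra (kf_path p0) (W h) = h)" by blast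
  from someI_ex[OF this] show "W (volterra (kf_path p0) h) = h" "volterra (kf_path p0) (W h) = h"
    unfolding W_def by blast+
qed

lemma volterra_kf: "volterra (kf_path p0) h t = h t + Kf (kep p0 (clampt t)) (Jop (Jop h) t)"
  by (simp add: volterra_apply kf_path_apply[OF p0])

definition s0 :: real where "s0 = peri_speed (p0 $ 1)"

lemma s0: "0 < s0"
  unfolding s0_def by (rule peri_speed_sq(2)[OF e0'])

definition spath :: path where "spath = clampf (scal p0)"

lemma spath: "t \<in> {0..2 * pi} \<Longrightarrow> spath t = scal p0 t"
  unfolding spath_def scal_def[abs_def]
  by (subst clampf_apply) (auto intro!: continuous_intros kep_cont p0)

text \<open>The drift of the scaling variation is along the velocity, which at the apsis is a
  multiple of \<open>QQ p0\<close>. The factor is nonzero for \<open>p\<close> near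
  \<open>p0\<close>, so pairing with \<open>spath\<close> detects \<open>\<kappa>\<close>.\<close>

lemma QQ_scal_jump: "QQ p \<bullet> spath (2 * pi) - QQ p \<bullet> spath 0 = - (3 * pi * s0) * (QQ p \<bullet> QQ p0)"
  by (simp add: spath scal_ends[OF p0] inner_diff_right kep_0(2)[OF p0] s0_def)

text \<open>The value for which the drift of \<open>spath\<close> balances the forcing term in
  Green's identity. \<open>h0\<close> then solves the forced linear equation with this initial
  speed.\<close>

definition \<kappa>0 :: real where "\<kappa>0 = pair (gpath H p0) spath / (3 * pi * s0)"

definition h0 :: path where
  "h0 = W (- gpath H p0 - bc_bil blinfun_apply (kf_path p0) (tpath (\<kappa>0 *\<^sub>R QQ p0)))"

text \<open>The differential equation holds by construction of \<open>h0\<close>; the point is that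
  its solution closes up. Green's identity with the four parameter variations (criticality), the
  velocity (\<open>gpath_kepv\<close>) and the scaling variation (choice of
  \<open>\<kappa>0\<close>) gives the relations of \<open>jacobi_span\<close> for the jumps
  \<open>\<alpha>\<close> of position and \<open>\<beta>\<close> of velocity. Both vanish, including
  the component of \<open>\<beta>\<close> not contained in \<open>bif\<close>.\<close>

lemma base_point: "F ((h0, (p0, \<kappa>0)), 0) = 0" "Jop h0 (2 * pi) = 0"
proof -
  let ?\<theta> = "(h0, (p0, \<kappa>0))"
  have Kadd: "Kf u (x + y) = Kf u x + Kf u y" for u x y
    using linear_add[OF bounded_linear.linear[OF bounded_linear_Kf]] .
  have "fst (F (?\<theta>, 0)) t = 0" for t
  proof -
    have "volterra (kf_path p0) h0 t = - gpath H p0 t - Kf (kep p0 (clampt t)) (clampt t *\<^sub>R \<kappa>0 *\<^sub>R QQ p0)"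
      unfolding h0_def W(2) by (simp add: bc_bil_apply[OF bounded_bilinear_blinfun_apply] kf_path_apply[OF p0] tpath_apply)
    then show ?thesis unfolding bif_apply_0[OF free] volterra_kf vpath_apply Kadd by (simp add: algebra_simps)
  qed
  then have f: "fst (F (?\<theta>, 0)) = 0" by (intro bcontfun_eqI) simp
  define \<alpha> where "\<alpha> = vpath ?\<theta> (2 * pi)"
  define \<beta> where "\<beta> = Jop h0 (2 * pi)"
  note g = bif_green[OF free, of _ _ _ p0 h0 \<kappa>0, unfolded f pair_0, folded \<alpha>_def \<beta>_def]
  have v: "\<beta> \<bullet> apsis_x p0 \<delta> = \<alpha> \<bullet> apsis_v p0 \<delta>" for \<delta>
  proof -
    obtain k' where k': "jacobi p0 (fderiv kep_path p0 \<delta>) k'" "k' 0 = apsis_v p0 \<delta>" "k' (2 * pi) = apsis_v p0 \<delta>"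
      "fderiv kep_path p0 \<delta> 0 = apsis_x p0 \<delta>" "fderiv kep_path p0 \<delta> (2 * pi) = apsis_x p0 \<delta>"
      by (rule jacobi_variation[OF p0, of \<delta>]) (rule that; assumption)
    show ?thesis using g[OF k'(1) refl] critical[of \<delta>, unfolded melnikov_def] by (simp add: k' inner_add_left)
  qed
  have t: "\<beta> \<bullet> kepv p0 0 = - (\<alpha> \<bullet> fK (kep p0 0))"
    using g[OF jacobi_kepv[OF p0], of "kepv_path p0"] gpath_kepv[OF H(1) free] kep_periodic[OF p0, of 0]
    by (simp add: kepv_path_apply[OF p0] inner_add_left)
  have "0 = \<beta> \<bullet> spath (2 * pi) - \<alpha> \<bullet> scal' p0 (2 * pi) + (\<kappa>0 * (QQ p0 \<bullet> spath (2 * pi) - QQ p0 \<bullet> spath 0) + pair (gpath H p0) spath)"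
    using g[OF jacobi_scal[OF p0], of spath] spath by (simp add: inner_add_left algebra_simps)
  also have "\<kappa>0 * (QQ p0 \<bullet> spath (2 * pi) - QQ p0 \<bullet> spath 0) + pair (gpath H p0) spath = 0"
    unfolding QQ_scal_jump using s0 by (simp add: frame_orthonormal \<kappa>0_def)
  finally have "\<beta> \<bullet> scal p0 (2 * pi) = \<alpha> \<bullet> scal' p0 (2 * pi)" by (simp add: spath)
  then have s: "\<beta> \<bullet> kep p0 0 = - (1 / 2) * (\<alpha> \<bullet> kepv p0 0)"
    using t by (simp add: scal_ends[OF p0] inner_diff_right inner_add_right)
  have "\<alpha> = 0" "\<beta> = 0" by (rule jacobi_span[OF p0 c2 _ v t s]; use e0 in simp)+
  then show "F (?\<theta>, 0) = 0" "Jop h0 (2 * pi) = 0"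
    using f unfolding \<alpha>_def \<beta>_def by (simp_all add: bif_def prod_eq_iff)
qed

definition DF :: "(unknown \<times> real) \<Rightarrow>\<^sub>L (path \<times> ((real^3) \<times> (real \<times> real)))" where
  "DF = fderiv F ((h0, (p0, \<kappa>0)), 0)"

lemma directional:
  "((\<lambda>s. F ((h0 + s *\<^sub>R h, (p0 + s *\<^sub>R p, \<kappa>0 + s * \<kappa>)), 0)) has_vector_derivative DF ((h, (p, \<kappa>)), 0)) (at 0)"
proof -
  have "((\<lambda>s. ((h0 + s *\<^sub>R h, (p0 + s *\<^sub>R p, \<kappa>0 + s * \<kappa>)), 0 :: real)) has_derivative (\<lambda>s. ((s *\<^sub>R h, (s *\<^sub>R p, s * \<kappa>)), 0))) (at 0)"
    by (auto intro!: derivative_eq_intros)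
  from has_derivative_compose[OF this, of F DF] C1_on_has_derivative[OF C1_bif[OF H(2)] ring_bif_dom[OF free]]
  have "((\<lambda>s. F ((h0 + s *\<^sub>R h, (p0 + s *\<^sub>R p, \<kappa>0 + s * \<kappa>)), 0)) has_derivative (\<lambda>s. DF ((s *\<^sub>R h, (s *\<^sub>R p, s * \<kappa>)), 0))) (at 0)"
    by (simp add: DF_def)
  moreover have "DF ((s *\<^sub>R h, (s *\<^sub>R p, s * \<kappa>)), 0) = s *\<^sub>R DF ((h, (p, \<kappa>)), 0)" for s
    by (simp flip: blinfun.scaleR_right)
  ultimately show ?thesis unfolding has_vector_derivative_def by simp
qed

lemma directional_limit:
  "((\<lambda>s. (1 / s) *\<^sub>R F ((h0 + s *\<^sub>R h, (p0 + s *\<^sub>R p, \<kappa>0 + s * \<kappa>)), 0)) \<longlongrightarrow> DF ((h, (p, \<kappa>)), 0)) (at 0)"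
  by (rule has_vector_derivative_quotient_limit[OF directional]) (simp add: base_point)

text \<open>At parameter 0 and over the base ellipse the equation is affine in \<open>h\<close>, so
  its difference quotients are constant.\<close>

lemma DF_volterra: "fst (DF ((h, 0), 0)) = volterra (kf_path p0) h"
proof -
  have lin: "Kf u (x + s *\<^sub>R y) = Kf u x + s *\<^sub>R Kf u y" for u x y s
    using linear_add[OF bounded_linear.linear[OF bounded_linear_Kf]] linear_scale[OF bounded_linear.linear[OF bounded_linear_Kf]] by simp
  have "fst (F ((h0 + s *\<^sub>R h, (p0, \<kappa>0)), 0)) = s *\<^sub>R volterra (kf_path p0) h" for s
  proof (rule bcontfun_eqI)
    fix t
    have v: "vpath (h0 + s *\<^sub>R h, (p0, \<kappa>0)) t = vpath (h0, (p0, \<kappa>0)) t + s *\<^sub>R Jop (Jop h) t"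
      by (simp add: vpath_apply blinfun.add_right blinfun.scaleR_right)
    have "fst (F ((h0, (p0, \<kappa>0)), 0)) t = 0" by (simp add: base_point)
    then show "fst (F ((h0 + s *\<^sub>R h, (p0, \<kappa>0)), 0)) t = (s *\<^sub>R volterra (kf_path p0) h) t"
      unfolding bif_apply_0[OF free] v lin by (simp add: volterra_kf scaleR_add_right algebra_simps)
  qed
  with tendsto_fst[OF directional_limit[of h 0 0]]
  have "((\<lambda>s :: real. (1 / s) *\<^sub>R s *\<^sub>R volterra (kf_path p0) h) \<longlongrightarrow> fst (DF ((h, 0), 0))) (at 0)"
    by (simp add: zero_prod_def)
  then have "((\<lambda>s :: real. volterra (kf_path p0) h) \<longlongrightarrow> fst (DF ((h, 0), 0))) (at 0)"
    by (rule Lim_transform_eventually) (auto simp: eventually_at_filter)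
  from tendsto_unique[OF _ this tendsto_const] show ?thesis by simp
qed

lemma ring_eventually: "\<forall>\<^sub>F s in at 0. p0 + s *\<^sub>R \<delta> \<in> ring_dom H"
proof -
  have "((\<lambda>s. p0 + s *\<^sub>R \<delta>) \<longlongrightarrow> p0 + 0 *\<^sub>R \<delta>) (at 0)" by (intro tendsto_intros)
  from topological_tendstoD[OF this open_ring_dom[OF H(2)]] free show ?thesis by simp
qed

text \<open>The identity \<open>bif_green\<close> at \<open>p0 + s p\<close> is divided by
  \<open>s\<close>. The quotient of \<open>F\<close> tends to 0 by assumption, and of the Jacobi
  solutions \<open>k p\<close> only continuity in \<open>p\<close> is used. Periodicity of
  \<open>k p\<close> removes \<open>\<kappa>\<close>, and \<open>Jop h0 (2 * pi) = 0\<close> leaves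
  only the jump of \<open>h\<close>.\<close>

lemma pairing_limit:
  fixes k :: "(real^4) \<Rightarrow> path"
  assumes D: "DF ((h, (p, \<kappa>)), 0) = 0"
    and k: "\<And>p. p \<in> ring_dom H \<Longrightarrow> jacobi p (k p) (k' p)" "\<And>p. p \<in> ring_dom H \<Longrightarrow> k p (2 * pi) = k p 0"
    and c: "(k \<longlongrightarrow> k p0) (at p0)" "((\<lambda>p. k' p (2 * pi)) \<longlongrightarrow> b) (at p0)"
  shows "((\<lambda>s. (1 / s) * pair (gpath H (p0 + s *\<^sub>R p)) (k (p0 + s *\<^sub>R p))) \<longlongrightarrow> - (Jop h (2 * pi) \<bullet> k p0 0)) (at 0)"
proof (cases "p = 0")
  case False
  let ?p = "\<lambda>s. p0 + s *\<^sub>R p"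
  have "filterlim ?p (at p0) (at 0)"
    unfolding filterlim_at using False by (auto simp: eventually_at_filter intro!: tendsto_eq_intros)
  note pl = this
  have k0: "((\<lambda>s. k (?p s)) \<longlongrightarrow> k p0) (at 0)" by (rule filterlim_compose[OF c(1) pl])
  have b0: "((\<lambda>s. k' (?p s) (2 * pi)) \<longlongrightarrow> b) (at 0)" by (rule filterlim_compose[OF c(2) pl])
  let ?f = "\<lambda>s. F ((h0 + s *\<^sub>R h, (?p s, \<kappa>0 + s * \<kappa>)), 0)"
  note L = directional_limit[of h p \<kappa>, unfolded D]
  have 1: "((\<lambda>s. pair (fst ((1 / s) *\<^sub>R ?f s)) (k (?p s))) \<longlongrightarrow> pair 0 (k p0)) (at 0)"
    by (rule tendsto_pair[OF _ k0]) (use tendsto_fst[OF L] in simp)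
  have 2: "((\<lambda>s. fst (snd ((1 / s) *\<^sub>R ?f s)) \<bullet> k' (?p s) (2 * pi)) \<longlongrightarrow> 0 \<bullet> b) (at 0)"
    by (rule tendsto_inner[OF _ b0]) (use tendsto_fst[OF tendsto_snd[OF L]] in simp)
  have 3: "((\<lambda>s. Jop h (2 * pi) \<bullet> k (?p s) 0) \<longlongrightarrow> Jop h (2 * pi) \<bullet> k p0 0) (at 0)"
    by (intro tendsto_inner tendsto_const bounded_linear.tendsto[OF bounded_linear_bc_apply] k0)
  have "((\<lambda>s. pair (fst ((1 / s) *\<^sub>R ?f s)) (k (?p s)) - Jop h (2 * pi) \<bullet> k (?p s) 0 + fst (snd ((1 / s) *\<^sub>R ?f s)) \<bullet> k' (?p s) (2 * pi))
    \<longlongrightarrow> - (Jop h (2 * pi) \<bullet> k p0 0)) (at 0)"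
    using tendsto_add[OF tendsto_diff[OF 1 3] 2] by (simp add: pair_0)
  then show ?thesis
  proof (rule Lim_transform_eventually)
    show "\<forall>\<^sub>F s in at 0. pair (fst ((1 / s) *\<^sub>R ?f s)) (k (?p s)) - Jop h (2 * pi) \<bullet> k (?p s) 0 + fst (snd ((1 / s) *\<^sub>R ?f s)) \<bullet> k' (?p s) (2 * pi)
      = (1 / s) * pair (gpath H (?p s)) (k (?p s))"
    proof (rule eventually_mono[OF eventually_conj[OF ring_eventually[of p] eventually_neq_at_within[of 0 0 UNIV]]])
      fix s :: real assume s: "?p s \<in> ring_dom H \<and> s \<noteq> 0"
      have "pair (fst (?f s)) (k (?p s)) = s * (Jop h (2 * pi) \<bullet> k (?p s) 0) - fst (snd (?f s)) \<bullet> k' (?p s) (2 * pi) + pair (gpath H (?p s)) (k (?p s))"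
        using bif_green[OF conjunct1[OF s] k(1)[OF conjunct1[OF s]] refl, of p0 "h0 + s *\<^sub>R h" "\<kappa>0 + s * \<kappa>"] k(2)[OF conjunct1[OF s]] base_point(2)
        by (simp add: inner_add_left blinfun.add_right blinfun.scaleR_right) (simp add: bif_def)
      then show "pair (fst ((1 / s) *\<^sub>R ?f s)) (k (?p s)) - Jop h (2 * pi) \<bullet> k (?p s) 0 + fst (snd ((1 / s) *\<^sub>R ?f s)) \<bullet> k' (?p s) (2 * pi)
        = (1 / s) * pair (gpath H (?p s)) (k (?p s))"
        using s by (simp add: pair_scaleR field_simps)
    qed
  qed
next
  case True
  \<comment> \<open>For \<open>p = 0\<close> the segment never leaves \<open>p0\<close>, so limits
    along punctured neighbourhoods do not apply; the identity at \<open>p0\<close> alone suffices,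
    the pairing of \<open>gpath\<close> being 0 there.\<close>
  let ?f = "\<lambda>s. F ((h0 + s *\<^sub>R h, (p0, \<kappa>0 + s * \<kappa>)), 0)"
  note L = directional_limit[of h p \<kappa>, unfolded D, unfolded True]
  have L: "((\<lambda>s. (1 / s) *\<^sub>R ?f s) \<longlongrightarrow> 0) (at 0)" using L by simp
  have g0: "pair (gpath H p0) (k p0) = 0"
    using bif_green[OF free k(1)[OF free] refl, of p0 h0 \<kappa>0] k(2)[OF free] base_point
    by (simp add: inner_add_left pair_0) (simp add: bif_def prod_eq_iff)
  have 1: "((\<lambda>s. pair (fst ((1 / s) *\<^sub>R ?f s)) (k p0)) \<longlongrightarrow> pair 0 (k p0)) (at 0)"
    by (rule tendsto_pair[OF _ tendsto_const]) (use tendsto_fst[OF L] in simp)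
  have 2: "((\<lambda>s. fst (snd ((1 / s) *\<^sub>R ?f s)) \<bullet> k' p0 (2 * pi)) \<longlongrightarrow> 0 \<bullet> k' p0 (2 * pi)) (at 0)"
    by (rule tendsto_inner[OF _ tendsto_const]) (use tendsto_fst[OF tendsto_snd[OF L]] in simp)
  have "((\<lambda>s. pair (fst ((1 / s) *\<^sub>R ?f s)) (k p0) + fst (snd ((1 / s) *\<^sub>R ?f s)) \<bullet> k' p0 (2 * pi)) \<longlongrightarrow> 0) (at 0)"
    using tendsto_add[OF 1 2] by (simp add: pair_0)
  then have "((\<lambda>s :: real. Jop h (2 * pi) \<bullet> k p0 0) \<longlongrightarrow> 0) (at 0)"
  proof (rule Lim_transform_eventually)
    have "pair (fst (?f s)) (k p0) = s * (Jop h (2 * pi) \<bullet> k p0 0) - fst (snd (?f s)) \<bullet> k' p0 (2 * pi)" for s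
      using bif_green[OF free k(1)[OF free] refl, of p0 "h0 + s *\<^sub>R h" "\<kappa>0 + s * \<kappa>"] k(2)[OF free] base_point(2) g0
      by (simp add: inner_add_left blinfun.add_right blinfun.scaleR_right) (simp add: bif_def)
    then show "\<forall>\<^sub>F s in at 0. pair (fst ((1 / s) *\<^sub>R ?f s)) (k p0) + fst (snd ((1 / s) *\<^sub>R ?f s)) \<bullet> k' p0 (2 * pi) = Jop h (2 * pi) \<bullet> k p0 0"
      by (auto simp: eventually_at_filter pair_scaleR field_simps)
  qed
  from tendsto_unique[OF _ this tendsto_const] show ?thesis using g0 True by simp
qed

lemma kepv_path_limit: "(kepv_path \<longlongrightarrow> kepv_path p0) (at p0)" "(kep_path \<longlongrightarrow> kep_path p0) (at p0)"
  "((\<lambda>p. fderiv kep_path p) \<longlongrightarrow> fderiv kep_path p0) (at p0)"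
  using C1_on_imp_isCont[OF C1_kepv_path p0] C1_on_imp_isCont[OF C1_kep_path p0]
    C1_on_fderiv[OF C1_kep_path] p0 by (auto simp: isCont_def continuous_on_eq_continuous_at[OF open_kep_dom])

text \<open>The relations come in a forced order: two components of the velocity jump from the last
  equations, the third from time translation, then \<open>p\<close> from the Hessian,
  \<open>\<kappa>\<close> from the scaling variation, and finally \<open>h\<close> from the Volterra
  equation. Each step needs the previous ones to clear its boundary terms.\<close>

lemma DF_injective:
  assumes D: "DF ((h, (p, \<kappa>)), 0) = 0"
  shows "h = 0" "p = 0" "\<kappa> = 0"
proof -
  let ?J = "Jop h (2 * pi)"
  let ?f = "\<lambda>s. F ((h0 + s *\<^sub>R h, (p0 + s *\<^sub>R p, \<kappa>0 + s * \<kappa>)), 0)"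
  note L = directional_limit[of h p \<kappa>, unfolded D]
  have c: "x = 0" if "((\<lambda>s. (1 / s) * (s * x)) \<longlongrightarrow> 0) (at 0)" for x :: real
  proof -
    have "((\<lambda>s :: real. x) \<longlongrightarrow> 0) (at 0)"
      by (rule Lim_transform_eventually[OF that]) (auto simp: eventually_at_filter)
    from tendsto_unique[OF _ this tendsto_const] show ?thesis by simp
  qed
  have sn: "snd (snd (?f s)) = (s * (PP p0 \<bullet> ?J), s * (NN p0 \<bullet> ?J))" for s
    by (simp add: bif_def blinfun.add_right blinfun.scaleR_right base_point(2))
  have P: "PP p0 \<bullet> ?J = 0" using tendsto_fst[OF tendsto_snd[OF tendsto_snd[OF L]]] by (intro c) (simp add: sn)
  have N: "NN p0 \<bullet> ?J = 0" using tendsto_snd[OF tendsto_snd[OF tendsto_snd[OF L]]] by (intro c) (simp add: sn)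
  \<comment> \<open>The pairing with the velocity vanishes identically in \<open>p\<close>, so the
    limit gives the component of the jump that \<open>bif\<close> does not prescribe.\<close>
  have "((\<lambda>s. (1 / s) * pair (gpath H (p0 + s *\<^sub>R p)) (kepv_path (p0 + s *\<^sub>R p))) \<longlongrightarrow> - (?J \<bullet> kepv_path p0 0)) (at 0)"
  proof (rule pairing_limit[OF D, where k' = "\<lambda>p t. - fK (kep p t)" and b = "- fK (kep p0 (2 * pi))"])
    fix p assume p: "p \<in> ring_dom H"
    note k = ring_dom_kep[OF p]
    show "jacobi p (kepv_path p) (\<lambda>t. - fK (kep p t))"
      using jacobi_kepv[OF k] kepv_path_apply[OF k] unfolding jacobi_def
      by (auto intro: has_vector_derivative_transform)
    show "kepv_path p (2 * pi) = kepv_path p 0" using kep_periodic(2)[OF k, of 0] by (simp add: kepv_path_apply[OF k])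
  next
    have "isCont (\<lambda>p. fK (kep p (2 * pi))) p0"
      by (rule C1_on_imp_isCont[OF C1_fK[OF C1_kep] p0]) (auto intro: C1_intros simp: kep_nonzero)
    then show "((\<lambda>p. - fK (kep p (2 * pi))) \<longlongrightarrow> - fK (kep p0 (2 * pi))) (at p0)"
      unfolding isCont_def by (rule tendsto_minus)
  qed (rule kepv_path_limit)
  then have "((\<lambda>s. 0) \<longlongrightarrow> - (?J \<bullet> kepv_path p0 0)) (at (0::real))"
    by (rule Lim_transform_eventually) (rule eventually_mono[OF ring_eventually[of p]], simp add: gpath_kepv[OF H(1)])
  from tendsto_unique[OF _ this tendsto_const] have "?J \<bullet> kepv p0 0 = 0" by (simp add: kepv_path_apply[OF p0])
  then have "?J \<bullet> QQ p0 = 0" using s0 by (simp add: kep_0[OF p0] s0_def)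
  then have J: "?J = 0" using P N by (intro frame_zero[of _ "p0 $ 2" "p0 $ 3" "p0 $ 4"]) (simp_all add: inner_commute)
  have "(M *v p) \<bullet> \<delta> = 0" for \<delta>
  proof -
    have "((\<lambda>s. (1 / s) * pair (gpath H (p0 + s *\<^sub>R p)) (fderiv kep_path (p0 + s *\<^sub>R p) \<delta>)) \<longlongrightarrow> - (?J \<bullet> fderiv kep_path p0 \<delta> 0)) (at 0)"
    \<comment> \<open>The time derivative of the variation is only known to exist for each
      \<open>p\<close>. Continuity in \<open>p\<close> is required of its value at
      \<open>2 * pi\<close> alone, and there it equals \<open>apsis_v p \<delta>\<close>.\<close>
    proof (rule pairing_limit[OF D, where k' = "\<lambda>p. SOME k'. jacobi p (fderiv kep_path p \<delta>) k' \<and> k' (2 * pi) = apsis_v p \<delta>" and b = "apsis_v p0 \<delta>"])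
      have ex: "jacobi p (fderiv kep_path p \<delta>) (SOME k'. jacobi p (fderiv kep_path p \<delta>) k' \<and> k' (2 * pi) = apsis_v p \<delta>)"
        "(SOME k'. jacobi p (fderiv kep_path p \<delta>) k' \<and> k' (2 * pi) = apsis_v p \<delta>) (2 * pi) = apsis_v p \<delta>" if "p \<in> kep_dom" for p
      proof -
        have "\<exists>k'. jacobi p (fderiv kep_path p \<delta>) k' \<and> k' (2 * pi) = apsis_v p \<delta>"
          by (rule jacobi_variation[OF that, of \<delta>]) blast
        from someI_ex[OF this] show "jacobi p (fderiv kep_path p \<delta>) (SOME k'. jacobi p (fderiv kep_path p \<delta>) k' \<and> k' (2 * pi) = apsis_v p \<delta>)"
          "(SOME k'. jacobi p (fderiv kep_path p \<delta>) k' \<and> k' (2 * pi) = apsis_v p \<delta>) (2 * pi) = apsis_v p \<delta>" by blast+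
      qed
      fix p assume p: "p \<in> ring_dom H"
      show "jacobi p (fderiv kep_path p \<delta>) (SOME k'. jacobi p (fderiv kep_path p \<delta>) k' \<and> k' (2 * pi) = apsis_v p \<delta>)"
        by (rule ex[OF ring_dom_kep[OF p]])
      show "fderiv kep_path p \<delta> (2 * pi) = fderiv kep_path p \<delta> 0"
        by (rule jacobi_variation[OF ring_dom_kep[OF p], of \<delta>]) simp
    next
      show "((\<lambda>p. fderiv kep_path p \<delta>) \<longlongrightarrow> fderiv kep_path p0 \<delta>) (at p0)"
        by (rule blinfun.tendsto[OF kepv_path_limit(3) tendsto_const])
      have "((\<lambda>p. apsis_v p \<delta>) \<longlongrightarrow> apsis_v p0 \<delta>) (at p0)"
      proof -
        have "((\<lambda>p. peri_speed (p $ 1)) \<longlongrightarrow> peri_speed (p0 $ 1)) (at p0)"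
          by (rule isCont_tendsto_compose[OF DERIV_isCont[OF peri_speed_deriv[OF e0']]]) (intro tendsto_intros)
        moreover have "(QQ \<longlongrightarrow> QQ p0) (at p0)" "(PP \<longlongrightarrow> PP p0) (at p0)" "(NN \<longlongrightarrow> NN p0) (at p0)"
        proof -
          have "C1_on UNIV QQ" "C1_on UNIV PP" "C1_on UNIV NN" by (intro C1_intros)+
          from this[THEN C1_on_imp_isCont, OF UNIV_I, unfolded isCont_def]
          show "(QQ \<longlongrightarrow> QQ p0) (at p0)" "(PP \<longlongrightarrow> PP p0) (at p0)" "(NN \<longlongrightarrow> NN p0) (at p0)" .
        qed
        ultimately show ?thesis unfolding apsis_v_def
          by (intro tendsto_intros) (use s0 e0 in \<open>auto simp: s0_def\<close>)
      qed
      then show "((\<lambda>p. (SOME k'. jacobi p (fderiv kep_path p \<delta>) k' \<and> k' (2 * pi) = apsis_v p \<delta>) (2 * pi)) \<longlongrightarrow> apsis_v p0 \<delta>) (at p0)"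
      proof (rule Lim_transform_eventually)
        show "\<forall>\<^sub>F p in at p0. apsis_v p \<delta> = (SOME k'. jacobi p (fderiv kep_path p \<delta>) k' \<and> k' (2 * pi) = apsis_v p \<delta>) (2 * pi)"
        proof (rule eventually_mono[OF eventually_at_in_open'[OF open_kep_dom p0]])
          fix p :: "real^4" assume "p \<in> kep_dom"
          then have "\<exists>k'. jacobi p (fderiv kep_path p \<delta>) k' \<and> k' (2 * pi) = apsis_v p \<delta>"
            by (rule jacobi_variation[of p \<delta>]) blast
          from someI_ex[OF this] show "apsis_v p \<delta> = (SOME k'. jacobi p (fderiv kep_path p \<delta>) k' \<and> k' (2 * pi) = apsis_v p \<delta>) (2 * pi)" by simp
        qed
      qed
    qed
    then have 0: "((\<lambda>s. (1 / s) *\<^sub>R melnikov H (p0 + s *\<^sub>R p) \<delta>) \<longlongrightarrow> 0) (at 0)" by (simp add: J melnikov_def)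
    have "((\<lambda>s. p0 + s *\<^sub>R p) has_derivative (\<lambda>s. s *\<^sub>R p)) (at 0)" by (auto intro!: derivative_eq_intros)
    from has_derivative_compose[OF this, of "\<lambda>p. melnikov H p \<delta>" "\<lambda>k. - ((M *v k) \<bullet> \<delta>)"] melnikov_derivative[of \<delta>]
    have "((\<lambda>s. melnikov H (p0 + s *\<^sub>R p) \<delta>) has_vector_derivative - ((M *v p) \<bullet> \<delta>)) (at 0)"
      unfolding has_vector_derivative_def by (simp add: matrix_vector_mult_scaleR)
    from has_vector_derivative_quotient_limit[OF this] critical
    have "((\<lambda>s. (1 / s) *\<^sub>R melnikov H (p0 + s *\<^sub>R p) \<delta>) \<longlongrightarrow> - ((M *v p) \<bullet> \<delta>)) (at 0)" by simp
    from tendsto_unique[OF _ this 0] show ?thesis by simp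
  qed
  then have "M *v p = 0" by (metis inner_eq_zero_iff)
  then show p: "p = 0" using M by (metis invertible_def matrix_vector_mul_assoc matrix_vector_mul_lid matrix_vector_mult_0_right)
  \<comment> \<open>With \<open>p = 0\<close> the base ellipse stays fixed; the scaling variation is
    the one Jacobi solution in use that is not periodic, so its pairing still contains
    \<open>\<kappa>\<close>.\<close>
  let ?g = "\<lambda>s. F ((h0 + s *\<^sub>R h, (p0, \<kappa>0 + s * \<kappa>)), 0)"
  have L: "((\<lambda>s. (1 / s) *\<^sub>R ?g s) \<longlongrightarrow> 0) (at 0)" using L p by simp
  have green: "pair (fst (?g s)) spath = s * (\<kappa> * (- (3 * pi * s0))) - fst (snd (?g s)) \<bullet> scal' p0 (2 * pi)" for s
  proof -
    have a: "pair (fst (?g s)) spath = (\<kappa>0 + s * \<kappa>) * (QQ p0 \<bullet> spath (2 * pi) - QQ p0 \<bullet> spath 0) - fst (snd (?g s)) \<bullet> scal' p0 (2 * pi) + pair (gpath H p0) spath"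
      using bif_green[OF free jacobi_scal[OF p0], of spath p0 "h0 + s *\<^sub>R h" "\<kappa>0 + s * \<kappa>"] spath J base_point(2)
      by (simp add: blinfun.add_right blinfun.scaleR_right) (simp add: bif_def algebra_simps)
    show ?thesis unfolding a QQ_scal_jump using s0 by (simp add: frame_orthonormal \<kappa>0_def field_simps)
  qed
  have 1: "((\<lambda>s. pair (fst ((1 / s) *\<^sub>R ?g s)) spath) \<longlongrightarrow> pair 0 spath) (at 0)"
    by (rule tendsto_pair[OF _ tendsto_const]) (use tendsto_fst[OF L] in simp)
  have 2: "((\<lambda>s. fst (snd ((1 / s) *\<^sub>R ?g s)) \<bullet> scal' p0 (2 * pi)) \<longlongrightarrow> 0 \<bullet> scal' p0 (2 * pi)) (at 0)"
    by (rule tendsto_inner[OF _ tendsto_const]) (use tendsto_fst[OF tendsto_snd[OF L]] in simp)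
  have eq: "pair (fst ((1 / s) *\<^sub>R ?g s)) spath + fst (snd ((1 / s) *\<^sub>R ?g s)) \<bullet> scal' p0 (2 * pi)
      = (1 / s) * (s * (\<kappa> * (- (3 * pi * s0))))" for s
    unfolding fst_scaleR snd_scaleR pair_scaleR inner_scaleR_left green by (simp only: right_diff_distrib diff_add_cancel)
  from tendsto_add[OF 1 2, unfolded eq pair_0 inner_zero_left add_0]
  have "((\<lambda>s. (1 / s) * (s * (\<kappa> * (- (3 * pi * s0))))) \<longlongrightarrow> 0) (at 0)" .
  from c[OF this] show \<kappa>: "\<kappa> = 0" using s0 by simp
  have "volterra (kf_path p0) h = 0" using DF_volterra[of h] D p \<kappa> by (simp add: zero_prod_def)
  then show "h = 0" using W(1)[of h] by (simp add: blinfun.zero_right)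
qed

theorem branch:
  obtains r d \<xi> where "0 < r" "0 < d" "C1_on {-d<..<d} \<xi>" "\<xi> 0 = (h0, (p0, \<kappa>0))"
    "\<And>\<epsilon>. \<bar>\<epsilon>\<bar> < d \<Longrightarrow> (\<xi> \<epsilon>, \<epsilon>) \<in> bif_dom H" "\<And>\<epsilon>. \<bar>\<epsilon>\<bar> < d \<Longrightarrow> F (\<xi> \<epsilon>, \<epsilon>) = 0"
    "\<And>\<epsilon> x. \<bar>\<epsilon>\<bar> < d \<Longrightarrow> dist (h0, (p0, \<kappa>0)) x < r \<Longrightarrow> F (x, \<epsilon>) = 0 \<Longrightarrow> x = \<xi> \<epsilon>"
proof -
  have lin: "bounded_linear (\<lambda>z. (z, 0 :: real))"
    by (intro bounded_linear_Pair bounded_linear_ident bounded_linear_zero)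
  define D where "D = DF o\<^sub>L Blinfun (\<lambda>z. (z, 0))"
  have D: "D z = DF (z, 0)" for z by (simp add: D_def bounded_linear_Blinfun_apply[OF lin])
  obtain T where T: "\<And>z. blinfun_apply T (D z) = z" "\<And>z. D (blinfun_apply T z) = z"
  proof (rule schur_inverse[of D "volterra (kf_path p0)" W])
    show "fst (D (h, 0)) = volterra (kf_path p0) h" for h by (simp add: D DF_volterra)
    show "z = 0" if "D z = 0" for z
      using DF_injective[of "fst z" "fst (snd z)" "snd (snd z)"] that by (simp add: D prod_eq_iff)
  qed (auto simp: W)
  show ?thesis
    by (rule C1_implicit_function[OF C1_bif[OF H(2), of p0] open_bif_dom[OF H(2)] ring_bif_dom[OF free] base_point(1) T[unfolded D DF_def]])
      (rule that; assumption)
qed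

end

section \<open>The reduced action\<close>

text \<open>Positive eccentricity makes \<open>kepler_ellipse\<close> agree with \<open>kep\<close>;
  as an open condition it does not affect derivatives at \<open>p\<close>.\<close>

lemma reduced_action_eq:
  assumes p: "p \<in> ring_dom H" "0 < p $ 1"
  shows "reduced_action H p = Jop (Nem (WH H) (kep_path p)) (2 * pi)"
proof -
  note k = ring_dom_kep[OF p(1)]
  have e: "0 \<le> p $ 1" "p $ 1 < 1" using p(2) k by (auto simp: kep_dom_def)
  have W: "Nem (WH H) (kep_path p) t = WH H (kep p (clampt t))" for t
    using Nem_apply[OF C1_on_imp_continuous_on[OF C1_WH], of "kep_path p" H t] p(1) kep_path_apply[OF k] by (simp add: ring_dom_def)
  have c: "continuous_on {0..2 * pi} (\<lambda>t. WH H (kep p t))"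
    by (rule continuous_on_compose2[OF C1_on_imp_continuous_on[OF C1_WH] kep_cont(1)[OF k]]) (use ring_dom_Dom[OF p(1)] in auto)
  have "reduced_action H p = (\<integral>t. WH H (kep p t) \<partial>period_measure)"
    unfolding reduced_action_def kepler_ellipse_kep[OF e] action1_def WH_def by simp
  also have "\<dots> = integral {0..2 * pi} (\<lambda>t. WH H (kep p t))" by (rule period_integral_cont[OF c])
  also have "\<dots> = integral {0..2 * pi} (apply_bcontfun (Nem (WH H) (kep_path p)))"
    by (rule integral_cong) (simp add: W)
  finally show ?thesis by (simp add: Jop_apply)
qed

lemma reduced_action_derivative:
  assumes H: "rotation_group H" "finite H" and p: "p \<in> ring_dom H" "0 < p $ 1"
  shows "(reduced_action H has_derivative (\<lambda>\<delta>. - melnikov H p \<delta>)) (at p)"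
proof -
  let ?R = "ring_dom H \<inter> {p. 0 < p $ 1}"
  note k = ring_dom_kep[OF p(1)]
  have R: "open ?R" "p \<in> ?R"
    using p by (auto intro!: open_Int open_ring_dom H open_Collect_less continuous_intros)
  let ?N = "Nem (WH H)"
  have "(kep_path has_derivative fderiv kep_path p) (at p)" by (rule C1_on_has_derivative[OF C1_kep_path k])
  from has_derivative_compose[OF this C1_on_has_derivative[OF C1_on_Nem[OF C1_WH open_Dom[OF H(2)]]]] p(1)
  have "((\<lambda>p. ?N (kep_path p)) has_derivative (\<lambda>\<delta>. fderiv ?N (kep_path p) (fderiv kep_path p \<delta>))) (at p)"
    by (simp add: ring_dom_def)
  from bounded_linear.has_derivative[OF bounded_linear_bc_apply bounded_linear.has_derivative[OF blinfun.bounded_linear_right[of Jop] this], of "2 * pi"]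
  have "((\<lambda>p. Jop (?N (kep_path p)) (2 * pi)) has_derivative (\<lambda>\<delta>. Jop (fderiv ?N (kep_path p) (fderiv kep_path p \<delta>)) (2 * pi))) (at p)" .
  moreover have "Jop (fderiv ?N (kep_path p) (fderiv kep_path p \<delta>)) (2 * pi) = - melnikov H p \<delta>" for \<delta>
  proof -
    have "fderiv ?N (kep_path p) (fderiv kep_path p \<delta>) t = - (gpath H p t \<bullet> fderiv kep_path p \<delta> t)" for t
      using p(1) ring_dom_Dom[OF p(1)]
      by (simp add: ring_dom_def fderiv_Nem[OF C1_WH open_Dom[OF H(2)]] kep_path_apply[OF k] fderiv_WH[OF H(1)] gpath_apply[OF p(1)])
    then have "apply_bcontfun (fderiv ?N (kep_path p) (fderiv kep_path p \<delta>)) = (\<lambda>t. - (gpath H p t \<bullet> fderiv kep_path p \<delta> t))" by auto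
    then show ?thesis by (simp add: Jop_apply melnikov_def pair_eq)
  qed
  ultimately have "((\<lambda>p. Jop (?N (kep_path p)) (2 * pi)) has_derivative (\<lambda>\<delta>. - melnikov H p \<delta>)) (at p)" by simp
  from has_derivative_transform_within_open[OF this R(1,2)] show ?thesis by (simp add: reduced_action_eq)
qed

text \<open>A sum over an infinite set is 0 by convention, so an infinite \<open>H\<close> would
  make the reduced action vanish identically and its Hessian singular. Nondegeneracy thus takes the
  place of a count of group elements.\<close>

lemma nondegenerate_finite:
  assumes "nondegenerate_critical_point (reduced_action H) p" shows "finite H"
proof (rule ccontr)
  assume inf: "infinite H"
  then have "infinite (H - {mat 1})" by simp
  then have "reduced_action H = (\<lambda>_. 0)" by (simp add: fun_eq_iff reduced_action_def action1_def)
  with assms obtain G M where G: "\<forall>\<^sub>F x in nhds p. GDERIV (\<lambda>_. 0) x :> G x"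
    and M: "(G has_derivative (\<lambda>h. M *v h)) (at p)" "invertible M"
    unfolding nondegenerate_critical_point_def by metis
  have 0: "G x = 0" if "GDERIV (\<lambda>_. 0) x :> G x" for x
  proof -
    have "(\<lambda>h. h \<bullet> G x) = (\<lambda>h. 0)"
      using that has_derivative_const[of 0 "at x"] has_derivative_unique unfolding gderiv_def by blast
    from fun_cong[OF this, of "G x"] show ?thesis by simp
  qed
  then have ev: "\<forall>\<^sub>F x in nhds p. G x = 0" using G by (rule eventually_mono[rotated])
  then obtain S where S: "open S" "p \<in> S" "\<And>x. x \<in> S \<Longrightarrow> G x = 0" unfolding eventually_nhds by blast
  have "((\<lambda>_. 0) has_derivative (\<lambda>h. M *v h)) (at p)"
    by (rule has_derivative_transform_within_open[OF M(1) S(1,2)]) (rule S(3))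
  then have z: "(\<lambda>h. M *v h) = (\<lambda>h. 0)" using has_derivative_const has_derivative_unique by blast
  obtain M' where "M' ** M = mat 1" using M(2) unfolding invertible_def by blast
  then have "M' *v (M *v 1) = 1" by (simp add: matrix_vector_mul_assoc)
  then show False using fun_cong[OF z, of 1] by simp
qed

text \<open>Near the base point \<open>melnikov\<close> is minus the inner product of the gradient
  field \<open>G\<close> with the direction, so the derivative of \<open>G\<close> becomes the
  derivative of \<open>melnikov\<close>. Avoidance of the axes by the great circle carries over to
  the ellipse because fixed vectors of \<open>L\<close> are invariant under positive
  scaling.\<close>

lemma kepler_branchI:
  fixes e0 :: real and \<psi>0 :: "real^3"
  defines "p0 \<equiv> vector [e0, \<psi>0 $ 1, \<psi>0 $ 2, \<psi>0 $ 3] :: real^4"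
  assumes H: "rotation_group H" and e: "0 < e0" "e0 < 1" and c: "cos (\<psi>0 $ 2) \<noteq> 0"
    and circ: "\<forall>\<theta>. \<forall>L\<in>H - {mat 1}. L *v (rot \<psi>0 *v unit_circle \<theta>) \<noteq> rot \<psi>0 *v unit_circle \<theta>"
    and nd: "nondegenerate_critical_point (reduced_action H) p0"
  obtains M where "kepler_branch H p0 M"
proof -
  have pc: "p0 $ 1 = e0" "p0 $ 2 = \<psi>0 $ 1" "p0 $ 3 = \<psi>0 $ 2" "p0 $ 4 = \<psi>0 $ 3"
    by (simp_all add: p0_def vector_def)
  have \<psi>: "vector [p0 $ 2, p0 $ 3, p0 $ 4] = \<psi>0" by (simp add: pc vec_eq_iff forall_3 vector_3)
  have p: "p0 \<in> kep_dom" using e by (simp add: kep_dom_def pc)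
  have fin: "finite H" by (rule nondegenerate_finite[OF nd])
  have free: "p0 \<in> ring_dom H"
  proof (rule ring_domI[OF p])
    fix t
    let ?u = "rot \<psi>0 *v unit_circle (kepler_angle e0 t)" and ?r = "kepler_radius e0 (kepler_angle e0 t)"
    have k: "kep p0 t = ?r *\<^sub>R ?u"
      using fun_cong[OF kepler_ellipse_kep[of p0], of t] e unfolding \<psi>
      by (simp add: pc kepler_ellipse_def matrix_vector_mult_scaleR)
    have r: "?r \<noteq> 0" using kep_nonzero[OF p, of t] k by auto
    have "kep p0 t \<noteq> L *v kep p0 t" if "L \<in> H - {mat 1}" for L
    proof -
      have "L *v kep p0 t = ?r *\<^sub>R (L *v ?u)" unfolding k by (rule matrix_vector_mult_scaleR)
      moreover have "L *v ?u \<noteq> ?u" using circ that by blast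
      ultimately show ?thesis using r unfolding k by (metis real_vector.scale_left_imp_eq)
    qed
    then show "kep p0 t \<in> Dom H" using kep_nonzero[OF p, of t] unfolding Dom_def by blast
  qed
  obtain G M where g0: "GDERIV (reduced_action H) p0 :> 0" and G: "\<forall>\<^sub>F x in nhds p0. GDERIV (reduced_action H) x :> G x"
    and M: "(G has_derivative (\<lambda>h. M *v h)) (at p0)" "invertible M"
    using nd unfolding nondegenerate_critical_point_def by blast
  have e1: "0 < p0 $ 1" using e by (simp add: pc)
  have mel: "melnikov H p \<delta> = - (g \<bullet> \<delta>)" if "p \<in> ring_dom H" "0 < p $ 1" "GDERIV (reduced_action H) p :> g" for p g \<delta>
    using has_derivative_unique[OF reduced_action_derivative[OF H fin that(1,2)] that(3)[unfolded gderiv_def]]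
    by (simp add: fun_eq_iff inner_commute) (metis minus_minus)
  have "\<forall>\<^sub>F x in nhds p0. x \<in> ring_dom H \<inter> {p. 0 < p $ 1}"
    using free e1 by (intro eventually_nhds_in_open open_Int open_ring_dom fin open_Collect_less continuous_intros) auto
  then have "\<forall>\<^sub>F x in nhds p0. \<forall>\<delta>. melnikov H x \<delta> = - (G x \<bullet> \<delta>)"
    using G by eventually_elim (auto simp: mel)
  then obtain S where S: "open S" "p0 \<in> S" "\<And>x \<delta>. x \<in> S \<Longrightarrow> melnikov H x \<delta> = - (G x \<bullet> \<delta>)"
    unfolding eventually_nhds by blast
  have "kepler_branch H p0 M"
  proof
    show "melnikov H p0 \<delta> = 0" for \<delta> using mel[OF free e1 g0] by simp
    show "((\<lambda>p. melnikov H p \<delta>) has_derivative (\<lambda>k. - ((M *v k) \<bullet> \<delta>))) (at p0)" for \<delta>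
    proof (rule has_derivative_transform_within_open[OF _ S(1,2)])
      show "((\<lambda>p. - (G p \<bullet> \<delta>)) has_derivative (\<lambda>k. - ((M *v k) \<bullet> \<delta>))) (at p0)"
        by (intro has_derivative_minus has_derivative_inner_left M(1))
    qed (simp add: S(3))
  qed (use H fin e c free M in \<open>auto simp: pc\<close>)
  then show ?thesis by (rule that)
qed

section \<open>The symmetric many-body problem\<close>

lemma fK_matrix: "orthogonal_matrix L \<Longrightarrow> fK (L *v x) = L *v fK x"
  by (simp add: fK_def orthogonal_matrix_norm matrix_vector_mult_scaleR)

text \<open>With \<open>B = L ** C\<close> the difference is \<open>L\<close> applied to
  \<open>x - C *v x\<close>, and \<open>fK\<close> commutes with orthogonal maps.\<close>

lemma ring_fK_sum:
  assumes H: "rotation_group H" and L: "L \<in> H"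
  shows "(\<Sum>B\<in>H - {L}. fK (L *v x - B *v x)) = L *v gH H x"
proof -
  have o: "orthogonal_matrix A" if "A \<in> H" for A using H that by (simp add: rotation_group_def)
  have m: "A ** B \<in> H" "transpose A \<in> H" if "A \<in> H" "B \<in> H" for A B using H that by (auto simp: rotation_group_def)
  have c: "transpose L ** L = mat 1" "L ** transpose L = mat 1" using o[OF L] by (auto simp: orthogonal_matrix_def)
  have "(\<Sum>B\<in>H - {L}. fK (L *v x - B *v x)) = (\<Sum>C\<in>H - {mat 1}. fK (L *v x - (L ** C) *v x))"
  proof (rule sum.reindex_bij_witness[of _ "\<lambda>C. L ** C" "\<lambda>B. transpose L ** B"])
    show "L ** (transpose L ** B) = B" "transpose L ** (L ** B) = B" for B
      by (simp_all add: matrix_mul_assoc c)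
    note i = this
    show "transpose L ** B \<in> H - {mat 1}" if "B \<in> H - {L}" for B
      using m[OF m(2)[OF L L], of B] that i(1)[of B] by auto
    show "L ** C \<in> H - {L}" if "C \<in> H - {mat 1}" for C
      using m(1)[OF L, of C] that i(2)[of C] c by auto
    show "fK (L *v x - (L ** (transpose L ** B)) *v x) = fK (L *v x - B *v x)" for B by (simp only: i)
  qed
  also have "\<dots> = (\<Sum>C\<in>H - {mat 1}. L *v fK (x - C *v x))"
    by (intro sum.cong refl) (simp only: matrix_vector_mul_assoc[symmetric] matrix_diff_right[symmetric] fK_matrix[OF o[OF L]])
  also have "\<dots> = L *v gH H x"
    unfolding gH_def by (rule linear_sum[OF matrix_vector_mul_linear, symmetric])
  finally show ?thesis .
qed

lemma GDERIV_inverse_norm: "y \<noteq> a \<Longrightarrow> GDERIV (\<lambda>x. 1 / norm (x - a)) y :> - fK (y - a)"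
proof -
  assume "y \<noteq> a"
  then have "y - a \<noteq> 0" by simp
  have "((\<lambda>x. x - a) has_derivative (\<lambda>k. k)) (at y)" by (auto intro!: derivative_eq_intros)
  from has_derivative_compose[OF this inverse_norm_has_derivative[OF \<open>y - a \<noteq> 0\<close>]]
  show ?thesis unfolding gderiv_def by (rule has_derivative_eq_rhs) (simp add: fun_eq_iff fK_def inner_commute)
qed

lemma GDERIV_sum:
  "(\<And>i. i \<in> I \<Longrightarrow> GDERIV (f i) x :> g i) \<Longrightarrow> GDERIV (\<lambda>x. \<Sum>i\<in>I. f i x) x :> (\<Sum>i\<in>I. g i)"
  unfolding gderiv_def by (rule has_derivative_eq_rhs[OF has_derivative_sum]) (auto simp: inner_sum_right)

lemma GDERIV_cmult_add: "GDERIV f x :> g \<Longrightarrow> GDERIV h x :> k \<Longrightarrow> GDERIV (\<lambda>x. c * f x + h x + d) x :> c *\<^sub>R g + k"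
  unfolding gderiv_def
  by (rule has_derivative_eq_rhs[OF has_derivative_add[OF has_derivative_add[OF has_derivative_mult_right _] has_derivative_const]])
    (auto simp: inner_add_right)

text \<open>In the ordered double sum the body \<open>L\<close> occurs twice in each of its pairs,
  which cancels the factor 1/2; everything else is the additive constant \<open>d\<close> of
  \<open>GDERIV_cmult_add\<close>.\<close>

lemma nbody_potential_update:
  assumes H: "finite H" "L \<in> H"
  shows "nbody_potential H \<mu> 0 (q(L := x)) = - \<mu> * (1 / norm (x - 0)) + (\<Sum>B\<in>H - {L}. - 1 * (1 / norm (x - q B)))
    + (- \<mu> * (\<Sum>B\<in>H - {L}. 1 / norm (q B)) - (1 / 2) * (\<Sum>A\<in>H - {L}. \<Sum>B\<in>H - {A} - {L}. 1 / norm (q A - q B)))"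
proof -
  let ?q = "q(L := x)"
  have "(\<Sum>A\<in>H. \<Sum>B\<in>H - {A}. 1 / norm (?q A - ?q B))
    = (\<Sum>B\<in>H - {L}. 1 / norm (x - q B)) + (\<Sum>A\<in>H - {L}. \<Sum>B\<in>H - {A}. 1 / norm (?q A - ?q B))"
    using H by (subst sum.remove[of H L]) auto
  also have "(\<Sum>A\<in>H - {L}. \<Sum>B\<in>H - {A}. 1 / norm (?q A - ?q B))
    = (\<Sum>A\<in>H - {L}. 1 / norm (x - q A) + (\<Sum>B\<in>H - {A} - {L}. 1 / norm (q A - q B)))"
  proof (rule sum.cong[OF refl])
    fix A assume A: "A \<in> H - {L}"
    have "(\<Sum>B\<in>H - {A}. 1 / norm (?q A - ?q B)) = 1 / norm (?q A - ?q L) + (\<Sum>B\<in>H - {A} - {L}. 1 / norm (?q A - ?q B))"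
      using H A by (intro sum.remove) auto
    then show "(\<Sum>B\<in>H - {A}. 1 / norm (?q A - ?q B)) = 1 / norm (x - q A) + (\<Sum>B\<in>H - {A} - {L}. 1 / norm (q A - q B))"
      using A by (simp add: norm_minus_commute)
  qed
  moreover have "(\<Sum>A\<in>H. 1 / norm (?q A - 0)) = 1 / norm x + (\<Sum>B\<in>H - {L}. 1 / norm (q B))"
    using H by (subst sum.remove[of H L]) auto
  ultimately show ?thesis
    unfolding nbody_potential_def by (simp add: sum.distrib sum_negf algebra_simps)
qed

text \<open>The time change multiplies accelerations by \<open>c * c = 1 / \<epsilon>\<close>, which
  turns \<open>fK + \<epsilon> gH\<close> into the attraction of a central mass
  \<open>1 / \<epsilon>\<close> plus the mutual attraction of the orbit. Equivariance transfers the
  equation of one body to all of them, and the central body stays at rest by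
  \<open>rotation_group_sum\<close>.\<close>

lemma ring_nbody_solution:
  assumes H: "rotation_group H" "finite H" and D: "\<And>t. x t \<in> Dom H" and "0 < \<epsilon>"
    and x: "\<And>t. (x has_vector_derivative V t) (at t)" "\<And>t. (V has_vector_derivative force H \<epsilon> (x t)) (at t)"
  shows "nbody_solution H (1 / \<epsilon>) (\<lambda>t. 0) (\<lambda>L t. L *v x (\<epsilon> powr (- 1 / 2) * t))"
proof -
  define c where "c = \<epsilon> powr (- 1 / 2)"
  have cc: "c * c = 1 / \<epsilon>" using \<open>0 < \<epsilon>\<close> by (simp add: c_def powr_minus_divide flip: powr_add)
  have o: "orthogonal_matrix L" if "L \<in> H" for L using H(1) that by (simp add: rotation_group_def)
  have x0: "x t \<noteq> 0" for t using D Dom_nonzero(1) by blast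
  have q0: "L *v x t \<noteq> 0" if "L \<in> H" for L t
    using orthogonal_matrix_norm[OF o[OF that], of "x t"] x0[of t] by (metis norm_eq_zero)
  have inj: "inj_on (\<lambda>L. L *v x t) H" for t
  proof (rule inj_onI)
    fix A B assume AB: "A \<in> H" "B \<in> H" "A *v x t = B *v x t"
    let ?C = "transpose A ** B"
    have "?C \<in> H" using H(1) AB by (simp add: rotation_group_def)
    have "?C *v x t = transpose A *v (A *v x t)" unfolding AB(3) by (rule matrix_vector_mul_assoc[symmetric])
    also have "\<dots> = x t" by (rule orthogonal_matrix_cancel[OF o[OF AB(1)]])
    finally have "?C = mat 1" using D[of t] \<open>?C \<in> H\<close> unfolding Dom_def by force
    then have "A ** (transpose A ** B) = A" by simp
    then show "A = B" using o[OF AB(1)] by (simp add: matrix_mul_assoc orthogonal_matrix_def)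
  qed
  have chain: "((\<lambda>t. f (c * t)) has_vector_derivative c *\<^sub>R f' (c * t)) (at t)"
    if "\<And>t. (f has_vector_derivative f' t) (at t)" for f f' :: "real \<Rightarrow> real^3" and t
  proof -
    have "((\<lambda>t. c * t) has_vector_derivative c) (at t)" by (auto intro!: derivative_eq_intros)
    from vector_diff_chain_at[OF this that] show ?thesis by (simp add: o_def)
  qed
  have d1: "((\<lambda>t. L *v x (c * t)) has_vector_derivative L *v (c *\<^sub>R V (c * t))) (at t)" for L t
    by (rule bounded_linear.has_vector_derivative[OF matrix_vector_mul_bounded_linear chain[OF x(1)]])
  have d2: "((\<lambda>t. L *v (c *\<^sub>R V (c * t))) has_vector_derivative L *v (c *\<^sub>R c *\<^sub>R force H \<epsilon> (x (c * t)))) (at t)" for L t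
    by (intro bounded_linear.has_vector_derivative[OF matrix_vector_mul_bounded_linear]
        bounded_linear.has_vector_derivative[OF bounded_linear_scaleR_right] chain[OF x(2)])
  let ?q = "\<lambda>L t. L *v x (c * t)"
  have central: "GDERIV (\<lambda>z. nbody_potential H (1 / \<epsilon>) z (\<lambda>L. ?q L t)) 0 :> 0" for t
  proof -
    have "GDERIV (\<lambda>z. \<Sum>L\<in>H. 1 / norm (z - ?q L t)) 0 :> (\<Sum>L\<in>H. - fK (0 - ?q L t))"
      by (intro GDERIV_sum GDERIV_inverse_norm) (use q0 in metis)
    moreover have "(\<Sum>L\<in>H. - fK (0 - ?q L t)) = 0"
    proof -
      have "(\<Sum>L\<in>H. - fK (0 - ?q L t)) = (\<Sum>L\<in>H. L *v fK (x (c * t)))"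
        by (intro sum.cong refl) (simp add: fK_matrix[OF o, symmetric], simp add: fK_def)
      then show ?thesis using rotation_group_sum[OF H(1)] by simp
    qed
    ultimately have S: "GDERIV (\<lambda>z. \<Sum>L\<in>H. 1 / norm (z - ?q L t)) 0 :> 0" by simp
    have "GDERIV (\<lambda>z. 0) (0 :: real^3) :> 0" unfolding gderiv_def by simp
    from GDERIV_cmult_add[OF S this, of "- (1 / \<epsilon>)" "- (1 / 2) * (\<Sum>L\<in>H. \<Sum>L'\<in>H - {L}. 1 / norm (?q L t - ?q L' t))"]
    show ?thesis unfolding nbody_potential_def by (simp add: norm_minus_commute)
  qed
  have ring: "GDERIV (\<lambda>z. nbody_potential H (1 / \<epsilon>) 0 ((\<lambda>L'. ?q L' t)(L := z))) (?q L t) :> - (L *v (c *\<^sub>R c *\<^sub>R force H \<epsilon> (x (c * t))))"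
    if L: "L \<in> H" for L t
  proof -
    have 1: "GDERIV (\<lambda>z. 1 / norm (z - 0)) (?q L t) :> - fK (?q L t - 0)"
      by (rule GDERIV_inverse_norm) (use q0[OF L] in auto)
    have ne: "?q L t \<noteq> ?q B t" if "B \<in> H - {L}" for B using inj[of "c * t"] L that by (auto dest: inj_onD)
    have 2: "GDERIV (\<lambda>z. \<Sum>B\<in>H - {L}. - 1 * (1 / norm (z - ?q B t))) (?q L t) :> (\<Sum>B\<in>H - {L}. fK (?q L t - ?q B t))"
    proof (rule GDERIV_sum)
      fix B assume "B \<in> H - {L}"
      from has_derivative_minus[OF GDERIV_inverse_norm[OF ne[OF this], unfolded gderiv_def]]
      show "GDERIV (\<lambda>z. - 1 * (1 / norm (z - ?q B t))) (?q L t) :> fK (?q L t - ?q B t)" unfolding gderiv_def by simp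
    qed
    have v: "- (1 / \<epsilon>) *\<^sub>R (- fK (?q L t - 0)) + L *v gH H (x (c * t)) = - (L *v (c *\<^sub>R c *\<^sub>R force H \<epsilon> (x (c * t))))"
    proof -
      have "- (L *v (c *\<^sub>R c *\<^sub>R force H \<epsilon> (x (c * t)))) = (1 / \<epsilon>) *\<^sub>R (L *v (fK (x (c * t)) + \<epsilon> *\<^sub>R gH H (x (c * t))))"
        unfolding force_def by (simp only: scaleR_scaleR cc scaleR_minus_right matrix_vector_mult_scaleR minus_minus
            linear_neg[OF matrix_vector_mul_linear])
      also have "\<dots> = (1 / \<epsilon>) *\<^sub>R (L *v fK (x (c * t))) + L *v gH H (x (c * t))"
        using \<open>0 < \<epsilon>\<close> by (simp add: matrix_vector_right_distrib matrix_vector_mult_scaleR scaleR_add_right)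
      finally show ?thesis by (simp add: fK_matrix[OF o[OF L]])
    qed
    show ?thesis
      unfolding nbody_potential_update[OF H(2) L] v[symmetric] ring_fK_sum[OF H(1) L, symmetric]
      by (rule GDERIV_cmult_add[OF 1 2])
  qed
  show ?thesis
    unfolding nbody_solution_def c_def[symmetric]
  proof (intro conjI allI ballI)
    show "\<exists>v a. \<forall>t. ((\<lambda>t. 0) has_vector_derivative v t) (at t) \<and> (v has_vector_derivative a t) (at t) \<and>
      GDERIV (\<lambda>z. nbody_potential H (1 / \<epsilon>) z (\<lambda>L. ?q L t)) 0 :> - ((1 / \<epsilon>) *\<^sub>R a t)"
      using central by (intro exI[of _ "\<lambda>_. 0"]) simp
    show "\<exists>v a. \<forall>t. (?q L has_vector_derivative v t) (at t) \<and> (v has_vector_derivative a t) (at t) \<and>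
      GDERIV (\<lambda>z. nbody_potential H (1 / \<epsilon>) 0 ((\<lambda>L'. ?q L' t)(L := z))) (?q L t) :> - a t" if "L \<in> H" for L
      by (rule exI[of _ "\<lambda>t. L *v (c *\<^sub>R V (c * t))"], rule exI[of _ "\<lambda>t. L *v (c *\<^sub>R c *\<^sub>R force H \<epsilon> (x (c * t)))"],
          rule allI, rule conjI, rule d1, rule conjI, rule d2, rule ring[OF that])
  qed (use q0 inj in auto)
qed

section \<open>Periodic solutions from the bifurcation equation\<close>

lemma primitive_unique:
  fixes F G :: "real \<Rightarrow> 'b::banach"
  assumes "\<And>t. t \<in> {0..2 * pi} \<Longrightarrow> (F has_vector_derivative h t) (at t within {0..2 * pi})"
    "\<And>t. t \<in> {0..2 * pi} \<Longrightarrow> (G has_vector_derivative h t) (at t within {0..2 * pi})" "F 0 = G 0" "t \<in> {0..2 * pi}"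
  shows "F t = G t"
proof -
  have "(h has_integral (f t - f 0)) {0..t}"
    if "\<And>t. t \<in> {0..2 * pi} \<Longrightarrow> (f has_vector_derivative h t) (at t within {0..2 * pi})" for f
  proof (rule fundamental_theorem_of_calculus)
    show "(f has_vector_derivative h s) (at s within {0..t})" if "s \<in> {0..t}" for s
      by (rule has_vector_derivative_within_subset[OF \<open>\<And>t. t \<in> {0..2 * pi} \<Longrightarrow> (f has_vector_derivative h t) (at t within {0..2 * pi})\<close>])
        (use that assms(4) in auto)
  qed (use assms(4) in simp)
  from has_integral_unique[OF this[of F] this[of G]] assms(1,2,3) show ?thesis by simp
qed

text \<open>The right-hand side along \<open>x\<close> is extended periodically and integrated twice
  over the whole line; matching end values make both primitives periodic, and on one period they
  agree with the given data.\<close>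

lemma periodic_ode:
  fixes x V :: "real \<Rightarrow> real^3"
  assumes x: "\<And>t. t \<in> {0..2 * pi} \<Longrightarrow> (x has_vector_derivative V t) (at t within {0..2 * pi})"
    and V: "\<And>t. t \<in> {0..2 * pi} \<Longrightarrow> (V has_vector_derivative f (x t)) (at t within {0..2 * pi})"
    and c: "continuous_on {0..2 * pi} (\<lambda>t. f (x t))" and ends: "x (2 * pi) = x 0" "V (2 * pi) = V 0"
  obtains y Y where "\<And>t. (y has_vector_derivative Y t) (at t)" "\<And>t. (Y has_vector_derivative f (y t)) (at t)"
    "\<And>t. y (t + 2 * pi) = y t" "\<And>t. t \<in> {0..2 * pi} \<Longrightarrow> y t = x t" "\<And>t. t \<in> {0..2 * pi} \<Longrightarrow> Y t = V t"
proof -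
  let ?g = "\<lambda>t. f (x (per t))"
  have gc: "continuous_on UNIV ?g" by (rule continuous_periodic_extension[OF c]) (simp add: ends)
  have g: "?g t = f (x t)" if "t \<in> {0..2 * pi}" for t
    using per_agree[of x t] ends that by simp
  obtain Y where Y: "\<And>t. (Y has_vector_derivative ?g t) (at t)" "Y 0 = V 0"
    by (rule antiderivative_exists[OF gc]) (rule that; assumption)
  have YV: "Y t = V t" if "t \<in> {0..2 * pi}" for t
  proof (rule primitive_unique[where F = Y and G = V and h = "\<lambda>t. f (x t)"])
    show "(Y has_vector_derivative f (x t)) (at t within {0..2 * pi})" if "t \<in> {0..2 * pi}" for t
      using has_vector_derivative_at_within[OF Y(1)[of t]] unfolding g[OF that] .
  qed (use V Y(2) that in auto)
  have Yp: "Y (t + 2 * pi) = Y t" for t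
    by (rule periodic_primitive[OF Y(1)]) (simp_all add: per_periodic YV ends)
  have "continuous_on UNIV Y" by (auto intro!: continuous_at_imp_continuous_on has_vector_derivative_continuous Y(1))
  then obtain y where y: "\<And>t. (y has_vector_derivative Y t) (at t)" "y 0 = x 0"
    by (rule antiderivative_exists) (rule that; assumption)
  have yx: "y t = x t" if "t \<in> {0..2 * pi}" for t
  proof (rule primitive_unique[where F = y and G = x and h = V])
    show "(y has_vector_derivative V t) (at t within {0..2 * pi})" if "t \<in> {0..2 * pi}" for t
      using has_vector_derivative_at_within[OF y(1)[of t]] unfolding YV[OF that] .
  qed (use x y(2) that in auto)
  have yp: "y (t + 2 * pi) = y t" for t
    by (rule periodic_primitive[OF y(1) Yp]) (simp add: yx ends)
  have "(Y has_vector_derivative f (y t)) (at t)" for t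
    using Y(1)[of t] periodic_per[of y t, OF yp] yx[of "per t"] by simp
  then show ?thesis using that y(1) yp yx YV by blast
qed

text \<open>Multiplication by \<open>\<epsilon>\<close> turns \<open>Qf\<close> into a difference of
  Kepler forces, so \<open>x\<close> solves the full equation without any division by the parameter,
  at \<open>\<epsilon> = 0\<close> as well.\<close>

lemma bif_zero_ode:
  fixes h :: path
  assumes F: "bif H p0 ((h, (p, \<kappa>)), \<epsilon>) = 0" and D: "((h, (p, \<kappa>)), \<epsilon>) \<in> bif_dom H"
  defines "x \<equiv> \<lambda>t. kep p t + \<epsilon> *\<^sub>R vpath (h, (p, \<kappa>)) t" and "V \<equiv> \<lambda>t. kepv p t + \<epsilon> *\<^sub>R (\<kappa> *\<^sub>R QQ p + Jop h t)"
  shows "\<And>t. t \<in> {0..2 * pi} \<Longrightarrow> (x has_vector_derivative V t) (at t within {0..2 * pi})"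
    "\<And>t. t \<in> {0..2 * pi} \<Longrightarrow> (V has_vector_derivative force H \<epsilon> (x t)) (at t within {0..2 * pi})"
    "x (2 * pi) = x 0" "x 0 = kep p 0" "V (2 * pi) = V 0 + \<epsilon> *\<^sub>R Jop h (2 * pi)"
    "V 0 = (peri_speed (p $ 1) + \<epsilon> * \<kappa>) *\<^sub>R QQ p"
    "\<And>t. t \<in> {0..2 * pi} \<Longrightarrow> force H \<epsilon> (x t) = - fK (kep p t) + \<epsilon> *\<^sub>R h t"
    "Jop h (2 * pi) \<bullet> PP p0 = 0" "Jop h (2 * pi) \<bullet> NN p0 = 0"
proof -
  let ?v = "vpath (h, (p, \<kappa>))"
  note p = bif_domD(1)[OF D]
  have v2: "?v (2 * pi) = 0" using F by (simp add: bif_def prod_eq_iff)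
  show "Jop h (2 * pi) \<bullet> PP p0 = 0" "Jop h (2 * pi) \<bullet> NN p0 = 0"
    using F by (simp_all add: bif_def prod_eq_iff inner_commute)
  show "x 0 = kep p 0" by (simp add: x_def vpath_apply)
  then show "x (2 * pi) = x 0" using kep_periodic(1)[OF p, of 0] by (simp add: x_def v2)
  show "V (2 * pi) = V 0 + \<epsilon> *\<^sub>R Jop h (2 * pi)"
    using kep_periodic(2)[OF p, of 0] by (simp add: V_def scaleR_add_right)
  show "V 0 = (peri_speed (p $ 1) + \<epsilon> * \<kappa>) *\<^sub>R QQ p" by (simp add: V_def kep_0[OF p] scaleR_add_left)
  show f: "force H \<epsilon> (x t) = - fK (kep p t) + \<epsilon> *\<^sub>R h t" if t: "t \<in> {0..2 * pi}" for t
  proof -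
    have "x t \<noteq> 0" using Dom_nonzero(1)[OF bif_domD(2)[OF D t]] by (simp add: x_def)
    then have Q: "\<epsilon> *\<^sub>R Qf (kep p t) (?v t) \<epsilon> = fK (x t) - fK (kep p t)"
      unfolding x_def by (intro Qf_mult kep_nonzero[OF p]) simp
    have "h t + Qf (kep p t) (?v t) \<epsilon> + gH H (x t) = 0"
      using bif_apply[OF D, of p0 t] F t by (simp add: x_def)
    then have "h t = - Qf (kep p t) (?v t) \<epsilon> - gH H (x t)" by (simp add: eq_neg_iff_add_eq_0 algebra_simps)
    then have "\<epsilon> *\<^sub>R h t = - (\<epsilon> *\<^sub>R Qf (kep p t) (?v t) \<epsilon>) - \<epsilon> *\<^sub>R gH H (x t)" by (simp add: scaleR_diff_right)
    then show ?thesis unfolding Q force_def by simp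
  qed
  show "(x has_vector_derivative V t) (at t within {0..2 * pi})" if t: "t \<in> {0..2 * pi}" for t
  proof -
    have "((\<lambda>t. t *\<^sub>R \<kappa> *\<^sub>R QQ p + Jop (Jop h) t) has_vector_derivative 1 *\<^sub>R \<kappa> *\<^sub>R QQ p + Jop h t) (at t within {0..2 * pi})"
      by (rule has_vector_derivative_add[OF _ Jop_deriv[OF t]]) (auto intro!: derivative_eq_intros)
    then have d: "((\<lambda>t. t *\<^sub>R \<kappa> *\<^sub>R QQ p + Jop (Jop h) t) has_vector_derivative \<kappa> *\<^sub>R QQ p + Jop h t) (at t within {0..2 * pi})"
      by (simp only: scaleR_one)
    have "(?v has_vector_derivative \<kappa> *\<^sub>R QQ p + Jop h t) (at t within {0..2 * pi})"
      by (rule has_vector_derivative_transform[OF t _ d]) (simp add: vpath_apply)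
    from has_vector_derivative_add[OF has_vector_derivative_at_within[OF kep_deriv[OF p]] bounded_linear.has_vector_derivative[OF bounded_linear_scaleR_right this]]
    show ?thesis unfolding x_def V_def .
  qed
  show "(V has_vector_derivative force H \<epsilon> (x t)) (at t within {0..2 * pi})" if t: "t \<in> {0..2 * pi}" for t
    unfolding f[OF t] V_def
    using has_vector_derivative_add[OF has_vector_derivative_at_within[OF kepv_deriv[OF p]]
       bounded_linear.has_vector_derivative[OF bounded_linear_scaleR_right
         has_vector_derivative_add[OF has_vector_derivative_const[of "\<kappa> *\<^sub>R QQ p"] Jop_deriv[OF t, of h]]]] by simp
qed

text \<open>\<open>potential\<close> is the negative of the physical potential energy, so
  \<open>?E\<close> is twice the energy. Equal end positions leave equal end speeds.\<close>

lemma energy_conserved: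
  assumes H: "rotation_group H" and D: "\<And>t. t \<in> {0..2 * pi} \<Longrightarrow> x t \<in> Dom H"
    and x: "\<And>t. t \<in> {0..2 * pi} \<Longrightarrow> (x has_vector_derivative V t) (at t within {0..2 * pi})"
    and V: "\<And>t. t \<in> {0..2 * pi} \<Longrightarrow> (V has_vector_derivative force H \<epsilon> (x t)) (at t within {0..2 * pi})"
    and ends: "x (2 * pi) = x 0"
  shows "V (2 * pi) \<bullet> V (2 * pi) = V 0 \<bullet> V 0"
proof -
  let ?E = "\<lambda>t. V t \<bullet> V t - 2 * potential H \<epsilon> (x t)"
  have "(?E has_vector_derivative 0) (at t within {0..2 * pi})" if t: "t \<in> {0..2 * pi}" for t
  proof -
    have "((\<lambda>t. potential H \<epsilon> (x t)) has_vector_derivative force H \<epsilon> (x t) \<bullet> V t) (at t within {0..2 * pi})"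
      unfolding has_vector_derivative_def
      by (rule has_derivative_eq_rhs[OF has_derivative_compose[OF x[OF t, unfolded has_vector_derivative_def]
            potential_has_derivative_force[OF H D[OF t]]]]) (simp add: fun_eq_iff)
    from has_vector_derivative_diff[OF bounded_bilinear.has_vector_derivative[OF bounded_bilinear_inner V[OF t] V[OF t]]
        bounded_linear.has_vector_derivative[OF bounded_linear_mult_right[of 2] this]]
    show ?thesis by (simp add: inner_commute)
  qed
  note E = this
  have "?E (2 * pi) = (\<lambda>_. ?E 0) (2 * pi)"
  proof (rule primitive_unique[where F = ?E and G = "\<lambda>_. ?E 0" and h = "\<lambda>_. 0"])
    show "(?E has_vector_derivative 0) (at t within {0..2 * pi})" if "t \<in> {0..2 * pi}" for t by (rule E[OF that])
    show "((\<lambda>_. ?E 0) has_vector_derivative 0) (at t within {0..2 * pi})" for t by (rule has_vector_derivative_const)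
  qed simp_all
  then show ?thesis using ends by simp
qed

text \<open>Defined through \<open>Pop\<close> for all arguments, so that smooth dependence on
  \<open>\<theta>\<close> and \<open>\<epsilon>\<close> does not presuppose that the solution closes
  up.\<close>

definition branch_curve :: "unknown \<Rightarrow> real \<Rightarrow> H2_per" where
  "branch_curve \<theta> \<epsilon> = Pop (kep (fst (snd \<theta>)) 0) (- Nem fK (kep_path (fst (snd \<theta>))) + \<epsilon> *\<^sub>R fst \<theta>)"

text \<open>The velocity jump is \<open>\<epsilon> *\<^sub>R ?J\<close> with \<open>?J\<close> along
  \<open>QQ p0\<close>. Equal speeds at both ends read
  \<open>\<epsilon> ?c (2 V 0 . QQ p0 + \<epsilon> ?c) = 0\<close>, and \<open>pos\<close> says that
  for nonzero \<open>\<epsilon>\<close> the bracket is positive, so \<open>?c = 0\<close>.\<close>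

lemma branch_critical:
  fixes h :: path
  assumes H: "rotation_group H" "finite H" and F: "bif H p0 ((h, (p, \<kappa>)), \<epsilon>) = 0" and D: "((h, (p, \<kappa>)), \<epsilon>) \<in> bif_dom H"
    and pos: "\<epsilon> = 0 \<or> 0 < 2 * (peri_speed (p $ 1) + \<epsilon> * \<kappa>) * (QQ p \<bullet> QQ p0) + \<epsilon> * (Jop h (2 * pi) \<bullet> QQ p0)"
  shows "critical_point H \<epsilon> (branch_curve (h, (p, \<kappa>)) \<epsilon>)"
    "\<And>t. t \<in> {0..2 * pi} \<Longrightarrow> curve (branch_curve (h, (p, \<kappa>)) \<epsilon>) t = kep p t + \<epsilon> *\<^sub>R vpath (h, (p, \<kappa>)) t"
proof -
  define x where "x t = kep p t + \<epsilon> *\<^sub>R vpath (h, (p, \<kappa>)) t" for t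
  define V where "V t = kepv p t + \<epsilon> *\<^sub>R (\<kappa> *\<^sub>R QQ p + Jop h t)" for t
  note o = bif_zero_ode[OF F D, folded x_def V_def]
  note p = bif_domD(1)[OF D]
  have xD: "x t \<in> Dom H" if "t \<in> {0..2 * pi}" for t using bif_domD(2)[OF D that] by (simp add: x_def)
  let ?J = "Jop h (2 * pi)" and ?c = "Jop h (2 * pi) \<bullet> QQ p0"
  have J: "?J = ?c *\<^sub>R QQ p0" using frame_expand[of ?J "p0 $ 2" "p0 $ 3" "p0 $ 4"] o(8,9) by simp
  have "\<epsilon> *\<^sub>R ?J = 0"
  proof (cases "\<epsilon> = 0")
    case False
    have "V (2 * pi) \<bullet> V (2 * pi) = V 0 \<bullet> V 0" by (rule energy_conserved[OF H(1) xD o(1,2,3)])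
    then have e1: "2 * (V 0 \<bullet> (\<epsilon> *\<^sub>R ?J)) + (\<epsilon> *\<^sub>R ?J) \<bullet> (\<epsilon> *\<^sub>R ?J) = 0"
      unfolding o(5) by (simp add: inner_add_left inner_add_right inner_commute)
    have e2: "V 0 \<bullet> (\<epsilon> *\<^sub>R ?J) = \<epsilon> * ?c * ((peri_speed (p $ 1) + \<epsilon> * \<kappa>) * (QQ p \<bullet> QQ p0))"
      by (subst J) (simp add: o(6))
    have e3: "(\<epsilon> *\<^sub>R ?J) \<bullet> (\<epsilon> *\<^sub>R ?J) = \<epsilon> * ?c * (\<epsilon> * ?c)"
    proof -
      have "?J \<bullet> ?J = ?c * ?c" by (subst (1 2) J) (simp add: frame_orthonormal)
      then show ?thesis by simp
    qed
    have "\<epsilon> * ?c * (2 * (peri_speed (p $ 1) + \<epsilon> * \<kappa>) * (QQ p \<bullet> QQ p0) + \<epsilon> * ?c) = 0"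
      using e1 unfolding e2 e3 by (simp add: algebra_simps)
    then have "?c = 0" using False pos by auto
    then show ?thesis using J by simp
  qed simp
  then have V2: "V (2 * pi) = V 0" using o(5) by simp
  have xc: "continuous_on {0..2 * pi} x" using o(1) by (meson continuous_on_vector_derivative)
  have fc: "continuous_on {0..2 * pi} (\<lambda>t. force H \<epsilon> (x t))"
    by (rule continuous_on_compose2[OF C1_on_imp_continuous_on[OF C1_force] xc]) (use xD in auto)
  obtain y Y where y: "\<And>t. (y has_vector_derivative Y t) (at t)" "\<And>t. (Y has_vector_derivative force H \<epsilon> (y t)) (at t)"
    "\<And>t. y (t + 2 * pi) = y t" "\<And>t. t \<in> {0..2 * pi} \<Longrightarrow> y t = x t" "\<And>t. t \<in> {0..2 * pi} \<Longrightarrow> Y t = V t"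
    by (rule periodic_ode[OF o(1,2) fc o(3) V2]) (assumption, assumption, (rule that; assumption))
  have "curve (Pop (y 0) (- Nem fK (kep_path p) + \<epsilon> *\<^sub>R h)) = y"
  proof (rule curve_Pop_eq[where x = y and V = Y])
    show "y (t + 2 * pi) = y t" for t by (rule y(3))
    fix t assume t: "t \<in> {0..2 * pi}"
    show "(y has_vector_derivative Y t) (at t within {0..2 * pi})" by (rule has_vector_derivative_at_within[OF y(1)])
    show "(Y has_vector_derivative (- Nem fK (kep_path p) + \<epsilon> *\<^sub>R h) t) (at t within {0..2 * pi})"
      using has_vector_derivative_at_within[OF y(2)[of t], of "{0..2 * pi}"] t
      by (simp add: y(4) o(7) Nem_fK_kep[OF p])
  qed (simp add: y(5) V2)
  then have c: "curve (branch_curve (h, (p, \<kappa>)) \<epsilon>) = y" using o(4) by (simp add: branch_curve_def y(4))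
  have "y t \<in> Dom H" for t using periodic_per[of y t, OF y(3)] y(4)[of "per t"] xD[of "per t"] by simp
  then show "critical_point H \<epsilon> (branch_curve (h, (p, \<kappa>)) \<epsilon>)"
    unfolding critical_point_iff[OF H] c using y(1,2) by blast
  show "\<And>t. t \<in> {0..2 * pi} \<Longrightarrow> curve (branch_curve (h, (p, \<kappa>)) \<epsilon>) t = kep p t + \<epsilon> *\<^sub>R vpath (h, (p, \<kappa>)) t"
    unfolding c by (simp add: y(4) x_def)
qed

lemma branch_curve_kep:
  assumes "p \<in> kep_dom" shows "curve (branch_curve (0, (p, \<kappa>)) \<epsilon>) = kep p"
proof -
  have "curve (Pop (kep p 0) (- Nem fK (kep_path p))) = kep p"
    by (rule curve_Pop_eq[where x = "kep p" and V = "kepv p"])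
      (use assms kep_periodic[OF assms] kep_periodic(2)[OF assms, of 0] in \<open>auto simp: Nem_fK_kep intro: has_vector_derivative_at_within kep_deriv kepv_deriv\<close>)
  then show ?thesis by (simp add: branch_curve_def)
qed

lemma C1_branch_curve:
  assumes \<theta>: "C1_on S \<theta>" and "C1_on S e" and p: "\<And>x. x \<in> S \<Longrightarrow> fst (snd (\<theta> x)) \<in> kep_dom"
  shows "C1_on S (\<lambda>x. branch_curve (\<theta> x) (e x))"
proof -
  have n: "C1_on S (\<lambda>x. Nem fK (kep_path (fst (snd (\<theta> x)))))"
  proof (rule C1_on_compose[OF _ C1_on_Nem[OF C1_fK']])
    show "C1_on S (\<lambda>x. kep_path (fst (snd (\<theta> x))))"
      by (rule C1_on_compose[OF _ C1_kep_path p]) (intro C1_intros \<theta>)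
    show "kep_path (fst (snd (\<theta> x))) \<in> nem_dom (- {0})" if "x \<in> S" for x
      using kep_nonzero[OF p[OF that]] by (intro kep_path_dom p that) auto
  qed (rule open_Compl, simp)
  have "C1_on S (\<lambda>x. (kep (fst (snd (\<theta> x))) 0, - Nem fK (kep_path (fst (snd (\<theta> x)))) + e x *\<^sub>R fst (\<theta> x)))"
    by (intro C1_intros C1_kep \<theta> n assms(2) p)
  from C1_on_linear_compose[OF bounded_linear_Pop this] show ?thesis by (simp add: branch_curve_def)
qed

lemma C1_bigo:
  fixes f :: "real \<Rightarrow> 'a::real_normed_vector"
  assumes "C1_on {-d<..<d} f" "0 < d"
  shows "(\<lambda>\<epsilon>. norm (f \<epsilon> - f 0)) \<in> O[at_right 0](\<lambda>\<epsilon>. \<epsilon>)"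
proof -
  have "(f has_derivative fderiv f 0) (at 0)" by (rule C1_on_has_derivative[OF assms(1)]) (use assms(2) in auto)
  then have "((\<lambda>s. f s - f 0) has_derivative fderiv f 0) (at 0)" by (auto intro!: derivative_eq_intros)
  moreover have "blinfun_apply (fderiv f 0) = (\<lambda>s. s *\<^sub>R fderiv f 0 1)"
    by (auto simp: fun_eq_iff simp flip: blinfun.scaleR_right)
  ultimately have "((\<lambda>s. f s - f 0) has_vector_derivative fderiv f 0 1) (at 0)"
    unfolding has_vector_derivative_def by simp
  from tendsto_norm[OF has_vector_derivative_quotient_limit[OF this]]
  have "((\<lambda>s. norm ((1 / s) *\<^sub>R (f s - f 0))) \<longlongrightarrow> norm (fderiv f 0 1)) (at 0)" by simp
  from order_tendstoD(2)[OF this, of "norm (fderiv f 0 1) + 1"]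
  have "\<forall>\<^sub>F s in at 0. norm ((1 / s) *\<^sub>R (f s - f 0)) < norm (fderiv f 0 1) + 1" by simp
  from filter_leD[OF at_le[OF subset_UNIV, of 0 "{0<..}"] this]
  have "\<forall>\<^sub>F s in at_right 0. norm ((1 / s) *\<^sub>R (f s - f 0)) < norm (fderiv f 0 1) + 1" .
  then show ?thesis
    by (intro bigoI[of _ "norm (fderiv f 0 1) + 1"], elim eventually_mono[OF eventually_conj[OF _ eventually_at_right_less[of 0]]])
      (auto simp: pos_divide_less_eq less_imp_le)
qed

section \<open>Uniqueness\<close>

lemma pair_in_ball:
  fixes a c :: "'a::real_normed_vector" and b d :: "'b::real_normed_vector"
  assumes "norm (a - c) < e / 2" "norm (b - d) < e / 2" shows "(a, b) \<in> ball (c, d) e"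
proof -
  have "dist (c, d) (a, b) \<le> dist c a + dist d b"
    unfolding dist_Pair_Pair by (rule sqrt_sum_squares_le_sum) auto
  then show ?thesis using assms by (simp add: dist_norm norm_minus_commute)
qed

lemma kep_uniform:
  assumes p: "p \<in> kep_dom" and "0 < \<rho>"
  obtains \<eta> where "0 < \<eta>"
    "\<And>t s. t \<in> {0..2 * pi} \<Longrightarrow> \<bar>s\<bar> \<le> \<eta> \<Longrightarrow> norm (kep p (t + s) - kep p t) < \<rho>"
    "\<And>t s. t \<in> {0..2 * pi} \<Longrightarrow> \<bar>s\<bar> \<le> \<eta> \<Longrightarrow> norm (kepv p (t + s) - kepv p t) < \<rho>"
proof -
  let ?f = "\<lambda>t. (kep p t, kepv p t)"
  have "uniformly_continuous_on {-1..2 * pi + 1} ?f"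
    by (intro compact_uniformly_continuous continuous_intros kep_cont p) simp
  then obtain d where d: "0 < d" "\<And>x y. x \<in> {-1..2 * pi + 1} \<Longrightarrow> y \<in> {-1..2 * pi + 1} \<Longrightarrow> dist y x < d \<Longrightarrow> dist (?f y) (?f x) < \<rho>"
    using \<open>0 < \<rho>\<close> unfolding uniformly_continuous_on_def by metis
  have k: "dist (?f (t + s)) (?f t) < \<rho>" if "t \<in> {0..2 * pi}" "\<bar>s\<bar> \<le> min 1 (d / 2)" for t s
    by (rule d(2)) (use that d(1) in \<open>auto simp: dist_norm\<close>)
  show ?thesis
  proof (rule that[of "min 1 (d / 2)"])
    fix t s assume ts: "t \<in> {0..2 * pi}" "\<bar>s\<bar> \<le> min 1 (d / 2)"
    show "norm (kep p (t + s) - kep p t) < \<rho>" "norm (kepv p (t + s) - kepv p t) < \<rho>"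
      using k[OF ts] dist_fst_le[of "?f (t + s)" "?f t"] dist_snd_le[of "?f (t + s)" "?f t"] by (simp_all add: dist_norm)
  qed (use d(1) in simp)
qed

section \<open>Nearness in phase space and the choice of the phase\<close>

lemma curve_deriv_periodic:
  assumes X: "\<And>t. (curve w has_vector_derivative X t) (at t)" shows "X (t + 2 * pi) = X t"
proof -
  have "((\<lambda>t. t + 2 * pi) has_vector_derivative 1) (at t)" by (auto intro!: derivative_eq_intros)
  from vector_diff_chain_at[OF this X[of "t + 2 * pi"]]
  have "(curve w has_vector_derivative X (t + 2 * pi)) (at t)" by (simp add: o_def curve_periodic)
  from vector_derivative_unique_at[OF this X] show ?thesis .
qed

lemma curve_C1_close:
  assumes u: "curve u = kep p" and p: "p \<in> kep_dom" and X: "\<And>t. (curve w has_vector_derivative X t) (at t)"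
  shows "norm (curve w t - kep p t) \<le> 8 * norm (w - u)" "norm (X t - kepv p t) \<le> 8 * norm (w - u)"
proof -
  show "norm (curve w t - kep p t) \<le> 8 * norm (w - u)"
    using curve_sup_bound[of "w - u" t] by (simp add: curve_diff u)
  obtain D where D: "\<And>t. t \<in> {0..2 * pi} \<Longrightarrow> (curve (w - u) has_vector_derivative D t) (at t within {0..2 * pi})"
    "\<And>t. t \<in> {0..2 * pi} \<Longrightarrow> norm (D t) \<le> 8 * norm (w - u)"
    by (rule H2_per_C1[of "w - u"]) (rule that; assumption)
  note Xp = curve_deriv_periodic[OF X]
  have DX: "D t = X t - kepv p t" if "t \<in> {0..2 * pi}" for t
  proof (rule vector_derivative_unique_within_closed_interval[of 0 "2 * pi" t "curve (w - u)"])
    have "((\<lambda>t. curve w t - kep p t) has_vector_derivative X t - kepv p t) (at t within {0..2 * pi})"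
      by (rule has_vector_derivative_diff[OF has_vector_derivative_at_within[OF X] has_vector_derivative_at_within[OF kep_deriv[OF p]]])
    moreover have "curve (w - u) = (\<lambda>t. curve w t - kep p t)" by (simp add: fun_eq_iff curve_diff u)
    ultimately show "(curve (w - u) has_vector_derivative X t - kepv p t) (at t within cbox 0 (2 * pi))" by simp
  qed (use D(1)[OF that] that in auto)
  have "X t - kepv p t = X (per t) - kepv p (per t)"
    using periodic_per[of X t, OF Xp] periodic_per[of "kepv p" t, OF kep_periodic(2)[OF p]] by simp
  then show "norm (X t - kepv p t) \<le> 8 * norm (w - u)" using D(2)[of "per t"] DX[of "per t"] by simp
qed

text \<open>The derivative of \<open>kep . kepv\<close> at the apsis is \<open>e / (1 - e)\<close>.
  For positive eccentricity the zero is thus a transversal sign change, which small perturbations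
  cannot destroy.\<close>

lemma kep_radial_speed:
  assumes p: "p \<in> kep_dom" "0 < p $ 1" and "0 < \<eta>"
  obtains h where "0 < h" "h \<le> \<eta>" "0 < kep p h \<bullet> kepv p h" "kep p (- h) \<bullet> kepv p (- h) < 0"
proof -
  let ?g = "\<lambda>t. kep p t \<bullet> kepv p t"
  define r where "r = 1 - p $ 1"
  have e: "\<bar>p $ 1\<bar> < 1" using p by (simp add: kep_dom_def)
  have r: "0 < r" using e by (simp add: r_def)
  have n: "norm (kep p 0) = r" using kep_norm[OF p(1), of 0] e by (simp add: ecc_0 r_def)
  have "(?g has_vector_derivative kep p 0 \<bullet> (- fK (kep p 0)) + kepv p 0 \<bullet> kepv p 0) (at 0)"
    by (rule bounded_bilinear.has_vector_derivative[OF bounded_bilinear_inner kep_deriv[OF p(1)] kepv_deriv[OF p(1)]])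
  moreover have "kep p 0 \<bullet> (- fK (kep p 0)) + kepv p 0 \<bullet> kepv p 0 = p $ 1 / r"
  proof -
    have "kep p 0 \<bullet> fK (kep p 0) = 1 / r"
      unfolding fK_def n using r by (simp add: kep_0[OF p(1)] frame_orthonormal r_def[symmetric] power3_eq_cube)
    moreover have "kepv p 0 \<bullet> kepv p 0 = (1 + p $ 1) / r"
      using peri_speed_sq(1)[OF e] r by (simp add: kep_0[OF p(1)] frame_orthonormal r_def field_simps)
    ultimately show ?thesis by (simp add: diff_divide_distrib[symmetric])
  qed
  ultimately have d: "DERIV ?g 0 :> p $ 1 / r" by (simp add: has_real_derivative_iff_has_vector_derivative)
  have pos: "0 < p $ 1 / r" using p(2) r by simp
  have g0: "?g 0 = 0" by (simp add: kep_0[OF p(1)] frame_orthonormal)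
  obtain d1 where d1: "0 < d1" "\<And>h. 0 < h \<Longrightarrow> h < d1 \<Longrightarrow> ?g 0 < ?g (0 + h)"
    using DERIV_pos_inc_right[OF d pos] by blast
  obtain d2 where d2: "0 < d2" "\<And>h. 0 < h \<Longrightarrow> h < d2 \<Longrightarrow> ?g (0 - h) < ?g 0"
    using DERIV_pos_inc_left[OF d pos] by blast
  let ?h = "min \<eta> (min (d1 / 2) (d2 / 2))"
  have h: "0 < ?h" "?h \<le> \<eta>" "?h < d1" "?h < d2" using d1(1) d2(1) \<open>0 < \<eta>\<close> by (auto simp: min_less_iff_disj)
  show ?thesis by (rule that[OF h(1,2)]) (use d1(2)[OF h(1,3)] d2(2)[OF h(1,4)] in \<open>simp_all add: g0\<close>)
qed

text \<open>The signs of the radial speed at \<open>- h\<close> and \<open>h\<close> persist under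
  perturbations small in \<open>C^1\<close>, which nearness in X controls with the factor 8. The
  intermediate value theorem gives an apsis of the perturbed curve at some \<open>\<phi>\<close>
  with \<open>\<bar>\<phi>\<bar> \<le> h\<close>, and \<open>h \<le> \<eta>\<close> keeps the
  shifted curve near the ellipse.\<close>

lemma apsis_time:
  assumes u: "curve u = kep p" and p: "p \<in> kep_dom" "0 < p $ 1" and "0 < \<rho>"
  obtains \<delta> where "0 < \<delta>"
    "\<And>w X. norm (w - u) < \<delta> \<Longrightarrow> (\<And>t. (curve w has_vector_derivative X t) (at t)) \<Longrightarrow> continuous_on UNIV X \<Longrightarrow>
      \<exists>\<phi>. curve w \<phi> \<bullet> X \<phi> = 0 \<and> (\<forall>t\<in>{0..2 * pi}. norm (curve w (t + \<phi>) - kep p t) < \<rho> \<and> norm (X (t + \<phi>) - kepv p t) < \<rho>)"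
proof -
  obtain \<eta> where \<eta>: "0 < \<eta>" "\<And>t s. t \<in> {0..2 * pi} \<Longrightarrow> \<bar>s\<bar> \<le> \<eta> \<Longrightarrow> norm (kep p (t + s) - kep p t) < \<rho> / 2"
    "\<And>t s. t \<in> {0..2 * pi} \<Longrightarrow> \<bar>s\<bar> \<le> \<eta> \<Longrightarrow> norm (kepv p (t + s) - kepv p t) < \<rho> / 2"
    by (rule kep_uniform[OF p(1), of "\<rho> / 2"]) (use \<open>0 < \<rho>\<close> in simp, (rule that; assumption))
  obtain h where h: "0 < h" "h \<le> \<eta>" "0 < kep p h \<bullet> kepv p h" "kep p (- h) \<bullet> kepv p (- h) < 0"
    by (rule kep_radial_speed[OF p \<eta>(1)]) (rule that; assumption)
  have "open {z :: (real^3) \<times> (real^3). 0 < fst z \<bullet> snd z}" "open {z :: (real^3) \<times> (real^3). fst z \<bullet> snd z < 0}"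
    by (intro open_Collect_less continuous_intros)+
  then obtain e1 e2 where e: "0 < e1" "ball (kep p h, kepv p h) e1 \<subseteq> {z. 0 < fst z \<bullet> snd z}"
    "0 < e2" "ball (kep p (- h), kepv p (- h)) e2 \<subseteq> {z. fst z \<bullet> snd z < 0}"
    using h(3,4) unfolding open_contains_ball by (metis (no_types, lifting) fst_conv mem_Collect_eq snd_conv)
  define \<delta> where "\<delta> = min (\<rho> / 2) (min (e1 / 2) (e2 / 2)) / 8"
  have \<delta>: "0 < \<delta>" "8 * \<delta> \<le> \<rho> / 2" "8 * \<delta> \<le> e1 / 2" "8 * \<delta> \<le> e2 / 2"
    using e(1,3) \<open>0 < \<rho>\<close> by (auto simp: \<delta>_def)
  show ?thesis
  proof (rule that[OF \<delta>(1)])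
    fix w X assume w: "norm (w - u) < \<delta>" and X: "\<And>t. (curve w has_vector_derivative X t) (at t)" and Xc: "continuous_on UNIV X"
    have c: "norm (curve w t - kep p t) < 8 * \<delta>" "norm (X t - kepv p t) < 8 * \<delta>" for t
      using curve_C1_close[OF u p(1) X, of t] w by linarith+
    have "(curve w h, X h) \<in> ball (kep p h, kepv p h) e1" "(curve w (- h), X (- h)) \<in> ball (kep p (- h), kepv p (- h)) e2"
      using c[of h] c[of "- h"] \<delta>(3,4) by (intro pair_in_ball; linarith)+
    with e(2,4) have s: "0 < curve w h \<bullet> X h" "curve w (- h) \<bullet> X (- h) < 0" by auto
    have "\<exists>\<phi>. - h \<le> \<phi> \<and> \<phi> \<le> h \<and> curve w \<phi> \<bullet> X \<phi> = 0"
      by (rule IVT') (use s h(1) in \<open>auto intro!: continuous_intros continuous_on_subset[OF Xc]\<close>)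
    then obtain \<phi> where "- h \<le> \<phi>" "\<phi> \<le> h" "curve w \<phi> \<bullet> X \<phi> = 0" by blast
    with h(2) have \<phi>: "\<bar>\<phi>\<bar> \<le> \<eta>" "curve w \<phi> \<bullet> X \<phi> = 0" by simp_all
    have "norm (curve w (t + \<phi>) - kep p t) < \<rho>" "norm (X (t + \<phi>) - kepv p t) < \<rho>" if t: "t \<in> {0..2 * pi}" for t
    proof -
      have "norm (curve w (t + \<phi>) - kep p t) \<le> norm (curve w (t + \<phi>) - kep p (t + \<phi>)) + norm (kep p (t + \<phi>) - kep p t)"
        "norm (X (t + \<phi>) - kepv p t) \<le> norm (X (t + \<phi>) - kepv p (t + \<phi>)) + norm (kepv p (t + \<phi>) - kepv p t)"
        using norm_triangle_ineq[of "curve w (t + \<phi>) - kep p (t + \<phi>)" "kep p (t + \<phi>) - kep p t"]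
          norm_triangle_ineq[of "X (t + \<phi>) - kepv p (t + \<phi>)" "kepv p (t + \<phi>) - kepv p t"] by simp_all
      then show "norm (curve w (t + \<phi>) - kep p t) < \<rho>" "norm (X (t + \<phi>) - kepv p t) < \<rho>"
        using c[of "t + \<phi>"] \<eta>(2,3)[OF t \<phi>(1)] \<delta>(2) by linarith+
    qed
    then show "\<exists>\<phi>. curve w \<phi> \<bullet> X \<phi> = 0 \<and> (\<forall>t\<in>{0..2 * pi}. norm (curve w (t + \<phi>) - kep p t) < \<rho> \<and> norm (X (t + \<phi>) - kepv p t) < \<rho>)"
      using \<phi>(2) by blast
  qed
qed

text \<open>By \<open>apsis_injective\<close> the map from \<open>(p, \<sigma>, \<rho>)\<close> to
  phase space is a local diffeomorphism in dimension six. The coordinate \<open>\<rho>\<close> is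
  the radial velocity, which orthogonality forces to be 0; what remains are the initial data used in
  the blow-up.\<close>

lemma apsis_param:
  assumes p0: "p0 \<in> kep_dom" "cos (p0 $ 3) \<noteq> 0" and "0 < r"
  obtains \<rho> where "0 < \<rho>"
    "\<And>a b. norm (a - kep p0 0) < \<rho> \<Longrightarrow> norm (b - kepv p0 0) < \<rho> \<Longrightarrow> a \<bullet> b = 0 \<Longrightarrow>
      \<exists>p \<sigma>. p \<in> kep_dom \<and> norm (p - p0) < r \<and> a = kep p 0 \<and> b = (peri_speed (p $ 1) + \<sigma>) *\<^sub>R QQ p"
proof -
  let ?S = "kep_dom \<times> (UNIV :: (real \<times> real) set)"
  let ?\<Phi> = "\<lambda>z :: (real^4) \<times> (real \<times> real). ((1 - fst z $ 1) *\<^sub>R PP (fst z), (peri_speed (fst z $ 1) + fst (snd z)) *\<^sub>R QQ (fst z) + snd (snd z) *\<^sub>R PP (fst z))"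
  let ?z0 = "(p0, (0, 0)) :: (real^4) \<times> (real \<times> real)"
  have C: "C1_on ?S ?\<Phi>"
    unfolding peri_speed_def by (intro C1_intros C1_kepler_c) (auto simp: kep_dom_def)
  have S: "open ?S" "?z0 \<in> ?S" using p0(1) by (auto intro!: open_Times open_kep_dom)
  let ?D = "\<lambda>z. (apsis_x p0 (fst z), apsis_v p0 (fst z) + fst (snd z) *\<^sub>R QQ p0 + snd (snd z) *\<^sub>R PP p0)"
  have f: "((\<lambda>z :: (real^4) \<times> (real \<times> real). f (fst z)) has_derivative (\<lambda>z. f' (fst z))) (at ?z0)"
    if "(f has_derivative f') (at p0)" for f :: "real^4 \<Rightarrow> real^3" and f'
    using has_derivative_compose[OF bounded_linear_imp_has_derivative[OF bounded_linear_fst], of f f' ?z0 UNIV] that by simp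
  note pd = peri_has_derivative(1,2)[OF p0(1)]
  have D: "(?\<Phi> has_derivative ?D) (at ?z0)"
  proof -
    have 1: "((\<lambda>z :: (real^4) \<times> (real \<times> real). fst (snd z) *\<^sub>R QQ (fst z)) has_derivative (\<lambda>z. fst (snd z) *\<^sub>R QQ p0)) (at ?z0)"
      "((\<lambda>z :: (real^4) \<times> (real \<times> real). snd (snd z) *\<^sub>R PP (fst z)) has_derivative (\<lambda>z. snd (snd z) *\<^sub>R PP p0)) (at ?z0)"
    proof -
      have L: "((\<lambda>z :: (real^4) \<times> (real \<times> real). fst (snd z)) has_derivative (\<lambda>z. fst (snd z))) (at ?z0)"
        "((\<lambda>z :: (real^4) \<times> (real \<times> real). snd (snd z)) has_derivative (\<lambda>z. snd (snd z))) (at ?z0)"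
        by (rule bounded_linear_imp_has_derivative, rule bounded_linear_compose[OF _ bounded_linear_snd],
            rule bounded_linear_fst bounded_linear_snd)+
      show "((\<lambda>z :: (real^4) \<times> (real \<times> real). fst (snd z) *\<^sub>R QQ (fst z)) has_derivative (\<lambda>z. fst (snd z) *\<^sub>R QQ p0)) (at ?z0)"
        by (rule has_derivative_eq_rhs[OF has_derivative_scaleR[OF L(1) f[OF frame_has_derivative(2)]]]) (simp add: fun_eq_iff)
      show "((\<lambda>z :: (real^4) \<times> (real \<times> real). snd (snd z) *\<^sub>R PP (fst z)) has_derivative (\<lambda>z. snd (snd z) *\<^sub>R PP p0)) (at ?z0)"
        by (rule has_derivative_eq_rhs[OF has_derivative_scaleR[OF L(2) f[OF frame_has_derivative(1)]]]) (simp add: fun_eq_iff)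
    qed
    show ?thesis
      using has_derivative_Pair[OF f[OF pd(1)] has_derivative_add[OF has_derivative_add[OF f[OF pd(2)] 1(1)] 1(2)]]
      by (simp add: scaleR_add_left)
  qed
  have Df: "blinfun_apply (fderiv ?\<Phi> ?z0) = ?D"
    by (rule has_derivative_unique[OF C1_on_has_derivative[OF C S(2)] D])
  have inj: "z = 0" if "?D z = 0" for z
    using apsis_injective[OF p0, of "fst z" "fst (snd z)" "snd (snd z)"] that by (simp add: prod_eq_iff)
  have lin: "linear ?D" using has_derivative_linear[OF D] .
  obtain g where g: "bounded_linear g" "\<And>x. g (?D x) = x" "\<And>y. ?D (g y) = y"
    by (rule linear_injective_inverse[OF lin inj]) (simp, simp, (rule that; assumption))
  obtain r1 V G where G: "0 < r1" "open V" "?\<Phi> ?z0 \<in> V" "C1_on V G"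
    "\<And>y. y \<in> V \<Longrightarrow> G y \<in> ball ?z0 r1" "\<And>x y. x \<in> ball ?z0 r1 \<Longrightarrow> y \<in> V \<Longrightarrow> ?\<Phi> x = y \<longleftrightarrow> x = G y" "cball ?z0 r1 \<subseteq> ?S"
  proof (rule C1_inverse_function[OF C S])
    show "Blinfun g o\<^sub>L fderiv ?\<Phi> ?z0 = id_blinfun" "fderiv ?\<Phi> ?z0 o\<^sub>L Blinfun g = id_blinfun"
      using g(2,3) by (auto intro!: blinfun_eqI simp: Df bounded_linear_Blinfun_apply[OF g(1)])
  qed (rule that; assumption)
  have y0: "?\<Phi> ?z0 = (kep p0 0, kepv p0 0)" by (simp add: kep_0[OF p0(1)])
  have zb: "?z0 \<in> ball ?z0 r1" using G(1) by simp
  have z0: "?z0 = G (?\<Phi> ?z0)" by (rule G(6)[OF zb G(3), THEN iffD1, OF refl])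
  have "(G \<longlongrightarrow> G (?\<Phi> ?z0)) (nhds (?\<Phi> ?z0))"
    using C1_on_imp_isCont[OF G(4,3)] unfolding isCont_def tendsto_at_iff_tendsto_nhds .
  from tendstoD[OF this \<open>0 < r\<close>]
  have "\<forall>\<^sub>F y in nhds (?\<Phi> ?z0). dist (G y) ?z0 < r \<and> y \<in> V"
    using eventually_nhds_in_open[OF G(2,3)] unfolding z0[symmetric] by eventually_elim auto
  then obtain e where e: "0 < e" "\<And>y. dist y (?\<Phi> ?z0) < e \<Longrightarrow> dist (G y) ?z0 < r \<and> y \<in> V"
    unfolding eventually_nhds_metric by blast
  show ?thesis
  proof (rule that[of "e / 2"])
    show "0 < e / 2" using e(1) by simp
    fix a b :: "real^3" assume ab: "norm (a - kep p0 0) < e / 2" "norm (b - kepv p0 0) < e / 2" "a \<bullet> b = 0"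
    have "dist (a, b) (?\<Phi> ?z0) < e" using pair_in_ball[OF ab(1,2)] unfolding y0 by (simp add: dist_commute)
    note y = e(2)[OF this]
    obtain p \<sigma> \<rho> where z: "G (a, b) = (p, (\<sigma>, \<rho>))" by (metis prod.exhaust)
    have zb: "G (a, b) \<in> ball ?z0 r1" using G(5) y by blast
    then have "(p, (\<sigma>, \<rho>)) \<in> cball ?z0 r1" unfolding z by simp
    with G(7) have p: "p \<in> kep_dom" by blast
    have eq: "?\<Phi> (p, (\<sigma>, \<rho>)) = (a, b)" using G(6)[OF zb, of "(a, b)"] y unfolding z by blast
    then have a: "a = kep p 0" and b: "b = (peri_speed (p $ 1) + \<sigma>) *\<^sub>R QQ p + \<rho> *\<^sub>R PP p"
      by (simp_all add: kep_0[OF p])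
    have "(1 - p $ 1) * \<rho> = 0"
      using ab(3) unfolding a b by (auto simp: kep_0[OF p] inner_add_right frame_orthonormal)
    then have "\<rho> = 0" using p by (auto simp: kep_dom_def)
    moreover have "norm (p - p0) < r" using dist_fst_le[of "G (a, b)" ?z0] y unfolding z by (simp add: dist_norm)
    ultimately show "\<exists>p \<sigma>. p \<in> kep_dom \<and> norm (p - p0) < r \<and> a = kep p 0 \<and> b = (peri_speed (p $ 1) + \<sigma>) *\<^sub>R QQ p"
      using p a b by auto
  qed
qed

text \<open>Subtracting the ellipse with the same apsis position and dividing by
  \<open>\<epsilon>\<close> produces \<open>v\<close> with \<open>v 0 = 0\<close> and
  \<open>v' 0\<close> equal to \<open>\<sigma> / \<epsilon>\<close> times \<open>QQ p\<close>. No
  bound on \<open>h\<close> or on \<open>\<sigma> / \<epsilon>\<close> is available at this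
  stage.\<close>

lemma solution_blowup:
  fixes y Y :: "real \<Rightarrow> real^3"
  assumes y: "\<And>t. (y has_vector_derivative Y t) (at t)" "\<And>t. (Y has_vector_derivative force H \<epsilon> (y t)) (at t)"
    and D: "\<And>t. y t \<in> Dom H" and ends: "y (2 * pi) = y 0" "Y (2 * pi) = Y 0" and "0 < \<epsilon>" and p: "p \<in> kep_dom"
    and y0: "y 0 = kep p 0" "Y 0 = (peri_speed (p $ 1) + \<sigma>) *\<^sub>R QQ p"
  obtains h where "((h, (p, \<sigma> / \<epsilon>)), \<epsilon>) \<in> bif_dom H" "bif H p0 ((h, (p, \<sigma> / \<epsilon>)), \<epsilon>) = 0" "Jop h (2 * pi) = 0"
    "\<And>t. t \<in> {0..2 * pi} \<Longrightarrow> y t = kep p t + \<epsilon> *\<^sub>R vpath (h, (p, \<sigma> / \<epsilon>)) t"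
proof -
  let ?I = "{0..2 * pi}" and ?\<kappa> = "\<sigma> / \<epsilon>"
  have e0: "\<epsilon> \<noteq> 0" using \<open>0 < \<epsilon>\<close> by simp
  define g where "g t = (1 / \<epsilon>) *\<^sub>R (force H \<epsilon> (y t) + fK (kep p t))" for t
  have yc: "continuous_on ?I y" using y(1) by (auto intro!: continuous_at_imp_continuous_on has_vector_derivative_continuous)
  have "continuous_on ?I (\<lambda>t. force H \<epsilon> (y t))" "continuous_on ?I (\<lambda>t. fK (kep p t))"
    by (rule continuous_on_compose2[OF C1_on_imp_continuous_on[OF C1_force] yc], use D in auto)
      (rule continuous_on_compose2[OF C1_on_imp_continuous_on[OF C1_fK'] kep_cont(1)[OF p]], use kep_nonzero[OF p] in auto)
  then have gc: "continuous_on ?I g" unfolding g_def[abs_def] by (intro continuous_intros)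
  define h where "h = clampf g"
  have h: "h t = g (clampt t)" for t unfolding h_def by (rule clampf_apply[OF gc])
  have 1: "(1 / \<epsilon>) *\<^sub>R (Y t - kepv p t) - (1 / \<epsilon>) *\<^sub>R (Y 0 - kepv p 0) = Jop h t" if "t \<in> ?I" for t
  proof (rule Jop_FTC[OF _ that])
    fix t assume t: "t \<in> ?I"
    show "((\<lambda>t. (1 / \<epsilon>) *\<^sub>R (Y t - kepv p t)) has_vector_derivative h t) (at t within ?I)"
    proof -
      have "((\<lambda>t. (1 / \<epsilon>) *\<^sub>R (Y t - kepv p t)) has_vector_derivative (1 / \<epsilon>) *\<^sub>R (force H \<epsilon> (y t) - (- fK (kep p t)))) (at t within ?I)"
        by (rule bounded_linear.has_vector_derivative[OF bounded_linear_scaleR_right],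
            rule has_vector_derivative_diff, rule has_vector_derivative_at_within, rule y(2),
            rule has_vector_derivative_at_within, rule kepv_deriv, rule p)
      then show ?thesis using t by (simp add: h g_def)
    qed
  qed
  have c: "(1 / \<epsilon>) *\<^sub>R (Y 0 - kepv p 0) = ?\<kappa> *\<^sub>R QQ p" by (simp add: y0 kep_0[OF p] scaleR_add_left)
  show ?thesis
  proof (rule that)
    show J: "Jop h (2 * pi) = 0"
      using 1[of "2 * pi"] ends(2) kep_periodic(2)[OF p, of 0] by simp
    have 2: "(1 / \<epsilon>) *\<^sub>R (y t - kep p t) = vpath (h, (p, ?\<kappa>)) t" if t: "t \<in> ?I" for t
    proof -
      have "(1 / \<epsilon>) *\<^sub>R (y t - kep p t) - t *\<^sub>R ?\<kappa> *\<^sub>R QQ p - ((1 / \<epsilon>) *\<^sub>R (y 0 - kep p 0) - 0 *\<^sub>R ?\<kappa> *\<^sub>R QQ p) = Jop (Jop h) t"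
      proof (rule Jop_FTC[OF _ t])
        fix t assume t: "t \<in> ?I"
        have "((\<lambda>t. (1 / \<epsilon>) *\<^sub>R (y t - kep p t)) has_vector_derivative (1 / \<epsilon>) *\<^sub>R (Y t - kepv p t)) (at t within ?I)"
          by (rule bounded_linear.has_vector_derivative[OF bounded_linear_scaleR_right
              has_vector_derivative_diff[OF has_vector_derivative_at_within[OF y(1)] has_vector_derivative_at_within[OF kep_deriv[OF p]]]])
        moreover have "((\<lambda>t. t *\<^sub>R ?\<kappa> *\<^sub>R QQ p) has_vector_derivative ?\<kappa> *\<^sub>R QQ p) (at t within ?I)"
          by (auto intro!: derivative_eq_intros simp: e0)
        ultimately have "((\<lambda>t. (1 / \<epsilon>) *\<^sub>R (y t - kep p t) - t *\<^sub>R ?\<kappa> *\<^sub>R QQ p) has_vector_derivative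
            (1 / \<epsilon>) *\<^sub>R (Y t - kepv p t) - ?\<kappa> *\<^sub>R QQ p) (at t within ?I)" by (rule has_vector_derivative_diff)
        then show "((\<lambda>t. (1 / \<epsilon>) *\<^sub>R (y t - kep p t) - t *\<^sub>R ?\<kappa> *\<^sub>R QQ p) has_vector_derivative Jop h t) (at t within ?I)"
          using 1[OF t] unfolding c by simp
      qed
      then show ?thesis using t by (simp add: y0(1) vpath_apply algebra_simps)
    qed
    show 3: "y t = kep p t + \<epsilon> *\<^sub>R vpath (h, (p, ?\<kappa>)) t" if "t \<in> ?I" for t
    proof -
      have "\<epsilon> *\<^sub>R vpath (h, (p, ?\<kappa>)) t = y t - kep p t"
        unfolding 2[OF that, symmetric] by (simp add: e0)
      then show ?thesis by simp
    qed
    show dom: "((h, (p, ?\<kappa>)), \<epsilon>) \<in> bif_dom H" by (rule bif_domI[OF p]) (simp add: 3[symmetric] D)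
    have v2: "vpath (h, (p, ?\<kappa>)) (2 * pi) = 0"
      using 2[of "2 * pi"] ends(1) kep_periodic(1)[OF p, of 0] by (simp add: y0(1))
    have "fst (bif H p0 ((h, (p, ?\<kappa>)), \<epsilon>)) t = 0" for t
    proof -
      let ?s = "clampt t" and ?v = "vpath (h, (p, ?\<kappa>)) t"
      have ys: "y ?s = kep p ?s + \<epsilon> *\<^sub>R ?v" using 3[of ?s] by (simp add: vpath_clampt)
      have "\<epsilon> *\<^sub>R Qf (kep p ?s) ?v \<epsilon> = fK (y ?s) - fK (kep p ?s)"
        unfolding ys by (rule Qf_mult[OF kep_nonzero[OF p]]) (use Dom_nonzero(1)[OF D[of ?s]] ys in simp)
      then have "\<epsilon> *\<^sub>R (h t + Qf (kep p ?s) ?v \<epsilon> + gH H (y ?s)) = 0"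
        by (simp add: h g_def force_def scaleR_add_right e0)
      then show ?thesis using e0 unfolding bif_apply[OF dom] ys[symmetric] by simp
    qed
    then have "fst (bif H p0 ((h, (p, ?\<kappa>)), \<epsilon>)) = 0" by (intro bcontfun_eqI) simp
    then show "bif H p0 ((h, (p, ?\<kappa>)), \<epsilon>) = 0" using v2 J by (simp add: bif_def prod_eq_iff)
  qed
qed

section \<open>A priori bounds for the blown-up unknowns\<close>

context kepler_branch
begin

text \<open>Strict differentiability, uniform along the ellipse. Applied to the full curve and to
  \<open>kep p\<close>, it compares the two Kepler forces with the linearisation at the base ellipse
  relative to the size of \<open>\<epsilon> v\<close>, so the estimate survives division by
  \<open>\<epsilon>\<close>.\<close>

lemma fK_strict:
  assumes "0 < \<eta>"
  obtains d where "0 < d" "\<And>t a b. t \<in> {0..2 * pi} \<Longrightarrow> norm (a - kep p0 t) \<le> d \<Longrightarrow> norm (b - kep p0 t) \<le> d \<Longrightarrow>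
    norm (fK a - fK b - Kf (kep p0 t) (a - b)) \<le> \<eta> * norm (a - b)"
proof -
  let ?K = "kep p0 ` {0..2 * pi}"
  have K: "compact ?K" "?K \<subseteq> - {0}"
    using kep_nonzero[OF p0] by (auto intro!: compact_continuous_image kep_cont p0)
  have o: "open (- {0 :: real^3})" by (rule open_Compl) simp
  obtain d where d: "0 < d" "\<And>x k. x \<in> ?K \<Longrightarrow> norm k \<le> d \<Longrightarrow> x + k \<in> - {0}"
    "\<And>x k. x \<in> ?K \<Longrightarrow> norm k \<le> d \<Longrightarrow> norm (fderiv fK (x + k) - fderiv fK x) \<le> \<eta>"
    by (rule C1_on_uniform[OF C1_fK' o K assms]) (rule that; assumption)
  show ?thesis
  proof (rule that[OF d(1)])
    fix t a b assume t: "t \<in> {0..2 * pi}" and ab: "norm (a - kep p0 t) \<le> d" "norm (b - kep p0 t) \<le> d"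
    let ?c = "kep p0 t"
    have z: "z \<in> - {0}" "norm (fderiv fK z - fderiv fK ?c) \<le> \<eta>" if "z \<in> cball ?c d" for z
      using d(2,3)[of ?c "z - ?c"] t that by (auto simp: dist_norm norm_minus_commute)
    have "norm ((fK a - fderiv fK ?c a) - (fK b - fderiv fK ?c b)) \<le> \<eta> * norm (a - b)"
    proof (rule differentiable_bound[of "cball ?c d" "\<lambda>z. fK z - fderiv fK ?c z" "\<lambda>z. blinfun_apply (fderiv fK z - fderiv fK ?c)"])
      fix z assume "z \<in> cball ?c d"
      note zz = z[OF this]
      show "((\<lambda>z. fK z - fderiv fK ?c z) has_derivative blinfun_apply (fderiv fK z - fderiv fK ?c)) (at z within cball ?c d)"
        by (rule has_derivative_at_withinI, rule has_derivative_eq_rhs[OF has_derivative_diff[OF C1_on_has_derivative[OF C1_fK' zz(1)]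
              bounded_linear_imp_has_derivative[OF blinfun.bounded_linear_right]]]) (simp add: fun_eq_iff blinfun.diff_left)
      show "onorm (blinfun_apply (fderiv fK z - fderiv fK ?c)) \<le> \<eta>" using zz(2) by (simp add: norm_blinfun.rep_eq)
    qed (use ab in \<open>auto simp: dist_norm norm_minus_commute\<close>)
    then show "norm (fK a - fK b - Kf ?c (a - b)) \<le> \<eta> * norm (a - b)"
      by (simp add: fderiv_fK[OF kep_nonzero[OF p0]] blinfun.diff_right[of "fderiv fK ?c", unfolded fderiv_fK[OF kep_nonzero[OF p0]]] algebra_simps)
  qed
qed

lemma gH_uniform:
  assumes "0 < \<eta>"
  obtains d where "0 < d" "\<And>t a. t \<in> {0..2 * pi} \<Longrightarrow> norm (a - kep p0 t) \<le> d \<Longrightarrow> norm (gH H a - gH H (kep p0 t)) \<le> \<eta>"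
proof -
  let ?K = "kep p0 ` {0..2 * pi}"
  have K: "compact ?K" "?K \<subseteq> Dom H"
    using ring_dom_Dom[OF free] by (auto intro!: compact_continuous_image kep_cont p0)
  obtain r L where r: "0 < r" and L: "compact L" "L \<subseteq> Dom H" and inL: "\<And>x k. x \<in> ?K \<Longrightarrow> norm k \<le> r \<Longrightarrow> x + k \<in> L"
    by (rule compact_tube[OF open_Dom[OF H(2)] K]) (rule that; assumption)
  have "uniformly_continuous_on L (gH H)"
    by (rule compact_uniformly_continuous[OF continuous_on_subset[OF C1_on_imp_continuous_on[OF C1_gH'] L(2)] L(1)])
  then obtain d where d: "0 < d" "\<And>x y. x \<in> L \<Longrightarrow> y \<in> L \<Longrightarrow> dist y x < d \<Longrightarrow> dist (gH H y) (gH H x) < \<eta>"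
    using assms unfolding uniformly_continuous_on_def by metis
  show ?thesis
  proof (rule that[of "min r (d / 2)"])
    fix t a assume t: "t \<in> {0..2 * pi}" and a: "norm (a - kep p0 t) \<le> min r (d / 2)"
    have "kep p0 t \<in> L" "a \<in> L" using inL[of "kep p0 t" 0] inL[of "kep p0 t" "a - kep p0 t"] t a r by auto
    from d(2)[OF this] show "norm (gH H a - gH H (kep p0 t)) \<le> \<eta>" using a d(1) by (simp add: dist_norm)
  qed (use r d(1) in simp)
qed

text \<open>The Jacobi operator with coefficients frozen at the base ellipse, so that all unknowns
  are compared through one fixed linear operator.\<close>

definition resid :: "unknown \<Rightarrow> path" where
  "resid \<theta> = fst \<theta> + bc_bil blinfun_apply (kf_path p0) (vpath \<theta>)"

lemma resid_apply: "resid \<theta> t = fst \<theta> t + Kf (kep p0 (clampt t)) (vpath \<theta> t)"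
  by (simp add: resid_def bc_bil_apply[OF bounded_bilinear_blinfun_apply] kf_path_apply[OF p0])

definition wt :: "real^3 \<Rightarrow> path" where
  "wt z = W (bc_bil blinfun_apply (kf_path p0) (tpath z))"

lemma bounded_linear_wt: "bounded_linear wt"
  unfolding wt_def
  by (intro bounded_linear_compose[OF blinfun.bounded_linear_right] bounded_linear_tpath
      bounded_linear_compose[OF bounded_bilinear.bounded_linear_right[OF bounded_bilinear_bc_bil[OF bounded_bilinear_blinfun_apply]]])

text \<open>Control of the residual and of the initial velocity controls \<open>h\<close>, because
  \<open>W\<close> inverts the Volterra part.\<close>

lemma resid_inverse: "h = W (resid (h, (p, \<kappa>))) - wt (\<kappa> *\<^sub>R QQ p)"
proof -
  have "resid (h, (p, \<kappa>)) = volterra (kf_path p0) h + bc_bil blinfun_apply (kf_path p0) (tpath (\<kappa> *\<^sub>R QQ p))"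
    unfolding resid_def vpath_def volterra_def
    by (simp add: bounded_bilinear.add_right[OF bounded_bilinear_bc_bil[OF bounded_bilinear_blinfun_apply]])
  then show ?thesis by (simp add: blinfun.add_right W(1) wt_def)
qed

lemma base_resid: "resid (h0, (p0, \<kappa>0)) = - gpath H p0"
proof (rule bcontfun_eqI)
  fix t
  have "fst (F ((h0, (p0, \<kappa>0)), 0)) t = 0" by (simp add: base_point)
  then show "resid (h0, (p0, \<kappa>0)) t = (- gpath H p0) t"
    unfolding bif_apply_0[OF free] resid_apply by (simp add: eq_neg_iff_add_eq_0)
qed

text \<open>When \<open>v\<close> closes up, all boundary terms of Green's identity vanish except
  the drift of the scaling variation, so \<open>\<kappa>\<close> can be read off from the
  residual.\<close>

lemma resid_pair:
  assumes "Jop h (2 * pi) = 0" "vpath (h, (p, \<kappa>)) (2 * pi) = 0"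
  shows "pair (resid (h, (p, \<kappa>))) spath = - (3 * pi * s0) * (\<kappa> * (QQ p \<bullet> QQ p0))"
proof -
  have v: "(2 * pi) *\<^sub>R \<kappa> *\<^sub>R QQ p + Jop (Jop h) (2 * pi) = 0" using assms(2) by (simp add: vpath_apply)
  have "((\<lambda>t. resid (h, (p, \<kappa>)) t \<bullet> spath t) has_integral
    (\<kappa> *\<^sub>R QQ p + Jop h (2 * pi)) \<bullet> scal p0 (2 * pi) - \<kappa> *\<^sub>R QQ p \<bullet> scal p0 0 - ((2 * pi) *\<^sub>R \<kappa> *\<^sub>R QQ p + Jop (Jop h) (2 * pi)) \<bullet> scal' p0 (2 * pi)) {0..2 * pi}"
    by (rule has_integral_eq[OF _ jacobi_green[OF jacobi_scal[OF p0]]]) (simp add: resid_apply vpath_apply spath)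
  from has_integral_unique[OF pair_has_integral this]
  have "pair (resid (h, (p, \<kappa>))) spath = \<kappa> * (QQ p \<bullet> spath (2 * pi) - QQ p \<bullet> spath 0)"
    unfolding v assms(1) by (simp add: spath right_diff_distrib)
  then show ?thesis unfolding QQ_scal_jump by simp
qed

text \<open>The residuals of the unknown and of the base point differ by at most
  \<open>\<eta> (1 + norm v)\<close>. Pairing with \<open>spath\<close> then bounds
  \<open>\<kappa> - \<kappa>0\<close>, and \<open>W\<close> bounds \<open>h - h0\<close>. As
  \<open>norm v\<close> is in turn bounded by \<open>h\<close> and \<open>\<kappa>\<close>, a small
  \<open>\<eta>\<close> lets the estimate close on itself although \<open>v\<close> has no a priori
  size.\<close>

lemma a_priori:
  assumes "0 < r"
  obtains \<rho> where "0 < \<rho>"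
    "\<And>h p \<kappa> \<epsilon>. 0 < \<epsilon> \<Longrightarrow> ((h, (p, \<kappa>)), \<epsilon>) \<in> bif_dom H \<Longrightarrow> F ((h, (p, \<kappa>)), \<epsilon>) = 0 \<Longrightarrow> Jop h (2 * pi) = 0 \<Longrightarrow>
      norm (p - p0) < \<rho> \<Longrightarrow> (\<And>t. t \<in> {0..2 * pi} \<Longrightarrow> norm (kep p t + \<epsilon> *\<^sub>R vpath (h, (p, \<kappa>)) t - kep p0 t) < \<rho>) \<Longrightarrow>
      dist (h0, (p0, \<kappa>0)) (h, (p, \<kappa>)) < r"
proof -
  let ?\<theta>b = "(h0, (p0, \<kappa>0))"
  obtain Kw where Kw: "0 \<le> Kw" "\<And>z. norm (wt z) \<le> norm z * Kw"
    using bounded_linear.nonneg_bounded[OF bounded_linear_wt] by blast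
  obtain Kt where Kt: "0 \<le> Kt" "\<And>z :: real^3. norm (tpath z) \<le> norm z * Kt"
    using bounded_linear.nonneg_bounded[OF bounded_linear_tpath] by blast
  have "bounded_linear (\<lambda>f. pair f spath)"
    unfolding pair_def
    by (rule bounded_linear_compose[OF bounded_linear_bc_apply], rule bounded_linear_compose[OF blinfun.bounded_linear_right],
        rule bounded_bilinear.bounded_linear_left[OF bounded_bilinear_bc_bil[OF bounded_bilinear_inner]])
  note lp = this
  obtain Ks where Ks: "0 \<le> Ks" "\<And>f. \<bar>pair f spath\<bar> \<le> norm f * Ks"
    using bounded_linear.nonneg_bounded[OF lp] by auto
  define s3 where "s3 = 3 * pi * s0"
  have s3: "0 < s3" using s0 by (simp add: s3_def)
  define Kp where "Kp = Ks / s3"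
  have Kp: "0 \<le> Kp" using Ks(1) s3 by (simp add: Kp_def)
  define w where "w = norm W"
  have w: "0 \<le> w" by (simp add: w_def)
  define C3 where "C3 = Kt + 2 * pi * (2 * pi)"
  have C3: "0 \<le> C3" using Kt(1) by (simp add: C3_def)
  define m0 where "m0 = norm h0 + \<bar>\<kappa>0\<bar>"
  have m0: "0 \<le> m0" by (simp add: m0_def)
  \<comment> \<open>\<open>E\<close> is what a unit of residual contributes to
    \<open>norm (h - h0) + \<bar>\<kappa> - \<kappa>0\<bar>\<close>. After \<open>\<eta>\<close> is
    factored out, \<open>B\<close> is the coefficient of the unknown size \<open>m\<close>, and
    \<open>A\<close> collects the terms that involve only the base point.\<close>
  define E where "E = w + (1 + Kw) * Kp"
  have E: "0 \<le> E" unfolding E_def using w Kw(1) Kp by simp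
  define B where "B = E * C3 + (1 + Kw)"
  have B: "0 < B" unfolding B_def using E C3 Kw(1) by (simp add: add_nonneg_pos)
  define A where "A = E + Kw * m0 + B * m0"
  have A: "0 \<le> A" unfolding A_def using E Kw(1) m0 B by simp
  \<comment> \<open>The first entry makes \<open>\<eta> * B\<close> at most 1/2, for absorption on
    the left; the second leaves a remainder below \<open>r / 4\<close>.\<close>
  define \<eta> where "\<eta> = min (1 / (2 * B)) (r / (8 * (A + 1)))"
  have \<eta>: "0 < \<eta>" "\<eta> * B \<le> 1 / 2" "\<eta> * A < r / 4"
  proof -
    show "0 < \<eta>" using B A \<open>0 < r\<close> by (simp add: \<eta>_def)
    have "\<eta> * B \<le> (1 / (2 * B)) * B" using B by (intro mult_right_mono) (auto simp: \<eta>_def)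
    then show "\<eta> * B \<le> 1 / 2" using B by simp
    have "\<eta> * A \<le> (r / (8 * (A + 1))) * (A + 1)" using A \<open>0 < \<eta>\<close> \<open>0 < r\<close> by (intro mult_mono) (auto simp: \<eta>_def)
    also have "\<dots> = r / 8" using A by (simp add: field_simps)
    finally show "\<eta> * A < r / 4" using \<open>0 < r\<close> by linarith
  qed
  obtain d1 where d1: "0 < d1" "\<And>t a b. t \<in> {0..2 * pi} \<Longrightarrow> norm (a - kep p0 t) \<le> d1 \<Longrightarrow> norm (b - kep p0 t) \<le> d1 \<Longrightarrow>
    norm (fK a - fK b - Kf (kep p0 t) (a - b)) \<le> \<eta> * norm (a - b)"
    by (rule fK_strict[OF \<eta>(1)]) (rule that; assumption)
  obtain d2 where d2: "0 < d2" "\<And>t a. t \<in> {0..2 * pi} \<Longrightarrow> norm (a - kep p0 t) \<le> d2 \<Longrightarrow> norm (gH H a - gH H (kep p0 t)) \<le> \<eta>"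
    by (rule gH_uniform[OF \<eta>(1)]) (rule that; assumption)
  obtain d3 where d3: "0 < d3" "\<And>p. dist p p0 < d3 \<Longrightarrow> dist (kep_path p) (kep_path p0) < d1"
    using C1_on_imp_isCont[OF C1_kep_path p0] d1(1) unfolding continuous_at_eps_delta by blast
  have "C1_on UNIV QQ" by (intro C1_intros)
  from C1_on_imp_isCont[OF this UNIV_I, of p0] obtain d4 where d4: "0 < d4" "\<And>p. dist p p0 < d4 \<Longrightarrow> dist (QQ p) (QQ p0) < \<eta>"
    using \<eta>(1) unfolding continuous_at_eps_delta by blast
  define \<rho> where "\<rho> = min (min d1 d2) (min (min d3 d4) (r / 4))"
  have \<rho>: "0 < \<rho>" "\<rho> \<le> d1" "\<rho> \<le> d2" "\<rho> \<le> d3" "\<rho> \<le> d4" "\<rho> \<le> r / 4"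
    using d1(1) d2(1) d3(1) d4(1) \<open>0 < r\<close> by (auto simp: \<rho>_def)
  show ?thesis
  proof (rule that[OF \<rho>(1)])
    fix h :: path and p :: "real^4" and \<kappa> \<epsilon> :: real
    assume "0 < \<epsilon>" and dom: "((h, (p, \<kappa>)), \<epsilon>) \<in> bif_dom H" and F: "F ((h, (p, \<kappa>)), \<epsilon>) = 0" and J: "Jop h (2 * pi) = 0"
      and p: "norm (p - p0) < \<rho>"
      and y: "\<And>t. t \<in> {0..2 * pi} \<Longrightarrow> norm (kep p t + \<epsilon> *\<^sub>R vpath (h, (p, \<kappa>)) t - kep p0 t) < \<rho>"
    let ?\<theta> = "(h, (p, \<kappa>))"
    let ?v = "vpath ?\<theta>"
    note pk = bif_domD(1)[OF dom]
    have pd: "dist (kep_path p) (kep_path p0) < d1" "norm (QQ p - QQ p0) < \<eta>"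
      using d3(2)[of p] d4(2)[of p] p \<rho> by (auto simp: dist_norm)
    define N where "N = norm (resid ?\<theta> - resid ?\<theta>b)"
    define n where "n = norm ?v"
    have "norm ((resid ?\<theta> - resid ?\<theta>b) t) \<le> \<eta> * (1 + n)" for t
    proof -
      let ?s = "clampt t" and ?vt = "?v t"
      let ?y = "kep p ?s + \<epsilon> *\<^sub>R ?vt"
      have ya: "norm (?y - kep p0 ?s) < \<rho>" using y[of ?s] by (simp add: vpath_clampt)
      have ka: "norm (kep p ?s - kep p0 ?s) \<le> d1"
        using dist_bounded[of "kep_path p" ?s "kep_path p0"] pd(1) by (simp add: kep_path_apply[OF pk] kep_path_apply[OF p0] dist_norm)
      have Q: "\<epsilon> *\<^sub>R Qf (kep p ?s) ?vt \<epsilon> = fK ?y - fK (kep p ?s)"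
        by (rule Qf_mult[OF kep_nonzero[OF pk]]) (use Dom_nonzero(1)[OF bif_domD(2)[OF dom, of ?s]] in \<open>simp add: vpath_clampt\<close>)
      have "Kf (kep p0 ?s) (\<epsilon> *\<^sub>R ?vt) = \<epsilon> *\<^sub>R Kf (kep p0 ?s) ?vt"
        by (rule linear_scale[OF bounded_linear.linear[OF bounded_linear_Kf]])
      then have "\<epsilon> *\<^sub>R (Qf (kep p ?s) ?vt \<epsilon> - Kf (kep p0 ?s) ?vt) = fK ?y - fK (kep p ?s) - Kf (kep p0 ?s) (?y - kep p ?s)"
        by (simp add: scaleR_diff_right Q)
      moreover have "norm (fK ?y - fK (kep p ?s) - Kf (kep p0 ?s) (?y - kep p ?s)) \<le> \<eta> * norm (?y - kep p ?s)"
        by (rule d1(2)[OF clampt_in(1) _ ka]) (use ya \<rho>(2) in linarith)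
      ultimately have "norm (\<epsilon> *\<^sub>R (Qf (kep p ?s) ?vt \<epsilon> - Kf (kep p0 ?s) ?vt)) \<le> \<eta> * norm (\<epsilon> *\<^sub>R ?vt)"
        by simp
      then have "\<epsilon> * norm (Qf (kep p ?s) ?vt \<epsilon> - Kf (kep p0 ?s) ?vt) \<le> \<epsilon> * (\<eta> * norm ?vt)"
        using \<open>0 < \<epsilon>\<close> by (simp add: mult.left_commute)
      then have q1: "norm (Qf (kep p ?s) ?vt \<epsilon> - Kf (kep p0 ?s) ?vt) \<le> \<eta> * norm ?vt"
        using \<open>0 < \<epsilon>\<close> by (rule mult_left_le_imp_le)
      have q0: "\<eta> * norm ?vt \<le> \<eta> * n" unfolding n_def using \<eta>(1) by (intro mult_left_mono norm_bounded) simp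
      have q2: "norm (gH H ?y - gH H (kep p0 ?s)) \<le> \<eta>"
        by (rule d2(2)[OF clampt_in(1)]) (use ya \<rho>(3) in linarith)
      have r3: "(resid ?\<theta> - resid ?\<theta>b) t = - (Qf (kep p ?s) ?vt \<epsilon> - Kf (kep p0 ?s) ?vt) - (gH H ?y - gH H (kep p0 ?s))"
      proof -
        have "h t + Qf (kep p ?s) ?vt \<epsilon> + gH H ?y = 0" using bif_apply[OF dom, of p0 t] F by simp
        then have e1: "h t = - Qf (kep p ?s) ?vt \<epsilon> - gH H ?y" by (simp add: eq_neg_iff_add_eq_0 algebra_simps)
        have e2: "(resid ?\<theta> - resid ?\<theta>b) t = h t + Kf (kep p0 ?s) ?vt + gH H (kep p0 ?s)"
        proof -
          have "resid ?\<theta>b t = - gH H (kep p0 ?s)" unfolding base_resid by (simp add: gpath_apply[OF free])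
          moreover have "resid ?\<theta> t = h t + Kf (kep p0 ?s) ?vt" by (simp add: resid_apply)
          moreover have "(resid ?\<theta> - resid ?\<theta>b) t = resid ?\<theta> t - resid ?\<theta>b t" by (rule minus_bcontfun.rep_eq[THEN fun_cong])
          ultimately show ?thesis by simp
        qed
        show ?thesis unfolding e2 e1 by (simp add: algebra_simps)
      qed
      have n3: "norm (- (Qf (kep p ?s) ?vt \<epsilon> - Kf (kep p0 ?s) ?vt) - (gH H ?y - gH H (kep p0 ?s)))
        \<le> norm (Qf (kep p ?s) ?vt \<epsilon> - Kf (kep p0 ?s) ?vt) + norm (gH H ?y - gH H (kep p0 ?s))"
        using norm_triangle_ineq4[of "- (Qf (kep p ?s) ?vt \<epsilon> - Kf (kep p0 ?s) ?vt)" "gH H ?y - gH H (kep p0 ?s)"] by (simp only: norm_minus_cancel)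
      have "norm ((resid ?\<theta> - resid ?\<theta>b) t) \<le> \<eta> * n + \<eta>"
        unfolding r3 by (rule order_trans[OF n3]) (rule add_mono[OF order_trans[OF q1 q0] q2])
      then show ?thesis by (simp add: distrib_left)
    qed
    then have N: "N \<le> \<eta> * (1 + n)" unfolding N_def by (rule norm_bound)
    define m where "m = norm h + \<bar>\<kappa>\<bar>"
    have nQ: "norm (QQ q) = 1" for q by (simp add: norm_eq_sqrt_inner frame_orthonormal)
    have n: "n \<le> C3 * m"
    proof -
      have "norm (Jop (Jop h)) \<le> 2 * pi * (2 * pi * norm h)"
        by (rule order_trans[OF norm_Jop]) (intro mult_left_mono norm_Jop, simp)
      moreover have "norm (tpath (\<kappa> *\<^sub>R QQ p)) \<le> \<bar>\<kappa>\<bar> * Kt" using Kt(2)[of "\<kappa> *\<^sub>R QQ p"] by (simp add: nQ)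
      ultimately have "n \<le> \<bar>\<kappa>\<bar> * Kt + 2 * pi * (2 * pi) * norm h"
        unfolding n_def vpath_def using norm_triangle_ineq[of "tpath (\<kappa> *\<^sub>R QQ p)" "Jop (Jop h)"] by simp
      also have "\<dots> \<le> C3 * m" unfolding C3_def m_def using Kt(1) by (simp add: algebra_simps)
      finally show ?thesis .
    qed
    have v2: "vpath ?\<theta> (2 * pi) = 0" using F by (simp add: bif_def prod_eq_iff)
    have v02: "vpath ?\<theta>b (2 * pi) = 0" using base_point(1) by (simp add: bif_def prod_eq_iff)
    let ?\<chi> = "QQ p \<bullet> QQ p0"
    have "pair (resid ?\<theta> - resid ?\<theta>b) spath = - s3 * (\<kappa> * ?\<chi> - \<kappa>0)"
      unfolding linear_diff[OF bounded_linear.linear[OF lp]] resid_pair[OF J v2] resid_pair[OF base_point(2) v02] s3_def[symmetric]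
      by (simp add: frame_orthonormal algebra_simps)
    then have "s3 * \<bar>\<kappa> * ?\<chi> - \<kappa>0\<bar> \<le> N * Ks" using Ks(2)[of "resid ?\<theta> - resid ?\<theta>b"] s3 by (simp add: abs_mult N_def)
    then have k1: "\<bar>\<kappa> * ?\<chi> - \<kappa>0\<bar> \<le> N * Kp" using s3 by (simp add: Kp_def field_simps)
    have "\<bar>1 - ?\<chi>\<bar> = \<bar>(QQ p0 - QQ p) \<bullet> QQ p0\<bar>" by (simp add: inner_diff_left frame_orthonormal)
    also have "\<dots> \<le> norm (QQ p0 - QQ p) * norm (QQ p0)" by (rule Cauchy_Schwarz_ineq2)
    finally have x1: "\<bar>1 - ?\<chi>\<bar> \<le> \<eta>" using pd(2) by (simp add: nQ norm_minus_commute)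
    define k where "k = \<bar>\<kappa> - \<kappa>0\<bar>"
    \<comment> \<open>The pairing determines \<open>\<kappa>\<close> only up to the factor
      \<open>?\<chi>\<close>, which is within \<open>\<eta>\<close> of 1 because the frames at
      \<open>p\<close> and \<open>p0\<close> are close.\<close>
    have "k = \<bar>(\<kappa> * ?\<chi> - \<kappa>0) + \<kappa> * (1 - ?\<chi>)\<bar>" unfolding k_def by (simp add: algebra_simps)
    also have "\<dots> \<le> \<bar>\<kappa> * ?\<chi> - \<kappa>0\<bar> + \<bar>\<kappa> * (1 - ?\<chi>)\<bar>" by (rule abs_triangle_ineq)
    also have "\<bar>\<kappa> * (1 - ?\<chi>)\<bar> \<le> m * \<eta>" unfolding abs_mult using x1 by (intro mult_mono) (auto simp: m_def)
    finally have k: "k \<le> N * Kp + m * \<eta>" using k1 by linarith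
    have "\<kappa> *\<^sub>R QQ p - \<kappa>0 *\<^sub>R QQ p0 = (\<kappa> - \<kappa>0) *\<^sub>R QQ p + \<kappa>0 *\<^sub>R (QQ p - QQ p0)" by (simp add: algebra_simps)
    then have "norm (\<kappa> *\<^sub>R QQ p - \<kappa>0 *\<^sub>R QQ p0) \<le> k + \<bar>\<kappa>0\<bar> * norm (QQ p - QQ p0)"
      using norm_triangle_ineq[of "(\<kappa> - \<kappa>0) *\<^sub>R QQ p" "\<kappa>0 *\<^sub>R (QQ p - QQ p0)"] by (simp add: nQ k_def)
    also have "\<bar>\<kappa>0\<bar> * norm (QQ p - QQ p0) \<le> m0 * \<eta>" using pd(2) m0 by (intro mult_mono) (auto simp: m0_def)
    finally have kq: "norm (\<kappa> *\<^sub>R QQ p - \<kappa>0 *\<^sub>R QQ p0) \<le> k + m0 * \<eta>" by simp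
    define l where "l = norm (h - h0)"
    have "h - h0 = W (resid ?\<theta> - resid ?\<theta>b) - wt (\<kappa> *\<^sub>R QQ p - \<kappa>0 *\<^sub>R QQ p0)"
      unfolding blinfun.diff_right linear_diff[OF bounded_linear.linear[OF bounded_linear_wt]]
      by (subst resid_inverse[of h p \<kappa>], subst resid_inverse[of h0 p0 \<kappa>0]) (simp add: algebra_simps)
    then have "l \<le> norm (W (resid ?\<theta> - resid ?\<theta>b)) + norm (wt (\<kappa> *\<^sub>R QQ p - \<kappa>0 *\<^sub>R QQ p0))"
      unfolding l_def by (simp only: norm_triangle_ineq4)
    also have "norm (W (resid ?\<theta> - resid ?\<theta>b)) \<le> w * N" unfolding w_def N_def by (rule norm_blinfun)
    also have "norm (wt (\<kappa> *\<^sub>R QQ p - \<kappa>0 *\<^sub>R QQ p0)) \<le> (k + m0 * \<eta>) * Kw"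
      by (rule order_trans[OF Kw(2)]) (rule mult_right_mono[OF kq Kw(1)])
    finally have l: "l \<le> w * N + (k + m0 * \<eta>) * Kw" by simp
    have "l + k \<le> w * N + (1 + Kw) * k + m0 * \<eta> * Kw" using l by (simp add: algebra_simps)
    also have "(1 + Kw) * k \<le> (1 + Kw) * (N * Kp + m * \<eta>)" using k Kw(1) by (intro mult_left_mono) auto
    finally have "l + k \<le> E * N + (1 + Kw) * m * \<eta> + m0 * \<eta> * Kw" by (simp add: E_def algebra_simps)
    also have "E * N \<le> E * (\<eta> * (1 + C3 * m))"
      using E N n \<eta>(1) by (intro mult_left_mono order_trans[OF N]) auto
    finally have "l + k \<le> \<eta> * (E + Kw * m0 + B * m)" by (simp add: B_def algebra_simps)
    \<comment> \<open>The size \<open>m\<close> is at most the base value plus the distance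
      \<open>l + k\<close>. The inequality now involves \<open>l + k\<close> alone, and half of it
      is absorbed.\<close>
    also have "\<dots> \<le> \<eta> * (E + Kw * m0 + B * (m0 + (l + k)))"
    proof -
      have "norm h \<le> norm h0 + l" unfolding l_def using norm_triangle_sub[of h h0] by simp
      moreover have "\<bar>\<kappa>\<bar> \<le> \<bar>\<kappa>0\<bar> + k" unfolding k_def by linarith
      ultimately have "m \<le> m0 + (l + k)" by (simp add: m_def m0_def)
      then show ?thesis using \<eta>(1) B by (intro mult_left_mono add_left_mono) auto
    qed
    also have "\<dots> = \<eta> * A + (\<eta> * B) * (l + k)" by (simp add: A_def algebra_simps)
    also have "(\<eta> * B) * (l + k) \<le> (1 / 2) * (l + k)" using \<eta>(2) by (intro mult_right_mono) (auto simp: l_def k_def)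
    finally have lk: "l + k \<le> \<eta> * A + (1 / 2) * (l + k)" by simp
    have "a < r / 2" if "a \<le> X + (1 / 2) * a" "X < r / 4" for a X :: real
      using that by simp
    from this[OF lk \<eta>(3)] have "l + k < r / 2" .
    moreover have "dist ?\<theta>b ?\<theta> \<le> l + (norm (p - p0) + k)"
    proof -
      have "dist (p0, \<kappa>0) (p, \<kappa>) \<le> dist p0 p + dist \<kappa>0 \<kappa>" unfolding dist_Pair_Pair by (rule sqrt_sum_squares_le_sum) auto
      moreover have "dist ?\<theta>b ?\<theta> \<le> dist h0 h + dist (p0, \<kappa>0) (p, \<kappa>)"
        unfolding dist_Pair_Pair[of h0 "(p0, \<kappa>0)"] by (rule sqrt_sum_squares_le_sum) auto
      ultimately show ?thesis by (simp add: l_def k_def dist_norm norm_minus_commute abs_minus_commute)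
    qed
    ultimately show "dist ?\<theta>b ?\<theta> < r" using p \<rho>(6) \<open>0 < r\<close> by linarith
  qed
qed

text \<open>A phase shift puts an apsis at time 0, \<open>apsis_param\<close> reads off
  \<open>p\<close> and the excess speed, \<open>solution_blowup\<close> turns the critical point
  into an exact zero of \<open>F\<close>, and \<open>a_priori\<close> places this zero in the ball
  where the implicit function theorem gives uniqueness.\<close>

lemma local_uniqueness:
  assumes u: "curve u0 = kep p0" and "0 < r"
  obtains \<delta> where "0 < \<delta>"
    "\<And>\<epsilon> w. 0 < \<epsilon> \<Longrightarrow> norm (w - u0) < \<delta> \<Longrightarrow> critical_point H \<epsilon> w \<Longrightarrow>
      \<exists>\<phi> \<theta>. dist (h0, (p0, \<kappa>0)) \<theta> < r \<and> F (\<theta>, \<epsilon>) = 0 \<and>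
        (\<forall>t\<in>{0..2 * pi}. curve w (t + \<phi>) = kep (fst (snd \<theta>)) t + \<epsilon> *\<^sub>R vpath \<theta> t)"
proof -
  obtain \<rho> where \<rho>: "0 < \<rho>"
    "\<And>h p \<kappa> \<epsilon>. 0 < \<epsilon> \<Longrightarrow> ((h, (p, \<kappa>)), \<epsilon>) \<in> bif_dom H \<Longrightarrow> F ((h, (p, \<kappa>)), \<epsilon>) = 0 \<Longrightarrow> Jop h (2 * pi) = 0 \<Longrightarrow>
      norm (p - p0) < \<rho> \<Longrightarrow> (\<And>t. t \<in> {0..2 * pi} \<Longrightarrow> norm (kep p t + \<epsilon> *\<^sub>R vpath (h, (p, \<kappa>)) t - kep p0 t) < \<rho>) \<Longrightarrow>
      dist (h0, (p0, \<kappa>0)) (h, (p, \<kappa>)) < r"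
    by (rule a_priori[OF \<open>0 < r\<close>]) blast
  obtain \<rho>1 where \<rho>1: "0 < \<rho>1" "\<And>a b. norm (a - kep p0 0) < \<rho>1 \<Longrightarrow> norm (b - kepv p0 0) < \<rho>1 \<Longrightarrow> a \<bullet> b = 0 \<Longrightarrow>
      \<exists>p \<sigma>. p \<in> kep_dom \<and> norm (p - p0) < \<rho> \<and> a = kep p 0 \<and> b = (peri_speed (p $ 1) + \<sigma>) *\<^sub>R QQ p"
    by (rule apsis_param[OF p0 c2 \<rho>(1)]) (rule that; assumption)
  have m: "0 < min \<rho> \<rho>1" using \<rho>(1) \<rho>1(1) by simp
  obtain \<delta> where \<delta>: "0 < \<delta>"
    "\<And>w X. norm (w - u0) < \<delta> \<Longrightarrow> (\<And>t. (curve w has_vector_derivative X t) (at t)) \<Longrightarrow> continuous_on UNIV X \<Longrightarrow>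
      \<exists>\<phi>. curve w \<phi> \<bullet> X \<phi> = 0 \<and> (\<forall>t\<in>{0..2 * pi}. norm (curve w (t + \<phi>) - kep p0 t) < min \<rho> \<rho>1 \<and> norm (X (t + \<phi>) - kepv p0 t) < min \<rho> \<rho>1)"
    by (rule apsis_time[OF u p0 e0(1) m]) blast
  show ?thesis
  proof (rule that[OF \<delta>(1)])
    fix \<epsilon> w assume "0 < \<epsilon>" and w: "norm (w - u0) < \<delta>" and crit: "critical_point H \<epsilon> w"
    obtain X where D: "\<And>t. curve w t \<in> Dom H" and X: "\<And>t. (curve w has_vector_derivative X t) (at t)"
      "\<And>t. (X has_vector_derivative force H \<epsilon> (curve w t)) (at t)"
      using crit unfolding critical_point_iff[OF H] by blast
    have "continuous_on UNIV X" using X(2) by (auto intro!: continuous_at_imp_continuous_on has_vector_derivative_continuous)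
    from \<delta>(2)[OF w X(1) this] obtain \<phi> where \<phi>: "curve w \<phi> \<bullet> X \<phi> = 0"
      "\<And>t. t \<in> {0..2 * pi} \<Longrightarrow> norm (curve w (t + \<phi>) - kep p0 t) < min \<rho> \<rho>1"
      "\<And>t. t \<in> {0..2 * pi} \<Longrightarrow> norm (X (t + \<phi>) - kepv p0 t) < min \<rho> \<rho>1" by blast
    have "\<exists>p \<sigma>. p \<in> kep_dom \<and> norm (p - p0) < \<rho> \<and> curve w \<phi> = kep p 0 \<and> X \<phi> = (peri_speed (p $ 1) + \<sigma>) *\<^sub>R QQ p"
      by (rule \<rho>1(2)) (use \<phi>(1) \<phi>(2,3)[of 0] in simp_all)
    then obtain p \<sigma> where p: "p \<in> kep_dom" "norm (p - p0) < \<rho>" "curve w \<phi> = kep p 0" "X \<phi> = (peri_speed (p $ 1) + \<sigma>) *\<^sub>R QQ p" by blast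
    let ?y = "\<lambda>t. curve w (t + \<phi>)" and ?Y = "\<lambda>t. X (t + \<phi>)"
    have sh: "((\<lambda>t. t + \<phi>) has_vector_derivative 1) (at t)" for t by (auto intro!: derivative_eq_intros)
    have y: "(?y has_vector_derivative ?Y t) (at t)" "(?Y has_vector_derivative force H \<epsilon> (?y t)) (at t)" for t
      using vector_diff_chain_at[OF sh X(1)[of "t + \<phi>"]] vector_diff_chain_at[OF sh X(2)[of "t + \<phi>"]] by (simp_all add: o_def)
    have per: "?y (2 * pi) = ?y 0" "?Y (2 * pi) = ?Y 0"
      using curve_periodic[of w \<phi>] curve_deriv_periodic[OF X(1), of \<phi>] by (simp_all add: add.commute)
    have y0: "?y 0 = kep p 0" "?Y 0 = (peri_speed (p $ 1) + \<sigma>) *\<^sub>R QQ p" using p(3,4) by simp_all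
    obtain h where h: "((h, (p, \<sigma> / \<epsilon>)), \<epsilon>) \<in> bif_dom H" "F ((h, (p, \<sigma> / \<epsilon>)), \<epsilon>) = 0" "Jop h (2 * pi) = 0"
      "\<And>t. t \<in> {0..2 * pi} \<Longrightarrow> ?y t = kep p t + \<epsilon> *\<^sub>R vpath (h, (p, \<sigma> / \<epsilon>)) t"
      by (rule solution_blowup[OF y D per \<open>0 < \<epsilon>\<close> p(1) y0]) (rule that; assumption)
    have "dist (h0, (p0, \<kappa>0)) (h, (p, \<sigma> / \<epsilon>)) < r"
      by (rule \<rho>(2)[OF \<open>0 < \<epsilon>\<close> h(1,2,3) p(2)]) (use \<phi>(2) h(4) in simp)
    then show "\<exists>\<phi> \<theta>. dist (h0, (p0, \<kappa>0)) \<theta> < r \<and> F (\<theta>, \<epsilon>) = 0 \<and>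
        (\<forall>t\<in>{0..2 * pi}. curve w (t + \<phi>) = kep (fst (snd \<theta>)) t + \<epsilon> *\<^sub>R vpath \<theta> t)"
      using h(2,4) by (intro exI[of _ \<phi>] exI[of _ "(h, (p, \<sigma> / \<epsilon>))"]) simp
  qed
qed

end

theorem theorem5:
  fixes H :: "(real^3^3) set" and e0 :: real and \<psi>0 :: "real^3"
  assumes "H \<in> {tetrahedral, octahedral, icosahedral}"
    and "0 < e0" and "e0 < 1" and "cos (\<psi>0 $ 2) \<noteq> 0"
    and "\<forall>\<theta>. \<forall>L\<in>H - {mat 1}. L *v (rot \<psi>0 *v unit_circle \<theta>) \<noteq> rot \<psi>0 *v unit_circle \<theta>"
    and "nondegenerate_critical_point (reduced_action H)
           (vector [e0, \<psi>0 $ 1, \<psi>0 $ 2, \<psi>0 $ 3])"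
  shows "\<exists>\<epsilon>0 > 0. \<exists>u :: real \<Rightarrow> H2_per.
    (\<exists>u'. (\<forall>\<epsilon>\<in>{0..<\<epsilon>0}. (u has_vector_derivative u' \<epsilon>) (at \<epsilon> within {0..<\<epsilon>0})) \<and>
          continuous_on {0..<\<epsilon>0} u') \<and>
    (\<forall>\<epsilon>\<in>{0..<\<epsilon>0}. critical_point H \<epsilon> (u \<epsilon>)) \<and>
    curve (u 0) = kepler_ellipse e0 \<psi>0 \<and>
    (\<exists>N. open N \<and> u 0 \<in> N \<and>
       (\<forall>\<epsilon>\<in>{0<..<\<epsilon>0}. \<forall>w\<in>N. critical_point H \<epsilon> w \<longrightarrow>
          (\<exists>\<phi>. \<forall>\<tau>. curve w \<tau> = curve (u \<epsilon>) (\<tau> + \<phi>)))) \<and>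
    (\<forall>\<epsilon>\<in>{0..<\<epsilon>0}. \<forall>\<phi>. \<exists>w. (\<forall>\<tau>. curve w \<tau> = curve (u \<epsilon>) (\<tau> + \<phi>)) \<and> critical_point H \<epsilon> w) \<and>
    (\<forall>\<epsilon>\<in>{0<..<\<epsilon>0}. \<forall>q0 q.
       q0 = (\<lambda>t. 0) \<longrightarrow> q = (\<lambda>L t. L *v curve (u \<epsilon>) (\<epsilon> powr (- 1 / 2) * t)) \<longrightarrow>
       nbody_solution H (1 / \<epsilon>) q0 q \<and> H_symmetric H q0 q \<and>
       (\<forall>L\<in>H. \<forall>t. q L (t + 2 * pi * \<epsilon> powr (1 / 2)) = q L t)) \<and>
    (\<exists>(e :: real \<Rightarrow> real) (\<psi> :: real \<Rightarrow> real^3) (w :: real \<Rightarrow> H2_per).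
       (\<forall>\<epsilon>\<in>{0..<\<epsilon>0}. 0 \<le> e \<epsilon> \<and> e \<epsilon> < 1 \<and> curve (w \<epsilon>) = kepler_ellipse (e \<epsilon>) (\<psi> \<epsilon>)) \<and>
       (\<lambda>\<epsilon>. norm (u \<epsilon> - w \<epsilon>)) \<in> O[at_right 0](\<lambda>\<epsilon>. \<epsilon>) \<and>
       (\<lambda>\<epsilon>. e \<epsilon> - e0) \<in> O[at_right 0](\<lambda>\<epsilon>. \<epsilon>) \<and>
       (\<lambda>\<epsilon>. norm (\<psi> \<epsilon> - \<psi>0)) \<in> O[at_right 0](\<lambda>\<epsilon>. \<epsilon>)) \<and>
    (\<lambda>\<epsilon>. norm (u \<epsilon> - u 0)) \<in> O[at_right 0](\<lambda>\<epsilon>. \<epsilon>)"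
proof -
  define p0 where "p0 = (vector [e0, \<psi>0 $ 1, \<psi>0 $ 2, \<psi>0 $ 3] :: real^4)"
  have pc: "p0 $ 1 = e0" "p0 $ 2 = \<psi>0 $ 1" "p0 $ 3 = \<psi>0 $ 2" "p0 $ 4 = \<psi>0 $ 3"
    by (simp_all add: p0_def vector_def)
  have \<psi>v: "vector [p0 $ 2, p0 $ 3, p0 $ 4] = \<psi>0" by (simp add: pc vec_eq_iff forall_3 vector_3)
  have RG: "rotation_group H" by (rule rotation_group_cases[OF assms(1)])
  obtain M where M: "kepler_branch H (vector [e0, \<psi>0 $ 1, \<psi>0 $ 2, \<psi>0 $ 3]) M"
    by (rule kepler_branchI[OF RG assms(2-6)]) (rule that; assumption)
  interpret kepler_branch H p0 M unfolding p0_def by (rule M)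
  obtain r d \<xi> where r: "0 < r" and d: "0 < d" and C\<xi>: "C1_on {-d<..<d} \<xi>" and \<xi>0: "\<xi> 0 = (h0, (p0, \<kappa>0))"
    and dom: "\<And>\<epsilon>. \<bar>\<epsilon>\<bar> < d \<Longrightarrow> (\<xi> \<epsilon>, \<epsilon>) \<in> bif_dom H" and zero: "\<And>\<epsilon>. \<bar>\<epsilon>\<bar> < d \<Longrightarrow> F (\<xi> \<epsilon>, \<epsilon>) = 0"
    and uniq: "\<And>\<epsilon> x. \<bar>\<epsilon>\<bar> < d \<Longrightarrow> dist (h0, (p0, \<kappa>0)) x < r \<Longrightarrow> F (x, \<epsilon>) = 0 \<Longrightarrow> x = \<xi> \<epsilon>"
    by (rule branch) (rule that; assumption)
  let ?D = "{-d<..<d}"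
  define hh pp kk where "hh \<epsilon> = fst (\<xi> \<epsilon>)" and "pp \<epsilon> = fst (snd (\<xi> \<epsilon>))" and "kk \<epsilon> = snd (snd (\<xi> \<epsilon>))" for \<epsilon>
  have \<xi>: "\<xi> \<epsilon> = (hh \<epsilon>, (pp \<epsilon>, kk \<epsilon>))" for \<epsilon> by (simp add: hh_def pp_def kk_def)
  have at0: "hh 0 = h0" "pp 0 = p0" "kk 0 = \<kappa>0" by (simp_all add: hh_def pp_def kk_def \<xi>0)
  have C: "C1_on ?D hh" "C1_on ?D pp" "C1_on ?D kk"
    unfolding hh_def pp_def kk_def by (intro C1_intros C\<xi>)+
  have ppD: "pp \<epsilon> \<in> kep_dom" if "\<bar>\<epsilon>\<bar> < d" for \<epsilon>
    using bif_domD(1) dom[OF that] unfolding \<xi> by blast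
  \<comment> \<open>The quantity that \<open>branch_critical\<close> wants positive. At 0 it equals
    \<open>2 * s0\<close>, so by continuity it stays positive for small parameters.\<close>
  define pos where "pos \<epsilon> = 2 * (peri_speed (pp \<epsilon> $ 1) + \<epsilon> * kk \<epsilon>) * (QQ (pp \<epsilon>) \<bullet> QQ p0) + \<epsilon> * (Jop (hh \<epsilon>) (2 * pi) \<bullet> QQ p0)" for \<epsilon>
  have "C1_on ?D pos"
    unfolding pos_def peri_speed_def
    by (intro C1_intros C1_kepler_c C C1_on_linear_compose[OF bounded_linear_bc_apply] C1_on_linear_compose[OF blinfun.bounded_linear_right])
      (use ppD in \<open>fastforce simp: kep_dom_def abs_less_iff\<close>)+
  moreover have "C1_on ?D (\<lambda>\<epsilon>. pp \<epsilon> $ 1)" by (intro C1_intros C)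
  ultimately have "isCont pos 0" "isCont (\<lambda>\<epsilon>. pp \<epsilon> $ 1) 0" using d by (auto intro: C1_on_imp_isCont)
  then have "(pos \<longlongrightarrow> pos 0) (nhds 0)" "((\<lambda>\<epsilon>. pp \<epsilon> $ 1) \<longlongrightarrow> pp 0 $ 1) (nhds 0)"
    unfolding isCont_def
    by (simp_all only: tendsto_at_iff_tendsto_nhds[of pos 0] tendsto_at_iff_tendsto_nhds[of "\<lambda>\<epsilon>. pp \<epsilon> $ 1" 0])
  moreover have "0 < pos 0" "0 < pp 0 $ 1"
    using s0 e0 by (simp_all add: pos_def at0 frame_orthonormal s0_def)
  ultimately have "\<forall>\<^sub>F \<epsilon> in nhds 0. 0 < pos \<epsilon> \<and> 0 < pp \<epsilon> $ 1"
    by (intro eventually_conj order_tendstoD(1))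
  then obtain d1 where d1: "0 < d1" "\<And>\<epsilon>. dist \<epsilon> 0 < d1 \<Longrightarrow> 0 < pos \<epsilon> \<and> 0 < pp \<epsilon> $ 1"
    unfolding eventually_nhds_metric by blast
  define \<epsilon>0 where "\<epsilon>0 = min d d1"
  have \<epsilon>0: "0 < \<epsilon>0" using d d1(1) by (simp add: \<epsilon>0_def)
  have small: "\<bar>\<epsilon>\<bar> < d" "0 < pos \<epsilon>" "0 < pp \<epsilon> $ 1" if "\<epsilon> \<in> {0..<\<epsilon>0}" for \<epsilon>
    using that d1(2)[of \<epsilon>] by (auto simp: \<epsilon>0_def dist_real_def)
  define u where "u \<epsilon> = branch_curve (\<xi> \<epsilon>) \<epsilon>" for \<epsilon>
  \<comment> \<open>The comparison ellipse carries the parameters of the branch itself. It agrees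
    with the branch at 0, and both are \<open>C^1\<close> in X, whence the difference is of first
    order.\<close>
  define w where "w \<epsilon> = branch_curve (0, (pp \<epsilon>, 0)) 0" for \<epsilon>
  have Cu: "C1_on ?D u" unfolding u_def
    by (intro C1_branch_curve C\<xi> C1_intros) (use ppD in \<open>auto simp: pp_def[symmetric] abs_less_iff\<close>)
  have Cw: "C1_on ?D w" unfolding w_def
    by (intro C1_branch_curve C C1_intros) (use ppD in \<open>auto simp: abs_less_iff\<close>)
  have crit: "critical_point H \<epsilon> (u \<epsilon>)"
    and cu: "\<And>t. t \<in> {0..2 * pi} \<Longrightarrow> curve (u \<epsilon>) t = kep (pp \<epsilon>) t + \<epsilon> *\<^sub>R vpath (\<xi> \<epsilon>) t" if \<epsilon>: "\<epsilon> \<in> {0..<\<epsilon>0}" for \<epsilon>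
    using branch_critical[OF H zero[OF small(1)[OF \<epsilon>], unfolded \<xi>] dom[OF small(1)[OF \<epsilon>], unfolded \<xi>]] small(2)[OF \<epsilon>]
    unfolding u_def \<xi> pos_def by blast+
  have cw: "curve (w \<epsilon>) = kep (pp \<epsilon>)" if "\<bar>\<epsilon>\<bar> < d" for \<epsilon>
    unfolding w_def by (rule branch_curve_kep[OF ppD[OF that]])
  have uw: "u 0 = w 0" by (simp add: u_def w_def branch_curve_def pp_def)
  have u0: "curve (u 0) = kep p0" unfolding uw using cw[of 0] d by (simp add: at0)
  have ell: "kepler_ellipse (pp \<epsilon> $ 1) (vector [pp \<epsilon> $ 2, pp \<epsilon> $ 3, pp \<epsilon> $ 4]) = kep (pp \<epsilon>)" "pp \<epsilon> $ 1 < 1" if "\<epsilon> \<in> {0..<\<epsilon>0}" for \<epsilon>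
    using small(3)[OF that] ppD[OF small(1)[OF that]] by (auto simp: kep_dom_def intro!: kepler_ellipse_kep)
  obtain \<delta> where \<delta>: "0 < \<delta>"
    "\<And>\<epsilon> w. 0 < \<epsilon> \<Longrightarrow> norm (w - u 0) < \<delta> \<Longrightarrow> critical_point H \<epsilon> w \<Longrightarrow>
      \<exists>\<phi> \<theta>. dist (h0, (p0, \<kappa>0)) \<theta> < r \<and> F (\<theta>, \<epsilon>) = 0 \<and>
        (\<forall>t\<in>{0..2 * pi}. curve w (t + \<phi>) = kep (fst (snd \<theta>)) t + \<epsilon> *\<^sub>R vpath \<theta> t)"
    by (rule local_uniqueness[OF u0 r]) blast
  \<comment> \<open>At \<open>\<epsilon> = 0\<close> all nearby ellipses are critical points, so
    uniqueness concerns positive parameters.\<close>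
  have unique: "\<exists>\<phi>. \<forall>\<tau>. curve w \<tau> = curve (u \<epsilon>) (\<tau> + \<phi>)"
    if \<epsilon>: "\<epsilon> \<in> {0<..<\<epsilon>0}" and w: "w \<in> ball (u 0) \<delta>" "critical_point H \<epsilon> w" for \<epsilon> w
  proof -
    have \<epsilon>': "\<epsilon> \<in> {0..<\<epsilon>0}" "0 < \<epsilon>" using \<epsilon> by auto
    have "norm (w - u 0) < \<delta>" using w(1) by (simp add: dist_norm norm_minus_commute)
    from \<delta>(2)[OF \<epsilon>'(2) this w(2)] obtain \<phi> \<theta> where \<theta>: "dist (h0, (p0, \<kappa>0)) \<theta> < r" "F (\<theta>, \<epsilon>) = 0"
      "\<And>t. t \<in> {0..2 * pi} \<Longrightarrow> curve w (t + \<phi>) = kep (fst (snd \<theta>)) t + \<epsilon> *\<^sub>R vpath \<theta> t" by blast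
    have eq: "\<theta> = \<xi> \<epsilon>" by (rule uniq[OF small(1)[OF \<epsilon>'(1)] \<theta>(1,2)])
    have "curve w (t + \<phi>) = curve (u \<epsilon>) t" for t
    proof (rule periodic_eqI[where f = "\<lambda>t. curve w (t + \<phi>)"])
      show "curve w (t + 2 * pi + \<phi>) = curve w (t + \<phi>)" for t
        using curve_periodic[of w "t + \<phi>"] by (simp add: add_ac)
      show "curve w (t + \<phi>) = curve (u \<epsilon>) t" if "t \<in> {0..2 * pi}" for t
        using \<theta>(3)[OF that] cu[OF \<epsilon>'(1) that] by (simp add: eq pp_def)
    qed (rule curve_periodic)
    from this[of "\<tau> - \<phi>" for \<tau>] have "curve w \<tau> = curve (u \<epsilon>) (\<tau> + (- \<phi>))" for \<tau> by simp
    then show ?thesis by blast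
  qed
  have translate: "\<exists>w. (\<forall>\<tau>. curve w \<tau> = curve (u \<epsilon>) (\<tau> + \<phi>)) \<and> critical_point H \<epsilon> w" if \<epsilon>: "\<epsilon> \<in> {0..<\<epsilon>0}" for \<epsilon> \<phi>
  proof -
    obtain X where D: "\<And>t. curve (u \<epsilon>) t \<in> Dom H" and X: "\<And>t. (curve (u \<epsilon>) has_vector_derivative X t) (at t)"
      "\<And>t. (X has_vector_derivative force H \<epsilon> (curve (u \<epsilon>) t)) (at t)"
      using crit[OF \<epsilon>] unfolding critical_point_iff[OF H] by blast
    let ?y = "\<lambda>t. curve (u \<epsilon>) (t + \<phi>)" and ?Y = "\<lambda>t. X (t + \<phi>)"
    have sh: "((\<lambda>t. t + \<phi>) has_vector_derivative 1) (at t)" for t by (auto intro!: derivative_eq_intros)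
    have y: "(?y has_vector_derivative ?Y t) (at t)" "(?Y has_vector_derivative force H \<epsilon> (?y t)) (at t)" for t
      using vector_diff_chain_at[OF sh X(1)[of "t + \<phi>"]] vector_diff_chain_at[OF sh X(2)[of "t + \<phi>"]] by (simp_all add: o_def)
    have per: "?y (t + 2 * pi) = ?y t" for t using curve_periodic[of "u \<epsilon>" "t + \<phi>"] by (simp add: add_ac)
    obtain v where "curve v = ?y" "critical_point H \<epsilon> v"
      by (rule critical_pointI[OF H per D y]) (rule that; assumption)
    then show ?thesis by (intro exI[of _ v]) simp
  qed
  have nbody: "nbody_solution H (1 / \<epsilon>) (\<lambda>t. 0) q \<and> H_symmetric H (\<lambda>t. 0) q \<and>
      (\<forall>L\<in>H. \<forall>t. q L (t + 2 * pi * \<epsilon> powr (1 / 2)) = q L t)"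
    if \<epsilon>: "\<epsilon> \<in> {0<..<\<epsilon>0}" and q: "q = (\<lambda>L t. L *v curve (u \<epsilon>) (\<epsilon> powr (- 1 / 2) * t))" for \<epsilon> q
  proof -
    have \<epsilon>': "\<epsilon> \<in> {0..<\<epsilon>0}" "0 < \<epsilon>" using \<epsilon> by auto
    obtain X where D: "\<And>t. curve (u \<epsilon>) t \<in> Dom H" and X: "\<And>t. (curve (u \<epsilon>) has_vector_derivative X t) (at t)"
      "\<And>t. (X has_vector_derivative force H \<epsilon> (curve (u \<epsilon>) t)) (at t)"
      using crit[OF \<epsilon>'(1)] unfolding critical_point_iff[OF H] by blast
    have one: "\<epsilon> powr (- 1 / 2) * \<epsilon> powr (1 / 2) = 1" using \<epsilon>'(2) by (simp flip: powr_add)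
    have "\<epsilon> powr (- 1 / 2) * (t + 2 * pi * \<epsilon> powr (1 / 2)) = \<epsilon> powr (- 1 / 2) * t + 2 * pi * (\<epsilon> powr (- 1 / 2) * \<epsilon> powr (1 / 2))" for t
      by (simp add: algebra_simps)
    then have t: "\<epsilon> powr (- 1 / 2) * (t + 2 * pi * \<epsilon> powr (1 / 2)) = \<epsilon> powr (- 1 / 2) * t + 2 * pi" for t
      unfolding one by simp
    have "nbody_solution H (1 / \<epsilon>) (\<lambda>t. 0) q" unfolding q by (rule ring_nbody_solution[OF H D \<epsilon>'(2) X])
    moreover have "H_symmetric H (\<lambda>t. 0) q" by (simp add: H_symmetric_def q)
    moreover have "q L (t + 2 * pi * \<epsilon> powr (1 / 2)) = q L t" for L t
      unfolding q t curve_periodic ..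
    ultimately show ?thesis by blast
  qed
  have asym: "(\<lambda>\<epsilon>. norm (u \<epsilon> - w \<epsilon>)) \<in> O[at_right 0](\<lambda>\<epsilon>. \<epsilon>)" "(\<lambda>\<epsilon>. norm (u \<epsilon> - u 0)) \<in> O[at_right 0](\<lambda>\<epsilon>. \<epsilon>)"
    "(\<lambda>\<epsilon>. pp \<epsilon> $ 1 - e0) \<in> O[at_right 0](\<lambda>\<epsilon>. \<epsilon>)"
    "(\<lambda>\<epsilon>. norm (vector [pp \<epsilon> $ 2, pp \<epsilon> $ 3, pp \<epsilon> $ 4] - \<psi>0)) \<in> O[at_right 0](\<lambda>\<epsilon>. \<epsilon>)"
  proof -
    show "(\<lambda>\<epsilon>. norm (u \<epsilon> - w \<epsilon>)) \<in> O[at_right 0](\<lambda>\<epsilon>. \<epsilon>)"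
      using C1_bigo[OF C1_on_diff[OF Cu Cw] d] by (simp add: uw)
    show "(\<lambda>\<epsilon>. norm (u \<epsilon> - u 0)) \<in> O[at_right 0](\<lambda>\<epsilon>. \<epsilon>)" by (rule C1_bigo[OF Cu d])
    have "C1_on ?D (\<lambda>\<epsilon>. pp \<epsilon> $ 1)" by (intro C1_intros C)
    from C1_bigo[OF this d] show "(\<lambda>\<epsilon>. pp \<epsilon> $ 1 - e0) \<in> O[at_right 0](\<lambda>\<epsilon>. \<epsilon>)" by (simp add: at0 pc)
    have "C1_on ?D (\<lambda>\<epsilon>. vector [pp \<epsilon> $ 2, pp \<epsilon> $ 3, pp \<epsilon> $ 4] :: real^3)"
      unfolding vector3_axis by (intro C1_intros C)
    from C1_bigo[OF this d] show "(\<lambda>\<epsilon>. norm (vector [pp \<epsilon> $ 2, pp \<epsilon> $ 3, pp \<epsilon> $ 4] - \<psi>0)) \<in> O[at_right 0](\<lambda>\<epsilon>. \<epsilon>)"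
      by (simp add: at0 \<psi>v)
  qed
  show ?thesis
  proof (rule exI[of _ \<epsilon>0], rule conjI[OF \<epsilon>0], rule exI[of _ u], intro conjI)
    show "\<exists>u'. (\<forall>\<epsilon>\<in>{0..<\<epsilon>0}. (u has_vector_derivative u' \<epsilon>) (at \<epsilon> within {0..<\<epsilon>0})) \<and> continuous_on {0..<\<epsilon>0} u'"
    proof (intro exI[of _ "\<lambda>\<epsilon>. fderiv u \<epsilon> 1"] conjI ballI)
      have sub: "{0..<\<epsilon>0} \<subseteq> ?D" using small(1) by fastforce
      show "continuous_on {0..<\<epsilon>0} (\<lambda>\<epsilon>. fderiv u \<epsilon> 1)"
        by (intro continuous_intros continuous_on_subset[OF C1_on_fderiv[OF Cu] sub])
      fix \<epsilon> assume "\<epsilon> \<in> {0..<\<epsilon>0}"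
      then have "(u has_derivative fderiv u \<epsilon>) (at \<epsilon>)" using sub by (intro C1_on_has_derivative[OF Cu]) blast
      moreover have "blinfun_apply (fderiv u \<epsilon>) = (\<lambda>s. s *\<^sub>R fderiv u \<epsilon> 1)"
        by (auto simp: fun_eq_iff simp flip: blinfun.scaleR_right)
      ultimately have "(u has_vector_derivative fderiv u \<epsilon> 1) (at \<epsilon>)" unfolding has_vector_derivative_def by simp
      then show "(u has_vector_derivative fderiv u \<epsilon> 1) (at \<epsilon> within {0..<\<epsilon>0})" by (rule has_vector_derivative_at_within)
    qed
    show "curve (u 0) = kepler_ellipse e0 \<psi>0"
      using ell(1)[of 0] \<epsilon>0 by (simp add: u0 at0 pc \<psi>v[unfolded pc])
    show "\<exists>N. open N \<and> u 0 \<in> N \<and> (\<forall>\<epsilon>\<in>{0<..<\<epsilon>0}. \<forall>w\<in>N. critical_point H \<epsilon> w \<longrightarrow> (\<exists>\<phi>. \<forall>\<tau>. curve w \<tau> = curve (u \<epsilon>) (\<tau> + \<phi>)))"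
      using unique \<delta>(1) by (intro exI[of _ "ball (u 0) \<delta>"]) auto
    show "\<exists>(e :: real \<Rightarrow> real) (\<psi> :: real \<Rightarrow> real^3) (w :: real \<Rightarrow> H2_per).
       (\<forall>\<epsilon>\<in>{0..<\<epsilon>0}. 0 \<le> e \<epsilon> \<and> e \<epsilon> < 1 \<and> curve (w \<epsilon>) = kepler_ellipse (e \<epsilon>) (\<psi> \<epsilon>)) \<and>
       (\<lambda>\<epsilon>. norm (u \<epsilon> - w \<epsilon>)) \<in> O[at_right 0](\<lambda>\<epsilon>. \<epsilon>) \<and>
       (\<lambda>\<epsilon>. e \<epsilon> - e0) \<in> O[at_right 0](\<lambda>\<epsilon>. \<epsilon>) \<and>
       (\<lambda>\<epsilon>. norm (\<psi> \<epsilon> - \<psi>0)) \<in> O[at_right 0](\<lambda>\<epsilon>. \<epsilon>)"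
      by (rule exI[of _ "\<lambda>\<epsilon>. pp \<epsilon> $ 1"], rule exI[of _ "\<lambda>\<epsilon>. vector [pp \<epsilon> $ 2, pp \<epsilon> $ 3, pp \<epsilon> $ 4]"], rule exI[of _ w])
        (use asym(1,3,4) small ell cw in \<open>auto simp: less_imp_le\<close>)
  qed (use crit translate nbody asym(2) in auto)
qed

end
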